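(* Let $T\in\mathcal{K}(V)$ be bisectorial of angle $\omega\in(0,\frac{\pi}{2})$ and let $p,q$ be two intrinsic polynomials such that $q$ does not have any zeros in $\overline{D_\omega}$. Then $q[T]$ is bijective (from $\operatorname{dom}(q[T])$ onto $V$), there exists some $\theta\in(\omega,\frac{\pi}{2})$ such that $\frac{p}{q}\in\mathcal{N}^{\mathrm{reg}}(D_\theta)$, and $$\Big(\frac{p}{q}\Big)(T)=p[T]q[T]^{-1},$$ where the left hand side is given by the $H^\infty$-functional calculus.
   Context: Clifford setting. Fix an integer $n\geq 1$. $\mathbb{R}_n$ is the real Clifford algebra generated by $e_1,\dots,e_n$ with $e_i^2=-1$, $e_ie_j=-e_je_i$ ($i\neq j$), with basis $e_A=e_{i_1}\cdots e_{i_r}$ for $A=(i_1<\dots<i_r)$, $e_\emptyset=1$, and $|s|^2=\sum_As_A^2$ for $s=\sum_As_Ae_A$. Paravectors: $\mathbb{R}^{n+1}=\{s_0+s_1e_1+\dots+s_ne_n\}\subseteq\mathbb{R}_n$ with $\overline{s}=s_0-s_1e_1-\dots-s_ne_n$. $\mathbb{S}=\{s\in\mathbb{R}^{n+1}: s_0=0,|s|=1\}$ and $\mathbb{C}_J=\{x+Jy: x,y\in\mathbb{R}\}$ for $J\in\mathbb{S}$. $U\subseteq\mathbb{R}^{n+1}$ is axially symmetric if $x+Jy\in U$ ($x,y\in\mathbb{R}$, $J\in\mathbb{S}$) implies $x+Iy\in U$ for all $I\in\mathbb{S}$. Slice hyperholomorphic functions. For $U$ open and axially symmetric, $f:U\to\mathbb{R}_n$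 is left slice hyperholomorphic ($f\in\mathcal{SH}_L(U)$) if there are continuously differentiable $f_0,f_1:\{(x,y)\in\mathbb{R}^2: x+\mathbb{S}y\subseteq U\}\to\mathbb{R}_n$ with $f(x+Jy)=f_0(x,y)+Jf_1(x,y)$ for all $J\in\mathbb{S}$, $f_0(x,-y)=f_0(x,y)$, $f_1(x,-y)=-f_1(x,y)$, $\partial_xf_0=\partial_yf_1$, $\partial_yf_0=-\partial_xf_1$. If $f_0,f_1$ are real valued, $f$ is called intrinsic ($f\in\mathcal{N}(U)$). Operators. $V_\mathbb{R}$ is a real Banach space, $V=\{\sum_Av_A\otimes e_A: v_A\in V_\mathbb{R}\}$ the corresponding Clifford module with norm $\|v\|^2=\sum_A\|v_A\|^2$ and the natural left and right multiplications by $\mathbb{R}_n$. $\mathcal{B}(V)$: bounded everywhere defined right-linear operators; $\mathcal{K}(V)$: closed right-linear operators $T:\operatorname{dom}(T)\to V$ with right-linear domain $\operatorname{dom}(T)\subseteq V$. A Clifford number $a$ is identified with the operator $v\mapsto av$, so $(aT)v=a(Tv)$, $(Ta)v=T(av)$. Products of operators have their natural domains. For $s\in\mathbb{R}^{n+1}$, $Q_s[T]=T^2-2s_0T+|s|^2$ on $\operatorname{dom}(T^2)$; $\rho_S(T)=\{s\in\mathbb{R}^{n+1}: Q_s[T]^{-1}\in\mathcal{B}(V)\}$, $\sigma_S(T)=\mathbb{R}^{n+1}\setminus\rho_S(T)$, and $S_L^{-1}(s,T)=Q_s[T]^{-1}\overline{s}-TQ_s[T]^{-1}$ for $s\in\rho_S(T)$.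 Bisectorial operators. For $\omega\in(0,\frac{\pi}{2})$, $I_\omega=(-\omega,\omega)\cup(\pi-\omega,\pi+\omega)$ and $D_\omega=\{re^{J\phi}: r>0,\,J\in\mathbb{S},\,\phi\in I_\omega\}\subseteq\mathbb{R}^{n+1}$ (so $0\in\overline{D_\omega}$). $T\in\mathcal{K}(V)$ is bisectorial of angle $\omega$ if $\sigma_S(T)\subseteq\overline{D_\omega}$ and for every $\varphi\in(\omega,\frac{\pi}{2})$ there is $C_\varphi\geq 0$ with $\|S_L^{-1}(s,T)\|\leq\frac{C_\varphi}{|s|}$ for all $s\in\mathbb{R}^{n+1}\setminus(D_\varphi\cup\{0\})$. $\omega$-functional calculus. $\mathcal{SH}_L^0(D_\theta)$ is the set of bounded $f\in\mathcal{SH}_L(D_\theta)$ with $\int_0^\infty|f(te^{J\phi})|\frac{dt}{t}<\infty$ for all $J\in\mathbb{S}$, $\phi\in I_\theta$; $\mathcal{N}^0(D_\theta)$ is the set of intrinsic such functions. For $T$ bisectorial of angle $\omega$, $\theta\in(\omega,\frac{\pi}{2})$ and $f\in\mathcal{SH}_L^0(D_\theta)$, $$f(T)=\frac{1}{2\pi}\int_{\partial D_\varphi\cap\mathbb{C}_J}S_L^{-1}(s,T)ds_Jf(s):=\frac{1}{2\pi}\sum_\pm\int_\mathbb{R}S_L^{-1}(\gamma_\pm(t),T)\frac{\gamma_\pm'(t)}{J}f(\gamma_\pm(t))dt\in\mathcal{B}(V),$$ with $\gamma_\pm(t)=\pm|t|e^{-\operatorname{sgn}(t)J\varphi}$; it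 does not depend on the choice of $\varphi\in(\omega,\theta)$ and $J\in\mathbb{S}$. Extended $\omega$-functional calculus. $\mathcal{N}^{\mathrm{bnd}}(D_\theta)$ is the set of functions $g(s)=g_\infty+\frac{1}{1+s^2}(g_0-g_\infty)+\widetilde{g}(s)$ on $D_\theta$ with $g_0,g_\infty\in\mathbb{R}$, $\widetilde{g}\in\mathcal{N}^0(D_\theta)$ (unique components). For such $g$, $g(T):=g_\infty+(1+T^2)^{-1}(g_0-g_\infty)+\widetilde{g}(T)\in\mathcal{B}(V)$; here $1+T^2$ is boundedly invertible since $\mathbb{S}\subseteq\rho_S(T)$. $H^\infty$-functional calculus. $\mathcal{N}^{\mathrm{reg}}(D_\theta)$ is the set of $g\in\mathcal{N}(D_\theta)$ for which there exists $e\in\mathcal{N}^{\mathrm{bnd}}(D_\theta)$ (a regularizer of $g$) with $eg\in\mathcal{N}^{\mathrm{bnd}}(D_\theta)$ and $e(T)$ injective. For such $g$, $g(T):=e(T)^{-1}(eg)(T)$ with its natural domain $\operatorname{dom}(g(T))=\{v\in V: (eg)(T)v\in\operatorname{ran}(e(T))\}$; this closed operator is independent of the regularizer $e$. Polynomials. An intrinsic polynomial of degree $m$ is $p(s)=p_0+p_1s+\dots+p_ms^m$ with real coefficients, $p_m\neq 0$, as a function of $s\in\mathbb{R}^{n+1}$; $p[T]=p_0+p_1T+\dots+p_mT^m$ with $\operatorname{dom}(p[T])=\operatorname{dom}(T^m)$. *)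

theory Defs
  imports "HOL-Analysis.Analysis" "HOL-Computational_Algebra.Polynomial"
begin

section \<open>The real Clifford algebra\<close>

text \<open>
  The generators are indexed by a finite linearly ordered type \<open>'n\<close>, so that
  \<open>n = CARD('n) \<ge> 1\<close>. An element is its coefficient vector \<open>(s\<^sub>A)\<close>, indexed by the
  subsets \<open>A\<close> of \<open>'n\<close>. The type is a copy of \<^typ>\<open>real^('n set)\<close> because the product on
  the latter is the componentwise one.
\<close>

typedef 'n clifford = "UNIV :: (real^('n::{finite,linorder} set)) set"
  morphisms cl_vec Clifford by simp

setup_lifting type_definition_clifford

abbreviation cl_coeff :: "'n::{finite,linorder} clifford \<Rightarrow> 'n set \<Rightarrow> real" where
  "cl_coeff s A \<equiv> cl_vec s $ A"

lemma cl_eqI: "(\<And>A. cl_coeff s A = cl_coeff t A) \<Longrightarrow> s = t"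
  by transfer (simp add: vec_eq_iff)

instantiation clifford :: ("{finite,linorder}") real_vector
begin
lift_definition zero_clifford :: "'a clifford" is 0 .
lift_definition plus_clifford :: "'a clifford \<Rightarrow> 'a clifford \<Rightarrow> 'a clifford" is "(+)" .
lift_definition minus_clifford :: "'a clifford \<Rightarrow> 'a clifford \<Rightarrow> 'a clifford" is "(-)" .
lift_definition uminus_clifford :: "'a clifford \<Rightarrow> 'a clifford" is uminus .
lift_definition scaleR_clifford :: "real \<Rightarrow> 'a clifford \<Rightarrow> 'a clifford" is scaleR .
instance
  by standard (transfer, simp add: algebra_simps scaleR_add_left scaleR_add_right)+
end

instantiation clifford :: ("{finite,linorder}") real_normed_vector
begin
lift_definition norm_clifford :: "'a clifford \<Rightarrow> real" is norm .
definition sgn_clifford :: "'a clifford \<Rightarrow> 'a clifford" where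
  "sgn_clifford s = s /\<^sub>R norm s"
definition dist_clifford :: "'a clifford \<Rightarrow> 'a clifford \<Rightarrow> real" where
  "dist_clifford s t = norm (s - t)"
definition uniformity_clifford :: "('a clifford \<times> 'a clifford) filter" where
  "uniformity_clifford = (INF e\<in>{0<..}. principal {(s, t). dist s t < e})"
definition open_clifford :: "'a clifford set \<Rightarrow> bool" where
  "open_clifford U \<longleftrightarrow> (\<forall>s\<in>U. \<forall>\<^sub>F (s', t) in uniformity. s' = s \<longrightarrow> t \<in> U)"
instance
proof
  fix s t :: "'a clifford" and r :: real
  show "norm s = 0 \<longleftrightarrow> s = 0" by transfer simp
  show "norm (s + t) \<le> norm s + norm t" by transfer (rule norm_triangle_ineq)
  show "norm (r *\<^sub>R s) = \<bar>r\<bar> * norm s" by transfer simp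
qed (simp_all add: sgn_clifford_def dist_clifford_def uniformity_clifford_def open_clifford_def)
end

lemma norm_clifford_power2: "(norm s)\<^sup>2 = (\<Sum>A\<in>UNIV. (cl_coeff s A)\<^sup>2)"
  by transfer (simp add: norm_vec_def L2_set_def sum_nonneg)

text \<open>
  The sign in \<open>e\<^sub>A e\<^sub>B = \<plusminus>e\<^bsub>A \<triangle> B\<^esub>\<close>: sorting the word
  contributes a factor \<open>-1\<close> for every \<open>(i, j) \<in> A \<times> B\<close> with \<open>j < i\<close>, and \<open>e\<^sub>i\<^sup>2 = -1\<close>
  contributes one for every pair with \<open>j = i\<close>.
\<close>

definition cl_sign :: "'n::{finite,linorder} set \<Rightarrow> 'n set \<Rightarrow> real" where
  "cl_sign A B = (\<Prod>i\<in>A. \<Prod>j\<in>B. if j \<le> i then - 1 else 1)"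

lift_definition cl_basis :: "'n::{finite,linorder} set \<Rightarrow> 'n clifford" is "\<lambda>A. axis A 1" .

abbreviation cl_gen :: "'n::{finite,linorder} \<Rightarrow> 'n clifford" where
  "cl_gen i \<equiv> cl_basis {i}"

lemma cl_sign_empty [simp]: "cl_sign {} B = 1" "cl_sign A {} = 1"
  by (simp_all add: cl_sign_def)

lemma prod_sym_diff:
  fixes f :: "'n::finite \<Rightarrow> real"
  assumes "\<And>i. f i * f i = 1"
  shows "prod f (sym_diff A B) = prod f A * prod f B"
proof -
  have *: "prod f (A \<inter> B) * prod f (A \<inter> B) = 1"
    using assms by (simp flip: prod.distrib)
  have A: "prod f A = prod f (A - B) * prod f (A \<inter> B)"
    by (metis Diff_Int finite_code Diff_empty Int_commute Int_lower1 Un_Diff_Int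
        Diff_disjoint prod.union_disjoint Diff_Int2 inf_assoc inf_bot_right Int_Diff)
  have B: "prod f B = prod f (B - A) * prod f (A \<inter> B)"
    by (metis Diff_Int finite_code Diff_empty Int_commute Int_lower1 Un_Diff_Int
        Diff_disjoint prod.union_disjoint Diff_Int2 inf_assoc inf_bot_right Int_Diff)
  have "prod f (sym_diff A B) = prod f (A - B) * prod f (B - A)"
    by (intro prod.union_disjoint) auto
  also have "\<dots> = prod f A * prod f B"
    using * unfolding A B by (metis mult.assoc mult.commute mult_1)
  finally show ?thesis .
qed

lemma cl_sign_square: "(\<Prod>j\<in>B. if j \<le> i then - 1 else (1::real)) * (\<Prod>j\<in>B. if j \<le> i then - 1 else 1) = 1"
  for i :: "'n::{finite,linorder}"
  by (simp flip: prod.distrib) (rule prod.neutral, simp)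

lemma cl_sign_sym_diff_left: "cl_sign (sym_diff A B) C = cl_sign A C * cl_sign B C"
  unfolding cl_sign_def by (rule prod_sym_diff) (rule cl_sign_square)

lemma cl_sign_sym_diff_right: "cl_sign A (sym_diff B C) = cl_sign A B * cl_sign A C"
  unfolding cl_sign_def by (subst prod_sym_diff) (auto simp: prod.distrib)

lemma cl_sign_cocycle:
  "cl_sign A B * cl_sign (sym_diff A B) C = cl_sign A (sym_diff B C) * cl_sign B C"
  by (simp only: cl_sign_sym_diff_left cl_sign_sym_diff_right mult_ac)

text \<open>
  Left and right multiplication on \<open>V = {\<Sum>\<^sub>A v\<^sub>A \<otimes> e\<^sub>A}\<close>, for \<open>V\<^sub>\<real>\<close> the type \<open>'v\<close>:
  \<open>axis A x\<close> is \<open>x \<otimes> e\<^sub>A\<close>, and \<open>e\<^sub>A (x \<otimes> e\<^sub>B) = x \<otimes> (e\<^sub>A e\<^sub>B)\<close>,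
  \<open>(x \<otimes> e\<^sub>A) e\<^sub>B = x \<otimes> (e\<^sub>A e\<^sub>B)\<close>. The norm of the type \<open>'v^('n set)\<close> is the one required
  of \<open>V\<close>, that is \<open>\<parallel>v\<parallel>\<^sup>2 = \<Sum>\<^sub>A \<parallel>v\<^sub>A\<parallel>\<^sup>2\<close>.
\<close>

definition lmult :: "'n::{finite,linorder} clifford \<Rightarrow> 'v::real_vector^('n set) \<Rightarrow> 'v^('n set)" where
  "lmult a v = (\<Sum>A\<in>UNIV. \<Sum>B\<in>UNIV.
     axis (sym_diff A B) ((cl_sign A B * cl_coeff a A) *\<^sub>R (v $ B)))"

definition rmult :: "'v::real_vector^('n::{finite,linorder} set) \<Rightarrow> 'n clifford \<Rightarrow> 'v^('n set)" where
  "rmult v a = (\<Sum>A\<in>UNIV. \<Sum>B\<in>UNIV.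
     axis (sym_diff A B) ((cl_sign A B * cl_coeff a B) *\<^sub>R (v $ A)))"

instantiation clifford :: ("{finite,linorder}") times
begin
definition times_clifford :: "'a clifford \<Rightarrow> 'a clifford \<Rightarrow> 'a clifford" where
  "a * b = (\<Sum>A\<in>UNIV. \<Sum>B\<in>UNIV.
     (cl_sign A B * cl_coeff a A * cl_coeff b B) *\<^sub>R cl_basis (sym_diff A B))"
instance ..
end

lemma cl_coeff_simps [simp]:
  "cl_coeff 0 A = 0" "cl_coeff (s + t) A = cl_coeff s A + cl_coeff t A"
  "cl_coeff (s - t) A = cl_coeff s A - cl_coeff t A" "cl_coeff (- s) A = - cl_coeff s A"
  "cl_coeff (r *\<^sub>R s) A = r * cl_coeff s A"
  "cl_coeff (cl_basis B) A = (if A = B then 1 else 0)"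
  by (transfer, simp add: axis_def)+

lemma cl_coeff_sum [simp]: "cl_coeff (sum f I) A = (\<Sum>i\<in>I. cl_coeff (f i) A)"
  by (induction I rule: infinite_finite_induct) auto

lemma cl_expansion: "s = (\<Sum>A\<in>UNIV. cl_coeff s A *\<^sub>R cl_basis A)"
  by (rule cl_eqI) (simp add: if_distrib cong: if_cong)

lemma cl_mult_add: "(a + b) * c = a * c + b * c" "c * (a + b) = c * a + c * b"
  for a b c :: "'n::{finite,linorder} clifford"
  by (simp_all add: times_clifford_def algebra_simps scaleR_add_left sum.distrib)

lemma cl_mult_scaleR: "(r *\<^sub>R a) * b = r *\<^sub>R (a * b)" "a * (r *\<^sub>R b) = r *\<^sub>R (a * b)"
  for a b :: "'n::{finite,linorder} clifford"
  by (simp_all add: times_clifford_def scaleR_sum_right mult_ac)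

lemma cl_mult_zero: "0 * b = 0" "b * 0 = 0" for b :: "'n::{finite,linorder} clifford"
  by (simp_all add: times_clifford_def)

lemma cl_mult_sum: "(\<Sum>i\<in>I. f i) * b = (\<Sum>i\<in>I. f i * b)" "b * (\<Sum>i\<in>I. f i) = (\<Sum>i\<in>I. b * f i)"
  for b :: "'n::{finite,linorder} clifford"
  by (induction I rule: infinite_finite_induct) (auto simp: cl_mult_add cl_mult_zero)

lemma cl_basis_mult: "cl_basis A * cl_basis B = cl_sign A B *\<^sub>R cl_basis (sym_diff A B)"
proof -
  have "cl_basis A * cl_basis B = (\<Sum>A'\<in>UNIV. \<Sum>B'\<in>UNIV.
     if A' = A then if B' = B then cl_sign A B *\<^sub>R cl_basis (sym_diff A B) else 0 else 0)"
    unfolding times_clifford_def by (intro sum.cong refl) auto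
  also have "\<dots> = (\<Sum>A'\<in>UNIV. if A' = A then cl_sign A B *\<^sub>R cl_basis (sym_diff A B) else 0)"
    by (intro sum.cong refl) auto
  finally show ?thesis by simp
qed

lemma cl_basis_assoc: "(cl_basis A * cl_basis B) * cl_basis C = cl_basis A * (cl_basis B * cl_basis C)"
proof -
  have "sym_diff (sym_diff A B) C = sym_diff A (sym_diff B C)" by auto
  then show ?thesis
    by (simp only: cl_basis_mult cl_mult_scaleR scaleR_scaleR cl_sign_cocycle mult.commute)
qed

instantiation clifford :: ("{finite,linorder}") real_algebra_1
begin
definition one_clifford :: "'a clifford" where "1 = cl_basis {}"
instance
proof
  fix a b c :: "'a clifford" and r :: real
  have "(\<Sum>A\<in>UNIV. cl_coeff a A *\<^sub>R cl_basis A) * (\<Sum>A\<in>UNIV. cl_coeff b A *\<^sub>R cl_basis A)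
       * (\<Sum>A\<in>UNIV. cl_coeff c A *\<^sub>R cl_basis A)
     = (\<Sum>A\<in>UNIV. cl_coeff a A *\<^sub>R cl_basis A) * ((\<Sum>A\<in>UNIV. cl_coeff b A *\<^sub>R cl_basis A)
       * (\<Sum>A\<in>UNIV. cl_coeff c A *\<^sub>R cl_basis A))"
    by (simp only: cl_mult_sum cl_mult_scaleR cl_basis_assoc)
  then show "a * b * c = a * (b * c)" by (simp flip: cl_expansion)
  have "1 * (\<Sum>A\<in>UNIV. cl_coeff a A *\<^sub>R cl_basis A) = (\<Sum>A\<in>UNIV. cl_coeff a A *\<^sub>R cl_basis A)"
    by (simp add: cl_mult_sum cl_mult_scaleR one_clifford_def cl_basis_mult)
  then show "1 * a = a" by (simp flip: cl_expansion)
  have "(\<Sum>A\<in>UNIV. cl_coeff a A *\<^sub>R cl_basis A) * 1 = (\<Sum>A\<in>UNIV. cl_coeff a A *\<^sub>R cl_basis A)"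
    by (simp add: cl_mult_sum cl_mult_scaleR one_clifford_def cl_basis_mult)
  then show "a * 1 = a" by (simp flip: cl_expansion)
  have "cl_coeff (0 :: 'a clifford) {} \<noteq> cl_coeff 1 {}" by (simp add: one_clifford_def)
  then show "(0 :: 'a clifford) \<noteq> 1" by metis
qed (simp_all add: cl_mult_add cl_mult_scaleR)
end

lemma cl_gen_square: "cl_gen i * cl_gen i = - 1"
  by (simp add: cl_basis_mult cl_sign_def one_clifford_def)

lemma cl_gen_anticommute: "i \<noteq> j \<Longrightarrow> cl_gen i * cl_gen j = - (cl_gen j * cl_gen i)"
proof -
  assume "i \<noteq> j"
  then have "sym_diff {i} {j} = {i, j}" "sym_diff {j} {i} = {i, j}" by auto
  with \<open>i \<noteq> j\<close> show ?thesis
    by (cases i j rule: linorder_cases) (auto simp: cl_basis_mult cl_sign_def)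
qed

lemma cl_basis_eq_prod_list: "cl_basis A = prod_list (map cl_gen (sorted_list_of_set A))"
proof -
  have "sorted xs \<Longrightarrow> distinct xs \<Longrightarrow> prod_list (map cl_gen xs) = cl_basis (set xs)" for xs :: "'a list"
  proof (induction xs)
    case Nil
    then show ?case by (simp add: one_clifford_def)
  next
    case (Cons x xs)
    then have "cl_sign {x} (set xs) = 1"
      by (auto simp: cl_sign_def intro!: prod.neutral)
    moreover have "sym_diff {x} (set xs) = insert x (set xs)" using Cons by auto
    ultimately show ?case using Cons by (simp add: cl_basis_mult)
  qed
  from this[of "sorted_list_of_set A"] show ?thesis by simp
qed

lemma cl_vec_sum: "cl_vec (sum f I) = (\<Sum>i\<in>I. cl_vec (f i))"
  by (simp add: vec_eq_iff)

lemma cl_vec_mult: "cl_vec (a * b) = lmult a (cl_vec b)" "cl_vec (a * b) = rmult (cl_vec a) b"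
proof -
  have *: "cl_vec (r *\<^sub>R cl_basis A) = axis A r" for r and A :: "'a set"
    by (simp add: vec_eq_iff axis_def)
  show "cl_vec (a * b) = lmult a (cl_vec b)" "cl_vec (a * b) = rmult (cl_vec a) b"
    by (simp_all add: times_clifford_def lmult_def rmult_def cl_vec_sum * mult_ac)
qed

text \<open>
  The inverse of a non-invertible element is set to \<open>0\<close>. Quotients \<open>a / b\<close> occur below only
  for commuting \<open>a\<close> and \<open>b\<close>.
\<close>

instantiation clifford :: ("{finite,linorder}") inverse
begin
definition inverse_clifford :: "'a clifford \<Rightarrow> 'a clifford" where
  "inverse_clifford a = (if \<exists>b. a * b = 1 \<and> b * a = 1 then (THE b. a * b = 1 \<and> b * a = 1) else 0)"
definition divide_clifford :: "'a clifford \<Rightarrow> 'a clifford \<Rightarrow> 'a clifford" where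
  "divide_clifford a b = a * inverse b"
instance ..
end

lemma cl_inverse_eqI: "a * b = 1 \<Longrightarrow> b * a = 1 \<Longrightarrow> inverse a = b"
  for a b :: "'n::{finite,linorder} clifford"
  unfolding inverse_clifford_def by (auto intro!: the_equality) (metis mult.assoc mult_1 mult_1_right)

section \<open>Paravectors and slice hyperholomorphic functions\<close>

definition paravectors :: "'n::{finite,linorder} clifford set" where
  "paravectors = {of_real a + (\<Sum>i\<in>UNIV. x i *\<^sub>R cl_gen i) | a x. True}"

abbreviation cl_re :: "'n::{finite,linorder} clifford \<Rightarrow> real" where
  "cl_re s \<equiv> cl_coeff s {}"

definition cl_conj :: "'n::{finite,linorder} clifford \<Rightarrow> 'n clifford" where
  "cl_conj s = of_real (cl_re s) - (\<Sum>i\<in>UNIV. cl_coeff s {i} *\<^sub>R cl_gen i)"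

definition imag_sphere :: "'n::{finite,linorder} clifford set" where
  "imag_sphere = {s \<in> paravectors. cl_re s = 0 \<and> norm s = 1}"

definition slice_pt :: "'n::{finite,linorder} clifford \<Rightarrow> real \<times> real \<Rightarrow> 'n clifford" where
  "slice_pt J z = of_real (fst z) + J * of_real (snd z)"

definition cl_exp :: "'n::{finite,linorder} clifford \<Rightarrow> real \<Rightarrow> 'n clifford" where
  "cl_exp J \<phi> = slice_pt J (cos \<phi>, sin \<phi>)"

definition axially_symmetric :: "'n::{finite,linorder} clifford set \<Rightarrow> bool" where
  "axially_symmetric U \<longleftrightarrow>
     (\<forall>z. \<forall>J\<in>imag_sphere. slice_pt J z \<in> U \<longrightarrow> (\<forall>I\<in>imag_sphere. slice_pt I z \<in> U))"

definition slice_domain :: "'n::{finite,linorder} clifford set \<Rightarrow> (real \<times> real) set" where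
  "slice_domain U = {z. \<forall>J\<in>imag_sphere. slice_pt J z \<in> U}"

text \<open>Continuous differentiability, with derivative \<open>g'\<close>, on an open set.\<close>

definition C1_on :: "('a::real_normed_vector \<Rightarrow> 'b::real_normed_vector) \<Rightarrow> ('a \<Rightarrow> 'a \<Rightarrow>\<^sub>L 'b) \<Rightarrow> 'a set \<Rightarrow> bool" where
  "C1_on g g' S \<longleftrightarrow>
     (\<forall>z\<in>S. (g has_derivative blinfun_apply (g' z)) (at z)) \<and> continuous_on S g'"

definition slice_decomposition ::
  "'n::{finite,linorder} clifford set \<Rightarrow> ('n clifford \<Rightarrow> 'n clifford)
    \<Rightarrow> (real \<times> real \<Rightarrow> 'n clifford) \<Rightarrow> (real \<times> real \<Rightarrow> 'n clifford) \<Rightarrow> bool" where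
  "slice_decomposition U f f0 f1 \<longleftrightarrow>
     (\<exists>f0' f1'. C1_on f0 f0' (slice_domain U) \<and> C1_on f1 f1' (slice_domain U) \<and>
       (\<forall>(x, y) \<in> slice_domain U.
          (\<forall>J\<in>imag_sphere. f (slice_pt J (x, y)) = f0 (x, y) + J * f1 (x, y)) \<and>
          f0 (x, - y) = f0 (x, y) \<and> f1 (x, - y) = - f1 (x, y) \<and>
          f0' (x, y) (1, 0) = f1' (x, y) (0, 1) \<and>
          f0' (x, y) (0, 1) = - f1' (x, y) (1, 0)))"

text \<open>Functions on \<open>U\<close> are total functions of which only the values on \<open>U\<close> matter.\<close>

definition slice_hyperholomorphic ::
  "'n::{finite,linorder} clifford set \<Rightarrow> ('n clifford \<Rightarrow> 'n clifford) set" where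
  "slice_hyperholomorphic U =
     {f. openin (top_of_set paravectors) U \<and> axially_symmetric U \<and>
         (\<exists>f0 f1. slice_decomposition U f f0 f1)}"

definition intrinsic ::
  "'n::{finite,linorder} clifford set \<Rightarrow> ('n clifford \<Rightarrow> 'n clifford) set" where
  "intrinsic U =
     {f. openin (top_of_set paravectors) U \<and> axially_symmetric U \<and>
         (\<exists>f0 f1. slice_decomposition U f f0 f1 \<and>
            (\<forall>z\<in>slice_domain U. f0 z \<in> \<real> \<and> f1 z \<in> \<real>))}"

definition sector_angles :: "real \<Rightarrow> real set" where
  "sector_angles \<omega> = {- \<omega><..<\<omega>} \<union> {pi - \<omega><..<pi + \<omega>}"

definition bisector :: "real \<Rightarrow> 'n::{finite,linorder} clifford set" where
  "bisector \<omega> = {r *\<^sub>R cl_exp J \<phi> | r J \<phi>. 0 < r \<and> J \<in> imag_sphere \<and> \<phi> \<in> sector_angles \<omega>}"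

definition SH0 :: "real \<Rightarrow> ('n::{finite,linorder} clifford \<Rightarrow> 'n clifford) set" where
  "SH0 \<theta> = {f \<in> slice_hyperholomorphic (bisector \<theta>).
     bounded (f ` bisector \<theta>) \<and>
     (\<forall>J\<in>imag_sphere. \<forall>\<phi>\<in>sector_angles \<theta>.
        set_integrable lborel {0<..} (\<lambda>t. norm (f (t *\<^sub>R cl_exp J \<phi>)) / t))}"

definition N0 :: "real \<Rightarrow> ('n::{finite,linorder} clifford \<Rightarrow> 'n clifford) set" where
  "N0 \<theta> = SH0 \<theta> \<inter> intrinsic (bisector \<theta>)"

section \<open>Unbounded operators\<close>

text \<open>
  An operator in \<open>V\<close> is a partial map \<open>T :: V \<rightharpoonup> V\<close> with domain \<^term>\<open>dom T\<close> and range
  \<^term>\<open>ran T\<close>; hence equality of operators includes equality of domains, and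
  \<^term>\<open>A \<circ>\<^sub>m B\<close> is the product with its natural domain.
\<close>

type_synonym ('v, 'n) operator = "'v^('n set) \<rightharpoonup> 'v^('n set)"

definition cl_op :: "'n::{finite,linorder} clifford \<Rightarrow> ('v::real_vector, 'n) operator" where
  "cl_op a = (\<lambda>v. Some (lmult a v))"

definition op_add :: "('v::real_vector, 'n::finite) operator \<Rightarrow> ('v, 'n) operator \<Rightarrow> ('v, 'n) operator" where
  "op_add A B = (\<lambda>v. if v \<in> dom A \<inter> dom B then Some (the (A v) + the (B v)) else None)"

definition op_diff :: "('v::real_vector, 'n::finite) operator \<Rightarrow> ('v, 'n) operator \<Rightarrow> ('v, 'n) operator" where
  "op_diff A B = (\<lambda>v. if v \<in> dom A \<inter> dom B then Some (the (A v) - the (B v)) else None)"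

text \<open>Only used for injective operators, that is if \<^prop>\<open>inj_on A (dom A)\<close>; then the domain of
  the inverse is \<^term>\<open>ran A\<close>.\<close>

definition op_inv :: "('v, 'n::finite) operator \<Rightarrow> ('v, 'n) operator" where
  "op_inv A = (\<lambda>w. if \<exists>!v. A v = Some w then Some (THE v. A v = Some w) else None)"

primrec op_power :: "('v, 'n::finite) operator \<Rightarrow> nat \<Rightarrow> ('v, 'n) operator" where
  "op_power T 0 = Some"
| "op_power T (Suc k) = T \<circ>\<^sub>m op_power T k"

definition right_linear_op :: "('v::real_vector, 'n::{finite,linorder}) operator \<Rightarrow> bool" where
  "right_linear_op T \<longleftrightarrow>
     subspace (dom T) \<and> (\<forall>v\<in>dom T. \<forall>a. rmult v a \<in> dom T) \<and>
     (\<forall>v\<in>dom T. \<forall>w\<in>dom T. T (v + w) = Some (the (T v) + the (T w))) \<and>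
     (\<forall>v\<in>dom T. \<forall>a. T (rmult v a) = Some (rmult (the (T v)) a))"

text \<open>\<^term>\<open>op_bound A c\<close> says that \<open>A\<close> is everywhere defined with \<open>\<parallel>A\<parallel> \<le> c\<close>.\<close>

definition op_bound :: "('v::real_normed_vector, 'n::finite) operator \<Rightarrow> real \<Rightarrow> bool" where
  "op_bound A c \<longleftrightarrow> dom A = UNIV \<and> (\<forall>v. norm (the (A v)) \<le> c * norm v)"

definition bounded_ops :: "('v::real_normed_vector, 'n::{finite,linorder}) operator set" where
  "bounded_ops = {A. right_linear_op A \<and> (\<exists>c. op_bound A c)}"

definition closed_ops :: "('v::real_normed_vector, 'n::{finite,linorder}) operator set" where
  "closed_ops = {T. right_linear_op T \<and> closed {(v, w). T v = Some w}}"

definition Q_op :: "'n::{finite,linorder} clifford \<Rightarrow> ('v::real_vector, 'n) operator \<Rightarrow> ('v, 'n) operator" where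
  "Q_op s T = op_add (op_diff (T \<circ>\<^sub>m T) (cl_op (of_real (2 * cl_re s)) \<circ>\<^sub>m T))
                     (cl_op (of_real ((norm s)\<^sup>2)))"

definition S_resolvent_set :: "('v::real_normed_vector, 'n::{finite,linorder}) operator \<Rightarrow> 'n clifford set" where
  "S_resolvent_set T =
     {s \<in> paravectors. inj_on (Q_op s T) (dom (Q_op s T)) \<and> op_inv (Q_op s T) \<in> bounded_ops}"

definition S_spectrum :: "('v::real_normed_vector, 'n::{finite,linorder}) operator \<Rightarrow> 'n clifford set" where
  "S_spectrum T = paravectors - S_resolvent_set T"

definition SL_resolvent :: "'n::{finite,linorder} clifford \<Rightarrow> ('v::real_vector, 'n) operator \<Rightarrow> ('v, 'n) operator" where
  "SL_resolvent s T = op_diff (op_inv (Q_op s T) \<circ>\<^sub>m cl_op (cl_conj s)) (T \<circ>\<^sub>m op_inv (Q_op s T))"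

definition bisectorial :: "real \<Rightarrow> ('v::real_normed_vector, 'n::{finite,linorder}) operator \<Rightarrow> bool" where
  "bisectorial \<omega> T \<longleftrightarrow>
     S_spectrum T \<subseteq> closure (bisector \<omega>) \<and>
     (\<forall>\<phi>\<in>{\<omega><..<pi/2}. \<exists>C\<ge>0. \<forall>s \<in> paravectors - (bisector \<phi> \<union> {0}).
        op_bound (SL_resolvent s T) (C / norm s))"

section \<open>Functional calculi\<close>

definition gamma :: "real \<Rightarrow> real \<Rightarrow> 'n::{finite,linorder} clifford \<Rightarrow> real \<Rightarrow> 'n clifford" where
  "gamma \<sigma> \<phi> J t = (\<sigma> * \<bar>t\<bar>) *\<^sub>R cl_exp J (- sgn t * \<phi>)"

text \<open>
  The integral in \<open>\<B>(V)\<close> is the gauge integral with values in the Banach space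
  of bounded real-linear operators on \<open>V\<close>, in which \<open>\<B>(V)\<close> is a closed subspace. The integrand at
  the single point \<open>t = 0\<close>, where it is meaningless, is irrelevant.
\<close>

definition omega_integral ::
  "real \<Rightarrow> 'n::{finite,linorder} clifford \<Rightarrow> ('v::banach, 'n) operator \<Rightarrow> ('n clifford \<Rightarrow> 'n clifford)
    \<Rightarrow> (('v^('n set)) \<Rightarrow>\<^sub>L ('v^('n set)))" where
  "omega_integral \<phi> J T f = (1 / (2 * pi)) *\<^sub>R (\<Sum>\<sigma>\<in>{1, - 1}. integral UNIV (\<lambda>t.
     Blinfun (the \<circ> (SL_resolvent (gamma \<sigma> \<phi> J t) T
       \<circ>\<^sub>m cl_op (vector_derivative (gamma \<sigma> \<phi> J) (at t) / J)
       \<circ>\<^sub>m cl_op (f (gamma \<sigma> \<phi> J t))))))"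

text \<open>The \<open>\<omega>\<close>-calculus for \<open>f \<in> SH0 \<theta>\<close>. The integral is independent of the angle \<open>\<phi> \<in> (\<omega>, \<theta>)\<close> and
  of \<open>J\<close>, so that an arbitrary choice defines it; the same holds for the regularizer below.\<close>

definition omega_calc ::
  "real \<Rightarrow> real \<Rightarrow> ('v::banach, 'n::{finite,linorder}) operator \<Rightarrow> ('n clifford \<Rightarrow> 'n clifford)
    \<Rightarrow> ('v, 'n) operator" where
  "omega_calc \<omega> \<theta> T f =
     (let (\<phi>, J) = (SOME (\<phi>, J). \<phi> \<in> {\<omega><..<\<theta>} \<and> J \<in> imag_sphere)
      in Some \<circ> blinfun_apply (omega_integral \<phi> J T f))"

definition bnd_components ::
  "real \<Rightarrow> ('n::{finite,linorder} clifford \<Rightarrow> 'n clifford) \<Rightarrow> real \<Rightarrow> real \<Rightarrow> ('n clifford \<Rightarrow> 'n clifford) \<Rightarrow> bool" where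
  "bnd_components \<theta> g g0 ginf gt \<longleftrightarrow>
     gt \<in> N0 \<theta> \<and>
     (\<forall>s\<in>bisector \<theta>. g s = of_real ginf + 1 / (1 + s\<^sup>2) * of_real (g0 - ginf) + gt s)"

definition Nbnd :: "real \<Rightarrow> ('n::{finite,linorder} clifford \<Rightarrow> 'n clifford) set" where
  "Nbnd \<theta> = {g. \<exists>g0 ginf gt. bnd_components \<theta> g g0 ginf gt}"

text \<open>The components \<open>g0\<close>, \<open>ginf\<close> and the restriction of \<open>gt\<close> to the bisector are unique.\<close>

definition bnd_calc ::
  "real \<Rightarrow> real \<Rightarrow> ('v::banach, 'n::{finite,linorder}) operator \<Rightarrow> ('n clifford \<Rightarrow> 'n clifford)
    \<Rightarrow> ('v, 'n) operator" where
  "bnd_calc \<omega> \<theta> T g =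
     (let (g0, ginf, gt) = (SOME (g0, ginf, gt). bnd_components \<theta> g g0 ginf gt)
      in op_add (op_add (cl_op (of_real ginf))
                        (op_inv (op_add (cl_op 1) (T \<circ>\<^sub>m T)) \<circ>\<^sub>m cl_op (of_real (g0 - ginf))))
                (omega_calc \<omega> \<theta> T gt))"

definition regularizer ::
  "real \<Rightarrow> real \<Rightarrow> ('v::banach, 'n::{finite,linorder}) operator \<Rightarrow> ('n clifford \<Rightarrow> 'n clifford)
    \<Rightarrow> ('n clifford \<Rightarrow> 'n clifford) \<Rightarrow> bool" where
  "regularizer \<omega> \<theta> T g e \<longleftrightarrow>
     e \<in> Nbnd \<theta> \<and> (\<lambda>s. e s * g s) \<in> Nbnd \<theta> \<and>
     inj_on (bnd_calc \<omega> \<theta> T e) (dom (bnd_calc \<omega> \<theta> T e))"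

definition Nreg ::
  "real \<Rightarrow> real \<Rightarrow> ('v::banach, 'n::{finite,linorder}) operator \<Rightarrow> ('n clifford \<Rightarrow> 'n clifford) set" where
  "Nreg \<omega> \<theta> T = {g \<in> intrinsic (bisector \<theta>). \<exists>e. regularizer \<omega> \<theta> T g e}"

definition Hinf_calc ::
  "real \<Rightarrow> real \<Rightarrow> ('v::banach, 'n::{finite,linorder}) operator \<Rightarrow> ('n clifford \<Rightarrow> 'n clifford)
    \<Rightarrow> ('v, 'n) operator" where
  "Hinf_calc \<omega> \<theta> T g =
     (let e = (SOME e. regularizer \<omega> \<theta> T g e)
      in op_inv (bnd_calc \<omega> \<theta> T e) \<circ>\<^sub>m bnd_calc \<omega> \<theta> T (\<lambda>s. e s * g s))"

section \<open>Intrinsic polynomials\<close>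

text \<open>\<^const>\<open>poly\<close> itself is not available over a noncommutative ring.\<close>

definition cl_poly :: "real poly \<Rightarrow> 'n::{finite,linorder} clifford \<Rightarrow> 'n clifford" where
  "cl_poly p s = (\<Sum>i\<le>degree p. coeff p i *\<^sub>R s ^ i)"

definition op_poly :: "real poly \<Rightarrow> ('v::real_vector, 'n::{finite,linorder}) operator \<Rightarrow> ('v, 'n) operator" where
  "op_poly p T = (\<lambda>v. if v \<in> dom (op_power T (degree p))
     then Some (\<Sum>i\<le>degree p. coeff p i *\<^sub>R the (op_power T i v)) else None)"

end

theory Submission
  imports Defs "HOL-Complex_Analysis.Complex_Analysis"
    "HOL-Computational_Algebra.Fundamental_Theorem_Algebra"
begin

text \<open>
  On every slice an intrinsic function is one holomorphic function \<open>F\<close> with \<open>F(cnj z) = cnj (F z)\<close>,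
  and pairing conjugate points of the contour turns the Clifford integral into
  \<open>F(T)v = (1/\<pi>) Re (i \<integral> F(z) (z - T)\<^sup>-\<^sup>1 v dz)\<close>, the contour being the ray of angle \<open>\<phi>\<close> minus the
  ray of angle \<open>\<pi> - \<phi>\<close>, with the resolvent of \<open>T\<close> on the complexification \<open>V \<times> V\<close>. This involves only
  real coefficients, so no left multiplication by Clifford numbers survives and the calculus commutes
  with \<open>T\<close>. Write \<open>\<lambda> = 1/(1 + z\<^sup>2)\<close> and \<open>\<Lambda> = (1 + T\<^sup>2)\<^sup>-\<^sup>1\<close>. Rotating rays (Cauchy's theorem in polar
  coordinates) gives \<open>(\<lambda>F)(T) = \<Lambda>F(T)\<close>, \<open>(z\<lambda>F)(T) = T\<Lambda>F(T)\<close> and \<open>(z\<lambda>)(T) = T\<Lambda>\<close>. Hence if \<open>p e = q g\<close> with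
  \<open>e\<close>, \<open>g\<close> in the extended calculus, then \<open>p[T]\<Lambda>\<^sup>ke(T) = q[T]\<Lambda>\<^sup>kg(T)\<close> for large \<open>k\<close>. For an arbitrary regularizer
  \<open>e\<close> of \<open>p/q\<close> and \<open>g = ep/q\<close>, injectivity of \<open>\<Lambda>\<^sup>k\<close> and \<open>e(T)\<close> yields \<open>e(T)\<^sup>-\<^sup>1g(T) = p[T]q[T]\<^sup>-\<^sup>1\<close>, the domains
  agreeing because \<open>p[T]u \<in> dom(T\<^sup>j)\<close> forces \<open>u \<in> dom(T\<^sup>m\<^sup>+\<^sup>j)\<close> for \<open>m\<close> the degree of \<open>p\<close>. The powers \<open>\<lambda>\<^sup>k\<close> are
  regularizers, and \<open>q[T]\<close> is bijective as a product of operators \<open>Q\<^sub>s[T]\<close>.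
\<close>

section \<open>Slices of the Clifford algebra\<close>

text \<open>No general product rule is established: the only multipliers that pass through the
  integral are \<open>lam\<close> and \<open>z lam\<close>. Each does so by a resolvent identity
  that leaves correction terms with scalar coefficients. These drop out because their ray integrals
  are real, whereas F(T)v is read off the imaginary part. The obstacle is the rational part e_inf +
  (e_0 - e_inf) lam of a function in the extended class. It tends to e_0 at 0 and to e_inf at
  infinity, so it is in general not integrable against dt/t and lies outside the integral calculus,
  and in p e = q g the rational parts of the two sides need not match. Their difference times lam^k
  is, however, equal on the sector to a combination of the integrable parts, which forces a zero at
  0. A factor z lam can then be split off, so that z lam is the only function whose contour integral
  has to be evaluated. Its value comes from the arctangent integral of lam over the positive
  axis.\<close>

definition cl_of :: "'n::{finite,linorder} clifford \<Rightarrow> complex \<Rightarrow> 'n clifford" where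
  "cl_of J z = slice_pt J (Re z, Im z)"

lemma cl_of_altdef: "cl_of J z = Re z *\<^sub>R 1 + Im z *\<^sub>R J"
  by (simp add: cl_of_def slice_pt_def of_real_def)

lemma slice_pt_eq_cl_of: "slice_pt J z = cl_of J (Complex (fst z) (snd z))"
  by (simp add: cl_of_def)

lemma cl_coeff_one: "cl_coeff 1 A = (if A = {} then 1 else 0)"
  by (simp add: one_clifford_def)

lemma paravectorE:
  assumes "s \<in> paravectors"
  obtains a x where "s = of_real a + (\<Sum>i\<in>UNIV. x i *\<^sub>R cl_gen i)"
  using assms by (auto simp: paravectors_def)

lemma cl_coeff_vector_part:
  fixes x :: "'n::{finite,linorder} \<Rightarrow> real"
  shows "cl_coeff (of_real a + (\<Sum>i\<in>UNIV. x i *\<^sub>R cl_gen i)) A =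
    (if A = {} then a else if \<exists>i. A = {i} then x (THE i. A = {i}) else 0)"
proof -
  have "(\<Sum>i\<in>UNIV. x i * (if A = {i} then 1 else 0)) = (if \<exists>i. A = {i} then x (THE i. A = {i}) else 0)"
  proof (cases "\<exists>i. A = {i}")
    case True
    then obtain j where "A = {j}" by blast
    then have "(\<Sum>i\<in>UNIV. x i * (if A = {i} then 1 else 0)) = (\<Sum>i\<in>UNIV. if i = j then x i else 0)"
      by (intro sum.cong) auto
    then show ?thesis using \<open>A = {j}\<close> by auto
  qed auto
  then show ?thesis
    by (auto simp: of_real_def cl_coeff_one)
qed

lemma sum_over_singletons:
  fixes x :: "'n::{finite,linorder} \<Rightarrow> real"
  shows "(\<Sum>A\<in>UNIV. (if A = {} then a else if \<exists>i. A = {i} then x (THE i. A = {i}) else 0)\<^sup>2)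
    = a\<^sup>2 + (\<Sum>i\<in>UNIV. (x i)\<^sup>2)"
proof -
  let ?f = "\<lambda>A :: 'n set. (if A = {} then a else if \<exists>i. A = {i} then x (THE i. A = {i}) else 0)\<^sup>2"
  have "sum ?f UNIV = sum ?f (insert {} ((\<lambda>i. {i}) ` UNIV))"
    by (rule sum.mono_neutral_right) auto
  also have "\<dots> = ?f {} + sum ?f ((\<lambda>i. {i}) ` UNIV)"
    by (rule sum.insert) auto
  also have "sum ?f ((\<lambda>i. {i}) ` UNIV) = (\<Sum>i\<in>UNIV. (x i)\<^sup>2)"
    by (subst sum.reindex) (auto simp: inj_on_def)
  finally show ?thesis by simp
qed

lemma norm_paravector:
  fixes x :: "'n::{finite,linorder} \<Rightarrow> real"
  shows "(norm (of_real a + (\<Sum>i\<in>UNIV. x i *\<^sub>R cl_gen i)))\<^sup>2 = a\<^sup>2 + (\<Sum>i\<in>UNIV. (x i)\<^sup>2)"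
  unfolding norm_clifford_power2 cl_coeff_vector_part by (rule sum_over_singletons)

text \<open>Symmetrizing the double sum cancels the off-diagonal pairs, since distinct generators
  anticommute; only the squares, each equal to -1, survive.\<close>

lemma vector_part_square:
  fixes x :: "'n::{finite,linorder} \<Rightarrow> real"
  shows "(\<Sum>i\<in>UNIV. x i *\<^sub>R cl_gen i) * (\<Sum>i\<in>UNIV. x i *\<^sub>R cl_gen i) = - (\<Sum>i\<in>UNIV. (x i)\<^sup>2) *\<^sub>R 1"
proof -
  let ?e = "\<lambda>i j. (x i * x j) *\<^sub>R (cl_gen i * cl_gen j :: 'n clifford)"
  have *: "?e i j + ?e j i = (if i = j then - 2 * (x i)\<^sup>2 else 0) *\<^sub>R 1" for i j
  proof (cases "i = j")
    case True
    have "?e j j + ?e j j = (2 * (x j * x j)) *\<^sub>R (- 1)"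
      by (simp only: cl_gen_square mult_2 scaleR_add_left)
    then show ?thesis using True by (simp add: power2_eq_square)
  next
    case False
    have "?e i j = (x j * x i) *\<^sub>R (cl_gen i * cl_gen j)" by (simp only: mult.commute)
    also have "\<dots> = - ?e j i" by (subst cl_gen_anticommute[OF False]) (rule scaleR_minus_right)
    finally have "?e i j = - ?e j i" .
    then show ?thesis using False by simp
  qed
  have "2 *\<^sub>R (\<Sum>i\<in>UNIV. \<Sum>j\<in>UNIV. ?e i j) = (\<Sum>i\<in>UNIV. \<Sum>j\<in>UNIV. ?e i j) + (\<Sum>j\<in>UNIV. \<Sum>i\<in>UNIV. ?e i j)"
    by (subst (2) sum.swap) (simp add: scaleR_2)
  also have "\<dots> = (\<Sum>i\<in>UNIV. \<Sum>j\<in>UNIV. ?e i j + ?e j i)"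
    by (simp add: sum.distrib)
  also have "\<dots> = (\<Sum>i\<in>UNIV. \<Sum>j\<in>UNIV. (if i = j then - 2 * (x i)\<^sup>2 else 0) *\<^sub>R 1)"
    by (simp only: *)
  also have "\<dots> = 2 *\<^sub>R (- (\<Sum>i\<in>UNIV. (x i)\<^sup>2) *\<^sub>R 1)"
    by (simp add: scaleR_sum_left[symmetric] sum_distrib_left sum_negf)
  finally have "(\<Sum>i\<in>UNIV. \<Sum>j\<in>UNIV. ?e i j) = - (\<Sum>i\<in>UNIV. (x i)\<^sup>2) *\<^sub>R 1"
    unfolding scaleR_cancel_left by simp
  then show ?thesis
    by (simp add: sum_product cl_mult_scaleR mult.commute)
qed

lemma imag_sphereE:
  assumes "J \<in> imag_sphere"
  obtains x where "J = (\<Sum>i\<in>UNIV. x i *\<^sub>R cl_gen i)" "(\<Sum>i\<in>UNIV. (x i)\<^sup>2) = 1"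
proof -
  from assms have J: "J \<in> paravectors" "cl_re J = 0" "norm J = 1" by (auto simp: imag_sphere_def)
  from J(1) obtain a x where ax: "J = of_real a + (\<Sum>i\<in>UNIV. x i *\<^sub>R cl_gen i)" by (rule paravectorE)
  have "a = 0" using J(2) unfolding ax cl_coeff_vector_part by simp
  moreover have "(\<Sum>i\<in>UNIV. (x i)\<^sup>2) = 1"
    using norm_paravector[of a x] J(3) unfolding ax[symmetric] by (simp add: \<open>a = 0\<close>)
  ultimately show ?thesis using that[of x] ax by simp
qed

lemma imag_sphere_square: "J \<in> imag_sphere \<Longrightarrow> J * J = - 1"
  by (elim imag_sphereE) (simp add: vector_part_square)

lemma paravector_coordinates:
  assumes "s \<in> paravectors"
  shows "s = of_real (cl_re s) + (\<Sum>i\<in>UNIV. cl_coeff s {i} *\<^sub>R cl_gen i)"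
proof -
  from assms obtain a x where ax: "s = of_real a + (\<Sum>i\<in>UNIV. x i *\<^sub>R cl_gen i)" by (rule paravectorE)
  have "cl_re s = a" "cl_coeff s {i} = x i" for i
    unfolding ax cl_coeff_vector_part by auto
  then show ?thesis using ax by simp
qed

lemma imag_sphere_vector:
  assumes "(\<Sum>i\<in>UNIV. (x i)\<^sup>2) = 1"
  shows "(\<Sum>i\<in>UNIV. x i *\<^sub>R cl_gen i) \<in> imag_sphere"
proof -
  let ?J = "\<Sum>i\<in>UNIV. x i *\<^sub>R cl_gen i"
  have "?J = of_real 0 + ?J" by simp
  then have "?J \<in> paravectors" unfolding paravectors_def by blast
  moreover have "cl_re ?J = 0" using cl_coeff_vector_part[of 0 x "{}"] by simp
  moreover have "norm ?J = 1" using norm_paravector[of 0 x] assms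
    by (simp add: power2_eq_1_iff) (metis norm_ge_zero not_one_le_zero neg_equal_iff_equal le_minus_one_simps(3))
  ultimately show ?thesis by (simp add: imag_sphere_def)
qed

lemma imag_sphere_nonempty: "(imag_sphere :: 'n::{finite,linorder} clifford set) \<noteq> {}"
proof -
  obtain k :: 'n where True by blast
  have "(\<Sum>i\<in>UNIV. (if i = k then 1 else 0 :: real)\<^sup>2) = 1"
    by (simp add: if_distrib[of "\<lambda>x. x\<^sup>2"] cong: if_cong)
  from imag_sphere_vector[OF this] show ?thesis by blast
qed

lemma cl_of_add: "cl_of J (z + w) = cl_of J z + cl_of J w"
  and cl_of_diff: "cl_of J (z - w) = cl_of J z - cl_of J w"
  and cl_of_minus: "cl_of J (- z) = - cl_of J z"
  and cl_of_scaleR: "cl_of J (r *\<^sub>R z) = r *\<^sub>R cl_of J z"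
  and cl_of_zero [simp]: "cl_of J 0 = 0"
  and cl_of_one [simp]: "cl_of J 1 = 1"
  and cl_of_i [simp]: "cl_of J \<i> = J"
  and cl_of_of_real [simp]: "cl_of J (of_real r) = of_real r"
  by (simp_all add: cl_of_altdef algebra_simps of_real_def)

lemma cl_of_mult: "J \<in> imag_sphere \<Longrightarrow> cl_of J (z * w) = cl_of J z * cl_of J w"
  by (simp add: cl_of_altdef cl_mult_add cl_mult_scaleR imag_sphere_square algebra_simps)

lemma cl_of_power: "J \<in> imag_sphere \<Longrightarrow> cl_of J (z ^ k) = cl_of J z ^ k"
  by (induction k) (simp_all add: cl_of_mult)

lemma cl_of_inverse:
  assumes "J \<in> imag_sphere"
  shows "cl_of J (inverse z) = inverse (cl_of J z)"
proof (cases "z = 0")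
  \<comment> \<open>The zero element is not invertible, so the right hand side is the default value
    0, in agreement with the complex convention.\<close>
  case True
  then show ?thesis by (simp add: inverse_clifford_def)
next
  case False
  then have "cl_of J z * cl_of J (inverse z) = 1" "cl_of J (inverse z) * cl_of J z = 1"
    using assms by (simp_all flip: cl_of_mult)
  then show ?thesis by (simp add: cl_inverse_eqI)
qed

lemma cl_of_divide: "J \<in> imag_sphere \<Longrightarrow> cl_of J (z / w) = cl_of J z / cl_of J w"
  by (simp add: divide_clifford_def divide_inverse cl_of_mult cl_of_inverse)

lemma cl_re_cl_of: "J \<in> imag_sphere \<Longrightarrow> cl_re (cl_of J z) = Re z"
  by (simp add: cl_of_altdef imag_sphere_def cl_coeff_one)

lemma norm_cl_of: 
  assumes "J \<in> imag_sphere" shows "norm (cl_of J z) = cmod z"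
proof -
  from assms obtain x where x: "J = (\<Sum>i\<in>UNIV. x i *\<^sub>R cl_gen i)" "(\<Sum>i\<in>UNIV. (x i)\<^sup>2) = 1"
    by (rule imag_sphereE)
  have "cl_of J z = of_real (Re z) + (\<Sum>i\<in>UNIV. (Im z * x i) *\<^sub>R cl_gen i)"
    by (simp add: cl_of_altdef x(1) scaleR_sum_right of_real_def)
  then have "(norm (cl_of J z))\<^sup>2 = (Re z)\<^sup>2 + (\<Sum>i\<in>UNIV. (Im z * x i)\<^sup>2)"
    by (simp only: norm_paravector)
  also have "\<dots> = (Re z)\<^sup>2 + (Im z)\<^sup>2"
    by (simp add: power_mult_distrib x(2) flip: sum_distrib_left)
  finally show ?thesis
    by (simp add: cmod_def real_sqrt_unique)
qed

lemma cl_of_paravector: 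
  assumes "J \<in> imag_sphere" shows "cl_of J z \<in> paravectors"
proof -
  from assms obtain x where x: "J = (\<Sum>i\<in>UNIV. x i *\<^sub>R cl_gen i)" by (rule imag_sphereE)
  have "cl_of J z = of_real (Re z) + (\<Sum>i\<in>UNIV. (Im z * x i) *\<^sub>R cl_gen i)"
    by (simp add: cl_of_altdef x(1) scaleR_sum_right of_real_def)
  then show ?thesis unfolding paravectors_def
    by (intro CollectI exI[of _ "Re z"] exI[of _ "\<lambda>i. Im z * x i"]) simp
qed

lemma cl_conj_cl_of:
  assumes "J \<in> imag_sphere" shows "cl_conj (cl_of J z) = cl_of J (cnj z)"
proof -
  have "cl_of J z = of_real (Re z) + (\<Sum>i\<in>UNIV. cl_coeff (cl_of J z) {i} *\<^sub>R cl_gen i)"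
    using paravector_coordinates[OF cl_of_paravector[OF assms]] by (simp add: cl_re_cl_of assms)
  then have "(\<Sum>i\<in>UNIV. cl_coeff (cl_of J z) {i} *\<^sub>R cl_gen i) = Im z *\<^sub>R J"
    by (simp add: cl_of_altdef of_real_def del: cl_coeff_simps)
  then show ?thesis
    by (simp add: cl_conj_def cl_re_cl_of assms del: cl_coeff_simps) (simp add: cl_of_altdef of_real_def)
qed

lemma cl_of_inject:
  assumes "J \<in> imag_sphere" shows "cl_of J z = cl_of J w \<longleftrightarrow> z = w"
  using norm_cl_of[OF assms, of "z - w"] by (auto simp: cl_of_diff)

text \<open>The unit \<open>J\<close> is the normalized vector part of \<open>s\<close>, which makes
  the imaginary coordinate nonnegative. A real paravector lies in every slice, and there
  \<open>J\<close> is arbitrary.\<close>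

lemma paravector_eq_cl_of:
  assumes "s \<in> paravectors"
  obtains J where "J \<in> imag_sphere" "s = cl_of J (Complex (cl_re s) (norm (s - of_real (cl_re s))))"
proof -
  define x where "x i = cl_coeff s {i}" for i
  define v where "v = (\<Sum>i\<in>UNIV. x i *\<^sub>R cl_gen i)"
  have s: "s = of_real (cl_re s) + v"
    using paravector_coordinates[OF assms] by (simp add: v_def x_def)
  then have v: "s - of_real (cl_re s) = v" by (metis add_diff_cancel_left')
  have nv: "(norm v)\<^sup>2 = (\<Sum>i\<in>UNIV. (x i)\<^sup>2)"
    using norm_paravector[of 0 x] by (simp add: v_def)
  show ?thesis
  proof (cases "v = 0")
    case True
    obtain J :: "'a clifford" where "J \<in> imag_sphere" using imag_sphere_nonempty by blast
    with that[of J] show ?thesis using s True by (simp add: cl_of_altdef of_real_def)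
  next
    case False
    have "(\<Sum>i\<in>UNIV. (x i / norm v)\<^sup>2) = 1"
      using False by (simp add: power_divide nv flip: sum_divide_distrib) (metis nv norm_eq_zero power_eq_0_iff)
    from imag_sphere_vector[OF this]
    have "(1 / norm v) *\<^sub>R v \<in> imag_sphere" by (simp add: v_def scaleR_sum_right)
    from that[OF this] show ?thesis
      unfolding v using s False by (simp add: cl_of_altdef of_real_def)
  qed
qed

lemma bounded_linear_cl_of: "bounded_linear (cl_of J)"
proof (rule bounded_linear_intro[where K = "norm (1 :: 'a clifford) + norm J"])
  fix z
  have "norm (cl_of J z) \<le> \<bar>Re z\<bar> * norm (1 :: 'a clifford) + \<bar>Im z\<bar> * norm J"
    unfolding cl_of_altdef by (rule norm_triangle_le) simp
  also have "\<dots> \<le> cmod z * norm (1 :: 'a clifford) + cmod z * norm J"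
    by (intro add_mono mult_right_mono abs_Re_le_cmod abs_Im_le_cmod) simp_all
  finally show "norm (cl_of J z) \<le> cmod z * (norm (1 :: 'a clifford) + norm J)" by (simp add: algebra_simps)
qed (simp_all add: cl_of_add cl_of_scaleR)

text \<open>Real coefficients commute with \<open>J\<close>, so an intrinsic polynomial acts on each
  slice as the same complex polynomial.\<close>

lemma cl_poly_cl_of:
  assumes "J \<in> imag_sphere"
  shows "cl_poly p (cl_of J z) = cl_of J (poly (map_poly of_real p) z)"
proof -
  have "poly (map_poly of_real p) z = (\<Sum>i\<le>degree p. of_real (coeff p i) * z ^ i)"
    by (simp add: poly_altdef coeff_map_poly degree_map_poly)
  also have "cl_of J \<dots> = (\<Sum>i\<le>degree p. cl_of J (of_real (coeff p i) * z ^ i))"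
    by (simp add: linear_sum[OF bounded_linear.linear[OF bounded_linear_cl_of]])
  also have "\<dots> = cl_poly p (cl_of J z)"
    unfolding cl_poly_def
    by (simp add: cl_of_scaleR cl_of_power assms flip: scaleR_conv_of_real)
  finally show ?thesis ..
qed

section \<open>Double sectors in the complex plane\<close>

definition csector :: "real \<Rightarrow> complex set" where
  "csector \<theta> = {z. \<bar>Im z\<bar> < tan \<theta> * \<bar>Re z\<bar>}"

text \<open>Tangents instead of angles make openness and closedness immediate. In contrast to
  \<open>csector\<close>, this set contains 0; both contain the rest of the real axis when the
  tangent is positive.\<close>

definition closed_csector :: "real \<Rightarrow> complex set" where
  "closed_csector \<theta> = {z. \<bar>Im z\<bar> \<le> tan \<theta> * \<bar>Re z\<bar>}"

lemma open_csector [simp]: "open (csector \<theta>)"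
  unfolding csector_def by (intro open_Collect_less continuous_intros)

lemma closed_closed_csector [simp]: "closed (closed_csector \<theta>)"
  unfolding closed_csector_def by (intro closed_Collect_le continuous_intros)

lemma csector_Re_nonzero: "z \<in> csector \<theta> \<Longrightarrow> Re z \<noteq> 0"
  by (auto simp: csector_def)

lemma cnj_in_csector [simp]: "cnj z \<in> csector \<theta> \<longleftrightarrow> z \<in> csector \<theta>"
  by (simp add: csector_def)

lemma uminus_in_csector [simp]: "- z \<in> csector \<theta> \<longleftrightarrow> z \<in> csector \<theta>"
  by (simp add: csector_def)

lemma tan_mono_le_0: "\<lbrakk>0 < a; a \<le> b; b < pi/2\<rbrakk> \<Longrightarrow> tan a \<le> tan b"
  by (metis tan_monotone less_eq_real_def less_minus_iff minus_pi_half_less_zero order.strict_trans)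

lemma rcis_uminus: "rcis r (\<psi> + pi) = - rcis r \<psi>" "rcis r (\<psi> - pi) = - rcis r \<psi>" "rcis r (pi - \<psi>) = - rcis r (- \<psi>)"
  by (simp_all add: rcis_def complex_eq_iff)

lemma rcis_in_csector_right:
  assumes "0 < \<theta>" "\<theta> < pi/2" "0 < r" "\<psi> \<in> {-\<theta><..<\<theta>}"
  shows "rcis r \<psi> \<in> csector \<theta>" "0 < Re (rcis r \<psi>)"
proof -
  have c: "0 < cos \<psi>" using assms by (intro cos_gt_zero_pi) auto
  have "tan \<bar>\<psi>\<bar> < tan \<theta>" using assms by (intro tan_monotone) (auto simp: abs_if)
  moreover have "\<bar>tan \<psi>\<bar> = tan \<bar>\<psi>\<bar>"
  proof (cases "\<psi> = 0")
    case False
    then have "0 < tan \<bar>\<psi>\<bar>" using assms by (intro tan_gt_zero) (auto simp: abs_if)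
    then show ?thesis by (auto simp: abs_if split: if_splits)
  qed simp
  ultimately have "\<bar>tan \<psi>\<bar> < tan \<theta>" by simp
  then have "\<bar>sin \<psi>\<bar> < tan \<theta> * \<bar>cos \<psi>\<bar>"
    using c by (simp add: tan_def field_simps)
  then show "rcis r \<psi> \<in> csector \<theta>"
    using assms(3) by (simp add: csector_def abs_mult mult.left_commute)
  show "0 < Re (rcis r \<psi>)" using c assms by simp
qed

lemma rcis_in_csector:
  assumes "0 < \<theta>" "\<theta> < pi/2" "0 < r" "\<psi> \<in> sector_angles \<theta>"
  shows "rcis r \<psi> \<in> csector \<theta>"
proof (cases "\<psi> \<in> {-\<theta><..<\<theta>}")
  case True
  then show ?thesis using rcis_in_csector_right assms by blast
next
  case False
  then have "\<psi> - pi \<in> {-\<theta><..<\<theta>}" using assms by (auto simp: sector_angles_def)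
  then have "rcis r (\<psi> - pi) \<in> csector \<theta>" using rcis_in_csector_right assms by blast
  then show ?thesis by (simp add: rcis_uminus)
qed

lemma csector_polar_right:
  assumes "0 < \<theta>" "\<theta> < pi/2" "z \<in> csector \<theta>" "0 < Re z"
  obtains r \<psi> where "0 < r" "\<psi> \<in> {-\<theta><..<\<theta>}" "z = rcis r \<psi>"
proof -
  have z: "z \<noteq> 0" using assms by auto
  have "\<bar>Arg z\<bar> < pi/2" using Re_Ln_pos_lt[of z] z assms by (simp add: Arg_eq_Im_Ln)
  have zr: "z = rcis (cmod z) (Arg z)" by (simp add: rcis_cmod_Arg)
  have "\<bar>Arg z\<bar> < \<theta>"
  proof (rule ccontr)
    assume *: "\<not> \<bar>Arg z\<bar> < \<theta>"
    then have "tan \<theta> \<le> tan \<bar>Arg z\<bar>"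
      using assms \<open>\<bar>Arg z\<bar> < pi/2\<close> by (intro tan_mono_le_0) auto
    moreover have "0 < cos (Arg z)" using \<open>\<bar>Arg z\<bar> < pi/2\<close> by (intro cos_gt_zero_pi) auto
    moreover have "tan \<bar>Arg z\<bar> = \<bar>sin (Arg z)\<bar> / cos (Arg z)"
    proof (cases "Arg z \<ge> 0")
      case True
      then have "0 \<le> sin (Arg z)" using \<open>\<bar>Arg z\<bar> < pi/2\<close> by (intro sin_ge_zero) auto
      then show ?thesis using True by (simp add: tan_def)
    next
      case False
      then have "0 \<le> sin (- Arg z)" using \<open>\<bar>Arg z\<bar> < pi/2\<close> by (intro sin_ge_zero) auto
      then show ?thesis using False by (simp add: tan_def)
    qed
    ultimately have "tan \<theta> * \<bar>cos (Arg z)\<bar> \<le> \<bar>sin (Arg z)\<bar>" by (simp add: field_simps)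
    then have "tan \<theta> * \<bar>Re (rcis (cmod z) (Arg z))\<bar> \<le> \<bar>Im (rcis (cmod z) (Arg z))\<bar>"
      by (simp add: abs_mult mult.left_commute mult_left_mono)
    then show False using assms(3) unfolding csector_def zr[symmetric] by simp
  qed
  then show ?thesis using z by (intro that[of "cmod z" "Arg z"] zr) auto
qed

lemma csector_polar:
  assumes "0 < \<theta>" "\<theta> < pi/2" "z \<in> csector \<theta>"
  obtains r \<psi> where "0 < r" "\<psi> \<in> sector_angles \<theta>" "z = rcis r \<psi>"
proof (cases "0 < Re z")
  case True
  then show ?thesis using csector_polar_right[OF assms] that unfolding sector_angles_def by blast
next
  case False
  then have "0 < Re (- z)" using csector_Re_nonzero[OF assms(3)] by auto
  moreover have "- z \<in> csector \<theta>" using assms by simp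
  ultimately obtain r \<psi> where *: "0 < r" "\<psi> \<in> {-\<theta><..<\<theta>}" "- z = rcis r \<psi>"
    using csector_polar_right[OF assms(1,2)] by blast
  then have "z = rcis r (\<psi> + pi)" by (simp add: rcis_uminus) (metis minus_minus)
  with * show ?thesis using that[of r "\<psi> + pi"] by (auto simp: sector_angles_def)
qed

lemma scaleR_cl_exp: "r *\<^sub>R cl_exp J \<phi> = cl_of J (rcis r \<phi>)"
  by (simp add: cl_exp_def slice_pt_eq_cl_of cl_of_altdef algebra_simps)

lemma bisector_eq_cl_of:
  assumes "0 < \<theta>" "\<theta> < pi/2"
  shows "bisector \<theta> = {cl_of J z | J z. J \<in> imag_sphere \<and> z \<in> csector \<theta>}" (is "?L = ?R")
proof
  show "?L \<subseteq> ?R"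
    unfolding bisector_def scaleR_cl_exp using rcis_in_csector[OF assms] by blast
  show "?R \<subseteq> ?L"
    unfolding bisector_def scaleR_cl_exp using csector_polar[OF assms] by blast
qed

lemma norm_cl_of_minus_re:
  assumes "J \<in> imag_sphere"
  shows "norm (cl_of J z - of_real (Re z)) = \<bar>Im z\<bar>"
proof -
  have "cl_of J z - of_real (Re z) = cl_of J (Complex 0 (Im z))"
    by (simp add: cl_of_altdef of_real_def)
  then show ?thesis using assms by (simp add: norm_cl_of cmod_def)
qed

text \<open>This description does not mention a unit \<open>J\<close>. It therefore decides
  membership for all representations of a point at once, and exhibits the double sector as
  relatively open.\<close>

lemma bisector_eq_norm:
  fixes \<theta> :: real
  assumes "0 < \<theta>" "\<theta> < pi/2"
  shows "(bisector \<theta> :: 'n::{finite,linorder} clifford set)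
    = paravectors \<inter> {s. norm (s - of_real (cl_re s)) < tan \<theta> * \<bar>cl_re s\<bar>}" (is "?L = ?R")
proof
  show "?L \<subseteq> ?R"
    unfolding bisector_eq_cl_of[OF assms]
    by (auto simp: cl_of_paravector cl_re_cl_of norm_cl_of_minus_re csector_def)
  show "?R \<subseteq> ?L"
  proof
    fix s :: "'n clifford" assume s: "s \<in> ?R"
    then obtain J where J: "J \<in> imag_sphere" "s = cl_of J (Complex (cl_re s) (norm (s - of_real (cl_re s))))"
      using paravector_eq_cl_of by blast
    have "Complex (cl_re s) (norm (s - of_real (cl_re s))) \<in> csector \<theta>"
      using s by (simp add: csector_def)
    then show "s \<in> ?L" unfolding bisector_eq_cl_of[OF assms] using J by blast
  qed
qed

lemma cl_of_in_bisector:
  assumes "0 < \<theta>" "\<theta> < pi/2" "J \<in> imag_sphere"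
  shows "cl_of J z \<in> bisector \<theta> \<longleftrightarrow> z \<in> csector \<theta>"
  unfolding bisector_eq_norm[OF assms(1,2)]
  by (simp add: cl_of_paravector cl_re_cl_of norm_cl_of_minus_re csector_def assms)

lemma abs_cl_coeff_le: "\<bar>cl_coeff a A\<bar> \<le> norm a"
proof -
  have "(cl_coeff a A)\<^sup>2 \<le> (norm a)\<^sup>2"
    unfolding norm_clifford_power2 by (rule member_le_sum) auto
  then show ?thesis by (simp add: abs_le_square_iff[symmetric])
qed

lemma bounded_linear_cl_coeff: "bounded_linear (\<lambda>s. cl_coeff s A)"
  by (rule bounded_linear_intro[where K = 1]) (simp_all add: abs_cl_coeff_le)

lemma continuous_on_cl_coeff [continuous_intros]:
  "continuous_on S f \<Longrightarrow> continuous_on S (\<lambda>x. cl_coeff (f x) A)"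
  by (rule bounded_linear.continuous_on[OF bounded_linear_cl_coeff])

lemma openin_bisector:
  assumes "0 < \<theta>" "\<theta> < pi/2"
  shows "openin (top_of_set paravectors) (bisector \<theta>)"
  unfolding bisector_eq_norm[OF assms] of_real_def
  by (intro openin_open_Int open_Collect_less continuous_intros)

lemma axially_symmetric_bisector:
  assumes "0 < \<theta>" "\<theta> < pi/2"
  shows "axially_symmetric (bisector \<theta>)"
  unfolding axially_symmetric_def slice_pt_eq_cl_of by (auto simp: cl_of_in_bisector[OF assms])

lemma slice_domain_bisector:
  assumes "0 < \<theta>" "\<theta> < pi/2"
  shows "slice_domain (bisector \<theta> :: 'n::{finite,linorder} clifford set)
    = {p. Complex (fst p) (snd p) \<in> csector \<theta>}"
  using imag_sphere_nonempty[where 'n = 'n]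
  unfolding slice_domain_def slice_pt_eq_cl_of by (auto simp: cl_of_in_bisector[OF assms])

text \<open>One inclusion holds because the weak inequality defines a closed set. For the other, a
  point of the closed sector is approximated inside its own slice.\<close>

lemma cl_of_in_closure_bisector:
  assumes "0 < \<omega>" "\<omega> < pi/2" and J: "J \<in> imag_sphere"
  shows "cl_of J z \<in> closure (bisector \<omega>) \<longleftrightarrow> z \<in> closed_csector \<omega>"
proof
  have "closed {s. norm (s - of_real (cl_re s)) \<le> tan \<omega> * \<bar>cl_re s\<bar>}"
    unfolding of_real_def by (intro closed_Collect_le continuous_intros)
  moreover have "bisector \<omega> \<subseteq> {s. norm (s - of_real (cl_re s)) \<le> tan \<omega> * \<bar>cl_re s\<bar>}"
    unfolding bisector_eq_norm[OF assms(1,2)] by auto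
  ultimately have "closure (bisector \<omega>) \<subseteq> {s. norm (s - of_real (cl_re s)) \<le> tan \<omega> * \<bar>cl_re s\<bar>}"
    by (rule closure_minimal[rotated])
  then show "cl_of J z \<in> closure (bisector \<omega>) \<Longrightarrow> z \<in> closed_csector \<omega>"
    by (force simp: cl_re_cl_of norm_cl_of_minus_re J closed_csector_def)
next
  assume z: "z \<in> closed_csector \<omega>"
  have t: "0 < tan \<omega>" using assms by (simp add: tan_gt_zero)
  \<comment> \<open>The real part is moved away from the imaginary axis while the imaginary part is
    kept, so the weak inequality becomes strict. The shift is nonzero also for Re z = 0, which takes
    care of the origin.\<close>
  define w where "w n = Complex (Re z + (if Re z < 0 then -1 else 1) / Suc n) (Im z)" for n :: nat
  have wn: "cl_of J (w n) \<in> bisector \<omega>" for n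
  proof -
    have "\<bar>Re z\<bar> < \<bar>Re z + (if Re z < 0 then -1 else 1) / Suc n\<bar>"
      by (auto simp: abs_if field_simps)
    then have "tan \<omega> * \<bar>Re z\<bar> < tan \<omega> * \<bar>Re z + (if Re z < 0 then -1 else 1) / Suc n\<bar>"
      using t by (rule mult_strict_left_mono)
    then have "w n \<in> csector \<omega>"
      using z unfolding csector_def closed_csector_def w_def by simp
    then show ?thesis using assms by (simp add: cl_of_in_bisector)
  qed
  have "w \<longlonglongrightarrow> z"
  proof -
    have "(\<lambda>n. (if Re z < 0 then -1 else 1) / real (Suc n)) \<longlonglongrightarrow> 0"
      by (rule LIMSEQ_Suc) (rule lim_const_over_n)
    then have "(\<lambda>n. Re z + (if Re z < 0 then -1 else 1) / real (Suc n)) \<longlonglongrightarrow> Re z + 0"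
      by (intro tendsto_intros)
    then have "w \<longlonglongrightarrow> Complex (Re z + 0) (Im z)"
      unfolding w_def by (intro tendsto_Complex tendsto_const)
    then show ?thesis by simp
  qed
  then have "(\<lambda>n. cl_of J (w n)) \<longlonglongrightarrow> cl_of J z"
    by (rule bounded_linear.tendsto[OF bounded_linear_cl_of])
  with wn show "cl_of J z \<in> closure (bisector \<omega>)"
    unfolding closure_sequential by (intro exI[of _ "\<lambda>n. cl_of J (w n)"]) simp
qed

section \<open>Intrinsic functions as holomorphic functions\<close>

definition holo_intrinsic :: "real \<Rightarrow> (complex \<Rightarrow> complex) \<Rightarrow> bool" where
  "holo_intrinsic \<theta> F \<longleftrightarrow> F holomorphic_on csector \<theta> \<and> (\<forall>z\<in>csector \<theta>. F (cnj z) = cnj (F z))"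

definition holo_N0 :: "real \<Rightarrow> (complex \<Rightarrow> complex) \<Rightarrow> bool" where
  "holo_N0 \<theta> F \<longleftrightarrow> holo_intrinsic \<theta> F \<and> bounded (F ` csector \<theta>) \<and>
     (\<forall>\<psi>\<in>sector_angles \<theta>. set_integrable lborel {0<..} (\<lambda>t. cmod (F (rcis t \<psi>)) / t))"

definition slice_extends :: "real \<Rightarrow> (complex \<Rightarrow> complex) \<Rightarrow> ('n::{finite,linorder} clifford \<Rightarrow> 'n clifford) \<Rightarrow> bool" where
  "slice_extends \<theta> F f \<longleftrightarrow> (\<forall>J\<in>imag_sphere. \<forall>z\<in>csector \<theta>. f (cl_of J z) = cl_of J (F z))"

lemma clifford_Reals_eq: "c \<in> \<real> \<Longrightarrow> c = of_real (cl_re c)" for c :: "'n::{finite,linorder} clifford"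
  by (auto simp: Reals_def of_real_def cl_coeff_one)

text \<open>For real valued components the differential equations of a slice decomposition are the
  Cauchy-Riemann equations of f0 + i f1, and the parity of the components in y is the symmetry of
  this function under conjugation.\<close>

lemma intrinsic_imp_holo:
  fixes f :: "'n::{finite,linorder} clifford \<Rightarrow> 'n clifford"
  assumes \<theta>: "0 < \<theta>" "\<theta> < pi/2" and f: "f \<in> intrinsic (bisector \<theta>)"
  obtains F where "holo_intrinsic \<theta> F" "slice_extends \<theta> F f"
proof -
  let ?U = "slice_domain (bisector \<theta> :: 'n clifford set)"
  from f obtain f0 f1 where "slice_decomposition (bisector \<theta>) f f0 f1"
    and re: "\<And>p. p \<in> ?U \<Longrightarrow> f0 p \<in> \<real> \<and> f1 p \<in> \<real>"
    unfolding intrinsic_def by blast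
  then obtain f0' f1' where C: "C1_on f0 f0' ?U" "C1_on f1 f1' ?U"
    and d: "\<And>x y J. (x, y) \<in> ?U \<Longrightarrow> J \<in> imag_sphere \<Longrightarrow> f (slice_pt J (x, y)) = f0 (x, y) + J * f1 (x, y)"
    and e: "\<And>x y. (x, y) \<in> ?U \<Longrightarrow> f0 (x, - y) = f0 (x, y) \<and> f1 (x, - y) = - f1 (x, y) \<and>
          f0' (x, y) (1, 0) = f1' (x, y) (0, 1) \<and> f0' (x, y) (0, 1) = - f1' (x, y) (1, 0)"
    unfolding slice_decomposition_def by blast
  define F where "F z = Complex (cl_re (f0 (Re z, Im z))) (cl_re (f1 (Re z, Im z)))" for z
  have U: "(Re z, Im z) \<in> ?U" if "z \<in> csector \<theta>" for z
    using that \<theta> by (simp add: slice_domain_bisector)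
  have "(F has_field_derivative Complex (cl_re (f0' (Re z, Im z) (1, 0))) (cl_re (f1' (Re z, Im z) (1, 0)))) (at z)"
    (is "(F has_field_derivative ?c) _") if z: "z \<in> csector \<theta>" for z
  proof -
    let ?p = "\<lambda>z. (Re z, Im z)"
    have p: "(?p has_derivative ?p) (at z)"
      by (intro has_derivative_Pair bounded_linear.has_derivative[OF bounded_linear_Re] bounded_linear.has_derivative[OF bounded_linear_Im] has_derivative_ident)
    have "((\<lambda>z. f0 (?p z)) has_derivative (\<lambda>h. f0' (?p z) (?p h))) (at z)"
      "((\<lambda>z. f1 (?p z)) has_derivative (\<lambda>h. f1' (?p z) (?p h))) (at z)"
      using C U[OF z] unfolding C1_on_def by (auto intro!: has_derivative_compose[OF p])
    then have "((\<lambda>z. of_real (cl_re (f0 (?p z))) + \<i> * of_real (cl_re (f1 (?p z)))) has_derivative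
        (\<lambda>h. of_real (cl_re (f0' (?p z) (?p h))) + \<i> * of_real (cl_re (f1' (?p z) (?p h))))) (at z)"
      by (intro has_derivative_add has_derivative_mult_right has_derivative_of_real
         bounded_linear.has_derivative[OF bounded_linear_cl_coeff])
    moreover have "of_real (cl_re (f0' (?p z) (?p h))) + \<i> * of_real (cl_re (f1' (?p z) (?p h))) = ?c * h" for h
    proof -
      have h: "?p h = Re h *\<^sub>R (1, 0) + Im h *\<^sub>R (0, 1)" by simp
      have "blinfun_apply L (?p h) = Re h *\<^sub>R blinfun_apply L (1, 0) + Im h *\<^sub>R blinfun_apply L (0, 1)" for L :: "(real \<times> real) \<Rightarrow>\<^sub>L 'n clifford"
        unfolding h by (simp only: blinfun.add_right blinfun.scaleR_right)
      then show ?thesis using e[OF U[OF z]]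
        by (simp add: complex_eq_iff algebra_simps)
    qed
    ultimately have "((\<lambda>z. of_real (cl_re (f0 (?p z))) + \<i> * of_real (cl_re (f1 (?p z)))) has_derivative (*) ?c) (at z)"
      by (simp only: eta_contract_eq)
    moreover have "F = (\<lambda>z. of_real (cl_re (f0 (?p z))) + \<i> * of_real (cl_re (f1 (?p z))))"
      by (auto simp: F_def complex_eq_iff)
    ultimately show ?thesis by (simp add: has_field_derivative_def)
  qed
  then have "F holomorphic_on csector \<theta>"
    by (meson holomorphic_onI has_field_derivative_at_within field_differentiable_def)
  moreover have "F (cnj z) = cnj (F z)" if "z \<in> csector \<theta>" for z
    using e[OF U[OF that]] by (simp add: F_def complex_eq_iff)
  moreover have "f (cl_of J z) = cl_of J (F z)" if "J \<in> imag_sphere" "z \<in> csector \<theta>" for J z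
  proof -
    have "f (cl_of J z) = of_real (cl_re (f0 (Re z, Im z))) + J * of_real (cl_re (f1 (Re z, Im z)))"
      using d[OF U[OF that(2)] that(1)] re[OF U[OF that(2)]] by (simp add: cl_of_def flip: clifford_Reals_eq)
    then show ?thesis by (simp add: F_def cl_of_def slice_pt_def)
  qed
  ultimately show ?thesis
    using that[of F] by (auto simp: holo_intrinsic_def slice_extends_def)
qed

lemma cl_of_eq_slice: "cl_of J z = of_real (Re z) + J * of_real (Im z)"
  by (simp add: cl_of_def slice_pt_def)

text \<open>The components are Re F and Im F read on the plane. Their derivatives are assembled by
  composing bounded linear maps with multiplication by F', so that continuity of the derivative is
  inherited from \<open>deriv F\<close>.\<close>

lemma holo_imp_intrinsic:
  fixes f :: "'n::{finite,linorder} clifford \<Rightarrow> 'n clifford"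
  assumes \<theta>: "0 < \<theta>" "\<theta> < pi/2" and F: "holo_intrinsic \<theta> F" and f: "slice_extends \<theta> F f"
  shows "f \<in> intrinsic (bisector \<theta>)"
proof -
  let ?U = "slice_domain (bisector \<theta> :: 'n clifford set)"
  have U: "?U = {p. Complex (fst p) (snd p) \<in> csector \<theta>}" by (rule slice_domain_bisector[OF \<theta>])
  have hol: "F holomorphic_on csector \<theta>" and cnj: "\<And>z. z \<in> csector \<theta> \<Longrightarrow> F (cnj z) = cnj (F z)"
    using F by (auto simp: holo_intrinsic_def)
  have c: "Complex x y = of_real x + \<i> * of_real y" for x y by (simp add: complex_eq_iff)
  define E where "E = Blinfun (\<lambda>p. Complex (fst p) (snd p))"
  have blE: "bounded_linear (\<lambda>p. Complex (fst p) (snd p))"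
    unfolding c by (intro bounded_linear_add bounded_linear_const_mult bounded_linear_compose[OF bounded_linear_of_real]
      bounded_linear_fst bounded_linear_snd)
  then have E: "blinfun_apply E p = Complex (fst p) (snd p)" for p
    unfolding E_def by (simp add: bounded_linear_Blinfun_apply)
  define R where "R = (Blinfun of_real :: real \<Rightarrow>\<^sub>L 'n clifford)"
  have R: "blinfun_apply R r = of_real r" for r
    unfolding R_def of_real_def
    by (rule bounded_linear_Blinfun_apply[THEN fun_cong]) (rule bounded_linear_scaleR_left)
  define f0 f1 where "f0 p = blinfun_apply R (Re (F (blinfun_apply E p)))"
    and "f1 p = blinfun_apply R (Im (F (blinfun_apply E p)))" for p
  define f0' f1' where
    "f0' p = R o\<^sub>L (Blinfun Re o\<^sub>L (blinfun_mult_right (deriv F (blinfun_apply E p)) o\<^sub>L E))"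
    and "f1' p = R o\<^sub>L (Blinfun Im o\<^sub>L (blinfun_mult_right (deriv F (blinfun_apply E p)) o\<^sub>L E))" for p
  have ReIm: "blinfun_apply (Blinfun Re) = Re" "blinfun_apply (Blinfun Im) = Im"
    by (simp_all add: bounded_linear_Blinfun_apply bounded_linear_Re bounded_linear_Im)
  have f'_apply: "blinfun_apply (f0' p) h = of_real (Re (deriv F (blinfun_apply E p) * blinfun_apply E h))"
    "blinfun_apply (f1' p) h = of_real (Im (deriv F (blinfun_apply E p) * blinfun_apply E h))" for p h
    by (simp_all add: f0'_def f1'_def R ReIm)
  have d: "((\<lambda>p. F (blinfun_apply E p)) has_derivative (\<lambda>h. deriv F (blinfun_apply E p) * blinfun_apply E h)) (at p)"
    if "p \<in> ?U" for p
  proof (rule has_derivative_compose[where g = F and f = "blinfun_apply E" and f' = "blinfun_apply E"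
        and g' = "(*) (deriv F (blinfun_apply E p))"])
    show "(blinfun_apply E has_derivative blinfun_apply E) (at p)"
      by (rule bounded_linear.has_derivative[OF blinfun.bounded_linear_right has_derivative_ident])
    show "(F has_derivative (*) (deriv F (blinfun_apply E p))) (at (blinfun_apply E p))"
      using holomorphic_derivI[OF hol open_csector, of "blinfun_apply E p" UNIV] that
      unfolding U E by (simp add: has_field_derivative_def)
  qed
  have cont: "continuous_on ?U (\<lambda>p. deriv F (blinfun_apply E p))"
  proof (rule continuous_on_compose2[where g = "deriv F"])
    show "continuous_on (csector \<theta>) (deriv F)"
      using holomorphic_deriv[OF hol open_csector] by (rule holomorphic_on_imp_continuous_on)
    show "continuous_on ?U (blinfun_apply E)" by (intro continuous_intros)
    show "blinfun_apply E ` ?U \<subseteq> csector \<theta>" by (auto simp: U E)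
  qed
  have comp: "continuous_on ?U (\<lambda>p. A o\<^sub>L g p)" if "continuous_on ?U g"
    for A :: "'b::real_normed_vector \<Rightarrow>\<^sub>L 'c::real_normed_vector" and g :: "real \<times> real \<Rightarrow> 'd::real_normed_vector \<Rightarrow>\<^sub>L 'b"
    by (intro bounded_bilinear.continuous_on[OF bounded_bilinear_blinfun_compose] continuous_on_const that)
  have comp2: "continuous_on ?U (\<lambda>p. g p o\<^sub>L A)" if "continuous_on ?U g"
    for A :: "'d::real_normed_vector \<Rightarrow>\<^sub>L 'b::real_normed_vector" and g :: "real \<times> real \<Rightarrow> 'b \<Rightarrow>\<^sub>L 'c::real_normed_vector"
    by (intro bounded_bilinear.continuous_on[OF bounded_bilinear_blinfun_compose] continuous_on_const that)
  have C: "C1_on f0 f0' ?U" "C1_on f1 f1' ?U"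
    unfolding C1_on_def
  proof safe
    fix x y assume p: "(x, y) \<in> ?U"
    have "(f0 has_derivative (\<lambda>h. blinfun_apply R (Re (deriv F (blinfun_apply E (x, y)) * blinfun_apply E h)))) (at (x, y))"
      unfolding f0_def
      by (intro bounded_linear.has_derivative[OF blinfun.bounded_linear_right]
        bounded_linear.has_derivative[OF bounded_linear_Re] d[OF p])
    then show "(f0 has_derivative blinfun_apply (f0' (x, y))) (at (x, y))"
      unfolding R f'_apply[symmetric] .
    have "(f1 has_derivative (\<lambda>h. blinfun_apply R (Im (deriv F (blinfun_apply E (x, y)) * blinfun_apply E h)))) (at (x, y))"
      unfolding f1_def
      by (intro bounded_linear.has_derivative[OF blinfun.bounded_linear_right]
        bounded_linear.has_derivative[OF bounded_linear_Im] d[OF p])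
    then show "(f1 has_derivative blinfun_apply (f1' (x, y))) (at (x, y))"
      unfolding R f'_apply[symmetric] .
  next
    show "continuous_on ?U f0'" "continuous_on ?U f1'"
      unfolding f0'_def f1'_def
      by (intro comp comp2 bounded_linear.continuous_on[OF bounded_linear_blinfun_mult_right] cont)+
  qed
  have "slice_decomposition (bisector \<theta>) f f0 f1"
    unfolding slice_decomposition_def
  proof (rule exI[of _ f0'], rule exI[of _ f1'], intro conjI C, clarify, intro conjI ballI)
    fix x y J assume p: "(x, y) \<in> ?U"
    then have z: "Complex x y \<in> csector \<theta>" by (simp add: U)
    show "f0 (x, - y) = f0 (x, y)" "f1 (x, - y) = - f1 (x, y)"
      using cnj[OF z] by (simp_all add: f0_def f1_def R E complex_cnj)
    show "blinfun_apply (f0' (x, y)) (1, 0) = blinfun_apply (f1' (x, y)) (0, 1)"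
      "blinfun_apply (f0' (x, y)) (0, 1) = - blinfun_apply (f1' (x, y)) (1, 0)"
      unfolding f'_apply E by simp_all
    assume J: "J \<in> (imag_sphere :: 'n clifford set)"
    show "f (slice_pt J (x, y)) = f0 (x, y) + J * f1 (x, y)"
      using f[unfolded slice_extends_def, rule_format, OF J z]
      by (simp add: slice_pt_eq_cl_of f0_def f1_def R E) (simp add: cl_of_eq_slice)
  qed
  moreover have "f0 p \<in> \<real>" "f1 p \<in> \<real>" for p by (simp_all add: f0_def f1_def R)
  ultimately show ?thesis
    unfolding intrinsic_def using openin_bisector[OF \<theta>] axially_symmetric_bisector[OF \<theta>] by blast
qed

lemma intrinsic_imp_slice_hyperholomorphic:
  "intrinsic U \<subseteq> slice_hyperholomorphic U"
  unfolding intrinsic_def slice_hyperholomorphic_def by blast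

lemma N0_imp_holo:
  fixes f :: "'n::{finite,linorder} clifford \<Rightarrow> 'n clifford"
  assumes \<theta>: "0 < \<theta>" "\<theta> < pi/2" and f: "f \<in> N0 \<theta>"
  obtains F where "holo_N0 \<theta> F" "slice_extends \<theta> F f"
proof -
  from f have i: "f \<in> intrinsic (bisector \<theta>)" and s: "f \<in> SH0 \<theta>" by (auto simp: N0_def)
  from intrinsic_imp_holo[OF \<theta> i] obtain F where F: "holo_intrinsic \<theta> F" "slice_extends \<theta> F f" .
  obtain J :: "'n clifford" where J: "J \<in> imag_sphere" using imag_sphere_nonempty by blast
  have n: "norm (f (cl_of J z)) = cmod (F z)" if "z \<in> csector \<theta>" for z
    using F(2) J that by (simp add: slice_extends_def norm_cl_of)
  from s obtain M where M: "\<And>s. s \<in> bisector \<theta> \<Longrightarrow> norm (f s) \<le> M"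
    unfolding SH0_def bounded_iff by blast
  have "cmod (F z) \<le> M" if "z \<in> csector \<theta>" for z
    using M[of "cl_of J z"] n[OF that] that by (simp add: cl_of_in_bisector[OF \<theta> J])
  then have "bounded (F ` csector \<theta>)" unfolding bounded_iff by blast
  moreover have "set_integrable lborel {0<..} (\<lambda>t. cmod (F (rcis t \<psi>)) / t)" if "\<psi> \<in> sector_angles \<theta>" for \<psi>
  proof -
    have "set_integrable lborel {0<..} (\<lambda>t. norm (f (t *\<^sub>R cl_exp J \<psi>)) / t)"
      using s J that unfolding SH0_def by blast
    also have "?this \<longleftrightarrow> ?thesis"
      by (rule set_integrable_cong) (auto simp: scaleR_cl_exp n rcis_in_csector[OF \<theta>] that)
    finally show ?thesis .
  qed
  ultimately have "holo_N0 \<theta> F" using F(1) by (simp add: holo_N0_def)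
  then show ?thesis using that F by blast
qed

lemma holo_imp_N0:
  fixes f :: "'n::{finite,linorder} clifford \<Rightarrow> 'n clifford"
  assumes \<theta>: "0 < \<theta>" "\<theta> < pi/2" and F: "holo_N0 \<theta> F" and f: "slice_extends \<theta> F f"
  shows "f \<in> N0 \<theta>"
proof -
  have i: "f \<in> intrinsic (bisector \<theta>)"
    using F by (intro holo_imp_intrinsic[OF \<theta> _ f]) (simp add: holo_N0_def)
  have n: "norm (f (cl_of J z)) = cmod (F z)" if "z \<in> csector \<theta>" "J \<in> imag_sphere" for J z
    using f that by (simp add: slice_extends_def norm_cl_of)
  from F obtain M where M: "\<And>z. z \<in> csector \<theta> \<Longrightarrow> cmod (F z) \<le> M"
    unfolding holo_N0_def bounded_iff by blast
  have "norm (f s) \<le> M" if "s \<in> bisector \<theta>" for s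
    using that unfolding bisector_eq_cl_of[OF \<theta>] by (auto simp: n M)
  then have "bounded (f ` bisector \<theta>)" unfolding bounded_iff by blast
  moreover have "set_integrable lborel {0<..} (\<lambda>t. norm (f (t *\<^sub>R cl_exp J \<psi>)) / t)"
    if "\<psi> \<in> sector_angles \<theta>" "J \<in> imag_sphere" for \<psi> J
  proof -
    have "set_integrable lborel {0<..} (\<lambda>t. cmod (F (rcis t \<psi>)) / t)"
      using F that unfolding holo_N0_def by blast
    also have "?this \<longleftrightarrow> ?thesis"
      by (rule set_integrable_cong) (auto simp: scaleR_cl_exp n rcis_in_csector[OF \<theta>] that)
    finally show ?thesis .
  qed
  ultimately show ?thesis
    using i intrinsic_imp_slice_hyperholomorphic[of "bisector \<theta>"] by (auto simp: N0_def SH0_def)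
qed

section \<open>Improper integrals with values in a Banach space\<close>

text \<open>The Bochner integral needs a separable range, which operators do not have. For the gauge integral
  the singular endpoint is handled by the antiderivative, which extends continuously to \<open>0\<close>.\<close>

lemma dominated_integrable_at_zero:
  fixes f :: "real \<Rightarrow> 'x::banach"
  assumes cont: "continuous_on {0<..} f" and bound: "\<And>t. 0 < t \<Longrightarrow> norm (f t) \<le> g t"
    and g: "g integrable_on {0<..}" and N: "0 < N"
  shows "f integrable_on {0..N}"
proof -
  have "(\<lambda>x. if x \<in> {0<..} then g x else 0) integrable_on cbox 0 N"
    using g unfolding integrable_alt[of g] by blast
  moreover have "{0<..} \<inter> cbox 0 N = {0<..N}" by auto
  ultimately have "g integrable_on {0<..N}"
    by (simp only: Henstock_Kurzweil_Integration.integrable_restrict_Int)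
  then have g0: "g integrable_on {0..N}"
    by (rule integrable_spike_set) (auto intro: negligible_subset[of "{0}"])
  define F \<gamma> where "F t = integral {t..N} f" and "\<gamma> t = integral {t..N} g" for t
  have fi: "f integrable_on {s..t}" if "0 < s" for s t
    using that by (intro integrable_continuous_interval continuous_on_subset[OF cont]) auto
  have gi: "g integrable_on {s..t}" if "0 \<le> s" "t \<le> N" for s t
    using that by (intro integrable_on_subinterval[OF g0]) auto
  \<comment> \<open>The increments of the antiderivative of \<open>f\<close> are dominated by those
    of the antiderivative of \<open>g\<close>, which is continuous up to 0. This makes
    \<open>F\<close> Cauchy at 0.\<close>
  have diff: "norm (F s - F t) \<le> \<gamma> s - \<gamma> t" if "0 < s" "s \<le> t" "t \<le> N" for s t
  proof -
    have "F s = integral {s..t} f + F t" "\<gamma> s = integral {s..t} g + \<gamma> t"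
      unfolding F_def \<gamma>_def using that fi gi by (auto intro!: Henstock_Kurzweil_Integration.integral_combine[symmetric])
    moreover have "norm (integral {s..t} f) \<le> integral {s..t} g"
      using that by (intro Henstock_Kurzweil_Integration.integral_norm_bound_integral fi gi bound) auto
    ultimately show ?thesis by simp
  qed
  have \<gamma>: "continuous_on {0..N} \<gamma>"
    unfolding \<gamma>_def by (rule indefinite_integral_continuous_1'[OF g0])
  define x where "x n = N / real (Suc n)" for n
  have x: "0 < x n" "x n \<le> N" for n using N by (auto simp: x_def field_simps)
  have x0: "x \<longlonglongrightarrow> 0" unfolding x_def by (rule LIMSEQ_Suc) (rule lim_const_over_n)
  have \<gamma>x: "(\<lambda>n. \<gamma> (x n)) \<longlonglongrightarrow> \<gamma> 0"
    by (rule continuous_on_tendsto_compose[OF \<gamma> x0]) (use x N in \<open>auto simp: less_imp_le\<close>)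
  have "Cauchy (\<lambda>n. F (x n))"
  proof (rule metric_CauchyI)
    fix e :: real assume "0 < e"
    then obtain M where M: "\<And>m n. m \<ge> M \<Longrightarrow> n \<ge> M \<Longrightarrow> dist (\<gamma> (x m)) (\<gamma> (x n)) < e"
      using LIMSEQ_imp_Cauchy[OF \<gamma>x] unfolding Cauchy_def by blast
    have "dist (F (x m)) (F (x n)) \<le> dist (\<gamma> (x m)) (\<gamma> (x n))" for m n
      using diff[of "x m" "x n"] diff[of "x n" "x m"] x[of m] x[of n]
      by (cases "x m \<le> x n") (auto simp: dist_norm norm_minus_commute abs_if)
    with M show "\<exists>M. \<forall>m\<ge>M. \<forall>n\<ge>M. dist (F (x m)) (F (x n)) < e"
      by (meson le_less_trans)
  qed
  then obtain L where L: "(\<lambda>n. F (x n)) \<longlonglongrightarrow> L"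
    using Cauchy_convergent_iff convergent_def by blast
  have FL: "norm (L - F t) \<le> \<gamma> 0 - \<gamma> t" if t: "0 < t" "t \<le> N" for t
  proof (rule tendsto_le[OF sequentially_bot])
    show "(\<lambda>n. norm (F (x n) - F t)) \<longlonglongrightarrow> norm (L - F t)" by (intro tendsto_intros L)
    show "(\<lambda>n. \<gamma> (x n) - \<gamma> t) \<longlonglongrightarrow> \<gamma> 0 - \<gamma> t" by (intro tendsto_intros \<gamma>x)
    have "eventually (\<lambda>n. x n < t) sequentially" by (rule order_tendstoD(2)[OF x0 t(1)])
    then show "eventually (\<lambda>n. norm (F (x n) - F t) \<le> \<gamma> (x n) - \<gamma> t) sequentially"
      by eventually_elim (use diff x t in auto)
  qed
  \<comment> \<open>\<open>F\<close> integrates from t to N, hence the minus sign. With the limit -L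
    as value at 0 this is an antiderivative continuous on the closed interval, as the fundamental
    theorem requires.\<close>
  define H where "H t = (if t = 0 then - L else - F t)" for t
  have der: "(H has_vector_derivative f t) (at t)" if t: "t \<in> {0<..<N}" for t
  proof -
    have "((\<lambda>u. integral {u..N} f) has_vector_derivative - f t) (at t within {t/2..N})"
      using t by (intro integral_has_vector_derivative' continuous_on_subset[OF cont]) auto
    moreover have "at t within {t/2..N} = at t"
      using t by (intro at_within_interior) auto
    ultimately have "((\<lambda>u. - F u) has_vector_derivative - (- f t)) (at t)"
      unfolding F_def by (intro derivative_intros) simp
    then have "((\<lambda>u. - F u) has_vector_derivative f t) (at t)" by simp
    then show ?thesis
      by (rule has_vector_derivative_transform_within_open[where S = "{0<..}"]) (use t in \<open>auto simp: H_def\<close>)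
  qed
  have "continuous_on {0..N} H"
    unfolding continuous_on_eq_continuous_within
  proof
    fix t assume t: "t \<in> {0..N}"
    show "continuous (at t within {0..N}) H"
    proof (cases "t = 0")
      case True
      have "((\<lambda>s. \<gamma> 0 - \<gamma> s) \<longlongrightarrow> \<gamma> 0 - \<gamma> 0) (at 0 within {0..N})"
        using \<gamma> N by (intro tendsto_intros) (auto simp: continuous_on_def)
      then have lim: "((\<lambda>s. \<gamma> 0 - \<gamma> s) \<longlongrightarrow> 0) (at 0 within {0..N})" by simp
      have "norm (H s - H 0) \<le> \<gamma> 0 - \<gamma> s" if "s \<in> {0..N}" "s \<noteq> 0" for s
        using FL[of s] that by (simp add: H_def)
      then have "\<forall>\<^sub>F s in at 0 within {0..N}. norm (H s - H 0) \<le> \<gamma> 0 - \<gamma> s"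
        unfolding eventually_at by (intro exI[of _ 1]) simp
      from Lim_null_comparison[OF this lim]
      have "((\<lambda>s. H s - H 0) \<longlongrightarrow> 0) (at 0 within {0..N})" .
      then show ?thesis using True LIM_zero_iff by (auto simp: continuous_within)
    next
      case False
      have "continuous_on {t/2..N} (\<lambda>u. integral {u..N} f)"
        by (rule indefinite_integral_continuous_1'[OF fi]) (use t False in auto)
      then have "continuous (at t within {t/2..N}) (\<lambda>u. - F u)"
        using t False by (auto simp: F_def continuous_on_eq_continuous_within intro!: continuous_intros)
      moreover have "at t within {t/2..N} = at t within {0..N}"
        by (rule at_within_nhd[of _ "{t/2<..}"]) (use t False in auto)
      ultimately have c: "continuous (at t within {0..N}) (\<lambda>u. - F u)" by simp
      show ?thesis
        by (rule continuous_transform_within[OF c, of t]) (use t False in \<open>auto simp: H_def dist_real_def\<close>)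
    qed
  qed
  then have "(f has_integral (H N - H 0)) {0..N}"
    using N der by (intro fundamental_theorem_of_calculus_interior) auto
  then show ?thesis by blast
qed

lemma dominated_integrable:
  fixes f :: "real \<Rightarrow> 'x::banach"
  assumes cont: "continuous_on {0<..} f" and bound: "\<And>t. 0 < t \<Longrightarrow> norm (f t) \<le> g t"
    and g: "g integrable_on {0<..}"
  shows "f integrable_on {0<..}"
proof (rule integrable_on_all_intervals_integrable_bound[OF _ _ g])
  show "norm (f x) \<le> g x" if "x \<in> {0<..}" for x using bound that by simp
  fix a b :: real
  define N where "N = \<bar>b\<bar> + 1"
  have f0: "f integrable_on {0..N}" by (rule dominated_integrable_at_zero[OF assms]) (auto simp: N_def)
  have "f integrable_on ({0<..} \<inter> cbox a b)"
  proof (cases "a \<le> 0")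
    case True
    have "f integrable_on {0..b}"
      by (rule integrable_on_subinterval[OF f0]) (auto simp: N_def)
    then have "f integrable_on {0<..b}"
      by (rule integrable_spike_set) (auto intro: negligible_subset[of "{0}"])
    moreover have "{0<..} \<inter> cbox a b = {0<..b}" using True by auto
    ultimately show ?thesis by simp
  next
    case False
    then have "{0<..} \<inter> cbox a b = {a..b}" by auto
    moreover have "f integrable_on {a..b}"
      by (rule integrable_on_subinterval[OF f0]) (use False in \<open>auto simp: N_def\<close>)
    ultimately show ?thesis by simp
  qed
  then show "(\<lambda>x. if x \<in> {0<..} then f x else 0) integrable_on cbox a b"
    by (simp only: Henstock_Kurzweil_Integration.integrable_restrict_Int)
qed

text \<open>Dominated convergence is applied to the real bound \<open>g\<close> alone. The vector
  valued tails are controlled in norm by the tails of \<open>g\<close>.\<close>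

lemma dominated_integral_limit:
  fixes f :: "real \<Rightarrow> 'x::banach"
  assumes f: "f integrable_on {0<..}" and bound: "\<And>t. 0 < t \<Longrightarrow> norm (f t) \<le> g t"
    and g: "g integrable_on {0<..}"
  shows "(\<lambda>n. integral {1 / Suc n..Suc n} f) \<longlonglongrightarrow> integral {0<..} f"
proof -
  let ?A = "\<lambda>n. {1 / real (Suc n)..real (Suc n)}"
  have restr: "h integrable_on ?A n" if "h integrable_on {0<..}" for n and h :: "real \<Rightarrow> 'y::banach"
    by (rule integrable_on_subinterval[OF that]) (auto intro: less_le_trans[of 0 "1 / real (Suc n)"])
  have sub: "?A n \<subseteq> {0<..}" for n by (auto intro: less_le_trans[of 0 "1 / real (Suc n)"])
  have restr': "(\<lambda>x. if x \<in> ?A n then h x else 0) integrable_on {0<..}"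
    "integral {0<..} (\<lambda>x. if x \<in> ?A n then h x else 0) = integral (?A n) h"
    if "h integrable_on {0<..}" for n and h :: "real \<Rightarrow> 'y::banach"
    using sub[of n] restr[OF that, of n]
    unfolding Henstock_Kurzweil_Integration.integrable_restrict_Int Henstock_Kurzweil_Integration.integral_restrict_Int
    by (simp_all only: Int_absorb2)
  have "(\<lambda>n. integral {0<..} (\<lambda>x. if x \<in> ?A n then g x else 0)) \<longlonglongrightarrow> integral {0<..} g"
  proof (rule dominated_convergence(2)[where h = g])
    show "(\<lambda>n. if x \<in> ?A n then g x else 0) \<longlonglongrightarrow> g x" if x: "x \<in> {0<..}" for x
    proof (rule tendsto_eventually)
      have "eventually (\<lambda>n. 1 / real (Suc n) < x) sequentially"
        by (rule order_tendstoD(2)[OF LIMSEQ_Suc[OF lim_const_over_n]]) (use x in auto)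
      moreover have "eventually (\<lambda>n. x < real (Suc n)) sequentially"
        by (rule filterlim_at_top_dense[THEN iffD1, rule_format])
           (intro filterlim_compose[OF filterlim_real_sequentially filterlim_Suc])
      ultimately show "eventually (\<lambda>n. (if x \<in> ?A n then g x else 0) = g x) sequentially"
        by eventually_elim auto
    qed
    show "norm (if x \<in> ?A n then g x else 0) \<le> g x" if "x \<in> {0<..}" for x n
      using order_trans[OF norm_ge_zero bound] that by auto
  qed (use g restr' in auto)
  then have lim: "(\<lambda>n. integral {0<..} g - integral (?A n) g) \<longlonglongrightarrow> 0"
    unfolding restr'(2)[OF g] by (intro tendsto_eq_intros) auto
  have "norm (integral {0<..} f - integral (?A n) f) \<le> integral {0<..} g - integral (?A n) g" for n
  proof -
    have "integral {0<..} f - integral (?A n) f = integral {0<..} (\<lambda>x. f x - (if x \<in> ?A n then f x else 0))"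
      using f restr'[OF f, of n] by (simp add: Henstock_Kurzweil_Integration.integral_diff)
    also have "norm \<dots> \<le> integral {0<..} (\<lambda>x. g x - (if x \<in> ?A n then g x else 0))"
      using bound
      by (intro Henstock_Kurzweil_Integration.integral_norm_bound_integral
        integrable_diff[OF f restr'(1)[OF f]] integrable_diff[OF g restr'(1)[OF g]]) auto
    also have "\<dots> = integral {0<..} g - integral (?A n) g"
      using g restr'[OF g, of n] by (simp add: Henstock_Kurzweil_Integration.integral_diff)
    finally show ?thesis .
  qed
  then have "(\<lambda>n. integral {0<..} f - integral (?A n) f) \<longlonglongrightarrow> 0"
    by (intro Lim_null_comparison[OF _ lim]) auto
  from tendsto_diff[OF tendsto_const[of "integral {0<..} f"] this] show ?thesis by simp
qed

lemma has_integral_reflect_UNIV: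
  fixes f :: "real \<Rightarrow> 'x::banach"
  assumes "(f has_integral i) UNIV"
  shows "((\<lambda>x. f (- x)) has_integral i) UNIV"
  unfolding has_integral_alt'[of _ i]
proof (intro conjI allI impI)
  have f: "f integrable_on cbox a b" for a b
    using assms unfolding has_integral_alt' by simp
  show "(\<lambda>x. if x \<in> UNIV then f (- x) else 0) integrable_on cbox a b" for a b
    using f[of "- b" "- a"] integrable_reflect[of f "- a" "- b"] by simp
  fix e :: real assume "0 < e"
  then obtain B where B: "0 < B" "\<And>a b. ball 0 B \<subseteq> cbox a b \<Longrightarrow> norm (integral (cbox a b) f - i) < e"
    using assms unfolding has_integral_alt' by force
  have "norm (integral (cbox a b) (\<lambda>x. f (- x)) - i) < e" if "ball 0 B \<subseteq> cbox a b" for a b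
  proof -
    have "ball 0 B \<subseteq> cbox (- b) (- a)"
    proof
      fix x :: real assume "x \<in> ball 0 B"
      then have "- x \<in> ball 0 B" by simp
      then have "- x \<in> cbox a b" using that by blast
      then show "x \<in> cbox (- b) (- a)" by auto
    qed
    then show ?thesis using B(2) Henstock_Kurzweil_Integration.integral_reflect[where a = "- b" and b = "- a" and f = f] by simp
  qed
  with B(1) show "\<exists>B>0. \<forall>a b. ball 0 B \<subseteq> cbox a b \<longrightarrow>
      norm (integral (cbox a b) (\<lambda>x. if x \<in> UNIV then f (- x) else 0) - i) < e" by auto
qed

text \<open>Each contour is parametrized over the whole line, with a corner at t = 0. The half lines
  carry its two rays, and the corner is negligible.\<close>

lemma has_integral_UNIV_halflines:
  fixes f :: "real \<Rightarrow> 'x::banach"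
  assumes p: "(f has_integral i) {0<..}" and m: "((\<lambda>x. f (- x)) has_integral j) {0<..}"
  shows "(f has_integral (i + j)) UNIV"
proof -
  have "((\<lambda>x. if x \<in> {0<..} then f (- x) else 0) has_integral j) UNIV"
    using m by (simp only: has_integral_restrict_UNIV)
  from has_integral_reflect_UNIV[OF this]
  have "((\<lambda>x. if x \<in> {..<0} then f x else 0) has_integral j) UNIV" by (simp cong: if_cong)
  then have "(f has_integral j) {..<0}" by (simp only: has_integral_restrict_UNIV)
  moreover have "{0<..} \<inter> {..<0 :: real} = {}" by auto
  ultimately have "(f has_integral (i + j)) ({0<..} \<union> {..<0})"
    using p by (intro has_integral_Un) simp_all
  moreover have "(f has_integral (i + j)) ({0<..} \<union> {..<0}) \<longleftrightarrow> (f has_integral (i + j)) UNIV"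
    by (rule has_integral_spike_set_eq) (auto intro: negligible_subset[of "{0}"])
  ultimately show ?thesis by simp
qed

section \<open>Rotation of rays\<close>

lemma arctan_integral:
  "set_integrable lborel {0<..} (\<lambda>x::real. 1 / (1 + x\<^sup>2))" "integral {0<..} (\<lambda>x::real. 1 / (1 + x\<^sup>2)) = pi/2"
proof -
  have e: "einterval 0 \<infinity> = {0<..}" by (auto simp: einterval_def)
  have A: "((arctan \<circ> real_of_ereal) \<longlongrightarrow> 0) (at_right 0)"
    unfolding zero_ereal_def ereal_tendsto_simps
    by (intro tendsto_eq_intros) auto
  have B: "((arctan \<circ> real_of_ereal) \<longlongrightarrow> pi/2) (at_left \<infinity>)"
    unfolding ereal_tendsto_simps by (rule tendsto_arctan_at_top)
  have nz: "1 + x\<^sup>2 \<noteq> 0" for x :: real using zero_le_power2[of x] by linarith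
  have D: "(arctan has_real_derivative 1 / (1 + x\<^sup>2)) (at x)" for x :: real
    using DERIV_arctan[of x] by (simp add: inverse_eq_divide)
  have C: "isCont (\<lambda>x. 1 / (1 + x\<^sup>2)) x" for x :: real
    by (intro continuous_intros nz)
  note * = interval_integral_FTC_nonneg[of 0 \<infinity> arctan "\<lambda>x. 1 / (1 + x\<^sup>2)" 0 "pi/2", OF _ D C _ A B]
  show s: "set_integrable lborel {0<..} (\<lambda>x::real. 1 / (1 + x\<^sup>2))"
    using *(1) unfolding e by simp
  have "(LBINT x=0..\<infinity>. 1 / (1 + x\<^sup>2)) = pi/2"
    using *(2) by simp
  then show "integral {0<..} (\<lambda>x::real. 1 / (1 + x\<^sup>2)) = pi/2"
    unfolding interval_lebesgue_integral_def e using set_borel_integral_eq_integral(2)[OF s] by simp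
qed

text \<open>The hypotheses bound x/r by C and by C/r^2. Adding the first bound and r^2 times the
  second gives (x/r)(1 + r^2) at most 2C.\<close>

lemma decay_integrable_bound:
  fixes r C :: real
  assumes "0 < r" "x \<le> C * r" "x \<le> C / r"
  shows "(1 / r) * x \<le> 2 * C * (1 / (1 + r\<^sup>2))"
proof -
  have "x * r \<le> C" "x * r\<^sup>2 \<le> C * r"
    using assms by (auto simp: field_simps power2_eq_square)
  then have "x * (1 + r\<^sup>2) \<le> 2 * C * r" using assms by (simp add: algebra_simps)
  moreover have "0 < 1 + r\<^sup>2" by (simp add: add_pos_nonneg)
  ultimately show ?thesis using assms by (simp add: divide_simps mult.commute)
qed

lemma has_vector_derivative_rcis:
  "((\<lambda>r. rcis r \<psi>) has_vector_derivative cis \<psi>) (at r within S)"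
  "((\<lambda>\<psi>. rcis r \<psi>) has_vector_derivative \<i> * rcis r \<psi>) (at \<psi> within S)"
proof -
  have r: "rcis r = (\<lambda>\<psi>. of_real r * exp (\<i> * of_real \<psi>))"
    by (simp add: rcis_def cis_conv_exp fun_eq_iff)
  show "((\<lambda>\<psi>. rcis r \<psi>) has_vector_derivative \<i> * rcis r \<psi>) (at \<psi> within S)"
    unfolding r by (rule has_vector_derivative_real_field) (auto intro!: derivative_eq_intros)
  show "((\<lambda>r. rcis r \<psi>) has_vector_derivative cis \<psi>) (at r within S)"
    unfolding rcis_def by (rule has_vector_derivative_real_field) (auto intro!: derivative_eq_intros)
qed

text \<open>The integrand is \<open>F(z) dz\<close> with \<open>K(z) = z F(z)\<close>: the derivative of \<open>K(re\<^sup>i\<^sup>\<psi>)/r\<close> with respect to \<open>\<psi>\<close> is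
  \<open>i\<close> times that of \<open>K(re\<^sup>i\<^sup>\<psi>)\<close> with respect to \<open>r\<close>, so rotating a ray only produces endpoint terms.\<close>

lemma polar_cauchy:
  fixes act :: "complex \<Rightarrow> 'x::banach \<Rightarrow> 'x"
  assumes bb: "bounded_bilinear act" and act_mult: "\<And>a b x. act a (act b x) = act (a * b) x"
    and act_real: "\<And>r x. act (of_real r) x = r *\<^sub>R x"
    and ab: "a \<le> b"
    and der: "\<And>r \<psi>. 0 < r \<Longrightarrow> \<psi> \<in> {a..b} \<Longrightarrow>
      (K has_derivative (\<lambda>h. act h (K' (rcis r \<psi>)))) (at (rcis r \<psi>))"
    and cont: "continuous_on {rcis r \<psi> | r \<psi>. 0 < r \<and> \<psi> \<in> {a..b}} K'"
    and bd: "\<And>r \<psi>. 0 < r \<Longrightarrow> \<psi> \<in> {a..b} \<Longrightarrow> norm (K (rcis r \<psi>)) \<le> C * r"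
      "\<And>r \<psi>. 0 < r \<Longrightarrow> \<psi> \<in> {a..b} \<Longrightarrow> norm (K (rcis r \<psi>)) \<le> C / r"
  shows "integral {0<..} (\<lambda>r. (1 / r) *\<^sub>R K (rcis r a)) = integral {0<..} (\<lambda>r. (1 / r) *\<^sub>R K (rcis r b))"
proof -
  interpret bounded_bilinear act by (rule bb)
  from bounded_linear.nonneg_bounded[OF bounded_linear_right[of \<i>]]
  obtain M where M': "0 \<le> M" "\<forall>x. norm (act \<i> x) \<le> norm x * M" by blast
  then have M: "norm (act \<i> x) \<le> M * norm x" "0 \<le> M" for x
    by (simp_all add: mult.commute[of M])
  define f where "f \<psi> r = (1 / r) *\<^sub>R K (rcis r \<psi>)" for \<psi> r
  define fx where "fx \<psi> r = act (\<i> * cis \<psi>) (K' (rcis r \<psi>))" for \<psi> r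
  have contK: "continuous_on {0<..} (\<lambda>r. K (rcis r \<psi>))" if "\<psi> \<in> {a..b}" for \<psi>
  proof (rule continuous_at_imp_continuous_on, rule ballI)
    fix r :: real assume "r \<in> {0<..}"
    then have "isCont K (rcis r \<psi>)"
      using der[OF _ that] by (intro has_derivative_continuous) auto
    moreover have "isCont (\<lambda>r. rcis r \<psi>) r"
      by (rule has_vector_derivative_continuous[OF has_vector_derivative_rcis(1)])
    ultimately show "isCont (\<lambda>r. K (rcis r \<psi>)) r" by (rule isCont_o2[rotated])
  qed
  have contf: "continuous_on {0<..} (f \<psi>)" if "\<psi> \<in> {a..b}" for \<psi>
    unfolding f_def using that by (intro continuous_intros contK) auto
  define g where "g r = 2 * C * (1 / (1 + r\<^sup>2))" for r :: real
  have g: "g integrable_on {0<..}"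
    unfolding g_def by (intro integrable_on_mult_right set_borel_integral_eq_integral(1)[OF arctan_integral(1)])
  have fg: "norm (f \<psi> r) \<le> g r" if "0 < r" "\<psi> \<in> {a..b}" for r \<psi>
    using decay_integrable_bound[OF that(1) bd(1)[OF that] bd(2)[OF that]] that(1) by (simp add: f_def g_def)
  have fi: "f \<psi> integrable_on {0<..}" if "\<psi> \<in> {a..b}" for \<psi>
    by (rule dominated_integrable[OF contf[OF that] fg[OF _ that] g])
  \<comment> \<open>The \<psi>-derivative of the truncated ray integral is the difference of i K at
    radius N and at radius \<delta>. The bound C/r controls the outer end and C r the inner
    one.\<close>
  have step: "norm (integral {\<delta>..N} (f b) - integral {\<delta>..N} (f a)) \<le> M * (C / N + C * \<delta>) * (b - a)"
    if \<delta>: "0 < \<delta>" "\<delta> \<le> N" for \<delta> N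
  proof -
    have fxi: "(fx \<psi> has_integral (act \<i> (K (rcis N \<psi>)) - act \<i> (K (rcis \<delta> \<psi>)))) {\<delta>..N}"
      if \<psi>: "\<psi> \<in> {a..b}" for \<psi>
    proof (rule fundamental_theorem_of_calculus[OF \<delta>(2)])
      fix r assume r: "r \<in> {\<delta>..N}"
      then have "0 < r" using \<delta> by auto
      have "((\<lambda>r. K (rcis r \<psi>)) has_derivative (\<lambda>h. act (h *\<^sub>R cis \<psi>) (K' (rcis r \<psi>)))) (at r within {\<delta>..N})"
        using has_vector_derivative_rcis(1)[unfolded has_vector_derivative_def] der[OF \<open>0 < r\<close> \<psi>]
        by (rule has_derivative_compose)
      then have "((\<lambda>r. act \<i> (K (rcis r \<psi>))) has_derivative (\<lambda>h. act \<i> (act (h *\<^sub>R cis \<psi>) (K' (rcis r \<psi>))))) (at r within {\<delta>..N})"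
        by (rule bounded_linear.has_derivative[OF bounded_linear_right])
      then show "((\<lambda>r. act \<i> (K (rcis r \<psi>))) has_vector_derivative fx \<psi> r) (at r within {\<delta>..N})"
        unfolding has_vector_derivative_def fx_def by (simp add: act_mult scaleR_left scaleR_right)
    qed
    have "((\<lambda>\<psi>. integral (cbox \<delta> N) (f \<psi>)) has_vector_derivative integral (cbox \<delta> N) (fx \<psi>)) (at \<psi> within {a..b})"
      if \<psi>: "\<psi> \<in> {a..b}" for \<psi>
    proof (rule leibniz_rule_vector_derivative[OF _ _ _ \<psi>])
      fix \<psi> r assume \<psi>: "\<psi> \<in> {a..b}" and "r \<in> cbox \<delta> N"
      then have r: "0 < r" using \<delta> by auto
      have "((\<lambda>\<psi>. K (rcis r \<psi>)) has_derivative (\<lambda>h. act (h *\<^sub>R (\<i> * rcis r \<psi>)) (K' (rcis r \<psi>)))) (at \<psi> within {a..b})"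
        using has_vector_derivative_rcis(2)[unfolded has_vector_derivative_def] der[OF r \<psi>]
        by (rule has_derivative_compose)
      then have "((\<lambda>\<psi>. (1 / r) *\<^sub>R K (rcis r \<psi>)) has_derivative (\<lambda>h. (1 / r) *\<^sub>R act (h *\<^sub>R (\<i> * rcis r \<psi>)) (K' (rcis r \<psi>)))) (at \<psi> within {a..b})"
        by (rule has_derivative_scaleR_right)
      moreover have "(1 / r) *\<^sub>R act (h *\<^sub>R (\<i> * rcis r \<psi>)) (K' (rcis r \<psi>)) = h *\<^sub>R fx \<psi> r" for h
      proof -
        have "\<i> * rcis r \<psi> = r *\<^sub>R (\<i> * cis \<psi>)" by (simp add: rcis_def scaleR_conv_of_real)
        then show ?thesis using r by (simp add: fx_def scaleR_left)
      qed
      ultimately show "((\<lambda>\<psi>. f \<psi> r) has_vector_derivative fx \<psi> r) (at \<psi> within {a..b})"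
        unfolding has_vector_derivative_def f_def by simp
    next
      show "f \<psi> integrable_on cbox \<delta> N" if "\<psi> \<in> {a..b}" for \<psi>
        using that \<delta> by (auto simp: box_real intro!: integrable_continuous_interval continuous_on_subset[OF contf])
      show "continuous_on ({a..b} \<times> cbox \<delta> N) (\<lambda>(\<psi>, r). fx \<psi> r)"
        unfolding fx_def split_beta
      proof (intro continuous_on continuous_intros)
        show "continuous_on ({a..b} \<times> cbox \<delta> N) (\<lambda>x. K' (rcis (snd x) (fst x)))"
          by (rule continuous_on_compose2[OF cont]) (use \<delta> in \<open>auto simp: rcis_def intro!: continuous_intros\<close>,
             metis \<delta>(1) atLeastAtMost_iff less_le_trans)
      qed
    qed simp
    then have "((\<lambda>\<psi>. integral (cbox \<delta> N) (fx \<psi>)) has_integral (integral (cbox \<delta> N) (f b) - integral (cbox \<delta> N) (f a))) {a..b}"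
      by (intro fundamental_theorem_of_calculus[OF ab])
    moreover have "norm (integral (cbox \<delta> N) (fx \<psi>)) \<le> M * (C / N + C * \<delta>)" if \<psi>: "\<psi> \<in> {a..b}" for \<psi>
    proof -
      have "integral (cbox \<delta> N) (fx \<psi>) = act \<i> (K (rcis N \<psi>) - K (rcis \<delta> \<psi>))"
        using integral_unique[OF fxi[OF \<psi>]] by (simp add: diff_right)
      also have "norm \<dots> \<le> M * norm (K (rcis N \<psi>) - K (rcis \<delta> \<psi>))" by (rule M)
      also have "\<dots> \<le> M * (C / N + C * \<delta>)"
        using \<delta> by (intro mult_left_mono[OF _ M(2)] norm_triangle_le_diff add_mono bd \<psi>) auto
      finally show ?thesis .
    qed
    moreover from this[of a] have "0 \<le> M * (C / N + C * \<delta>)" using ab by (auto intro: order_trans[OF norm_ge_zero])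
    ultimately have "norm (integral (cbox \<delta> N) (f b) - integral (cbox \<delta> N) (f a)) \<le> M * (C / N + C * \<delta>) * measure lborel {a..b}"
      using has_integral_bound_real by blast
    then show ?thesis using ab by simp
  qed
  let ?B = "\<lambda>n. M * (C / real (Suc n) + C * (1 / real (Suc n))) * (b - a)"
  let ?D = "\<lambda>n. integral {1 / real (Suc n)..real (Suc n)} (f b) - integral {1 / real (Suc n)..real (Suc n)} (f a)"
  have B: "?B \<longlonglongrightarrow> M * (0 + C * 0) * (b - a)"
    by (intro tendsto_intros LIMSEQ_Suc lim_const_over_n)
  then have B: "?B \<longlonglongrightarrow> 0" by simp
  have "norm (?D n) \<le> ?B n" for n
  proof (rule step)
    have "1 / real (Suc n) \<le> 1" "1 \<le> real (Suc n)" by (simp_all add: divide_simps)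
    then show "1 / real (Suc n) \<le> real (Suc n)" by linarith
  qed simp
  then have "\<forall>\<^sub>F n in sequentially. norm (?D n) \<le> ?B n"
    by (intro always_eventually allI)
  from Lim_null_comparison[OF this B] have D0: "?D \<longlonglongrightarrow> 0" .
  have a: "a \<in> {a..b}" "b \<in> {a..b}" using ab by auto
  have "?D \<longlonglongrightarrow> integral {0<..} (f b) - integral {0<..} (f a)"
    by (rule tendsto_diff; rule dominated_integral_limit[OF fi _ g]) (use a fg in auto)
  with D0 have "integral {0<..} (f b) - integral {0<..} (f a) = 0"
    using LIMSEQ_unique by blast
  then show ?thesis by (simp add: f_def[abs_def])
qed

section \<open>Scalar ray integrals\<close>

definition lam :: "complex \<Rightarrow> complex" where
  "lam z = 1 / (1 + z\<^sup>2)"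

text \<open>For z = x + iy in the closed sector, y^2 is at most t^2 x^2 with t = tan \<theta>, and 1
  is at most 2(y-1)^2 + 2y^2. So 1 + x^2 + y^2 is at most 2(y-1)^2 + x^2 + 3y^2, and the last term
  is at most 3 t^2 x^2. The constant 2 + 3t^2 covers all coefficients.\<close>

definition lam_bound :: "real \<Rightarrow> real" where
  "lam_bound \<theta> = 2 + 3 * (tan \<theta>)\<^sup>2"

lemma lam_bound_pos: "0 < lam_bound \<theta>"
  by (simp add: lam_bound_def add_pos_nonneg)

lemma closed_csector_norm_bound:
  assumes "z \<in> closed_csector \<theta>"
  shows "1 + (cmod z)\<^sup>2 \<le> lam_bound \<theta> * (cmod (z - \<i>))\<^sup>2"
    and "1 + (cmod z)\<^sup>2 \<le> lam_bound \<theta> * (cmod (z + \<i>))\<^sup>2"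
proof -
  define x y t where "x = Re z" and "y = Im z" and "t = tan \<theta>"
  have "\<bar>y\<bar>\<^sup>2 \<le> (t * \<bar>x\<bar>)\<^sup>2"
    using assms by (intro power_mono) (auto simp: closed_csector_def x_def y_def t_def)
  then have y: "y\<^sup>2 \<le> t\<^sup>2 * x\<^sup>2" by (simp add: power_mult_distrib)
  have "1 \<le> 2 * (y - 1)\<^sup>2 + 2 * y\<^sup>2" "1 \<le> 2 * (y + 1)\<^sup>2 + 2 * y\<^sup>2"
    using zero_le_power2[of "2 * y - 1"] zero_le_power2[of "2 * y + 1"]
    by (simp_all add: power2_eq_square algebra_simps)
  moreover have "0 \<le> 3 * t\<^sup>2 * (y - 1)\<^sup>2" "0 \<le> 3 * t\<^sup>2 * (y + 1)\<^sup>2" "0 \<le> x\<^sup>2" by simp_all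
  ultimately have "1 + (x\<^sup>2 + y\<^sup>2) \<le> (2 + 3 * t\<^sup>2) * (x\<^sup>2 + (y - 1)\<^sup>2)"
    "1 + (x\<^sup>2 + y\<^sup>2) \<le> (2 + 3 * t\<^sup>2) * (x\<^sup>2 + (y + 1)\<^sup>2)"
    using y by (simp_all only: distrib_left distrib_right)
  then show "1 + (cmod z)\<^sup>2 \<le> lam_bound \<theta> * (cmod (z - \<i>))\<^sup>2"
    "1 + (cmod z)\<^sup>2 \<le> lam_bound \<theta> * (cmod (z + \<i>))\<^sup>2"
    by (simp_all add: cmod_power2 lam_bound_def x_def y_def t_def)
qed

lemma one_plus_square_factor: "1 + z\<^sup>2 = (z - \<i>) * (z + \<i>)" for z :: complex
  by (simp add: power2_eq_square algebra_simps)

text \<open>The distances to the two poles i and -i of \<open>lam\<close> multiply to |1 + z^2|, so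
  the product of the two estimates is the square of the claim.\<close>

lemma one_plus_square_bound:
  assumes "z \<in> closed_csector \<theta>"
  shows "1 + (cmod z)\<^sup>2 \<le> lam_bound \<theta> * cmod (1 + z\<^sup>2)"
proof -
  have "0 \<le> 1 + (cmod z)\<^sup>2" by simp
  then have "(1 + (cmod z)\<^sup>2)\<^sup>2 \<le> (lam_bound \<theta> * (cmod (z - \<i>))\<^sup>2) * (lam_bound \<theta> * (cmod (z + \<i>))\<^sup>2)"
    unfolding power2_eq_square[of "1 + (cmod z)\<^sup>2"]
    by (intro mult_mono closed_csector_norm_bound[OF assms]) (auto intro: order_trans[OF _ closed_csector_norm_bound(1)[OF assms]])
  also have "\<dots> = (lam_bound \<theta> * cmod (1 + z\<^sup>2))\<^sup>2"
    by (simp add: one_plus_square_factor norm_mult power_mult_distrib) (simp add: power2_eq_square)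
  finally show ?thesis
    by (rule power2_le_imp_le) (simp add: lam_bound_pos less_imp_le)
qed

lemma one_plus_square_nonzero: "z \<in> closed_csector \<theta> \<Longrightarrow> 1 + z\<^sup>2 \<noteq> 0"
proof
  assume z: "z \<in> closed_csector \<theta>" and "1 + z\<^sup>2 = 0"
  then have "1 + (cmod z)\<^sup>2 \<le> 0" using one_plus_square_bound[OF z] by simp
  then show False using zero_le_power2[of "cmod z"] by linarith
qed

lemma csector_subset: "csector \<theta> \<subseteq> closed_csector \<theta>"
  by (auto simp: csector_def closed_csector_def)

lemma norm_lam_le:
  assumes "z \<in> closed_csector \<theta>"
  shows "cmod (lam z) \<le> lam_bound \<theta> * (1 / (1 + (cmod z)\<^sup>2))"
proof -
  have "0 < cmod (1 + z\<^sup>2)" using one_plus_square_nonzero[OF assms] by simp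
  moreover have "0 < 1 + (cmod z)\<^sup>2" by (simp add: add_pos_nonneg)
  ultimately show ?thesis
    using one_plus_square_bound[OF assms] by (simp add: lam_def norm_divide field_simps)
qed

text \<open>With r = |z|, all five bounds come from |lam z| (1 + r^2) being bounded, because 1, r
  and r^2 are each at most 1 + r^2.\<close>

lemma lam_bounds:
  assumes "z \<in> closed_csector \<theta>"
  shows "cmod (lam z) \<le> lam_bound \<theta>" "cmod (z * lam z) \<le> lam_bound \<theta>" "cmod (z * (z * lam z)) \<le> lam_bound \<theta>"
    "cmod (z * lam z) \<le> lam_bound \<theta> * cmod z" "cmod (z * lam z) * cmod z \<le> lam_bound \<theta>"
proof -
  let ?r = "cmod z"
  have p: "0 < 1 + ?r\<^sup>2" by (simp add: add_pos_nonneg)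
  have b: "cmod (lam z) * (1 + ?r\<^sup>2) \<le> lam_bound \<theta>"
    using norm_lam_le[OF assms] p by (simp add: field_simps)
  have r: "?r \<le> 1 + ?r\<^sup>2" using zero_le_power2[of "?r - 1/2"] by (simp add: power2_eq_square algebra_simps)
  have *: "cmod (lam z) * u \<le> lam_bound \<theta>" if "u \<le> 1 + ?r\<^sup>2" for u
    using mult_left_mono[OF that, of "cmod (lam z)"] b by simp
  show l: "cmod (lam z) \<le> lam_bound \<theta>" using *[of 1] by simp
  show "cmod (z * lam z) \<le> lam_bound \<theta>" using *[OF r] by (simp add: norm_mult mult.commute)
  show "cmod (z * (z * lam z)) \<le> lam_bound \<theta>" "cmod (z * lam z) * cmod z \<le> lam_bound \<theta>"
    using *[of "?r\<^sup>2"] by (simp_all add: norm_mult power2_eq_square mult_ac)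
  show "cmod (z * lam z) \<le> lam_bound \<theta> * cmod z"
    using mult_right_mono[OF l, of ?r] by (simp add: norm_mult mult.commute)
qed

lemma norm_lam_le_csector: "z \<in> csector \<theta> \<Longrightarrow> cmod (lam z) \<le> lam_bound \<theta>"
  and norm_z_lam_le_csector: "z \<in> csector \<theta> \<Longrightarrow> cmod (z * lam z) \<le> lam_bound \<theta>"
  using lam_bounds(1,2)[of z \<theta>] csector_subset[of \<theta>] by blast+

section \<open>Closure properties of the integrable class\<close>

lemma holo_intrinsic_mult:
  "holo_intrinsic \<theta> F \<Longrightarrow> holo_intrinsic \<theta> G \<Longrightarrow> holo_intrinsic \<theta> (\<lambda>z. F z * G z)"
  unfolding holo_intrinsic_def by (auto intro!: holomorphic_intros)

lemma holo_intrinsic_add: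
  "holo_intrinsic \<theta> F \<Longrightarrow> holo_intrinsic \<theta> G \<Longrightarrow> holo_intrinsic \<theta> (\<lambda>z. F z + G z)"
  unfolding holo_intrinsic_def by (auto intro!: holomorphic_intros)

lemma holo_intrinsic_of_real: "holo_intrinsic \<theta> (\<lambda>z. of_real r)"
  unfolding holo_intrinsic_def by auto

lemma holo_intrinsic_id: "holo_intrinsic \<theta> (\<lambda>z. z)"
  unfolding holo_intrinsic_def by auto

lemma holo_intrinsic_lam: "holo_intrinsic \<theta> lam"
  unfolding holo_intrinsic_def
  using one_plus_square_nonzero csector_subset
  by (auto simp: lam_def[abs_def] intro!: holomorphic_intros)

lemma continuous_on_rcis_ray:
  assumes \<theta>: "0 < \<theta>" "\<theta> < pi/2" and F: "continuous_on (csector \<theta>) F" and \<psi>: "\<psi> \<in> sector_angles \<theta>"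
  shows "continuous_on {0<..} (\<lambda>t. F (rcis t \<psi>))"
  by (rule continuous_on_compose2[OF F])
     (auto simp: rcis_def intro!: continuous_intros rcis_in_csector[OF \<theta> _ \<psi>, unfolded rcis_def])

lemma set_integrable_dominated:
  fixes f g :: "real \<Rightarrow> real"
  assumes "set_integrable lborel {0<..} g" "continuous_on {0<..} f" "\<And>t. 0 < t \<Longrightarrow> \<bar>f t\<bar> \<le> g t"
  shows "set_integrable lborel {0<..} f"
proof (rule set_integrable_bound[OF assms(1)])
  show "set_borel_measurable lborel {0<..} f"
    using assms(2) borel_measurable_continuous_on_indicator[of "{0<..}" f]
    by (simp add: set_borel_measurable_def)
  show "AE x in lborel. x \<in> {0<..} \<longrightarrow> norm (f x) \<le> norm (g x)"
    using assms(3) by (intro AE_I2 impI) (auto intro: order_trans[OF _ abs_ge_self])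
qed

lemma holo_N0_dominated:
  assumes \<theta>: "0 < \<theta>" "\<theta> < pi/2" and F: "holo_intrinsic \<theta> F"
    and b: "\<And>z. z \<in> csector \<theta> \<Longrightarrow> cmod (F z) \<le> M"
    and g: "\<And>\<psi>. \<psi> \<in> sector_angles \<theta> \<Longrightarrow> set_integrable lborel {0<..} (g \<psi>)"
    and Fg: "\<And>\<psi> t. \<psi> \<in> sector_angles \<theta> \<Longrightarrow> 0 < t \<Longrightarrow> cmod (F (rcis t \<psi>)) / t \<le> g \<psi> t"
  shows "holo_N0 \<theta> F"
  unfolding holo_N0_def
proof (intro conjI ballI F)
  show "bounded (F ` csector \<theta>)" using b unfolding bounded_iff by blast
  fix \<psi> assume \<psi>: "\<psi> \<in> sector_angles \<theta>"
  show "set_integrable lborel {0<..} (\<lambda>t. cmod (F (rcis t \<psi>)) / t)"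
  proof (rule set_integrable_dominated[OF g[OF \<psi>]])
    show "continuous_on {0<..} (\<lambda>t. cmod (F (rcis t \<psi>)) / t)"
      using F by (intro continuous_intros continuous_on_rcis_ray[OF \<theta> _ \<psi>] holomorphic_on_imp_continuous_on)
        (auto simp: holo_intrinsic_def)
  qed (use Fg[OF \<psi>] in auto)
qed

text \<open>Dividing the bound r/(1 + r^2) by r leaves a multiple of the integrable weight 1/(1 +
  r^2).\<close>

lemma holo_N0_decay:
  assumes \<theta>: "0 < \<theta>" "\<theta> < pi/2" and F: "holo_intrinsic \<theta> F"
    and b: "\<And>z. z \<in> csector \<theta> \<Longrightarrow> cmod (F z) \<le> C * (cmod z / (1 + (cmod z)\<^sup>2))"
  shows "holo_N0 \<theta> F"
proof (rule holo_N0_dominated[OF \<theta> F, where M = "\<bar>C\<bar>" and g = "\<lambda>\<psi> t. C * (1 / (1 + t\<^sup>2))"])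
  fix z assume z: "z \<in> csector \<theta>"
  have p: "0 < 1 + (cmod z)\<^sup>2" by (simp add: add_pos_nonneg)
  have "cmod z \<le> 1 + (cmod z)\<^sup>2" using zero_le_power2[of "cmod z - 1/2"] by (simp add: power2_eq_square algebra_simps)
  then have "cmod z / (1 + (cmod z)\<^sup>2) \<le> 1" using p by simp
  then have "\<bar>C\<bar> * (cmod z / (1 + (cmod z)\<^sup>2)) \<le> \<bar>C\<bar>" by (rule mult_left_le) simp
  moreover have "C * (cmod z / (1 + (cmod z)\<^sup>2)) \<le> \<bar>C\<bar> * (cmod z / (1 + (cmod z)\<^sup>2))"
    using p by (intro mult_right_mono) auto
  ultimately show "cmod (F z) \<le> \<bar>C\<bar>" using b[OF z] by linarith
next
  show "set_integrable lborel {0<..} (\<lambda>t. C * (1 / (1 + t\<^sup>2)))"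
    using arctan_integral(1) by (rule set_integrable_mult_right)
  fix \<psi> t assume "\<psi> \<in> sector_angles \<theta>" "0 < (t::real)"
  then show "cmod (F (rcis t \<psi>)) / t \<le> C * (1 / (1 + t\<^sup>2))"
    using b[OF rcis_in_csector[OF \<theta>, of t \<psi>]] by (simp add: norm_mult field_simps)
qed

lemma holo_N0_mult:
  assumes \<theta>: "0 < \<theta>" "\<theta> < pi/2" and F: "holo_N0 \<theta> F"
    and G: "holo_intrinsic \<theta> G" "\<And>z. z \<in> csector \<theta> \<Longrightarrow> cmod (G z) \<le> M"
  shows "holo_N0 \<theta> (\<lambda>z. G z * F z)"
proof -
  obtain N where N: "\<And>z. z \<in> csector \<theta> \<Longrightarrow> cmod (F z) \<le> N"
    using F unfolding holo_N0_def bounded_iff by blast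
  show ?thesis
  proof (rule holo_N0_dominated[OF \<theta>, where M = "M * N" and g = "\<lambda>\<psi> t. M * (cmod (F (rcis t \<psi>)) / t)"])
    show "holo_intrinsic \<theta> (\<lambda>z. G z * F z)"
      using F by (intro holo_intrinsic_mult G) (simp add: holo_N0_def)
    show "cmod (G z * F z) \<le> M * N" if "z \<in> csector \<theta>" for z
      unfolding norm_mult using G(2)[OF that] N[OF that] by (intro mult_mono) (auto intro: order_trans[OF norm_ge_zero])
    show "set_integrable lborel {0<..} (\<lambda>t. M * (cmod (F (rcis t \<psi>)) / t))" if "\<psi> \<in> sector_angles \<theta>" for \<psi>
      using F that by (intro set_integrable_mult_right) (simp add: holo_N0_def)
    show "cmod (G (rcis t \<psi>) * F (rcis t \<psi>)) / t \<le> M * (cmod (F (rcis t \<psi>)) / t)"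
      if "\<psi> \<in> sector_angles \<theta>" "0 < t" for \<psi> t
      using G(2)[OF rcis_in_csector[OF \<theta> that(2,1)]] that
      by (simp add: norm_mult divide_right_mono mult_right_mono)
  qed
qed

lemma holo_N0_add:
  assumes \<theta>: "0 < \<theta>" "\<theta> < pi/2" and F: "holo_N0 \<theta> F" and G: "holo_N0 \<theta> G"
  shows "holo_N0 \<theta> (\<lambda>z. F z + G z)"
proof -
  obtain N where N: "\<And>z. z \<in> csector \<theta> \<Longrightarrow> cmod (F z) \<le> N"
    using F unfolding holo_N0_def bounded_iff by blast
  obtain M where M: "\<And>z. z \<in> csector \<theta> \<Longrightarrow> cmod (G z) \<le> M"
    using G unfolding holo_N0_def bounded_iff by blast
  show ?thesis
  proof (rule holo_N0_dominated[OF \<theta>, where M = "N + M" and g = "\<lambda>\<psi> t. cmod (F (rcis t \<psi>)) / t + cmod (G (rcis t \<psi>)) / t"])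
    show "holo_intrinsic \<theta> (\<lambda>z. F z + G z)"
      using F G by (intro holo_intrinsic_add) (simp_all add: holo_N0_def)
    show "cmod (F z + G z) \<le> N + M" if "z \<in> csector \<theta>" for z
      using N[OF that] M[OF that] by (rule norm_triangle_mono)
    show "set_integrable lborel {0<..} (\<lambda>t. cmod (F (rcis t \<psi>)) / t + cmod (G (rcis t \<psi>)) / t)" if "\<psi> \<in> sector_angles \<theta>" for \<psi>
      using F G that by (intro set_integral_add(1)) (simp_all add: holo_N0_def)
    show "cmod (F (rcis t \<psi>) + G (rcis t \<psi>)) / t \<le> cmod (F (rcis t \<psi>)) / t + cmod (G (rcis t \<psi>)) / t"
      if "0 < t" for \<psi> t
      using that by (simp add: add_divide_distrib[symmetric] divide_right_mono norm_triangle_ineq)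
  qed
qed

lemma holo_N0_scale: "\<lbrakk>0 < \<theta>; \<theta> < pi/2; holo_N0 \<theta> F\<rbrakk> \<Longrightarrow> holo_N0 \<theta> (\<lambda>z. of_real r * F z)"
  by (rule holo_N0_mult[OF _ _ _ holo_intrinsic_of_real, where M = "\<bar>r\<bar>"]) auto

lemma holo_N0_lam: "\<lbrakk>0 < \<theta>; \<theta> < pi/2; holo_N0 \<theta> F\<rbrakk> \<Longrightarrow> holo_N0 \<theta> (\<lambda>z. lam z * F z)"
  by (rule holo_N0_mult[OF _ _ _ holo_intrinsic_lam, where M = "lam_bound \<theta>"])
     (simp_all add: norm_lam_le_csector)

lemma holo_N0_z_lam: "\<lbrakk>0 < \<theta>; \<theta> < pi/2; holo_N0 \<theta> F\<rbrakk> \<Longrightarrow> holo_N0 \<theta> (\<lambda>z. (z * lam z) * F z)"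
  by (rule holo_N0_mult[OF _ _ _ holo_intrinsic_mult[OF holo_intrinsic_id holo_intrinsic_lam], where M = "lam_bound \<theta>"])
     (simp_all add: norm_z_lam_le_csector)

text \<open>\<open>lam\<close> itself equals 1 at 0 and is not integrable against dt/t. The factor z
  repairs this at 0 and keeps enough decay at infinity, which makes z lam the generator from which
  rational members of the class are obtained.\<close>

lemma holo_N0_base:
  assumes "0 < \<theta>" "\<theta> < pi/2" shows "holo_N0 \<theta> (\<lambda>z. z * lam z)"
  by (rule holo_N0_decay[OF assms holo_intrinsic_mult[OF holo_intrinsic_id holo_intrinsic_lam], where C = "lam_bound \<theta>"])
     (use mult_left_mono[OF norm_lam_le norm_ge_zero] csector_subset in \<open>force simp: norm_mult mult_ac\<close>)

text \<open>The point reflection exchanges the right and left halves of the double sector. It serves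
  to reduce the left ray of the contour to a ray in the right half.\<close>

lemma holo_N0_uminus:
  assumes \<theta>: "0 < \<theta>" "\<theta> < pi/2" and F: "holo_N0 \<theta> F"
  shows "holo_N0 \<theta> (\<lambda>z. F (- z))"
proof -
  have F': "F holomorphic_on csector \<theta>" using F by (simp add: holo_N0_def holo_intrinsic_def)
  have hol: "(\<lambda>z. F (- z)) holomorphic_on csector \<theta>"
    by (rule holomorphic_on_compose_gen[OF _ F', unfolded o_def]) (auto intro!: holomorphic_intros)
  have "set_integrable lborel {0<..} (\<lambda>t. cmod (F (- rcis t \<psi>)) / t)" if "\<psi> \<in> sector_angles \<theta>" for \<psi>
  proof -
    have "\<psi> + pi \<in> sector_angles \<theta> \<or> \<psi> - pi \<in> sector_angles \<theta>"
      using that by (auto simp: sector_angles_def)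
    then show ?thesis
      using F unfolding holo_N0_def by (metis (mono_tags, lifting) rcis_uminus(1,2) set_integrable_cong)
  qed
  moreover have "bounded ((\<lambda>z. F (- z)) ` csector \<theta>)"
  proof -
    obtain N where N: "\<And>z. z \<in> csector \<theta> \<Longrightarrow> cmod (F z) \<le> N"
      using F unfolding holo_N0_def bounded_iff by blast
    have "cmod (F (- z)) \<le> N" if "z \<in> csector \<theta>" for z
      using N[of "- z"] that by simp
    then show ?thesis unfolding bounded_iff by blast
  qed
  moreover have "F (- cnj z) = cnj (F (- z))" if "z \<in> csector \<theta>" for z
    using F that unfolding holo_N0_def holo_intrinsic_def by (metis complex_cnj_minus uminus_in_csector)
  ultimately show ?thesis
    using hol unfolding holo_N0_def holo_intrinsic_def by auto
qed

text \<open>The multipliers \<open>n/(n + z)\<close> supply the decay of \<open>z H(z)\<close> at infinity that is not assumed.\<close>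

lemma ray_rotation:
  assumes \<theta>: "0 < \<theta>" "\<theta> < pi/2" and \<psi>: "\<psi> \<in> {-\<theta><..<\<theta>}"
    and hol: "H holomorphic_on {z \<in> csector \<theta>. 0 < Re z}"
    and b: "\<And>z. z \<in> csector \<theta> \<Longrightarrow> 0 < Re z \<Longrightarrow> cmod (H z) \<le> C"
      "\<And>z. z \<in> csector \<theta> \<Longrightarrow> 0 < Re z \<Longrightarrow> cmod (z * H z) \<le> C"
    and i: "(\<lambda>t. cmod (H (rcis t \<psi>))) integrable_on {0<..}" "(\<lambda>t. cmod (H (of_real t))) integrable_on {0<..}"
  shows "integral {0<..} (\<lambda>t. cis \<psi> * H (rcis t \<psi>)) = integral {0<..} (\<lambda>t. H (of_real t))"
proof -
  let ?U = "{z \<in> csector \<theta>. 0 < Re z}"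
  have U: "rcis t \<alpha> \<in> ?U" if "0 < t" "\<alpha> \<in> {-\<theta><..<\<theta>}" for t \<alpha>
    using rcis_in_csector_right[OF \<theta> that] by simp
  have opU: "open ?U"
    unfolding Collect_conj_eq Collect_mem_eq
    by (intro open_Int open_csector open_Collect_less continuous_intros)
  have i': "(\<lambda>t. cmod (H (rcis t \<alpha>))) integrable_on {0<..}" if "\<alpha> \<in> {0, \<psi>}" for \<alpha>
    using i that by auto
  define m where "m n z = of_nat (Suc n) / (of_nat (Suc n) + z)" for n :: nat and z :: complex
  have m1: "cmod (m n z) \<le> 1" "cmod (m n z) * cmod z \<le> Suc n" "of_nat (Suc n) + z \<noteq> 0" if "0 < Re z" for n z
  proof -
    have re: "real (Suc n) + Re z \<le> cmod (of_nat (Suc n) + z)"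
      using complex_Re_le_cmod[of "of_nat (Suc n) + z"] by simp
    then have le: "real (Suc n) \<le> cmod (of_nat (Suc n) + z)" using that by linarith
    then show "of_nat (Suc n) + z \<noteq> 0" by (metis norm_zero not_less of_nat_0_less_iff zero_less_Suc)
    have pos: "0 < cmod (of_nat (Suc n) + z)" using le by (meson less_le_trans of_nat_0_less_iff zero_less_Suc)
    have nn: "cmod (of_nat (Suc n)) = real (Suc n)" by (rule norm_of_nat)
    show "cmod (m n z) \<le> 1" unfolding m_def norm_divide nn using le pos by simp
    have "(cmod z)\<^sup>2 \<le> (cmod (of_nat (Suc n) + z))\<^sup>2"
      using that by (simp add: cmod_power2 power_mono)
    then have "cmod z \<le> cmod (of_nat (Suc n) + z)" by (rule power2_le_imp_le) simp
    then show "cmod (m n z) * cmod z \<le> Suc n"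
      unfolding m_def norm_divide nn using pos by (simp add: divide_le_eq mult_left_mono del: of_nat_Suc)
  qed
  have C0: "0 \<le> C" using b(1)[of "rcis 1 0"] U[of 1 0] \<theta> by (auto intro: order_trans[OF norm_ge_zero])
  have rot: "integral {0<..} (\<lambda>t. cis \<psi> * (m n (rcis t \<psi>) * H (rcis t \<psi>))) = integral {0<..} (\<lambda>t. m n (rcis t 0) * H (rcis t 0))" for n
  proof -
    \<comment> \<open>In the notation of \<open>polar_cauchy\<close> the integrand is K(z)/z.
      \<open>K\<close> is O(r) because \<open>m n\<close> and \<open>H\<close> are bounded, and
      O(1/r) because z \<open>m n\<close> z and z H z are bounded, for each fixed n.\<close>
    define K where "K z = z * (m n z * H z)" for z
    have Kh: "K holomorphic_on ?U"
      unfolding K_def m_def by (intro holomorphic_intros hol) (use m1(3) in auto)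
    have main: "integral {0<..} (\<lambda>r. (1 / r) *\<^sub>R K (rcis r a)) = integral {0<..} (\<lambda>r. (1 / r) *\<^sub>R K (rcis r c))"
      if ac: "a \<le> c" "-\<theta> < a" "c < \<theta>" for a c
    proof (rule polar_cauchy[where act = "(*)" and K' = "deriv K" and C = "C * Suc n"])
      fix r \<alpha> :: real assume r: "0 < r" and \<alpha>: "\<alpha> \<in> {a..c}"
      then have u: "rcis r \<alpha> \<in> ?U" using ac by (intro U) auto
      show "(K has_derivative (\<lambda>h. h * deriv K (rcis r \<alpha>))) (at (rcis r \<alpha>))"
        using holomorphic_derivI[OF Kh opU u, of UNIV] by (simp add: has_field_derivative_def mult.commute[of _ "deriv K (rcis r \<alpha>)"])
      have "cmod (K (rcis r \<alpha>)) = r * (cmod (m n (rcis r \<alpha>)) * cmod (H (rcis r \<alpha>)))"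
        using r by (simp add: K_def norm_mult)
      also have "\<dots> \<le> r * (1 * C)"
        using r u m1(1)[of "rcis r \<alpha>" n] b(1)[of "rcis r \<alpha>"] by (intro mult_left_mono mult_mono) auto
      also have "\<dots> \<le> C * Suc n * r" using r C0 by (simp add: algebra_simps)
      finally show "norm (K (rcis r \<alpha>)) \<le> C * Suc n * r" .
      have "cmod (K (rcis r \<alpha>)) * r = (cmod (m n (rcis r \<alpha>)) * cmod (rcis r \<alpha>)) * cmod (rcis r \<alpha> * H (rcis r \<alpha>))"
        using r by (simp add: K_def norm_mult)
      also have "\<dots> \<le> real (Suc n) * C"
        using u m1(2)[of "rcis r \<alpha>" n] b(2)[of "rcis r \<alpha>"] by (intro mult_mono) auto
      finally show "norm (K (rcis r \<alpha>)) \<le> C * Suc n / r" using r by (simp add: le_divide_eq mult.commute)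
    next
      have "continuous_on ?U (deriv K)"
        using holomorphic_deriv[OF Kh opU] by (rule holomorphic_on_imp_continuous_on)
      then show "continuous_on {rcis r \<psi> |r \<psi>. 0 < r \<and> \<psi> \<in> {a..c}} (deriv K)"
        by (rule continuous_on_subset) (use U ac in auto)
    qed (use ac in \<open>auto simp: bounded_bilinear_mult scaleR_conv_of_real\<close>)
    have K0: "integral {0<..} (\<lambda>r. (1 / r) *\<^sub>R K (rcis r \<psi>)) = integral {0<..} (\<lambda>r. (1 / r) *\<^sub>R K (rcis r 0))"
      using main[of \<psi> 0] main[of 0 \<psi>] \<psi> \<theta> by (cases "\<psi> \<le> 0") auto
    have "(1 / r) *\<^sub>R K (rcis r \<alpha>) = cis \<alpha> * (m n (rcis r \<alpha>) * H (rcis r \<alpha>))" if "r \<in> {0<..}" for r \<alpha>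
      using that by (simp add: K_def rcis_def scaleR_conv_of_real)
    then have K\<alpha>: "integral {0<..} (\<lambda>r. (1 / r) *\<^sub>R K (rcis r \<alpha>)) = integral {0<..} (\<lambda>t. cis \<alpha> * (m n (rcis t \<alpha>) * H (rcis t \<alpha>)))" for \<alpha>
      by (intro Henstock_Kurzweil_Integration.integral_cong) auto
    show ?thesis using K0 unfolding K\<alpha> by (simp only: cis_zero mult_1)
  qed
  have cont: "continuous_on {0<..} (\<lambda>t. H (rcis t \<alpha>))" if "\<alpha> \<in> {-\<theta><..<\<theta>}" for \<alpha>
    by (rule continuous_on_compose2[OF holomorphic_on_imp_continuous_on[OF hol]])
       (use U that in \<open>auto simp: rcis_def intro!: continuous_intros\<close>)
  \<comment> \<open>The multipliers have modulus at most 1 in the right half plane and tend to 1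
    pointwise, so |H| dominates along both rays.\<close>
  have lim: "(\<lambda>n. integral {0<..} (\<lambda>t. cis \<alpha> * (m n (rcis t \<alpha>) * H (rcis t \<alpha>)))) \<longlonglongrightarrow> integral {0<..} (\<lambda>t. cis \<alpha> * H (rcis t \<alpha>))"
    if \<alpha>: "\<alpha> \<in> {-\<theta><..<\<theta>}" "\<alpha> \<in> {0, \<psi>}" for \<alpha>
  proof (rule dominated_convergence(2)[OF _ i'[OF \<alpha>(2)]])
    have mb: "cmod (m n (rcis t \<alpha>) * H (rcis t \<alpha>)) \<le> cmod (H (rcis t \<alpha>))" if "0 < t" for t n
      using m1(1)[of "rcis t \<alpha>" n] U[OF that \<alpha>(1)] by (simp add: norm_mult mult_left_le_one_le)
    show "(\<lambda>t. cis \<alpha> * (m n (rcis t \<alpha>) * H (rcis t \<alpha>))) integrable_on {0<..}" for n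
    proof (rule dominated_integrable[OF _ _ i'[OF \<alpha>(2)]])
      show "continuous_on {0<..} (\<lambda>t. cis \<alpha> * (m n (rcis t \<alpha>) * H (rcis t \<alpha>)))"
        unfolding m_def using m1(3) U[OF _ \<alpha>(1)]
        by (intro continuous_intros cont \<alpha>) (auto simp: rcis_def intro!: continuous_intros)
    qed (use mb in \<open>auto simp: norm_mult\<close>)
    show "norm (cis \<alpha> * (m n (rcis t \<alpha>) * H (rcis t \<alpha>))) \<le> cmod (H (rcis t \<alpha>))" if "t \<in> {0<..}" for t n
      using mb[of t n] that by (simp add: norm_mult)
    have "(\<lambda>n. m n z) \<longlonglongrightarrow> 1" if "0 < Re z" for z
    proof -
      have "(\<lambda>n. 1 / (1 + z / of_nat (Suc n))) \<longlonglongrightarrow> 1 / (1 + 0)"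
        by (intro tendsto_intros LIMSEQ_Suc lim_const_over_n) simp
      moreover have "1 / (1 + z / of_nat (Suc n)) = m n z" for n
      proof -
        have "1 + z / of_nat (Suc n) = (of_nat (Suc n) + z) / of_nat (Suc n)"
          by (simp add: add_divide_distrib del: of_nat_Suc)
        then show ?thesis by (simp add: m_def)
      qed
      ultimately show ?thesis by simp
    qed
    then have "(\<lambda>n. cis \<alpha> * (m n (rcis t \<alpha>) * H (rcis t \<alpha>))) \<longlonglongrightarrow> cis \<alpha> * (1 * H (rcis t \<alpha>))" if "0 < t" for t
      using U[OF that \<alpha>(1)] by (intro tendsto_intros) auto
    then show "(\<lambda>n. cis \<alpha> * (m n (rcis t \<alpha>) * H (rcis t \<alpha>))) \<longlonglongrightarrow> cis \<alpha> * H (rcis t \<alpha>)" if "t \<in> {0<..}" for t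
      using that by simp
  qed
  have l\<psi>: "(\<lambda>n. integral {0<..} (\<lambda>t. m n (rcis t 0) * H (rcis t 0))) \<longlonglongrightarrow> integral {0<..} (\<lambda>t. cis \<psi> * H (rcis t \<psi>))"
    unfolding rot[symmetric] using \<psi> by (intro lim) auto
  have "(\<lambda>n. integral {0<..} (\<lambda>t. cis 0 * (m n (rcis t 0) * H (rcis t 0)))) \<longlonglongrightarrow> integral {0<..} (\<lambda>t. cis 0 * H (rcis t 0))"
    using \<theta> by (intro lim) auto
  then have "(\<lambda>n. integral {0<..} (\<lambda>t. m n (rcis t 0) * H (rcis t 0))) \<longlonglongrightarrow> integral {0<..} (\<lambda>t. cis 0 * H (rcis t 0))"
    by (simp only: cis_zero mult_1)
  from LIMSEQ_unique[OF l\<psi> this]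
  have "integral {0<..} (\<lambda>t. cis \<psi> * H (rcis t \<psi>)) = integral {0<..} (\<lambda>t. cis 0 * H (rcis t 0))" .
  then show ?thesis by (simp add: rcis_def)
qed


lemma csector_mem_closed: "z \<in> csector \<theta> \<Longrightarrow> z \<in> closed_csector \<theta>"
  using csector_subset by blast

text \<open>The factor \<open>G\<close> decays like 1/|z|, and thus |G F| is dominated by a multiple
  of |F|/t.\<close>

lemma holo_N0_ray_integrable:
  assumes \<theta>: "0 < \<theta>" "\<theta> < pi/2" and F: "holo_N0 \<theta> F" and \<psi>: "\<psi> \<in> sector_angles \<theta>"
    and G: "continuous_on (csector \<theta>) G" "\<And>z. z \<in> csector \<theta> \<Longrightarrow> cmod (G z) * cmod z \<le> C"
  shows "(\<lambda>t. cmod (G (rcis t \<psi>) * F (rcis t \<psi>))) integrable_on {0<..}"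
proof (rule dominated_integrable[where g = "\<lambda>t. C * (cmod (F (rcis t \<psi>)) / t)"])
  have "continuous_on (csector \<theta>) F"
    using F by (intro holomorphic_on_imp_continuous_on) (simp add: holo_N0_def holo_intrinsic_def)
  then show "continuous_on {0<..} (\<lambda>t. cmod (G (rcis t \<psi>) * F (rcis t \<psi>)))"
    by (intro continuous_intros continuous_on_rcis_ray[OF \<theta> _ \<psi>] G(1))
  show "(\<lambda>t. C * (cmod (F (rcis t \<psi>)) / t)) integrable_on {0<..}"
    using F \<psi> by (intro integrable_on_mult_right set_borel_integral_eq_integral(1)) (simp add: holo_N0_def)
  fix t :: real assume t: "0 < t"
  have "cmod (G (rcis t \<psi>)) * t \<le> C"
    using G(2)[OF rcis_in_csector[OF \<theta> t \<psi>]] t by simp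
  then have "cmod (G (rcis t \<psi>)) \<le> C / t" using t by (simp add: le_divide_eq)
  from mult_right_mono[OF this, of "cmod (F (rcis t \<psi>))"]
  show "norm (cmod (G (rcis t \<psi>) * F (rcis t \<psi>))) \<le> C * (cmod (F (rcis t \<psi>)) / t)"
    by (simp add: norm_mult)
qed

lemma integral_of_real_valued:
  fixes f :: "real \<Rightarrow> complex"
  assumes "\<And>t. t \<in> S \<Longrightarrow> f t \<in> \<real>"
  shows "Im (integral S f) = 0"
proof (cases "f integrable_on S")
  case True
  have "Im (integral S f) = integral S (Im \<circ> f)"
    using integral_linear[OF True bounded_linear_Im] by simp
  also have "\<dots> = integral S (\<lambda>_. 0)"
    using assms by (intro Henstock_Kurzweil_Integration.integral_cong) (auto simp: complex_is_Real_iff)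
  finally show ?thesis by simp
qed (simp add: not_integrable_integral)

text \<open>The ray can be rotated onto the positive real axis, where symmetry under conjugation
  makes the integrand real.\<close>

lemma ray_integral_real_right:
  assumes \<theta>: "0 < \<theta>" "\<theta> < pi/2" and F: "holo_N0 \<theta> F" and \<psi>: "\<psi> \<in> {-\<theta><..<\<theta>}"
    and G: "holo_intrinsic \<theta> G" "\<And>z. z \<in> csector \<theta> \<Longrightarrow> cmod (G z) \<le> C"
      "\<And>z. z \<in> csector \<theta> \<Longrightarrow> cmod (G z) * cmod z \<le> C"
  shows "Im (integral {0<..} (\<lambda>t. cis \<psi> * (G (rcis t \<psi>) * F (rcis t \<psi>)))) = 0"
proof -
  obtain N where N: "\<And>z. z \<in> csector \<theta> \<Longrightarrow> cmod (F z) \<le> N"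
    using F unfolding holo_N0_def bounded_iff by blast
  have hol: "holo_intrinsic \<theta> (\<lambda>z. G z * F z)"
    using F by (intro holo_intrinsic_mult G) (simp add: holo_N0_def)
  have sa: "\<psi> \<in> sector_angles \<theta>" "0 \<in> sector_angles \<theta>" using \<psi> \<theta> by (auto simp: sector_angles_def)
  have contG: "continuous_on (csector \<theta>) G"
    using G(1) by (intro holomorphic_on_imp_continuous_on) (simp add: holo_intrinsic_def)
  have C: "0 \<le> C" using G(2)[OF rcis_in_csector[OF \<theta> _ sa(2), of 1]] by (auto intro: order_trans[OF norm_ge_zero])
  have "integral {0<..} (\<lambda>t. cis \<psi> * (G (rcis t \<psi>) * F (rcis t \<psi>))) = integral {0<..} (\<lambda>t. G (of_real t) * F (of_real t))"
  proof (rule ray_rotation[OF \<theta> \<psi>, where C = "C * N"])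
    show "(\<lambda>z. G z * F z) holomorphic_on {z \<in> csector \<theta>. 0 < Re z}"
      using hol unfolding holo_intrinsic_def by (auto elim: holomorphic_on_subset)
    show "cmod (G z * F z) \<le> C * N" if "z \<in> csector \<theta>" for z
      unfolding norm_mult using G(2)[OF that] N[OF that] C by (intro mult_mono) auto
    show "cmod (z * (G z * F z)) \<le> C * N" if "z \<in> csector \<theta>" for z
    proof -
      have "(cmod (G z) * cmod z) * cmod (F z) \<le> C * N"
        using G(3)[OF that] N[OF that] C by (intro mult_mono) auto
      then show ?thesis by (simp add: norm_mult mult_ac)
    qed
    show "(\<lambda>t. cmod (G (rcis t \<psi>) * F (rcis t \<psi>))) integrable_on {0<..}"
      by (rule holo_N0_ray_integrable[OF \<theta> F sa(1) contG G(3)])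
    show "(\<lambda>t. cmod (G (of_real t) * F (of_real t))) integrable_on {0<..}"
      using holo_N0_ray_integrable[OF \<theta> F sa(2) contG G(3)] by (simp add: rcis_def)
  qed
  also have "Im \<dots> = 0"
  proof (rule integral_of_real_valued)
    fix t :: real assume "t \<in> {0<..}"
    then have t: "of_real t \<in> csector \<theta>" using \<theta> by (simp add: csector_def tan_gt_zero)
    have "G (of_real t) * F (of_real t) = cnj (G (of_real t) * F (of_real t))"
      using hol[unfolded holo_intrinsic_def] t by (metis complex_cnj_complex_of_real)
    then show "G (of_real t) * F (of_real t) \<in> \<real>" by (simp only: Reals_cnj_iff)
  qed
  finally show ?thesis .
qed

text \<open>The ray of angle pi - \<phi> is the negative of the ray of angle -\<phi>. As
  \<open>G\<close> is even or odd, reflection turns the integral into one over a right ray, up to a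
  sign, with F(-z) in place of F(z).\<close>

lemma ray_integral_real:
  assumes \<theta>: "0 < \<theta>" "\<theta> < pi/2" and F: "holo_N0 \<theta> F" and \<phi>: "\<phi> \<in> {0<..<\<theta>}" "\<psi> \<in> {\<phi>, pi - \<phi>}"
    and G: "holo_intrinsic \<theta> G" "\<And>z. z \<in> csector \<theta> \<Longrightarrow> cmod (G z) \<le> C"
      "\<And>z. z \<in> csector \<theta> \<Longrightarrow> cmod (G z) * cmod z \<le> C"
    and sgn: "\<And>z. z \<in> csector \<theta> \<Longrightarrow> G (- z) = \<epsilon> * G z" "\<epsilon> \<in> {1, -1}"
  shows "Im (integral {0<..} (\<lambda>t. cis \<psi> * (G (rcis t \<psi>) * F (rcis t \<psi>)))) = 0"
proof (cases "\<psi> = \<phi>")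
  case True
  then show ?thesis using \<phi> by (intro ray_integral_real_right[OF \<theta> F _ G]) auto
next
  case False
  then have \<psi>: "\<psi> = pi - \<phi>" using \<phi> by simp
  have "Im (integral {0<..} (\<lambda>t. cis (- \<phi>) * (G (rcis t (- \<phi>)) * F (- rcis t (- \<phi>))))) = 0"
    using \<phi> by (intro ray_integral_real_right[OF \<theta> holo_N0_uminus[OF \<theta> F] _ G]) auto
  moreover have "integral {0<..} (\<lambda>t. cis \<psi> * (G (rcis t \<psi>) * F (rcis t \<psi>)))
      = integral {0<..} (\<lambda>t. (- \<epsilon>) * (cis (- \<phi>) * (G (rcis t (- \<phi>)) * F (- rcis t (- \<phi>)))))"
  proof (rule Henstock_Kurzweil_Integration.integral_cong)
    fix t :: real assume t: "t \<in> {0<..}"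
    have "rcis t (- \<phi>) \<in> csector \<theta>" using t \<phi> by (intro rcis_in_csector[OF \<theta>]) (auto simp: sector_angles_def)
    moreover have "cis \<psi> = - cis (- \<phi>)" unfolding \<psi> using rcis_uminus(3)[of 1 \<phi>] by (simp add: rcis_def)
    ultimately show "cis \<psi> * (G (rcis t \<psi>) * F (rcis t \<psi>)) = (- \<epsilon>) * (cis (- \<phi>) * (G (rcis t (- \<phi>)) * F (- rcis t (- \<phi>))))"
      unfolding \<psi> rcis_uminus(3) using sgn(1) by simp
  qed
  ultimately show ?thesis using sgn(2) by auto
qed

lemma lam_uminus: "lam (- z) = lam z"
  by (simp add: lam_def)

lemma lam_ray_integrable:
  assumes \<theta>: "0 < \<theta>" "\<theta> < pi/2" and \<psi>: "\<psi> \<in> sector_angles \<theta>"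
  shows "(\<lambda>t. cmod (lam (rcis t \<psi>))) integrable_on {0<..}" "(\<lambda>t. cis \<psi> * lam (rcis t \<psi>)) integrable_on {0<..}"
proof -
  have g: "(\<lambda>t. lam_bound \<theta> * (1 / (1 + t\<^sup>2))) integrable_on {0<..}"
    by (intro integrable_on_mult_right set_borel_integral_eq_integral(1)[OF arctan_integral(1)])
  have cont: "continuous_on {0<..} (\<lambda>t. lam (rcis t \<psi>))"
    using holo_intrinsic_lam[of \<theta>]
    by (intro continuous_on_rcis_ray[OF \<theta> _ \<psi>] holomorphic_on_imp_continuous_on) (simp add: holo_intrinsic_def)
  have b: "cmod (lam (rcis t \<psi>)) \<le> lam_bound \<theta> * (1 / (1 + t\<^sup>2))" if "0 < t" for t
    using norm_lam_le[OF csector_mem_closed[OF rcis_in_csector[OF \<theta> that \<psi>]]] that by simp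
  show "(\<lambda>t. cmod (lam (rcis t \<psi>))) integrable_on {0<..}"
    by (rule dominated_integrable[OF _ _ g]) (use cont b in \<open>auto intro!: continuous_intros\<close>)
  show "(\<lambda>t. cis \<psi> * lam (rcis t \<psi>)) integrable_on {0<..}"
    by (rule dominated_integrable[OF _ _ g]) (use cont b in \<open>auto simp: norm_mult intro!: continuous_intros\<close>)
qed

lemma lam_ray_integral_right:
  assumes \<theta>: "0 < \<theta>" "\<theta> < pi/2" and \<psi>: "\<psi> \<in> {-\<theta><..<\<theta>}"
  shows "integral {0<..} (\<lambda>t. cis \<psi> * lam (rcis t \<psi>)) = of_real (pi/2)"
proof -
  have sa: "\<psi> \<in> sector_angles \<theta>" "0 \<in> sector_angles \<theta>" using \<psi> \<theta> by (auto simp: sector_angles_def)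
  have "integral {0<..} (\<lambda>t. cis \<psi> * lam (rcis t \<psi>)) = integral {0<..} (\<lambda>t. lam (of_real t))"
  proof (rule ray_rotation[OF \<theta> \<psi>, where C = "lam_bound \<theta>"])
    show "lam holomorphic_on {z \<in> csector \<theta>. 0 < Re z}"
      using holo_intrinsic_lam[of \<theta>] unfolding holo_intrinsic_def by (auto elim: holomorphic_on_subset)
    show "(\<lambda>t. cmod (lam (of_real t))) integrable_on {0<..}"
      using lam_ray_integrable(1)[OF \<theta> sa(2)] by (simp add: rcis_def)
  qed (use norm_lam_le_csector norm_z_lam_le_csector lam_ray_integrable(1)[OF \<theta> sa(1)] in auto)
  also have "\<dots> = integral {0<..} (complex_of_real \<circ> (\<lambda>t. 1 / (1 + t\<^sup>2)))"
    by (rule Henstock_Kurzweil_Integration.integral_cong) (simp add: lam_def)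
  also have "\<dots> = of_real (integral {0<..} (\<lambda>t. 1 / (1 + t\<^sup>2)))"
    by (intro integral_linear set_borel_integral_eq_integral(1)[OF arctan_integral(1)] bounded_linear_of_real)
  finally show ?thesis by (simp add: arctan_integral(2))
qed

text \<open>Reflection leaves the even function \<open>lam\<close> unchanged and reverses dz, so the
  left ray contributes the opposite sign. The two rays of the contour therefore add up instead of
  cancelling.\<close>

lemma lam_ray_integral_left:
  assumes \<theta>: "0 < \<theta>" "\<theta> < pi/2" and \<phi>: "\<phi> \<in> {-\<theta><..<\<theta>}"
  shows "integral {0<..} (\<lambda>t. cis (pi - \<phi>) * lam (rcis t (pi - \<phi>))) = - of_real (pi/2)"
proof -
  have "cis (pi - \<phi>) = - cis (- \<phi>)" using rcis_uminus(3)[of 1 \<phi>] by (simp add: rcis_def)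
  then have "integral {0<..} (\<lambda>t. cis (pi - \<phi>) * lam (rcis t (pi - \<phi>))) = integral {0<..} (\<lambda>t. - (cis (- \<phi>) * lam (rcis t (- \<phi>))))"
    by (simp add: rcis_uminus(3) lam_uminus)
  also have "\<dots> = - integral {0<..} (\<lambda>t. cis (- \<phi>) * lam (rcis t (- \<phi>)))" by (rule Henstock_Kurzweil_Integration.integral_neg)
  also have "\<dots> = - of_real (pi/2)" using \<phi> by (subst lam_ray_integral_right[OF \<theta>]) auto
  finally show ?thesis .
qed

section \<open>The resolvent on the complexification\<close>

text \<open>A pair (u, w) stands for u + i w with an external imaginary unit. Left multiplication by
  a Clifford unit J could not serve, because the operator need not commute with it.\<close>

definition cact :: "complex \<Rightarrow> 'w::real_normed_vector \<times> 'w \<Rightarrow> 'w \<times> 'w" where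
  "cact c p = (Re c *\<^sub>R fst p - Im c *\<^sub>R snd p, Re c *\<^sub>R snd p + Im c *\<^sub>R fst p)"

lemma norm_cact_le: "norm (cact c p) \<le> 4 * (cmod c * norm p)"
proof -
  have f: "norm (fst p) \<le> norm p" "norm (snd p) \<le> norm p"
    by (cases p, simp add: norm_fst_le norm_snd_le)+
  have m: "\<bar>Re c\<bar> * norm u \<le> cmod c * norm p" "\<bar>Im c\<bar> * norm u \<le> cmod c * norm p"
    if "norm u \<le> norm p" for u :: 'a
    using that by (auto intro!: mult_mono abs_Re_le_cmod abs_Im_le_cmod)
  have "norm (cact c p) \<le> norm (Re c *\<^sub>R fst p - Im c *\<^sub>R snd p) + norm (Re c *\<^sub>R snd p + Im c *\<^sub>R fst p)"
    unfolding cact_def by (rule norm_Pair_le)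
  also have "\<dots> \<le> (\<bar>Re c\<bar> * norm (fst p) + \<bar>Im c\<bar> * norm (snd p)) + (\<bar>Re c\<bar> * norm (snd p) + \<bar>Im c\<bar> * norm (fst p))"
    by (intro add_mono order_trans[OF norm_triangle_ineq4] order_trans[OF norm_triangle_ineq]) simp_all
  also have "\<dots> \<le> 4 * (cmod c * norm p)"
    using m[OF f(1)] m[OF f(2)] by linarith
  finally show ?thesis .
qed

lemma bounded_bilinear_cact: "bounded_bilinear cact"
proof
  have "norm (cact a b) \<le> norm a * norm b * 4" for a and b :: "'a \<times> 'a"
    using norm_cact_le[of a b] by (simp only: mult_ac)
  then show "\<exists>K. \<forall>a (b :: 'a \<times> 'a). norm (cact a b) \<le> norm a * norm b * K" by blast
qed (simp_all add: cact_def algebra_simps)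

interpretation cact: bounded_bilinear cact
  by (rule bounded_bilinear_cact)

lemma cact_cact [simp]: "cact a (cact b p) = cact (a * b) p"
  by (simp add: cact_def algebra_simps)

lemma cact_one [simp]: "cact 1 p = p"
  by (simp add: cact_def)

lemma cact_of_real: "cact (of_real r) p = r *\<^sub>R p"
  by (simp add: cact_def prod_eq_iff)

lemma cact_pair_linear:
  assumes "linear f"
  shows "cact c (f (fst p), f (snd p)) = (f (fst (cact c p)), f (snd (cact c p)))"
  by (simp add: cact_def linear_add[OF assms] linear_diff[OF assms] linear_scale[OF assms])

lemma not_csector_imp_not_closed:
  assumes "0 < \<omega>" "\<omega> < \<phi>" "\<phi> < pi/2" "z \<notin> csector \<phi>" "z \<noteq> 0"
  shows "z \<notin> closed_csector \<omega>"
proof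
  assume "z \<in> closed_csector \<omega>"
  have t: "tan \<omega> < tan \<phi>" using assms by (intro tan_monotone) auto
  have "Re z \<noteq> 0" using \<open>z \<in> closed_csector \<omega>\<close> \<open>z \<noteq> 0\<close> by (auto simp: closed_csector_def complex_eq_iff)
  then have "tan \<omega> * \<bar>Re z\<bar> < tan \<phi> * \<bar>Re z\<bar>" using t by simp
  with \<open>z \<in> closed_csector \<omega>\<close> assms(4) show False by (simp add: csector_def closed_csector_def)
qed

lemma rcis_not_closed_csector:
  assumes \<theta>: "0 < \<omega>" "\<omega> < \<phi>" "\<phi> < pi/2" and r: "0 < r" and \<psi>: "\<psi> \<in> {\<phi>..pi - \<phi>}"
  shows "rcis r \<psi> \<notin> closed_csector \<omega>" "0 < Im (rcis r \<psi>)"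
proof -
  have s: "0 < sin \<psi>" using \<psi> \<theta> by (intro sin_gt_zero) auto
  then show "0 < Im (rcis r \<psi>)" using r by simp
  have "tan \<omega> * \<bar>cos \<psi>\<bar> < sin \<psi>"
  proof (cases "cos \<psi> = 0")
    case True
    then show ?thesis using s by simp
  next
    case False
    show ?thesis
    proof (cases "\<psi> < pi/2")
      case True
      then have c: "0 < cos \<psi>" using \<psi> \<theta> by (intro cos_gt_zero_pi) auto
      have "tan \<omega> < tan \<psi>" using \<psi> \<theta> True by (intro tan_monotone) auto
      then show ?thesis using c by (simp add: tan_def[THEN fun_cong] field_simps)
    next
      case f: False
      \<comment> \<open>In the left quadrant the tangent is compared after reflection in the
        imaginary axis, which leaves the symmetric double sector invariant.\<close>
      define \<alpha> where "\<alpha> = pi - \<psi>"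
      have eq: "cos \<psi> = - cos \<alpha>" "sin \<psi> = sin \<alpha>" by (simp_all add: \<alpha>_def)
      have "\<alpha> \<noteq> pi/2" using False eq(1) by (metis cos_pi_half minus_zero)
      then have \<alpha>: "\<phi> \<le> \<alpha>" "\<alpha> < pi/2" using f \<psi> by (auto simp: \<alpha>_def)
      then have c: "0 < cos \<alpha>" using \<theta> by (intro cos_gt_zero_pi) auto
      have "tan \<omega> < tan \<alpha>" using \<alpha> \<theta> by (intro tan_monotone) auto
      then show ?thesis using c by (simp add: eq tan_def[THEN fun_cong] field_simps)
    qed
  qed
  then have "r * (tan \<omega> * \<bar>cos \<psi>\<bar>) < r * sin \<psi>" using r by simp
  then show "rcis r \<psi> \<notin> closed_csector \<omega>"
    using r s by (simp add: closed_csector_def abs_mult mult_ac)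
qed

text \<open>\<open>\<tau>\<close> is total, its values outside of the domain \<open>D\<close> of the operator are arbitrary. \<open>Qi z\<close> is
  the inverse of \<open>Q\<^sub>z[\<tau>]\<close>.\<close>

locale sector_op =
  fixes D :: "'w::banach set" and \<tau> :: "'w \<Rightarrow> 'w" and Qi :: "complex \<Rightarrow> 'w \<Rightarrow> 'w" and \<omega> :: real
  assumes \<omega>: "0 < \<omega>" "\<omega> < pi/2"
    and subspace_D: "subspace D"
    and \<tau>_add: "\<And>x y. x \<in> D \<Longrightarrow> y \<in> D \<Longrightarrow> \<tau> (x + y) = \<tau> x + \<tau> y"
    and \<tau>_scale: "\<And>c x. x \<in> D \<Longrightarrow> \<tau> (c *\<^sub>R x) = c *\<^sub>R \<tau> x"
    and Qi_D: "\<And>z v. z \<notin> closed_csector \<omega> \<Longrightarrow> Qi z v \<in> D"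
    and \<tau>_Qi_D: "\<And>z v. z \<notin> closed_csector \<omega> \<Longrightarrow> \<tau> (Qi z v) \<in> D"
    and Qi_eq: "\<And>z v. z \<notin> closed_csector \<omega> \<Longrightarrow>
       \<tau> (\<tau> (Qi z v)) - (2 * Re z) *\<^sub>R \<tau> (Qi z v) + (cmod z)\<^sup>2 *\<^sub>R Qi z v = v"
    and Qi_unique: "\<And>z u. z \<notin> closed_csector \<omega> \<Longrightarrow> u \<in> D \<Longrightarrow> \<tau> u \<in> D \<Longrightarrow>
       Qi z (\<tau> (\<tau> u) - (2 * Re z) *\<^sub>R \<tau> u + (cmod z)\<^sup>2 *\<^sub>R u) = u"
    and Qi_bound: "\<And>\<phi>. \<phi> \<in> {\<omega><..<pi/2} \<Longrightarrow> \<exists>C\<ge>0. \<forall>z v. z \<notin> csector \<phi> \<longrightarrow> z \<noteq> 0 \<longrightarrow>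
       norm (Qi z v) \<le> C / (cmod z)\<^sup>2 * norm v \<and> norm (\<tau> (Qi z v)) \<le> C / cmod z * norm v"
begin

lemma D_closed:
  "x \<in> D \<Longrightarrow> y \<in> D \<Longrightarrow> x + y \<in> D" "x \<in> D \<Longrightarrow> y \<in> D \<Longrightarrow> x - y \<in> D"
  "x \<in> D \<Longrightarrow> c *\<^sub>R x \<in> D" "0 \<in> D" "x \<in> D \<Longrightarrow> - x \<in> D"
  using subspace_add[OF subspace_D] subspace_diff[OF subspace_D] subspace_scale[OF subspace_D]
    subspace_0[OF subspace_D] subspace_neg[OF subspace_D] by simp_all

lemma \<tau>_minus: "x \<in> D \<Longrightarrow> \<tau> (- x) = - \<tau> x"
  using \<tau>_scale[of x "- 1"] by simp

lemma \<tau>_diff: "x \<in> D \<Longrightarrow> y \<in> D \<Longrightarrow> \<tau> (x - y) = \<tau> x - \<tau> y"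
  using \<tau>_add[of x "- y"] D_closed(5)[of y] by (simp add: \<tau>_minus)

lemma \<tau>_zero [simp]: "\<tau> 0 = 0"
  using \<tau>_scale[OF D_closed(4), of 0] by simp

lemmas \<tau>_linear = \<tau>_add \<tau>_diff \<tau>_scale \<tau>_minus

lemma Qi_eqI:
  assumes "z \<notin> closed_csector \<omega>" "u \<in> D" "\<tau> u \<in> D"
    "\<tau> (\<tau> u) - (2 * Re z) *\<^sub>R \<tau> u + (cmod z)\<^sup>2 *\<^sub>R u = v"
  shows "Qi z v = u"
  using Qi_unique[OF assms(1-3)] assms(4) by simp

lemma linear_Qi:
  assumes z: "z \<notin> closed_csector \<omega>"
  shows "linear (Qi z)"
proof (rule linearI)
  show "Qi z (v + w) = Qi z v + Qi z w" for v w
  proof (rule Qi_eqI[OF z])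
    have "\<tau> (\<tau> (Qi z v + Qi z w)) - (2 * Re z) *\<^sub>R \<tau> (Qi z v + Qi z w) + (cmod z)\<^sup>2 *\<^sub>R (Qi z v + Qi z w)
       = (\<tau> (\<tau> (Qi z v)) - (2 * Re z) *\<^sub>R \<tau> (Qi z v) + (cmod z)\<^sup>2 *\<^sub>R Qi z v)
        + (\<tau> (\<tau> (Qi z w)) - (2 * Re z) *\<^sub>R \<tau> (Qi z w) + (cmod z)\<^sup>2 *\<^sub>R Qi z w)"
      using z by (simp add: \<tau>_linear Qi_D \<tau>_Qi_D algebra_simps)
    then show "\<tau> (\<tau> (Qi z v + Qi z w)) - (2 * Re z) *\<^sub>R \<tau> (Qi z v + Qi z w) + (cmod z)\<^sup>2 *\<^sub>R (Qi z v + Qi z w) = v + w"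
      by (simp only: Qi_eq[OF z])
  qed (use z in \<open>simp_all add: \<tau>_linear Qi_D \<tau>_Qi_D D_closed\<close>)
  show "Qi z (c *\<^sub>R v) = c *\<^sub>R Qi z v" for c v
  proof (rule Qi_eqI[OF z])
    have "\<tau> (\<tau> (c *\<^sub>R Qi z v)) - (2 * Re z) *\<^sub>R \<tau> (c *\<^sub>R Qi z v) + (cmod z)\<^sup>2 *\<^sub>R (c *\<^sub>R Qi z v)
       = c *\<^sub>R (\<tau> (\<tau> (Qi z v)) - (2 * Re z) *\<^sub>R \<tau> (Qi z v) + (cmod z)\<^sup>2 *\<^sub>R Qi z v)"
      using z by (simp add: \<tau>_linear Qi_D \<tau>_Qi_D algebra_simps)
    then show "\<tau> (\<tau> (c *\<^sub>R Qi z v)) - (2 * Re z) *\<^sub>R \<tau> (c *\<^sub>R Qi z v) + (cmod z)\<^sup>2 *\<^sub>R (c *\<^sub>R Qi z v) = c *\<^sub>R v"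
      by (simp only: Qi_eq[OF z])
  qed (use z in \<open>simp_all add: \<tau>_linear Qi_D \<tau>_Qi_D D_closed\<close>)
qed

lemma \<tau>_\<tau>_Qi:
  assumes z: "z \<notin> closed_csector \<omega>"
  shows "\<tau> (\<tau> (Qi z v)) = v + (2 * Re z) *\<^sub>R \<tau> (Qi z v) - (cmod z)\<^sup>2 *\<^sub>R Qi z v"
  using Qi_eq[OF z, of v] by (simp add: algebra_simps)

lemma \<tau>_\<tau>_Qi_coords:
  assumes z: "z \<notin> closed_csector \<omega>"
  shows "\<tau> (\<tau> (Qi z v)) = v + Re z *\<^sub>R \<tau> (Qi z v) + Re z *\<^sub>R \<tau> (Qi z v)
    - (Re z * Re z) *\<^sub>R Qi z v - (Im z * Im z) *\<^sub>R Qi z v"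
proof -
  have "(cmod z)\<^sup>2 *\<^sub>R Qi z v = (Re z * Re z) *\<^sub>R Qi z v + (Im z * Im z) *\<^sub>R Qi z v"
    unfolding cmod_power2 by (simp add: power2_eq_square scaleR_add_left)
  moreover have "(2 * Re z) *\<^sub>R \<tau> (Qi z v) = Re z *\<^sub>R \<tau> (Qi z v) + Re z *\<^sub>R \<tau> (Qi z v)"
    by (simp only: mult_2 scaleR_add_left)
  ultimately show ?thesis unfolding \<tau>_\<tau>_Qi[OF z] by simp
qed

text \<open>For v in D the equation solved by u = Qi z v expresses T^2 u as a combination of v, u
  and T u, all in D. So T can be applied once more to the whole equation, and uniqueness identifies
  T u.\<close>

lemma Qi_\<tau>:
  assumes z: "z \<notin> closed_csector \<omega>" and v: "v \<in> D"
  shows "Qi z (\<tau> v) = \<tau> (Qi z v)"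
proof (rule Qi_eqI[OF z \<tau>_Qi_D[OF z]])
  show D: "\<tau> (\<tau> (Qi z v)) \<in> D"
    unfolding \<tau>_\<tau>_Qi[OF z] using v z by (intro D_closed Qi_D \<tau>_Qi_D)
  have "\<tau> (\<tau> (\<tau> (Qi z v)) - (2 * Re z) *\<^sub>R \<tau> (Qi z v) + (cmod z)\<^sup>2 *\<^sub>R Qi z v) = \<tau> v"
    by (simp only: Qi_eq[OF z])
  then show "\<tau> (\<tau> (\<tau> (Qi z v))) - (2 * Re z) *\<^sub>R \<tau> (\<tau> (Qi z v)) + (cmod z)\<^sup>2 *\<^sub>R \<tau> (Qi z v) = \<tau> v"
    using D z by (simp add: \<tau>_linear Qi_D \<tau>_Qi_D D_closed)
qed

text \<open>\<open>Qi w\<close> commutes with T on its domain, hence with Q_z[T]; applying it to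
  Q_z[T] Qi z v = v and using uniqueness interchanges the two inverses.\<close>

lemma Qi_commute:
  assumes z: "z \<notin> closed_csector \<omega>" and w: "w \<notin> closed_csector \<omega>"
  shows "Qi z (Qi w v) = Qi w (Qi z v)"
proof (rule Qi_eqI[OF z Qi_D[OF w]])
  interpret Qw: linear "Qi w" by (rule linear_Qi[OF w])
  have t: "\<tau> (Qi w (Qi z v)) = Qi w (\<tau> (Qi z v))" "\<tau> (Qi w (\<tau> (Qi z v))) = Qi w (\<tau> (\<tau> (Qi z v)))"
    using z w by (simp_all add: Qi_\<tau> Qi_D \<tau>_Qi_D)
  show "\<tau> (Qi w (Qi z v)) \<in> D" by (rule \<tau>_Qi_D[OF w])
  have "Qi w (\<tau> (\<tau> (Qi z v)) - (2 * Re z) *\<^sub>R \<tau> (Qi z v) + (cmod z)\<^sup>2 *\<^sub>R Qi z v) = Qi w v"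
    by (simp only: Qi_eq[OF z])
  then show "\<tau> (\<tau> (Qi w (Qi z v))) - (2 * Re z) *\<^sub>R \<tau> (Qi w (Qi z v)) + (cmod z)\<^sup>2 *\<^sub>R Qi w (Qi z v) = Qi w v"
    unfolding t by (simp add: Qw.add Qw.diff Qw.scale)
qed

text \<open>\<open>Rz z\<close> is \<open>(z - T)\<^sup>-\<^sup>1 = Q\<^sub>z[T]\<^sup>-\<^sup>1(cnj z - T)\<close> on the complexification.\<close>

definition Rz :: "complex \<Rightarrow> 'w \<times> 'w \<Rightarrow> 'w \<times> 'w" where
  "Rz z p = cact (cnj z) (Qi z (fst p), Qi z (snd p)) - (\<tau> (Qi z (fst p)), \<tau> (Qi z (snd p)))"

definition Tc :: "'w \<times> 'w \<Rightarrow> 'w \<times> 'w" where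
  "Tc p = (\<tau> (fst p), \<tau> (snd p))"

lemma Rz_components:
  "fst (Rz z p) = Re z *\<^sub>R Qi z (fst p) + Im z *\<^sub>R Qi z (snd p) - \<tau> (Qi z (fst p))"
  "snd (Rz z p) = Re z *\<^sub>R Qi z (snd p) - Im z *\<^sub>R Qi z (fst p) - \<tau> (Qi z (snd p))"
  by (simp_all add: Rz_def cact_def)

lemma Rz_D:
  assumes "z \<notin> closed_csector \<omega>"
  shows "Rz z p \<in> D \<times> D"
  unfolding mem_Times_iff Rz_components using assms by (intro conjI D_closed Qi_D \<tau>_Qi_D)

lemma Rz_right_inverse:
  assumes z: "z \<notin> closed_csector \<omega>"
  shows "cact z (Rz z p) - Tc (Rz z p) = p"
  using z
  by (simp add: prod_eq_iff Tc_def cact_def Rz_components \<tau>_linear D_closed Qi_D \<tau>_Qi_D \<tau>_\<tau>_Qi_coords algebra_simps)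

lemma Rz_left_inverse:
  assumes z: "z \<notin> closed_csector \<omega>" and p: "p \<in> D \<times> D"
  shows "Rz z (cact z p - Tc p) = p"
proof -
  interpret Q: linear "Qi z" by (rule linear_Qi[OF z])
  from p have "fst p \<in> D" "snd p \<in> D" by auto
  then show ?thesis
    using z
    by (simp add: prod_eq_iff Tc_def cact_def Rz_components \<tau>_linear D_closed Qi_D \<tau>_Qi_D \<tau>_\<tau>_Qi_coords
        Q.add Q.diff Q.scale Qi_\<tau> algebra_simps)
qed

lemma linear_Rz:
  assumes z: "z \<notin> closed_csector \<omega>"
  shows "linear (Rz z)"
proof -
  interpret Q: linear "Qi z" by (rule linear_Qi[OF z])
  show ?thesis
    using z by (intro linearI)
      (simp_all add: prod_eq_iff Rz_components Q.add Q.scale \<tau>_linear Qi_D algebra_simps)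
qed

lemma Rz_cact:
  assumes z: "z \<notin> closed_csector \<omega>"
  shows "Rz z (cact c p) = cact c (Rz z p)"
proof -
  interpret Q: linear "Qi z" by (rule linear_Qi[OF z])
  show ?thesis
    using z by (simp add: prod_eq_iff Rz_components cact_def Q.add Q.diff Q.scale \<tau>_linear D_closed Qi_D algebra_simps)
qed

lemma Rz_resolvent:
  assumes z: "z \<notin> closed_csector \<omega>" and w: "w \<notin> closed_csector \<omega>"
  shows "Rz z p - Rz w p = cact (w - z) (Rz z (Rz w p))"
proof -
  interpret R: linear "Rz z" by (rule linear_Rz[OF z])
  let ?u = "Rz w p"
  have p: "p = (cact z ?u - Tc ?u) + cact (w - z) ?u"
    using Rz_right_inverse[OF w, of p] by (simp add: cact.diff_left)
  have "Rz z p = Rz z (cact z ?u - Tc ?u) + Rz z (cact (w - z) ?u)"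
    by (subst p) (rule R.add)
  then show ?thesis using Rz_left_inverse[OF z Rz_D[OF w]] by (simp add: Rz_cact[OF z])
qed

section \<open>The bounded operators (1 + T^2)^(-1) and T(1 + T^2)^(-1)\<close>

lemma i_not_closed: "\<i> \<notin> closed_csector \<omega>"
  by (simp add: closed_csector_def)

text \<open>Since Re i = 0 and |i| = 1, the quadratic operator at i is 1 + T^2.\<close>

definition \<Lambda> :: "'w \<Rightarrow> 'w" where "\<Lambda> = Qi \<i>"
definition \<B> :: "'w \<Rightarrow> 'w" where "\<B> v = \<tau> (\<Lambda> v)"

lemma \<Lambda>_D: "\<Lambda> v \<in> D" and \<B>_D: "\<B> v \<in> D"
  using Qi_D[OF i_not_closed] \<tau>_Qi_D[OF i_not_closed] by (simp_all add: \<Lambda>_def \<B>_def)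

lemma \<tau>_\<B>: "\<tau> (\<B> v) = v - \<Lambda> v"
  using \<tau>_\<tau>_Qi[OF i_not_closed, of v] by (simp add: \<Lambda>_def \<B>_def)

lemma linear_\<Lambda>: "linear \<Lambda>" unfolding \<Lambda>_def by (rule linear_Qi[OF i_not_closed])

lemma \<Lambda>_\<tau>: "v \<in> D \<Longrightarrow> \<Lambda> (\<tau> v) = \<tau> (\<Lambda> v)"
  unfolding \<Lambda>_def by (rule Qi_\<tau>[OF i_not_closed])

lemma Qi_\<Lambda>: "z \<notin> closed_csector \<omega> \<Longrightarrow> Qi z (\<Lambda> v) = \<Lambda> (Qi z v)"
  unfolding \<Lambda>_def by (rule Qi_commute[OF _ i_not_closed])

lemma Qi_\<B>: "z \<notin> closed_csector \<omega> \<Longrightarrow> Qi z (\<B> v) = \<B> (Qi z v)"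
  unfolding \<B>_def by (simp add: Qi_\<tau> Qi_\<Lambda> \<Lambda>_D)

definition pmap :: "('w \<Rightarrow> 'w) \<Rightarrow> 'w \<times> 'w \<Rightarrow> 'w \<times> 'w" where
  "pmap f p = (f (fst p), f (snd p))"

lemma linear_\<B>: "linear \<B>"
  unfolding \<B>_def using linear_\<Lambda>
  by (intro linearI) (simp_all add: linear_add linear_scale \<tau>_linear \<Lambda>_D)

lemma cact_pmap: "linear f \<Longrightarrow> cact c (pmap f p) = pmap f (cact c p)"
  unfolding pmap_def by (rule cact_pair_linear)

lemma Tc_pmap_\<Lambda>: "Tc (pmap \<Lambda> p) = pmap \<B> p"
  by (simp add: Tc_def pmap_def \<B>_def)

lemma Tc_pmap_\<B>: "Tc (pmap \<B> p) = p - pmap \<Lambda> p"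
  by (simp add: Tc_def pmap_def \<tau>_\<B> prod_eq_iff)

lemma pmap_D: "pmap \<Lambda> p \<in> D \<times> D" "pmap \<B> p \<in> D \<times> D"
  by (simp_all add: pmap_def \<Lambda>_D \<B>_D)

lemma Rz_pmap:
  assumes z: "z \<notin> closed_csector \<omega>"
  shows "Rz z (pmap \<Lambda> p) = pmap \<Lambda> (Rz z p)" "Rz z (pmap \<B> p) = pmap \<B> (Rz z p)"
proof -
  interpret L: linear \<Lambda> by (rule linear_\<Lambda>)
  interpret B: linear \<B> by (rule linear_\<B>)
  show "Rz z (pmap \<Lambda> p) = pmap \<Lambda> (Rz z p)"
    using z by (simp add: prod_eq_iff Rz_components pmap_def Qi_\<Lambda> L.add L.diff L.scale \<Lambda>_\<tau> Qi_D)
  have "\<tau> (\<B> (Qi z v)) = \<B> (\<tau> (Qi z v))" for v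
    using z by (simp add: \<B>_def \<Lambda>_\<tau> Qi_D \<tau>_Qi_D)
  then show "Rz z (pmap \<B> p) = pmap \<B> (Rz z p)"
    using z by (simp add: prod_eq_iff Rz_components pmap_def Qi_\<B> B.add B.diff B.scale)
qed

lemma cact_z_Rz:
  assumes z: "z \<notin> closed_csector \<omega>" and p: "p \<in> D \<times> D"
  shows "cact z (Rz z p) = p + Rz z (Tc p)"
proof -
  interpret R: linear "Rz z" by (rule linear_Rz[OF z])
  show ?thesis using Rz_left_inverse[OF z p] by (simp add: R.diff Rz_cact[OF z] algebra_simps)
qed

text \<open>The rule z R(z) a = a + R(z) T a, used twice for a in the range of \<Lambda>, gives (1 +
  z^2) R(z) \<Lambda> p = z \<Lambda> p + \<B> p + R(z) p. Multiplication by lam yields the first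
  identity. Multiplying that by z and using z^2 lam = 1 - lam yields the second.\<close>

lemma lam_Rz:
  assumes z: "z \<notin> closed_csector \<omega>" and n: "1 + z\<^sup>2 \<noteq> 0"
  shows "cact (lam z) (Rz z p) = Rz z (pmap \<Lambda> p) - cact (z * lam z) (pmap \<Lambda> p) - cact (lam z) (pmap \<B> p)"
    and "cact (z * lam z) (Rz z p) = Rz z (pmap \<B> p) - cact (z * lam z) (pmap \<B> p) + cact (lam z) (pmap \<Lambda> p)"
proof -
  interpret R: linear "Rz z" by (rule linear_Rz[OF z])
  let ?A = "pmap \<Lambda> p" and ?B = "pmap \<B> p"
  have zA: "cact z (Rz z ?A) = ?A + Rz z ?B"
    using cact_z_Rz[OF z pmap_D(1)] by (simp add: Tc_pmap_\<Lambda>)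
  have zB: "cact z (Rz z ?B) = ?B + Rz z p - Rz z ?A"
    using cact_z_Rz[OF z pmap_D(2)] by (simp add: Tc_pmap_\<B> R.diff)
  have "cact (1 + z\<^sup>2) (Rz z ?A) = Rz z ?A + cact z (cact z (Rz z ?A))"
    by (simp add: cact.add_left power2_eq_square)
  also have "\<dots> = cact z ?A + ?B + Rz z p"
    unfolding zA by (simp add: cact.add_right zB)
  finally have "cact (lam z * (1 + z\<^sup>2)) (Rz z ?A) = cact (lam z) (cact z ?A + ?B + Rz z p)"
    by (metis cact_cact)
  then show 1: "cact (lam z) (Rz z p) = Rz z ?A - cact (z * lam z) ?A - cact (lam z) ?B"
    using n by (simp add: lam_def cact.add_right mult.commute[of z] algebra_simps)
  have l: "z * (z * lam z) = 1 - lam z" using n by (simp add: lam_def field_simps power2_eq_square)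
  have "cact (z * lam z) (Rz z p) = cact z (cact (lam z) (Rz z p))" by simp
  also have "\<dots> = cact z (Rz z ?A) - cact (z * (z * lam z)) ?A - cact (z * lam z) ?B"
    unfolding 1 by (simp add: cact.diff_right)
  also have "\<dots> = Rz z ?B - cact (z * lam z) ?B + cact (lam z) ?A"
    unfolding zA l by (simp add: cact.diff_left)
  finally show "cact (z * lam z) (Rz z p) = Rz z ?B - cact (z * lam z) ?B + cact (lam z) ?A" .
qed

lemma Rz_bound:
  assumes \<phi>: "\<phi> \<in> {\<omega><..<pi/2}"
  obtains C where "0 \<le> C" "\<And>z p. z \<notin> csector \<phi> \<Longrightarrow> z \<noteq> 0 \<Longrightarrow> norm (Rz z p) \<le> C / cmod z * norm p"
proof -
  obtain C where C: "0 \<le> C" "\<And>z v. z \<notin> csector \<phi> \<Longrightarrow> z \<noteq> 0 \<Longrightarrow>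
       norm (Qi z v) \<le> C / (cmod z)\<^sup>2 * norm v \<and> norm (\<tau> (Qi z v)) \<le> C / cmod z * norm v"
    using Qi_bound[OF \<phi>] by blast
  \<comment> \<open>The constant is 8 + 2: the complex scalar costs a factor 4 on a pair of two
    components, and the two components involving T add 2.\<close>
  have "norm (Rz z p) \<le> 10 * C / cmod z * norm p" if z: "z \<notin> csector \<phi>" "z \<noteq> 0" for z p
  proof -
    have f: "norm (fst p) \<le> norm p" "norm (snd p) \<le> norm p"
      by (cases p, simp add: norm_fst_le norm_snd_le)+
    have q: "norm (Qi z v) \<le> C / (cmod z)\<^sup>2 * norm p" "norm (\<tau> (Qi z v)) \<le> C / cmod z * norm p"
      if "norm v \<le> norm p" for v
      using C(2)[OF z, of v] mult_left_mono[OF that, of "C / (cmod z)\<^sup>2"] mult_left_mono[OF that, of "C / cmod z"] C(1)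
      by (auto intro: order_trans)
    have "norm (Qi z (fst p), Qi z (snd p)) \<le> C / (cmod z)\<^sup>2 * norm p + C / (cmod z)\<^sup>2 * norm p"
      by (rule order_trans[OF norm_Pair_le add_mono[OF q(1)[OF f(1)] q(1)[OF f(2)]]])
    then have N: "norm (Qi z (fst p), Qi z (snd p)) \<le> 2 * (C / (cmod z)\<^sup>2 * norm p)" by simp
    have "4 * (cmod (cnj z) * norm (Qi z (fst p), Qi z (snd p))) \<le> 4 * (cmod (cnj z) * (2 * (C / (cmod z)\<^sup>2 * norm p)))"
      by (rule mult_left_mono[OF mult_left_mono[OF N]]) simp_all
    also have "\<dots> = 8 * C / cmod z * norm p"
      using z(2) by (simp add: power2_eq_square field_simps)
    finally have a: "norm (cact (cnj z) (Qi z (fst p), Qi z (snd p))) \<le> 8 * C / cmod z * norm p"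
      by (rule order_trans[OF norm_cact_le])
    have b: "norm (\<tau> (Qi z (fst p)), \<tau> (Qi z (snd p))) \<le> C / cmod z * norm p + C / cmod z * norm p"
      by (rule order_trans[OF norm_Pair_le add_mono[OF q(2)[OF f(1)] q(2)[OF f(2)]]])
    have "norm (Rz z p) \<le> 8 * C / cmod z * norm p + (C / cmod z * norm p + C / cmod z * norm p)"
      unfolding Rz_def by (rule order_trans[OF norm_triangle_ineq4 add_mono[OF a b]])
    also have "\<dots> = 10 * C / cmod z * norm p" by (simp add: field_simps)
    finally show ?thesis .
  qed
  then show ?thesis using that[of "10 * C"] C(1) by auto
qed

lemma outside_csector:
  assumes "\<phi> \<in> {\<omega><..<pi/2}" "z \<notin> closed_csector \<phi>"
  shows "z \<notin> csector \<phi>" "z \<noteq> 0" "z \<notin> closed_csector \<omega>"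
proof -
  show 1: "z \<notin> csector \<phi>" using assms csector_subset by blast
  show 2: "z \<noteq> 0" using assms by (auto simp: closed_csector_def)
  show "z \<notin> closed_csector \<omega>" using not_csector_imp_not_closed[OF \<omega>(1) _ _ 1 2] assms by auto
qed

lemma bounded_linear_Rz:
  assumes \<phi>: "\<phi> \<in> {\<omega><..<pi/2}" and z: "z \<notin> closed_csector \<phi>"
  shows "bounded_linear (Rz z)"
proof -
  obtain C where "\<And>z p. z \<notin> csector \<phi> \<Longrightarrow> z \<noteq> 0 \<Longrightarrow> norm (Rz z p) \<le> C / cmod z * norm p"
    using Rz_bound[OF \<phi>] by blast
  from this[OF outside_csector(1,2)[OF \<phi> z]] linear_Rz[OF outside_csector(3)[OF \<phi> z]] show ?thesis
    by (intro bounded_linear_intro[where K = "C / cmod z"]) (simp_all add: linear_add linear_scale mult.commute)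
qed

section \<open>Norm continuity and differentiability of the resolvent\<close>

definition RB :: "complex \<Rightarrow> ('w \<times> 'w) \<Rightarrow>\<^sub>L ('w \<times> 'w)" where
  "RB z = Blinfun (Rz z)"

lemma RB_apply: "\<phi> \<in> {\<omega><..<pi/2} \<Longrightarrow> z \<notin> closed_csector \<phi> \<Longrightarrow> blinfun_apply (RB z) = Rz z"
  unfolding RB_def by (rule bounded_linear_Blinfun_apply) (rule bounded_linear_Rz)

text \<open>The resolvent identity bounds the difference by |z - w| times factors that stay bounded
  near z. Continuity in operator norm, not only pointwise, is what the operator valued contour
  integral requires.\<close>

lemma continuous_on_RB:
  assumes \<phi>: "\<phi> \<in> {\<omega><..<pi/2}"
  shows "continuous_on (- closed_csector \<phi>) RB"
proof (rule continuous_at_imp_continuous_on, rule ballI)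
  fix z assume "z \<in> - closed_csector \<phi>"
  then have z: "z \<notin> closed_csector \<phi>" by simp
  note zo = outside_csector[OF \<phi> z]
  obtain C where C: "0 \<le> C" "\<And>z p. z \<notin> csector \<phi> \<Longrightarrow> z \<noteq> 0 \<Longrightarrow> norm (Rz z p) \<le> C / cmod z * norm p"
    using Rz_bound[OF \<phi>] by blast
  have op: "open (- closed_csector \<phi>)" by (simp add: open_Compl)
  have "\<forall>\<^sub>F w in at z. w \<in> - closed_csector \<phi>"
    by (rule topological_tendstoD[OF tendsto_ident_at op]) (use z in simp)
  then have ev: "\<forall>\<^sub>F w in at z. norm (RB w - RB z) \<le> 4 * (cmod (z - w) * (C / cmod w * (C / cmod z)))"
  proof eventually_elim
    fix w assume "w \<in> - closed_csector \<phi>"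
    then have w: "w \<notin> closed_csector \<phi>" by simp
    note wo = outside_csector[OF \<phi> w]
    show "norm (RB w - RB z) \<le> 4 * (cmod (z - w) * (C / cmod w * (C / cmod z)))"
    proof (rule norm_blinfun_bound)
      show "0 \<le> 4 * (cmod (z - w) * (C / cmod w * (C / cmod z)))" using C(1) by simp
      fix p
      have "norm (blinfun_apply (RB w - RB z) p) = norm (cact (z - w) (Rz w (Rz z p)))"
        by (simp add: blinfun.diff_left RB_apply[OF \<phi>] z w Rz_resolvent[OF wo(3) zo(3)])
      also have "\<dots> \<le> 4 * (cmod (z - w) * norm (Rz w (Rz z p)))" by (rule norm_cact_le)
      also have "\<dots> \<le> 4 * (cmod (z - w) * (C / cmod w * (C / cmod z * norm p)))"
        using C(1) by (intro mult_left_mono order_trans[OF C(2)[OF wo(1,2)]] C(2)[OF zo(1,2)]) auto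
      finally show "norm (blinfun_apply (RB w - RB z) p) \<le> 4 * (cmod (z - w) * (C / cmod w * (C / cmod z))) * norm p"
        by (simp add: mult_ac)
    qed
  qed
  have "((\<lambda>w. 4 * (cmod (z - w) * (C / cmod w * (C / cmod z)))) \<longlongrightarrow> 4 * (cmod (z - z) * (C / cmod z * (C / cmod z)))) (at z)"
    using zo(2) by (intro tendsto_intros) auto
  then have "((\<lambda>w. 4 * (cmod (z - w) * (C / cmod w * (C / cmod z)))) \<longlongrightarrow> 0) (at z)" by simp
  from Lim_null_comparison[OF ev this] show "isCont RB z"
    unfolding isCont_def by (rule LIM_zero_cancel)
qed

text \<open>The derivative is -R(z)^2. By the resolvent identity the remainder is (z - w) times
  (R(w) - R(z)) R(z) p, and norm continuity makes it o(|w - z|).\<close>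

lemma Rz_has_derivative:
  assumes \<phi>: "\<phi> \<in> {\<omega><..<pi/2}" and z: "z \<notin> closed_csector \<phi>"
  shows "((\<lambda>z. Rz z p) has_derivative (\<lambda>h. cact h (- Rz z (Rz z p)))) (at z)"
proof -
  note zo = outside_csector[OF \<phi> z]
  have op: "open (- closed_csector \<phi>)" by (simp add: open_Compl)
  then obtain e where e: "0 < e" "\<And>w. dist w z < e \<Longrightarrow> w \<notin> closed_csector \<phi>"
    using z unfolding open_dist by force
  have "isCont RB z" using continuous_on_RB[OF \<phi>] op z by (simp add: continuous_on_eq_continuous_at)
  then have "((\<lambda>w. 4 * (norm (RB w - RB z) * norm (Rz z p))) \<longlongrightarrow> 4 * (norm (RB z - RB z) * norm (Rz z p))) (at z)"
    unfolding isCont_def by (intro tendsto_intros)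
  then have lim: "((\<lambda>w. 4 * (norm (RB w - RB z) * norm (Rz z p))) \<longlongrightarrow> 0) (at z)" by simp
  show ?thesis
  proof (rule has_derivativeI_sandwich[OF e(1) cact.bounded_linear_left _ lim])
    fix w assume "w \<noteq> z" "dist w z < e"
    then have w: "w \<notin> closed_csector \<phi>" using e by simp
    note wo = outside_csector[OF \<phi> w]
    have "Rz w p - Rz z p - cact (w - z) (- Rz z (Rz z p)) = cact (z - w) (Rz w (Rz z p) - Rz z (Rz z p))"
    proof -
      have "cact (w - z) (- Rz z (Rz z p)) = cact (z - w) (Rz z (Rz z p))"
        by (simp add: cact.minus_right cact.diff_left)
      then show ?thesis by (simp only: Rz_resolvent[OF wo(3) zo(3), of p] cact.diff_right)
    qed
    also have "\<dots> = cact (z - w) (blinfun_apply (RB w - RB z) (Rz z p))"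
      by (simp add: blinfun.diff_left RB_apply[OF \<phi>] z w)
    also have "norm \<dots> \<le> 4 * (cmod (z - w) * (norm (RB w - RB z) * norm (Rz z p)))"
      by (intro order_trans[OF norm_cact_le] mult_left_mono norm_blinfun) auto
    finally show "norm (Rz w p - Rz z p - cact (w - z) (- Rz z (Rz z p))) / norm (w - z) \<le> 4 * (norm (RB w - RB z) * norm (Rz z p))"
      using \<open>w \<noteq> z\<close> by (simp add: divide_le_eq norm_minus_commute[of w z] mult_ac)
  qed
qed

end

section \<open>The calculus as an integral over two rays\<close>

lemma cmod_add_i_bounds:
  assumes "0 \<le> Im z"
  shows "1 \<le> cmod (z + \<i>)" "cmod z \<le> cmod (z + \<i>)"
proof -
  show "1 \<le> cmod (z + \<i>)" using abs_Im_le_cmod[of "z + \<i>"] assms by simp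
  have "(cmod z)\<^sup>2 \<le> (cmod (z + \<i>))\<^sup>2"
    using assms by (simp add: cmod_power2 power_mono)
  then show "cmod z \<le> cmod (z + \<i>)" by (rule power2_le_imp_le) simp
qed

context sector_op
begin

definition ray_integral :: "(complex \<Rightarrow> complex) \<Rightarrow> real \<Rightarrow> 'w \<times> 'w \<Rightarrow> 'w \<times> 'w" where
  "ray_integral F \<psi> p = integral {0<..} (\<lambda>t. cact (cis \<psi> * F (rcis t \<psi>)) (Rz (rcis t \<psi>) p))"

text \<open>The real part of i times a complexified vector is minus its second component. The angle
  stays a parameter, to be instantiated by the one selected in the definition of the
  calculus.\<close>

definition \<Phi> :: "real \<Rightarrow> (complex \<Rightarrow> complex) \<Rightarrow> 'w \<Rightarrow> 'w" where
  "\<Phi> \<phi> F v = - (1 / pi) *\<^sub>R snd (ray_integral F \<phi> (v, 0) - ray_integral F (pi - \<phi>) (v, 0))"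

text \<open>The slightly smaller angle puts the rays of angle \<phi> into the open complement of a
  closed sector, where the resolvent is continuous and satisfies a uniform bound.\<close>

lemma mid_angle:
  assumes "\<phi> \<in> {\<omega><..<pi/2}"
  obtains \<alpha> where "\<alpha> \<in> {\<omega><..<pi/2}" "\<alpha> < \<phi>"
proof -
  have "(\<omega> + \<phi>) / 2 \<in> {\<omega><..<pi/2}" "(\<omega> + \<phi>) / 2 < \<phi>" using assms by (auto simp: field_simps)
  then show ?thesis using that by blast
qed

lemma mid_angle_rays:
  assumes "\<alpha> \<in> {\<omega><..<pi/2}" "\<alpha> < \<phi>" "\<phi> < pi/2" "0 < t" "\<psi> \<in> {\<phi>..pi - \<phi>}"
  shows "rcis t \<psi> \<notin> closed_csector \<alpha>" "0 < Im (rcis t \<psi>)"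
  using rcis_not_closed_csector[of \<alpha> \<phi> t \<psi>] \<omega> assms by auto

lemma continuous_on_ray_Rz:
  assumes \<phi>: "\<phi> \<in> {\<omega><..<pi/2}" and \<psi>: "\<psi> \<in> {\<phi>..pi - \<phi>}"
  shows "continuous_on {0<..} (\<lambda>t. Rz (rcis t \<psi>) p)"
proof -
  obtain \<alpha> where \<alpha>: "\<alpha> \<in> {\<omega><..<pi/2}" "\<alpha> < \<phi>" using mid_angle[OF \<phi>] .
  have z: "rcis t \<psi> \<notin> closed_csector \<alpha>" if "0 < t" for t
    using mid_angle_rays[OF \<alpha> _ that \<psi>] \<phi> by auto
  have "continuous_on {0<..} (\<lambda>t. RB (rcis t \<psi>))"
    by (rule continuous_on_compose2[OF continuous_on_RB[OF \<alpha>(1)]])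
       (auto simp: rcis_def z[unfolded rcis_def] intro!: continuous_intros)
  then have "continuous_on {0<..} (\<lambda>t. blinfun_apply (RB (rcis t \<psi>)) p)"
    by (intro continuous_intros)
  then show ?thesis
    by (rule continuous_on_cong[THEN iffD1, rotated 2]) (simp_all add: RB_apply[OF \<alpha>(1) z])
qed

lemma ray_Rz_bound:
  assumes \<phi>: "\<phi> \<in> {\<omega><..<pi/2}"
  obtains C where "0 \<le> C" "\<And>t \<psi> p. 0 < t \<Longrightarrow> \<psi> \<in> {\<phi>..pi - \<phi>} \<Longrightarrow> norm (Rz (rcis t \<psi>) p) \<le> C / t * norm p"
proof -
  obtain \<alpha> where \<alpha>: "\<alpha> \<in> {\<omega><..<pi/2}" "\<alpha> < \<phi>" using mid_angle[OF \<phi>] .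
  obtain C where C: "0 \<le> C" "\<And>z p. z \<notin> csector \<alpha> \<Longrightarrow> z \<noteq> 0 \<Longrightarrow> norm (Rz z p) \<le> C / cmod z * norm p"
    using Rz_bound[OF \<alpha>(1)] by blast
  have "norm (Rz (rcis t \<psi>) p) \<le> C / t * norm p" if "0 < t" "\<psi> \<in> {\<phi>..pi - \<phi>}" for t \<psi> p
    using C(2)[of "rcis t \<psi>" p] outside_csector[OF \<alpha>(1) mid_angle_rays(1)[OF \<alpha> _ that]] \<phi> that by simp
  then show ?thesis using that C(1) by blast
qed

lemma ray_angle_mem:
  assumes "\<phi> \<in> {\<omega><..<\<theta>}" "\<theta> < pi/2" "\<psi> \<in> {\<phi>, pi - \<phi>}"
  shows "\<phi> \<in> {\<omega><..<pi/2}" "\<psi> \<in> {\<phi>..pi - \<phi>}" "\<psi> \<in> sector_angles \<theta>" "0 < \<theta>" "\<phi> \<in> {0<..<\<theta>}"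
  using assms \<omega> by (auto simp: sector_angles_def)

lemma ray_integrable:
  assumes \<theta>: "\<theta> < pi/2" and \<phi>: "\<phi> \<in> {\<omega><..<\<theta>}" and \<psi>: "\<psi> \<in> {\<phi>, pi - \<phi>}" and F: "holo_N0 \<theta> F"
  shows "(\<lambda>t. cact (cis \<psi> * F (rcis t \<psi>)) (Rz (rcis t \<psi>) p)) integrable_on {0<..}"
proof -
  note r = ray_angle_mem[OF \<phi> \<theta> \<psi>]
  obtain C where C: "0 \<le> C" "\<And>t \<psi> p. 0 < t \<Longrightarrow> \<psi> \<in> {\<phi>..pi - \<phi>} \<Longrightarrow> norm (Rz (rcis t \<psi>) p) \<le> C / t * norm p"
    using ray_Rz_bound[OF r(1)] by blast
  show ?thesis
  proof (rule dominated_integrable[where g = "\<lambda>t. 4 * C * norm p * (cmod (F (rcis t \<psi>)) / t)"])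
    have "continuous_on (csector \<theta>) F"
      using F by (intro holomorphic_on_imp_continuous_on) (simp add: holo_N0_def holo_intrinsic_def)
    then show "continuous_on {0<..} (\<lambda>t. cact (cis \<psi> * F (rcis t \<psi>)) (Rz (rcis t \<psi>) p))"
      by (intro cact.continuous_on continuous_intros continuous_on_ray_Rz[OF r(1,2)]
        continuous_on_rcis_ray[OF r(4) \<theta> _ r(3)])
    show "(\<lambda>t. 4 * C * norm p * (cmod (F (rcis t \<psi>)) / t)) integrable_on {0<..}"
      using F r(3) by (intro integrable_on_mult_right set_borel_integral_eq_integral(1)) (simp add: holo_N0_def)
    fix t :: real assume t: "0 < t"
    have "norm (cact (cis \<psi> * F (rcis t \<psi>)) (Rz (rcis t \<psi>) p)) \<le> 4 * (cmod (cis \<psi> * F (rcis t \<psi>)) * norm (Rz (rcis t \<psi>) p))"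
      by (rule norm_cact_le)
    also have "\<dots> \<le> 4 * (cmod (cis \<psi> * F (rcis t \<psi>)) * (C / t * norm p))"
      using C(2)[OF t r(2)] by (intro mult_left_mono) auto
    finally show "norm (cact (cis \<psi> * F (rcis t \<psi>)) (Rz (rcis t \<psi>) p)) \<le> 4 * C * norm p * (cmod (F (rcis t \<psi>)) / t)"
      by (simp add: norm_mult mult_ac)
  qed
qed

lemma ray_not_closed:
  assumes \<theta>: "\<theta> < pi/2" and \<phi>: "\<phi> \<in> {\<omega><..<\<theta>}" and \<psi>: "\<psi> \<in> {\<phi>, pi - \<phi>}" and t: "0 < t"
  shows "rcis t \<psi> \<notin> closed_csector \<omega>"
  using rcis_not_closed_csector(1)[OF \<omega>(1) _ _ t ray_angle_mem(2)[OF \<phi> \<theta> \<psi>]] \<phi> \<theta> by auto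

lemma ray_integral_cong:
  assumes \<theta>: "\<theta> < pi/2" and \<phi>: "\<phi> \<in> {\<omega><..<\<theta>}" and \<psi>: "\<psi> \<in> {\<phi>, pi - \<phi>}"
    and "\<And>z. z \<in> csector \<theta> \<Longrightarrow> F z = G z"
  shows "ray_integral F \<psi> p = ray_integral G \<psi> p"
  unfolding ray_integral_def
  using assms(4) rcis_in_csector[OF ray_angle_mem(4)[OF \<phi> \<theta> \<psi>] \<theta> _ ray_angle_mem(3)[OF \<phi> \<theta> \<psi>]]
  by (intro Henstock_Kurzweil_Integration.integral_cong) auto

lemma \<Phi>_cong:
  assumes \<theta>: "\<theta> < pi/2" and \<phi>: "\<phi> \<in> {\<omega><..<\<theta>}" and "\<And>z. z \<in> csector \<theta> \<Longrightarrow> F z = G z"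
  shows "\<Phi> \<phi> F v = \<Phi> \<phi> G v"
  unfolding \<Phi>_def using ray_integral_cong[OF \<theta> \<phi> _ assms(3)] by simp

lemma \<Phi>_add:
  assumes \<theta>: "\<theta> < pi/2" and \<phi>: "\<phi> \<in> {\<omega><..<\<theta>}" and F: "holo_N0 \<theta> F" and G: "holo_N0 \<theta> G"
  shows "\<Phi> \<phi> (\<lambda>z. F z + G z) v = \<Phi> \<phi> F v + \<Phi> \<phi> G v"
proof -
  have "ray_integral (\<lambda>z. F z + G z) \<psi> p = ray_integral F \<psi> p + ray_integral G \<psi> p" if "\<psi> \<in> {\<phi>, pi - \<phi>}" for \<psi> p
    unfolding ray_integral_def distrib_left cact.add_left
    by (intro Henstock_Kurzweil_Integration.integral_add ray_integrable[OF \<theta> \<phi> that] F G)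
  then show ?thesis by (simp add: \<Phi>_def algebra_simps)
qed

lemma \<Phi>_scale:
  assumes \<theta>: "\<theta> < pi/2" and \<phi>: "\<phi> \<in> {\<omega><..<\<theta>}" and F: "holo_N0 \<theta> F"
  shows "\<Phi> \<phi> (\<lambda>z. of_real r * F z) v = r *\<^sub>R \<Phi> \<phi> F v"
proof -
  have "ray_integral (\<lambda>z. of_real r * F z) \<psi> p = r *\<^sub>R ray_integral F \<psi> p" for \<psi> p
  proof -
    have "ray_integral (\<lambda>z. of_real r * F z) \<psi> p = integral {0<..} (\<lambda>t. r *\<^sub>R cact (cis \<psi> * F (rcis t \<psi>)) (Rz (rcis t \<psi>) p))"
      unfolding ray_integral_def by (simp add: cact.scaleR_left[symmetric] scaleR_conv_of_real mult.left_commute)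
    then show ?thesis by (simp add: ray_integral_def)
  qed
  then show ?thesis by (simp add: \<Phi>_def algebra_simps)
qed

lemma bounded_linear_\<Lambda>: "bounded_linear \<Lambda>" and bounded_linear_\<B>: "bounded_linear \<B>"
proof -
  have \<phi>: "(\<omega> + pi/2) / 2 \<in> {\<omega><..<pi/2}" using \<omega> by (auto simp: field_simps)
  obtain C where C: "\<And>z v. z \<notin> csector ((\<omega> + pi/2) / 2) \<Longrightarrow> z \<noteq> 0 \<Longrightarrow>
       norm (Qi z v) \<le> C / (cmod z)\<^sup>2 * norm v \<and> norm (\<tau> (Qi z v)) \<le> C / cmod z * norm v"
    using Qi_bound[OF \<phi>] by blast
  have b: "norm (\<Lambda> v) \<le> norm v * C" "norm (\<B> v) \<le> norm v * C" for v
    using C[of \<i> v] by (simp_all add: csector_def \<Lambda>_def \<B>_def mult.commute)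
  show "bounded_linear \<Lambda>"
    by (rule bounded_linear_intro[where K = C]) (simp_all add: b linear_add[OF linear_\<Lambda>] linear_scale[OF linear_\<Lambda>])
  show "bounded_linear \<B>"
    by (rule bounded_linear_intro[where K = C]) (simp_all add: b linear_add[OF linear_\<B>] linear_scale[OF linear_\<B>])
qed

lemma bounded_linear_pmap: "bounded_linear f \<Longrightarrow> bounded_linear (pmap f)"
  unfolding pmap_def
  by (rule bounded_linear_Pair[OF bounded_linear_compose[OF _ bounded_linear_fst] bounded_linear_compose[OF _ bounded_linear_snd]])

text \<open>A bounded operator on V that commutes with the resolvent is pulled out of the integral.
  It acts on both components, so it also commutes with complex scalars.\<close>

lemma \<Phi>_commute:
  assumes \<theta>: "\<theta> < pi/2" and \<phi>: "\<phi> \<in> {\<omega><..<\<theta>}" and F: "holo_N0 \<theta> F"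
    and f: "bounded_linear f" "\<And>z p. z \<notin> closed_csector \<omega> \<Longrightarrow> Rz z (pmap f p) = pmap f (Rz z p)"
  shows "\<Phi> \<phi> F (f v) = f (\<Phi> \<phi> F v)"
proof -
  interpret f: bounded_linear f by (rule f(1))
  have *: "ray_integral F \<psi> (pmap f p) = pmap f (ray_integral F \<psi> p)" if \<psi>: "\<psi> \<in> {\<phi>, pi - \<phi>}" for \<psi> p
  proof -
    have "ray_integral F \<psi> (pmap f p) = integral {0<..} (pmap f \<circ> (\<lambda>t. cact (cis \<psi> * F (rcis t \<psi>)) (Rz (rcis t \<psi>) p)))"
      unfolding ray_integral_def
      by (intro Henstock_Kurzweil_Integration.integral_cong)
         (simp add: f(2) ray_not_closed[OF \<theta> \<phi> \<psi>] cact_pmap[OF f.linear_axioms])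
    then show ?thesis
      unfolding ray_integral_def by (simp add: integral_linear[OF ray_integrable[OF \<theta> \<phi> \<psi> F] bounded_linear_pmap[OF f(1)]])
  qed
  have "(f v, 0) = pmap f (v, 0)" by (simp add: pmap_def)
  then show ?thesis
    by (simp add: \<Phi>_def *) (simp add: pmap_def f.diff f.scaleR f.neg)
qed

lemma \<Phi>_\<Lambda>:
  assumes "\<theta> < pi/2" "\<phi> \<in> {\<omega><..<\<theta>}" "holo_N0 \<theta> F"
  shows "\<Phi> \<phi> F (\<Lambda> v) = \<Lambda> (\<Phi> \<phi> F v)" "\<Phi> \<phi> F (\<B> v) = \<B> (\<Phi> \<phi> F v)"
  by (intro \<Phi>_commute[OF assms] bounded_linear_\<Lambda> bounded_linear_\<B> Rz_pmap; assumption)+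

lemma linear_\<Phi>:
  assumes \<theta>: "\<theta> < pi/2" and \<phi>: "\<phi> \<in> {\<omega><..<\<theta>}" and F: "holo_N0 \<theta> F"
  shows "linear (\<Phi> \<phi> F)"
proof (rule linearI)
  have "ray_integral F \<psi> (p + q) = ray_integral F \<psi> p + ray_integral F \<psi> q" if \<psi>: "\<psi> \<in> {\<phi>, pi - \<phi>}" for \<psi> p q
  proof -
    have "ray_integral F \<psi> (p + q) = integral {0<..} (\<lambda>t. cact (cis \<psi> * F (rcis t \<psi>)) (Rz (rcis t \<psi>) p) + cact (cis \<psi> * F (rcis t \<psi>)) (Rz (rcis t \<psi>) q))"
      unfolding ray_integral_def
      by (intro Henstock_Kurzweil_Integration.integral_cong)
         (simp add: linear_add[OF linear_Rz] ray_not_closed[OF \<theta> \<phi> \<psi>] cact.add_right)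
    then show ?thesis unfolding ray_integral_def
      by (simp add: Henstock_Kurzweil_Integration.integral_add ray_integrable[OF \<theta> \<phi> \<psi> F])
  qed
  from this[of _ "(_, 0)" "(_, 0)"] show "\<Phi> \<phi> F (v + w) = \<Phi> \<phi> F v + \<Phi> \<phi> F w" for v w
    by (simp add: \<Phi>_def algebra_simps)
  have "ray_integral F \<psi> (c *\<^sub>R p) = c *\<^sub>R ray_integral F \<psi> p" if \<psi>: "\<psi> \<in> {\<phi>, pi - \<phi>}" for \<psi> p c
  proof -
    have "ray_integral F \<psi> (c *\<^sub>R p) = integral {0<..} (\<lambda>t. c *\<^sub>R cact (cis \<psi> * F (rcis t \<psi>)) (Rz (rcis t \<psi>) p))"
      unfolding ray_integral_def
      by (intro Henstock_Kurzweil_Integration.integral_cong)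
         (simp add: linear_scale[OF linear_Rz] ray_not_closed[OF \<theta> \<phi> \<psi>] cact.scaleR_right)
    then show ?thesis unfolding ray_integral_def by simp
  qed
  from this[of _ _ "(_, 0)"] show "\<Phi> \<phi> F (c *\<^sub>R v) = c *\<^sub>R \<Phi> \<phi> F v" for c v
    by (simp add: \<Phi>_def algebra_simps)
qed

lemma scalar_ray_integral_real:
  assumes \<theta>: "\<theta> < pi/2" and \<phi>: "\<phi> \<in> {\<omega><..<\<theta>}" and \<psi>: "\<psi> \<in> {\<phi>, pi - \<phi>}" and F: "holo_N0 \<theta> F"
    and G: "(G = lam) \<or> (G = (\<lambda>z. z * lam z))"
  shows "(\<lambda>t. cis \<psi> * (G (rcis t \<psi>) * F (rcis t \<psi>))) integrable_on {0<..}"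
    and "Im (integral {0<..} (\<lambda>t. cis \<psi> * (G (rcis t \<psi>) * F (rcis t \<psi>)))) = 0"
proof -
  note r = ray_angle_mem[OF \<phi> \<theta> \<psi>]
  have hG: "holo_intrinsic \<theta> G"
    using G by (auto intro: holo_intrinsic_lam holo_intrinsic_mult holo_intrinsic_id)
  have b: "cmod (G z) \<le> lam_bound \<theta>" "cmod (G z) * cmod z \<le> lam_bound \<theta>" if "z \<in> csector \<theta>" for z
    using G lam_bounds[OF csector_mem_closed[OF that]] by (auto simp: norm_mult mult_ac)
  have s: "\<exists>\<epsilon>\<in>{1, -1}. \<forall>z. G (- z) = \<epsilon> * G z" using G by (auto simp: lam_uminus)
  then obtain \<epsilon> where \<epsilon>: "\<epsilon> \<in> {1, -1}" "\<And>z. G (- z) = \<epsilon> * G z" by blast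
  show "Im (integral {0<..} (\<lambda>t. cis \<psi> * (G (rcis t \<psi>) * F (rcis t \<psi>)))) = 0"
    by (rule ray_integral_real[OF r(4) \<theta> F r(5) \<psi> hG b \<epsilon>(2,1)])
  have cG: "continuous_on (csector \<theta>) G" and cF: "continuous_on (csector \<theta>) F"
    using hG F by (auto intro!: holomorphic_on_imp_continuous_on simp: holo_N0_def holo_intrinsic_def)
  show "(\<lambda>t. cis \<psi> * (G (rcis t \<psi>) * F (rcis t \<psi>))) integrable_on {0<..}"
  proof (rule dominated_integrable[OF _ _ holo_N0_ray_integrable[OF r(4) \<theta> F r(3) cG b(2)]])
    show "continuous_on {0<..} (\<lambda>t. cis \<psi> * (G (rcis t \<psi>) * F (rcis t \<psi>)))"
      by (intro continuous_intros continuous_on_rcis_ray[OF r(4) \<theta> _ r(3)] cG cF)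
  qed (auto simp: norm_mult)
qed

lemma ray_one_plus_square:
  assumes \<theta>: "\<theta> < pi/2" and \<phi>: "\<phi> \<in> {\<omega><..<\<theta>}" and \<psi>: "\<psi> \<in> {\<phi>, pi - \<phi>}" and t: "0 < t"
  shows "1 + (rcis t \<psi>)\<^sup>2 \<noteq> 0"
  using ray_angle_mem[OF \<phi> \<theta> \<psi>] rcis_in_csector[OF _ \<theta> t] csector_mem_closed one_plus_square_nonzero by blast

text \<open>By \<open>lam_Rz\<close> the factor \<open>lam\<close> passes to the operator up to terms with scalar coefficients. Their ray
  integrals are real, hence invisible in the second component.\<close>

lemma \<Phi>_lam:
  assumes \<theta>: "\<theta> < pi/2" and \<phi>: "\<phi> \<in> {\<omega><..<\<theta>}" and F: "holo_N0 \<theta> F"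
  shows "\<Phi> \<phi> (\<lambda>z. lam z * F z) v = \<Lambda> (\<Phi> \<phi> F v)"
    and "\<Phi> \<phi> (\<lambda>z. (z * lam z) * F z) v = \<B> (\<Phi> \<phi> F v)"
proof -
  have *: "\<exists>a b c d :: real. ray_integral (\<lambda>z. lam z * F z) \<psi> p = ray_integral F \<psi> (pmap \<Lambda> p) - a *\<^sub>R pmap \<Lambda> p - b *\<^sub>R pmap \<B> p
    \<and> ray_integral (\<lambda>z. (z * lam z) * F z) \<psi> p = ray_integral F \<psi> (pmap \<B> p) - c *\<^sub>R pmap \<B> p + d *\<^sub>R pmap \<Lambda> p"
    if \<psi>: "\<psi> \<in> {\<phi>, pi - \<phi>}" for \<psi> p
  proof -
    let ?f = "\<lambda>p t. cact (cis \<psi> * F (rcis t \<psi>)) (Rz (rcis t \<psi>) p)"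
    let ?g = "\<lambda>G t. cis \<psi> * (G (rcis t \<psi>) * F (rcis t \<psi>))"
    let ?zl = "\<lambda>z. z * lam z"
    have fi: "?f p integrable_on {0<..}" for p by (rule ray_integrable[OF \<theta> \<phi> \<psi> F])
    have gi: "?g G integrable_on {0<..}" "Im (integral {0<..} (?g G)) = 0" if "G = lam \<or> G = ?zl" for G
      using scalar_ray_integral_real[OF \<theta> \<phi> \<psi> F that] by auto
    have gq: "(\<lambda>t. cact (?g G t) q) integrable_on {0<..}"
      "integral {0<..} (\<lambda>t. cact (?g G t) q) = Re (integral {0<..} (?g G)) *\<^sub>R q" if "G = lam \<or> G = ?zl" for G and q :: "'w \<times> 'w"
    proof -
      show "(\<lambda>t. cact (?g G t) q) integrable_on {0<..}"
        using integrable_linear[OF gi(1)[OF that] cact.bounded_linear_left] by (simp add: o_def)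
      have "integral {0<..} (\<lambda>t. cact (?g G t) q) = cact (integral {0<..} (?g G)) q"
        using integral_linear[OF gi(1)[OF that] cact.bounded_linear_left] by (simp add: o_def)
      also have "integral {0<..} (?g G) = of_real (Re (integral {0<..} (?g G)))"
        using gi(2)[OF that] by (simp add: complex_eq_iff)
      finally show "integral {0<..} (\<lambda>t. cact (?g G t) q) = Re (integral {0<..} (?g G)) *\<^sub>R q"
        by (simp only: cact_of_real)
    qed
    have "ray_integral (\<lambda>z. lam z * F z) \<psi> p
        = integral {0<..} (\<lambda>t. ?f (pmap \<Lambda> p) t - cact (?g ?zl t) (pmap \<Lambda> p) - cact (?g lam t) (pmap \<B> p))"
      unfolding ray_integral_def
    proof (rule Henstock_Kurzweil_Integration.integral_cong)
      fix t :: real assume "t \<in> {0<..}"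
      then have t: "0 < t" by simp
      let ?z = "rcis t \<psi>"
      have "cact (cis \<psi> * (lam ?z * F ?z)) (Rz ?z p) = cact (cis \<psi> * F ?z) (cact (lam ?z) (Rz ?z p))"
        by (simp add: mult_ac)
      also have "\<dots> = ?f (pmap \<Lambda> p) t - cact (?g ?zl t) (pmap \<Lambda> p) - cact (?g lam t) (pmap \<B> p)"
        unfolding lam_Rz(1)[OF ray_not_closed[OF \<theta> \<phi> \<psi> t] ray_one_plus_square[OF \<theta> \<phi> \<psi> t]]
        by (simp only: cact.diff_right cact_cact) (simp only: mult_ac)
      finally show "cact (cis \<psi> * (lam ?z * F ?z)) (Rz ?z p) = ?f (pmap \<Lambda> p) t - cact (?g ?zl t) (pmap \<Lambda> p) - cact (?g lam t) (pmap \<B> p)" .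
    qed
    also have "\<dots> = ray_integral F \<psi> (pmap \<Lambda> p) - Re (integral {0<..} (?g ?zl)) *\<^sub>R pmap \<Lambda> p - Re (integral {0<..} (?g lam)) *\<^sub>R pmap \<B> p"
      unfolding ray_integral_def gq(2)[of lam "pmap \<B> p", OF disjI1[OF refl], symmetric] gq(2)[of ?zl "pmap \<Lambda> p", OF disjI2[OF refl], symmetric]
      by (subst Henstock_Kurzweil_Integration.integral_diff,
          intro integrable_diff fi gq(1) disjI2 refl, intro gq(1) disjI1 refl,
          subst Henstock_Kurzweil_Integration.integral_diff, rule fi, intro gq(1) disjI2 refl) (rule refl)
    finally have 1: "ray_integral (\<lambda>z. lam z * F z) \<psi> p = ray_integral F \<psi> (pmap \<Lambda> p)
        - Re (integral {0<..} (?g ?zl)) *\<^sub>R pmap \<Lambda> p - Re (integral {0<..} (?g lam)) *\<^sub>R pmap \<B> p" .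
    have "ray_integral (\<lambda>z. (z * lam z) * F z) \<psi> p
        = integral {0<..} (\<lambda>t. ?f (pmap \<B> p) t - cact (?g ?zl t) (pmap \<B> p) + cact (?g lam t) (pmap \<Lambda> p))"
      unfolding ray_integral_def
    proof (rule Henstock_Kurzweil_Integration.integral_cong)
      fix t :: real assume "t \<in> {0<..}"
      then have t: "0 < t" by simp
      let ?z = "rcis t \<psi>"
      have "cact (cis \<psi> * (?zl ?z * F ?z)) (Rz ?z p) = cact (cis \<psi> * F ?z) (cact (?zl ?z) (Rz ?z p))"
        by (simp add: mult_ac)
      also have "\<dots> = ?f (pmap \<B> p) t - cact (?g ?zl t) (pmap \<B> p) + cact (?g lam t) (pmap \<Lambda> p)"
        unfolding lam_Rz(2)[OF ray_not_closed[OF \<theta> \<phi> \<psi> t] ray_one_plus_square[OF \<theta> \<phi> \<psi> t]]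
        by (simp only: cact.diff_right cact.add_right cact_cact) (simp only: mult_ac)
      finally show "cact (cis \<psi> * (?zl ?z * F ?z)) (Rz ?z p) = ?f (pmap \<B> p) t - cact (?g ?zl t) (pmap \<B> p) + cact (?g lam t) (pmap \<Lambda> p)" .
    qed
    also have "\<dots> = ray_integral F \<psi> (pmap \<B> p) - Re (integral {0<..} (?g ?zl)) *\<^sub>R pmap \<B> p + Re (integral {0<..} (?g lam)) *\<^sub>R pmap \<Lambda> p"
      unfolding ray_integral_def gq(2)[of lam "pmap \<Lambda> p", OF disjI1[OF refl], symmetric] gq(2)[of ?zl "pmap \<B> p", OF disjI2[OF refl], symmetric]
      by (subst Henstock_Kurzweil_Integration.integral_add,
          intro integrable_diff fi gq(1) disjI2 refl, intro gq(1) disjI1 refl,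
          subst Henstock_Kurzweil_Integration.integral_diff, rule fi, intro gq(1) disjI2 refl) (rule refl)
    finally show ?thesis using 1 by blast
  qed
  obtain a b c d a' b' c' d' :: real where e:
    "ray_integral (\<lambda>z. lam z * F z) \<phi> (v, 0) = ray_integral F \<phi> (pmap \<Lambda> (v, 0)) - a *\<^sub>R pmap \<Lambda> (v, 0) - b *\<^sub>R pmap \<B> (v, 0)"
    "ray_integral (\<lambda>z. (z * lam z) * F z) \<phi> (v, 0) = ray_integral F \<phi> (pmap \<B> (v, 0)) - c *\<^sub>R pmap \<B> (v, 0) + d *\<^sub>R pmap \<Lambda> (v, 0)"
    "ray_integral (\<lambda>z. lam z * F z) (pi - \<phi>) (v, 0) = ray_integral F (pi - \<phi>) (pmap \<Lambda> (v, 0)) - a' *\<^sub>R pmap \<Lambda> (v, 0) - b' *\<^sub>R pmap \<B> (v, 0)"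
    "ray_integral (\<lambda>z. (z * lam z) * F z) (pi - \<phi>) (v, 0) = ray_integral F (pi - \<phi>) (pmap \<B> (v, 0)) - c' *\<^sub>R pmap \<B> (v, 0) + d' *\<^sub>R pmap \<Lambda> (v, 0)"
    using *[of \<phi> "(v, 0)"] *[of "pi - \<phi>" "(v, 0)"] by blast
  \<comment> \<open>The correction terms are real multiples of vectors whose second component is
    0.\<close>
  have p: "pmap \<Lambda> (v, 0) = (\<Lambda> v, 0)" "pmap \<B> (v, 0) = (\<B> v, 0)"
    using linear_0[OF linear_\<Lambda>] linear_0[OF linear_\<B>] by (simp_all add: pmap_def)
  have "\<Phi> \<phi> (\<lambda>z. lam z * F z) v = \<Phi> \<phi> F (\<Lambda> v)" "\<Phi> \<phi> (\<lambda>z. (z * lam z) * F z) v = \<Phi> \<phi> F (\<B> v)"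
    unfolding \<Phi>_def e p by simp_all
  then show "\<Phi> \<phi> (\<lambda>z. lam z * F z) v = \<Lambda> (\<Phi> \<phi> F v)" "\<Phi> \<phi> (\<lambda>z. (z * lam z) * F z) v = \<B> (\<Phi> \<phi> F v)"
    using \<Phi>_\<Lambda>[OF assms] by simp_all
qed

text \<open>R(z) \<B> p behaves like \<B> p / z at infinity, and the subtracted term cancels this
  leading part. Its pole -i lies outside the upper half plane, so the rotation from \<phi> to pi -
  \<phi> through angles in which z - T is invertible meets no singularity. With q = p - \<Lambda> p
  = T \<B> p, the product z H(z) equals R(z) q + i/(z + i) \<B> p, which is O(1/r).\<close>

lemma ray_shift_invariance:
  assumes \<theta>: "\<theta> < pi/2" and \<phi>: "\<phi> \<in> {\<omega><..<\<theta>}"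
  defines "H \<equiv> \<lambda>p z. Rz z (pmap \<B> p) - cact (1 / (z + \<i>)) (pmap \<B> p)"
  shows "integral {0<..} (\<lambda>t. cact (cis \<phi>) (H p (rcis t \<phi>))) = integral {0<..} (\<lambda>t. cact (cis (pi - \<phi>)) (H p (rcis t (pi - \<phi>))))"
proof -
  let ?A = "pmap \<Lambda> p" and ?B = "pmap \<B> p"
  let ?q = "p - ?A"
  have \<phi>': "\<phi> \<in> {\<omega><..<pi/2}" using \<theta> \<phi> by auto
  obtain \<alpha> where \<alpha>: "\<alpha> \<in> {\<omega><..<pi/2}" "\<alpha> < \<phi>" using mid_angle[OF \<phi>'] .
  have z\<alpha>: "rcis t \<psi> \<notin> closed_csector \<alpha>" "0 < Im (rcis t \<psi>)" "rcis t \<psi> \<notin> closed_csector \<omega>"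
    if "0 < t" "\<psi> \<in> {\<phi>..pi - \<phi>}" for t \<psi>
    using mid_angle_rays[OF \<alpha> _ that] outside_csector(3)[OF \<alpha>(1)] \<phi>' by auto
  obtain C where C: "0 \<le> C" "\<And>t \<psi> p. 0 < t \<Longrightarrow> \<psi> \<in> {\<phi>..pi - \<phi>} \<Longrightarrow> norm (Rz (rcis t \<psi>) p) \<le> C / t * norm p"
    using ray_Rz_bound[OF \<phi>'] by blast
  define K where "K z = Rz z ?q + cact (\<i> / (z + \<i>)) ?B" for z
  define K' where "K' z = - Rz z (Rz z ?q) + cact (- \<i> / (z + \<i>)\<^sup>2) ?B" for z
  have nz: "z + \<i> \<noteq> 0" if "0 < Im z" for z using cmod_add_i_bounds(1)[of z] that by auto
  have K_alt: "K z = cact z (H p z)" if "z \<notin> closed_csector \<omega>" "z + \<i> \<noteq> 0" for z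
  proof -
    have "cact z (Rz z ?B) = ?B + Rz z ?q"
      using cact_z_Rz[OF that(1) pmap_D(2)] by (simp add: Tc_pmap_\<B>)
    moreover have "z * (1 / (z + \<i>)) = 1 - \<i> / (z + \<i>)" using that(2) by (simp add: field_simps)
    then have "cact z (cact (1 / (z + \<i>)) ?B) = ?B - cact (\<i> / (z + \<i>)) ?B"
      by (simp only: cact_cact cact.diff_left cact_one)
    ultimately show ?thesis by (simp add: K_def H_def cact.diff_right)
  qed
  define M where "M = C * norm ?q + 4 * norm ?B + C * norm ?A * 4 + 4 * norm ?A"
  have "integral {0<..} (\<lambda>r. (1 / r) *\<^sub>R K (rcis r \<phi>)) = integral {0<..} (\<lambda>r. (1 / r) *\<^sub>R K (rcis r (pi - \<phi>)))"
  proof (rule polar_cauchy[where act = cact and K' = K' and C = "4 * M", OF bounded_bilinear_cact cact_cact cact_of_real])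
    show "\<phi> \<le> pi - \<phi>" using \<phi>' by auto
    fix r \<psi> :: real assume r: "0 < r" and \<psi>: "\<psi> \<in> {\<phi>..pi - \<phi>}"
    let ?z = "rcis r \<psi>"
    note z = z\<alpha>[OF r \<psi>]
    note n = nz[OF z(2)]
    show "(K has_derivative (\<lambda>h. cact h (K' ?z))) (at ?z)"
    proof -
      have "((\<lambda>z. \<i> / (z + \<i>)) has_field_derivative (- \<i> / (?z + \<i>)\<^sup>2)) (at ?z)"
        using n by (auto intro!: derivative_eq_intros simp: power2_eq_square)
      then have "((\<lambda>z. \<i> / (z + \<i>)) has_derivative (\<lambda>h. h * (- \<i> / (?z + \<i>)\<^sup>2))) (at ?z)"
        by (simp only: has_field_derivative_def mult.commute[of _ "- \<i> / (?z + \<i>)\<^sup>2"])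
      then have "((\<lambda>z. cact (\<i> / (z + \<i>)) ?B) has_derivative (\<lambda>h. cact (h * (- \<i> / (?z + \<i>)\<^sup>2)) ?B)) (at ?z)"
        by (rule bounded_linear.has_derivative[OF cact.bounded_linear_left])
      from has_derivative_add[OF Rz_has_derivative[OF \<alpha>(1) z(1)] this]
      show ?thesis unfolding K_def K'_def by (simp only: cact.add_right cact_cact)
    qed
    have M0: "norm ?q * C \<le> M" "4 * norm ?B \<le> M" "C * norm ?A * 4 + 4 * norm ?A \<le> M" "C * norm ?q + 4 * norm ?B \<le> M" "0 \<le> M"
      using C(1) by (simp_all add: M_def mult.commute)
    have "norm (cact (\<i> / (?z + \<i>)) ?B) \<le> 4 * (cmod (\<i> / (?z + \<i>)) * norm ?B)" by (rule norm_cact_le)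
    also have "cmod (\<i> / (?z + \<i>)) \<le> 1 / r"
      using cmod_add_i_bounds(2)[of ?z] z(2) r by (simp add: norm_divide frac_le)
    finally have b: "norm (cact (\<i> / (?z + \<i>)) ?B) \<le> 4 * (1 / r * norm ?B)"
      by (simp add: mult_right_mono)
    have "norm (K ?z) \<le> C / r * norm ?q + 4 * (1 / r * norm ?B)"
      unfolding K_def by (rule norm_triangle_le[OF add_mono[OF C(2)[OF r \<psi>] b]])
    also have "\<dots> = (C * norm ?q + 4 * norm ?B) / r" by (simp add: add_divide_distrib)
    also have "\<dots> \<le> 4 * M / r" using M0(4,5) r by (intro divide_right_mono) auto
    finally show "norm (K ?z) \<le> 4 * M / r" .
    \<comment> \<open>Near 0 the bound on the resolvent alone is not enough. Because \<B> p = T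
      \<Lambda> p, the vector R(z) \<B> p equals z R(z) \<Lambda> p - \<Lambda> p and stays
      bounded.\<close>
    have "Rz ?z ?B = cact ?z (Rz ?z ?A) - ?A"
      using cact_z_Rz[OF z(3) pmap_D(1)[of p]] by (simp add: Tc_pmap_\<Lambda>)
    then have H: "H p ?z = cact ?z (Rz ?z ?A) - ?A - cact (1 / (?z + \<i>)) ?B" by (simp add: H_def)
    have "norm (cact ?z (Rz ?z ?A)) \<le> 4 * (r * (C / r * norm ?A))"
      using r by (intro order_trans[OF norm_cact_le] mult_left_mono mult_mono C(2)[OF r \<psi>]) auto
    then have h1: "norm (cact ?z (Rz ?z ?A)) \<le> C * norm ?A * 4" using r by simp
    have "norm (cact (1 / (?z + \<i>)) ?B) \<le> 4 * (cmod (1 / (?z + \<i>)) * norm ?B)" by (rule norm_cact_le)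
    also have "cmod (1 / (?z + \<i>)) \<le> 1"
      using cmod_add_i_bounds(1)[of ?z] z(2) by (simp add: norm_divide divide_le_eq)
    finally have h2: "norm (cact (1 / (?z + \<i>)) ?B) \<le> 4 * norm ?B"
      by (simp add: mult_right_mono)
    have "norm (H p ?z) \<le> (C * norm ?A * 4 + norm ?A) + 4 * norm ?B"
      unfolding H by (intro norm_triangle_le_diff add_mono h1 h2 order_refl)
    also have "\<dots> \<le> M" using C(1) by (simp add: M_def)
    finally have "norm (H p ?z) \<le> M" .
    from mult_left_mono[OF this, of r] have "r * norm (H p ?z) \<le> M * r" using r by (simp add: mult.commute)
    moreover have "norm (K ?z) \<le> 4 * (r * norm (H p ?z))"
      using norm_cact_le[of ?z "H p ?z"] r unfolding K_alt[OF z(3) n] by simp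
    ultimately show "norm (K ?z) \<le> 4 * M * r" by linarith
  next
    let ?S = "{rcis r \<psi> |r \<psi>. 0 < r \<and> \<psi> \<in> {\<phi>..pi - \<phi>}}"
    have S: "?S \<subseteq> - closed_csector \<alpha>" "\<And>z. z \<in> ?S \<Longrightarrow> 0 < Im z" using z\<alpha>(1,2) by (auto simp del: Im_rcis)
    have RBc: "continuous_on ?S RB" by (rule continuous_on_subset[OF continuous_on_RB[OF \<alpha>(1)] S(1)])
    have "continuous_on ?S (\<lambda>z. - blinfun_apply (RB z) (blinfun_apply (RB z) ?q) + cact (- \<i> / (z + \<i>)\<^sup>2) ?B)"
      using nz[OF S(2)] by (intro continuous_intros RBc cact.continuous_on) auto
    moreover have "- blinfun_apply (RB z) (blinfun_apply (RB z) ?q) + cact (- \<i> / (z + \<i>)\<^sup>2) ?B = K' z"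
      if "z \<in> ?S" for z
    proof -
      have "blinfun_apply (RB z) = Rz z" using S(1) that by (intro RB_apply[OF \<alpha>(1)]) blast
      then show ?thesis by (simp only: K'_def)
    qed
    ultimately show "continuous_on ?S K'"
      using continuous_on_cong[OF refl, of ?S "\<lambda>z. - blinfun_apply (RB z) (blinfun_apply (RB z) ?q) + cact (- \<i> / (z + \<i>)\<^sup>2) ?B" K']
      by blast
  qed
  moreover have "integral {0<..} (\<lambda>r. (1 / r) *\<^sub>R K (rcis r \<psi>)) = integral {0<..} (\<lambda>t. cact (cis \<psi>) (H p (rcis t \<psi>)))"
    if "\<psi> \<in> {\<phi>..pi - \<phi>}" for \<psi>
  proof (rule Henstock_Kurzweil_Integration.integral_cong)
    fix t :: real assume "t \<in> {0<..}"
    then have t: "0 < t" by simp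
    note z = z\<alpha>[OF t that]
    have "rcis t \<psi> = t *\<^sub>R cis \<psi>" by (simp add: rcis_def scaleR_conv_of_real)
    then have "cact (rcis t \<psi>) q = t *\<^sub>R cact (cis \<psi>) q" for q :: "'w \<times> 'w" by (simp only: cact.scaleR_left)
    then show "(1 / t) *\<^sub>R K (rcis t \<psi>) = cact (cis \<psi>) (H p (rcis t \<psi>))"
      unfolding K_alt[OF z(3) nz[OF z(2)]] using t by simp
  qed
  ultimately show ?thesis using \<phi>' by auto
qed

text \<open>Subtracting the pole leaves an integrand that is holomorphic between the two rays in the upper
  half plane and contributes nothing. What remains are integrals of \<open>lam\<close>, equal to \<open>\<plusminus>\<pi>/2\<close>.\<close>

lemma \<Phi>_base:
  assumes \<theta>: "\<theta> < pi/2" and \<phi>: "\<phi> \<in> {\<omega><..<\<theta>}"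
  shows "\<Phi> \<phi> (\<lambda>z. z * lam z) v = \<B> v"
proof -
  let ?p = "(v, 0) :: 'w \<times> 'w"
  define H where "H z = Rz z (pmap \<B> ?p) - cact (1 / (z + \<i>)) (pmap \<B> ?p)" for z
  \<comment> \<open>This is the coefficient of \<open>lam\<close> once z lam is expanded in partial
    fractions: \<Lambda> from the resolvent identity, and -i \<B> from i lam.\<close>
  define q where "q = pmap \<Lambda> ?p - cact \<i> (pmap \<B> ?p)"
  define I where "I \<psi> = integral {0<..} (\<lambda>t. cact (cis \<psi>) (H (rcis t \<psi>)))" for \<psi>
  have r: "ray_integral (\<lambda>z. z * lam z) \<psi> ?p = I \<psi> + cact (integral {0<..} (\<lambda>t. cis \<psi> * lam (rcis t \<psi>))) q"
    if \<psi>: "\<psi> \<in> {\<phi>, pi - \<phi>}" for \<psi>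
  proof -
    note m = ray_angle_mem[OF \<phi> \<theta> \<psi>]
    let ?f = "\<lambda>t. cact (cis \<psi> * (rcis t \<psi> * lam (rcis t \<psi>))) (Rz (rcis t \<psi>) ?p)"
    have fi: "?f integrable_on {0<..}"
      by (rule ray_integrable[OF \<theta> \<phi> \<psi> holo_N0_base[OF m(4) \<theta>]])
    have li: "(\<lambda>t. cact (cis \<psi> * lam (rcis t \<psi>)) q) integrable_on {0<..}"
      "integral {0<..} (\<lambda>t. cact (cis \<psi> * lam (rcis t \<psi>)) q) = cact (integral {0<..} (\<lambda>t. cis \<psi> * lam (rcis t \<psi>))) q"
      using integrable_linear[OF lam_ray_integrable(2)[OF m(4) \<theta> m(3)] cact.bounded_linear_left[of q]]
        integral_linear[OF lam_ray_integrable(2)[OF m(4) \<theta> m(3)] cact.bounded_linear_left[of q]]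
      by (simp_all add: o_def)
    have "I \<psi> = integral {0<..} (\<lambda>t. ?f t - cact (cis \<psi> * lam (rcis t \<psi>)) q)"
      unfolding I_def
    proof (rule Henstock_Kurzweil_Integration.integral_cong)
      fix t :: real assume "t \<in> {0<..}"
      then have t: "0 < t" by simp
      let ?z = "rcis t \<psi>"
      have n: "1 + ?z\<^sup>2 \<noteq> 0" by (rule ray_one_plus_square[OF \<theta> \<phi> \<psi> t])
      then have "?z + \<i> \<noteq> 0" "?z - \<i> \<noteq> 0" unfolding one_plus_square_factor by auto
      \<comment> \<open>The partial fraction separates the pole at -i, which is part of H, from a
        multiple of lam.\<close>
      then have e: "?z * lam ?z = 1 / (?z + \<i>) + \<i> * lam ?z"
        unfolding lam_def one_plus_square_factor by (simp add: divide_simps)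
      have "cact (?z * lam ?z) (Rz ?z ?p) = H ?z + cact (lam ?z) q"
        unfolding lam_Rz(2)[OF ray_not_closed[OF \<theta> \<phi> \<psi> t] n] unfolding e
        by (simp add: H_def q_def cact.add_left cact.diff_right mult.commute)
      moreover have "?f t = cact (cis \<psi>) (cact (?z * lam ?z) (Rz ?z ?p))" by (simp only: cact_cact)
      ultimately have "?f t = cact (cis \<psi>) (H ?z + cact (lam ?z) q)" by (simp only:)
      then show "cact (cis \<psi>) (H ?z) = ?f t - cact (cis \<psi> * lam ?z) q" by (simp add: cact.add_right)
    qed
    also have "\<dots> = ray_integral (\<lambda>z. z * lam z) \<psi> ?p - cact (integral {0<..} (\<lambda>t. cis \<psi> * lam (rcis t \<psi>))) q"
      unfolding ray_integral_def li(2)[symmetric] by (rule Henstock_Kurzweil_Integration.integral_diff[OF fi li(1)])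
    finally show ?thesis by simp
  qed
  have I: "I \<phi> = I (pi - \<phi>)"
    unfolding I_def H_def by (rule ray_shift_invariance[OF \<theta> \<phi>])
  have \<phi>m: "\<phi> \<in> {-\<theta><..<\<theta>}" "0 < \<theta>" using \<phi> \<omega> by auto
  \<comment> \<open>The H-integrals cancel, and the lam-integrals pi/2 and -pi/2 differ by pi. Only
    pi q remains, whose second component is -pi \<B> v.\<close>
  have "ray_integral (\<lambda>z. z * lam z) \<phi> ?p - ray_integral (\<lambda>z. z * lam z) (pi - \<phi>) ?p
     = cact (of_real (pi/2)) q - cact (- of_real (pi/2)) q"
    using r[of \<phi>, unfolded lam_ray_integral_right[OF \<phi>m(2) \<theta> \<phi>m(1)]]
      r[of "pi - \<phi>", unfolded lam_ray_integral_left[OF \<phi>m(2) \<theta> \<phi>m(1)]] I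
    by simp
  also have "\<dots> = pi *\<^sub>R q"
    by (simp only: cact.minus_left cact_of_real) (simp add: scaleR_add_left[symmetric])
  finally have "\<Phi> \<phi> (\<lambda>z. z * lam z) v = - snd q" by (simp add: \<Phi>_def)
  also have "\<dots> = \<B> v"
    using linear_0[OF linear_\<Lambda>] linear_0[OF linear_\<B>] by (simp add: q_def pmap_def cact_def)
  finally show ?thesis .
qed

end

section \<open>Polynomials of the operator\<close>

text \<open>A nonzero limit L would keep |H|/t above |L|/(2t) near 0, and the logarithmic divergence
  contradicts integrability against dt/t.\<close>

lemma holo_N0_limit_zero:
  assumes \<theta>: "0 < \<theta>" and H: "holo_N0 \<theta> H"
    and lim: "((\<lambda>t. H (of_real t)) \<longlongrightarrow> L) (at_right 0)"
  shows "L = 0"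
proof (rule ccontr)
  assume "L \<noteq> 0"
  then have L: "0 < cmod L / 2" by simp
  have "((\<lambda>t. cmod (H (of_real t))) \<longlongrightarrow> cmod L) (at_right 0)"
    by (intro tendsto_norm lim)
  then have "\<forall>\<^sub>F t in at_right 0. cmod L / 2 < cmod (H (of_real t))"
    by (rule order_tendstoD) (use L in linarith)
  then obtain b where b: "0 < b" "\<And>t. 0 < t \<Longrightarrow> t < b \<Longrightarrow> cmod L / 2 < cmod (H (of_real t))"
    unfolding eventually_at_right_field by blast
  have "0 \<in> sector_angles \<theta>" using \<theta> by (simp add: sector_angles_def)
  then have "set_integrable lborel {0<..} (\<lambda>t. cmod (H (rcis t 0)) / t)"
    using H unfolding holo_N0_def by blast
  then have int: "(\<lambda>t. cmod (H (of_real t)) / t) integrable_on {0<..}"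
    using set_borel_integral_eq_integral(1) by (fastforce simp: rcis_def)
  define M where "M = integral {0<..} (\<lambda>t. cmod (H (of_real t)) / t)"
  define d where "d = b / 2"
  have d: "0 < d" "d < b" using b by (auto simp: d_def)
  have bound: "cmod L / 2 * (ln d - ln x) \<le> M" if x: "0 < x" "x \<le> d" for x
  proof -
    have "((\<lambda>t. cmod L / 2 * (1 / t)) has_integral (cmod L / 2 * (ln d - ln x))) {x..d}"
    proof (rule has_integral_mult_right, rule fundamental_theorem_of_calculus[OF x(2)])
      fix t assume t: "t \<in> {x..d}"
      then have "(ln has_real_derivative 1 / t) (at t within {x..d})"
        using x by (auto intro!: derivative_eq_intros)
      then show "(ln has_vector_derivative 1 / t) (at t within {x..d})"
        by (simp only: has_real_derivative_iff_has_vector_derivative)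
    qed
    moreover have sub: "(\<lambda>t. cmod (H (of_real t)) / t) integrable_on {x..d}"
      by (rule integrable_on_subinterval[OF int]) (use x in auto)
    ultimately have "cmod L / 2 * (ln d - ln x) \<le> integral {x..d} (\<lambda>t. cmod (H (of_real t)) / t)"
    proof (rule has_integral_le[OF _ integrable_integral])
      fix t assume t: "t \<in> {x..d}"
      then have "cmod L / 2 \<le> cmod (H (of_real t))" using b(2)[of t] d x by auto
      then have "(cmod L / 2) / t \<le> cmod (H (of_real t)) / t"
        using t x by (intro divide_right_mono) auto
      then show "cmod L / 2 * (1 / t) \<le> cmod (H (of_real t)) / t" by simp
    qed
    also have "\<dots> \<le> M"
      unfolding M_def by (rule integral_subset_le[OF _ sub int]) (use x in auto)
    finally show ?thesis .
  qed
  \<comment> \<open>Chosen so that the lower bound at x = d exp(-K) equals |M| + 1, which exceeds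
    the full integral M.\<close>
  define K where "K = (\<bar>M\<bar> + 1) / (cmod L / 2)"
  have K: "0 < K" using L by (simp add: K_def)
  have "cmod L / 2 * (ln d - ln (d * exp (- K))) \<le> M"
    using d K by (intro bound) auto
  moreover have "ln (d * exp (- K)) = ln d - K" using d by (simp add: ln_mult)
  ultimately have "cmod L / 2 * K \<le> M" by simp
  moreover have "cmod L / 2 * K = \<bar>M\<bar> + 1" using L by (simp add: K_def)
  ultimately show False by linarith
qed

abbreviation cpoly :: "real poly \<Rightarrow> complex \<Rightarrow> complex" where
  "cpoly p \<equiv> poly (map_poly of_real p)"

lemma cpoly_altdef: "cpoly p z = (\<Sum>i\<le>degree p. of_real (coeff p i) * z ^ i)"
  by (simp add: poly_altdef coeff_map_poly degree_map_poly)

lemma cpoly_pCons [simp]: "cpoly (pCons a p) z = of_real a + z * cpoly p z"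
  by (simp add: map_poly_pCons)

lemma cpoly_add: "cpoly (p + q) z = cpoly p z + cpoly q z"
  by (induction p q rule: poly_induct2) (simp_all add: algebra_simps)

lemma cpoly_smult: "cpoly (smult a p) z = of_real a * cpoly p z"
  by (induction p) (simp_all add: algebra_simps)

lemma cpoly_mult: "cpoly (p * q) z = cpoly p z * cpoly q z"
  by (induction p) (simp_all add: cpoly_add cpoly_smult algebra_simps)

lemma cpoly_minus: "cpoly (- p) z = - cpoly p z"
  using cpoly_smult[of "- 1" p z] by simp

lemma cpoly_diff: "cpoly (p - q) z = cpoly p z - cpoly q z"
  using cpoly_add[of p "- q" z] by (simp add: cpoly_minus)

lemma cpoly_1 [simp]: "cpoly 1 z = 1"
  by (simp add: one_pCons)

lemma cpoly_power: "cpoly (p ^ k) z = cpoly p z ^ k"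
  by (induction k) (simp_all add: cpoly_mult)

text \<open>The real polynomial with roots z and cnj z. Evaluated at the operator it is
  Q_z[T].\<close>

definition quad :: "complex \<Rightarrow> real poly" where
  "quad z = [:(cmod z)\<^sup>2, - 2 * Re z, 1:]"

lemma degree_quad [simp]: "degree (quad z) = 2"
  by (simp add: quad_def)

lemma quad_nonzero [simp]: "quad z \<noteq> 0"
  by (simp add: quad_def)

lemma cpoly_quad_root: "cpoly (quad z) z = 0"
  by (simp add: quad_def complex_eq_iff cmod_power2) (simp add: power2_eq_square algebra_simps)

text \<open>The remainder is a real polynomial of degree at most 1 with a root off the real axis,
  hence it is 0.\<close>

lemma quad_dvd:
  assumes "cpoly q z = 0" "Im z \<noteq> 0"
  shows "quad z dvd q"
proof -
  let ?r = "q mod quad z"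
  have "degree ?r < 2 \<or> ?r = 0" using degree_mod_less[of "quad z" q] by auto
  then have "degree ?r \<le> 1" by auto
  then have "?r = [:coeff ?r 0, coeff ?r 1:]"
    by (intro poly_eqI) (auto simp: coeff_pCons coeff_eq_0 split: nat.split)
  then obtain a b where r: "?r = [:a, b:]" by blast
  have "q = quad z * (q div quad z) + ?r" by simp
  then have "cpoly q z = cpoly (quad z) z * cpoly (q div quad z) z + cpoly ?r z"
    by (metis cpoly_add cpoly_mult)
  then have "cpoly ?r z = 0" using assms by (simp add: cpoly_quad_root)
  then have "of_real a + z * of_real b = 0" by (simp add: r)
  then have "b = 0" "a = 0" using assms(2) by (auto simp: complex_eq_iff)
  then have "?r = 0" by (simp add: r)
  then show ?thesis by (simp add: dvd_eq_mod_eq_0)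
qed

section \<open>Domains of powers and polynomials of the operator\<close>

context sector_op
begin

text \<open>The domain of T^n. Only the iterates below n are asked to lie in D, since the n-th
  iterate is the value and may lie anywhere.\<close>

definition Dn :: "nat \<Rightarrow> 'w set" where
  "Dn n = {v. \<forall>i<n. (\<tau> ^^ i) v \<in> D}"

definition pT :: "real poly \<Rightarrow> 'w \<Rightarrow> 'w" where
  "pT p v = (\<Sum>i\<le>degree p. coeff p i *\<^sub>R (\<tau> ^^ i) v)"

lemma Dn_0 [simp]: "Dn 0 = UNIV" by (simp add: Dn_def)

lemma Dn_Suc: "v \<in> Dn (Suc n) \<longleftrightarrow> v \<in> D \<and> \<tau> v \<in> Dn n"
proof -
  have "v \<in> Dn (Suc n) \<longleftrightarrow> (\<forall>i\<in>{..<Suc n}. (\<tau> ^^ i) v \<in> D)" by (auto simp: Dn_def)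
  also have "\<dots> \<longleftrightarrow> v \<in> D \<and> (\<forall>i<n. (\<tau> ^^ Suc i) v \<in> D)"
    by (simp add: lessThan_Suc_eq_insert_0 del: funpow.simps) (auto simp: lessThan_def)
  finally show ?thesis by (simp add: Dn_def funpow_swap1)
qed

lemma Dn_2: "v \<in> Dn 2 \<longleftrightarrow> v \<in> D \<and> \<tau> v \<in> D"
  by (simp add: numeral_2_eq_2 Dn_Suc)

lemma Dn_mono: "v \<in> Dn n \<Longrightarrow> m \<le> n \<Longrightarrow> v \<in> Dn m"
  by (auto simp: Dn_def)

lemma funpow_Dn: "v \<in> Dn (i + n) \<Longrightarrow> (\<tau> ^^ i) v \<in> Dn n"
  by (induction i arbitrary: v) (simp_all add: Dn_Suc funpow_swap1)

lemma funpow_Dn_iff: "v \<in> Dn i \<Longrightarrow> v \<in> Dn (i + n) \<longleftrightarrow> (\<tau> ^^ i) v \<in> Dn n"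
  by (induction i arbitrary: v) (simp_all add: Dn_Suc funpow_swap1)

lemma Dn_add:
  "u \<in> Dn n \<Longrightarrow> v \<in> Dn n \<Longrightarrow> u + v \<in> Dn n"
  "u \<in> Dn n \<Longrightarrow> v \<in> Dn n \<Longrightarrow> (\<tau> ^^ n) (u + v) = (\<tau> ^^ n) u + (\<tau> ^^ n) v"
  by (induction n arbitrary: u v) (simp_all add: Dn_Suc funpow_swap1 \<tau>_add D_closed)

lemma Dn_scale:
  "u \<in> Dn n \<Longrightarrow> c *\<^sub>R u \<in> Dn n"
  "u \<in> Dn n \<Longrightarrow> (\<tau> ^^ n) (c *\<^sub>R u) = c *\<^sub>R (\<tau> ^^ n) u"
  by (induction n arbitrary: u) (simp_all add: Dn_Suc funpow_swap1 \<tau>_scale D_closed)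

lemma Dn_diff: "u \<in> Dn n \<Longrightarrow> v \<in> Dn n \<Longrightarrow> u - v \<in> Dn n"
  using Dn_add(1)[of u n "(- 1) *\<^sub>R v"] Dn_scale(1)[of v n "- 1"] by simp

lemma Dn_zero: "0 \<in> Dn n"
  by (induction n) (simp_all add: Dn_Suc D_closed)

lemma Dn_sum: "(\<And>i. i \<in> I \<Longrightarrow> f i \<in> Dn n) \<Longrightarrow> sum f I \<in> Dn n"
  by (induction I rule: infinite_finite_induct) (auto simp: Dn_zero Dn_add)

lemma pT_altdef: "degree p \<le> N \<Longrightarrow> pT p v = (\<Sum>i\<le>N. coeff p i *\<^sub>R (\<tau> ^^ i) v)"
  unfolding pT_def by (rule sum.mono_neutral_left) (auto simp: coeff_eq_0)

lemma pT_0 [simp]: "pT 0 v = 0" by (simp add: pT_def)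

text \<open>Horner's scheme peels \<tau> off at the inner end. This uses no additivity of \<tau>, so
  no domain condition enters.\<close>

lemma pT_pCons: "pT (pCons a p) v = a *\<^sub>R v + pT p (\<tau> v)"
proof -
  have "pT (pCons a p) v = (\<Sum>i\<le>Suc (degree p). coeff (pCons a p) i *\<^sub>R (\<tau> ^^ i) v)"
    by (rule pT_altdef) (simp add: degree_pCons_le)
  also have "\<dots> = a *\<^sub>R v + (\<Sum>i\<le>degree p. coeff p i *\<^sub>R (\<tau> ^^ Suc i) v)"
    by (subst sum.atMost_Suc_shift) simp
  also have "(\<Sum>i\<le>degree p. coeff p i *\<^sub>R (\<tau> ^^ Suc i) v) = pT p (\<tau> v)"
    by (simp add: pT_def funpow_swap1)
  finally show ?thesis .
qed

lemma pT_add_poly: "pT (p + q) v = pT p v + pT q v"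
proof -
  let ?N = "max (degree p) (degree q)"
  have "degree (p + q) \<le> ?N" by (rule degree_add_le_max)
  then show ?thesis
    by (simp add: pT_altdef[of p ?N] pT_altdef[of q ?N] pT_altdef[of "p + q" ?N] scaleR_add_left sum.distrib)
qed

lemma pT_smult: "pT (smult a p) v = a *\<^sub>R pT p v"
  by (induction p arbitrary: v) (simp_all add: pT_pCons algebra_simps)

lemma pT_diff_poly: "pT (p - q) v = pT p v - pT q v"
  using pT_add_poly[of p "- q" v] pT_smult[of "- 1" q v] by simp

lemma pT_1 [simp]: "pT 1 v = v"
  by (simp add: one_pCons pT_pCons)

lemma pT_add: "u \<in> Dn n \<Longrightarrow> v \<in> Dn n \<Longrightarrow> degree p \<le> n \<Longrightarrow> pT p (u + v) = pT p u + pT p v"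
  unfolding pT_def by (simp add: Dn_add(2)[OF Dn_mono Dn_mono] scaleR_add_right sum.distrib)

lemma pT_Dn: "v \<in> Dn (m + n) \<Longrightarrow> degree p \<le> m \<Longrightarrow> pT p v \<in> Dn n"
  unfolding pT_def
  by (intro Dn_sum Dn_scale funpow_Dn) (erule Dn_mono, simp)

lemma pT_\<tau>: "v \<in> Dn (Suc m) \<Longrightarrow> degree p \<le> m \<Longrightarrow> \<tau> (pT p v) = pT p (\<tau> v)"
proof (induction p arbitrary: v m)
  case (pCons a p)
  show ?case
  proof (cases "p = 0")
    case True
    then show ?thesis using pCons.prems by (simp add: pT_pCons \<tau>_scale Dn_Suc)
  next
    case False
    then obtain m' where m: "m = Suc m'" "degree p \<le> m'"
      using pCons.prems(2) by (cases m) auto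
    have v: "v \<in> D" "\<tau> v \<in> Dn (Suc m')" using pCons.prems m by (simp_all add: Dn_Suc)
    have "pT p (\<tau> v) \<in> Dn 1" using v m by (intro pT_Dn[of _ m']) simp_all
    then have "pT p (\<tau> v) \<in> D" by (simp add: Dn_Suc)
    then show ?thesis using v pCons.IH[OF v(2) m(2)] by (simp add: pT_pCons \<tau>_add \<tau>_scale D_closed)
  qed
qed simp

lemma pT_mult:
  "v \<in> Dn (m + n) \<Longrightarrow> degree p \<le> m \<Longrightarrow> degree q \<le> n \<Longrightarrow> pT (p * q) v = pT p (pT q v)"
proof (induction p arbitrary: v m)
  case (pCons a p)
  show ?case
  proof (cases "p = 0")
    case True
    then show ?thesis by (simp add: pT_pCons pT_smult)
  next
    case False
    then obtain m' where m: "m = Suc m'" "degree p \<le> m'"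
      using pCons.prems(2) by (cases m) auto
    have v: "v \<in> D" "\<tau> v \<in> Dn (m' + n)" using pCons.prems m by (simp_all add: Dn_Suc)
    have vn: "v \<in> Dn (Suc n)" by (rule Dn_mono[OF pCons.prems(1)]) (simp add: m)
    have "pT (p * q) (\<tau> v) = pT p (\<tau> (pT q v))"
      using pCons.IH[OF v(2) m(2) pCons.prems(3)] pT_\<tau>[OF vn pCons.prems(3)] by simp
    then show ?thesis by (simp add: pT_add_poly pT_smult pT_pCons)
  qed
qed simp

definition commuting :: "('w \<Rightarrow> 'w) \<Rightarrow> bool" where
  "commuting S \<longleftrightarrow> linear S \<and> (\<forall>v\<in>D. S v \<in> D \<and> \<tau> (S v) = S (\<tau> v))"

lemma commuting_Dn:
  assumes "commuting S"
  shows "v \<in> Dn n \<Longrightarrow> S v \<in> Dn n" "v \<in> Dn n \<Longrightarrow> (\<tau> ^^ n) (S v) = S ((\<tau> ^^ n) v)"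
  using assms by (induction n arbitrary: v) (simp_all add: Dn_Suc funpow_swap1 commuting_def)

lemma commuting_pT:
  assumes S: "commuting S" and v: "v \<in> Dn n" "degree p \<le> n"
  shows "pT p (S v) = S (pT p v)"
proof -
  have "linear S" using S by (simp add: commuting_def)
  then show ?thesis
    unfolding pT_def using v
    by (simp add: commuting_Dn(2)[OF S Dn_mono] linear_sum linear_scale)
qed

lemma commuting_funpow: "commuting S \<Longrightarrow> commuting (S ^^ k)"
proof (induction k)
  case 0
  then show ?case by (simp add: commuting_def linear_id[unfolded id_def])
next
  case (Suc k)
  then show ?case unfolding commuting_def by (auto simp: o_def intro: linear_compose[unfolded o_def])
qed

lemma commuting_\<Lambda>: "commuting \<Lambda>"
  by (simp add: commuting_def linear_\<Lambda> \<Lambda>_D \<Lambda>_\<tau>)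

text \<open>\<Lambda> v inherits the regularity of v, and so does T^2 \<Lambda> v = v - \<Lambda> v;
  therefore \<Lambda> gains exactly the two applications of T.\<close>

lemma \<Lambda>_Dn: "v \<in> Dn n \<Longrightarrow> \<Lambda> v \<in> Dn (n + 2)"
  using commuting_Dn(1)[OF commuting_\<Lambda>, of v n] \<Lambda>_D[of v] \<B>_D[of v] \<tau>_\<B>[of v]
  by (simp add: Dn_Suc \<B>_def Dn_diff)

lemma \<Lambda>pow_Dn: "(\<Lambda> ^^ k) v \<in> Dn (2 * k)"
proof (induction k)
  case (Suc k)
  have "2 * Suc k = 2 * k + 2" by simp
  then show ?case using \<Lambda>_Dn[OF Suc] by (simp only: funpow.simps o_def)
qed simp

lemma linear_\<Lambda>pow: "linear (\<Lambda> ^^ k)"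
  using commuting_funpow[OF commuting_\<Lambda>] by (simp add: commuting_def)

lemma pT_w_\<Lambda>: "pT [:1, 0, 1:] (\<Lambda> v) = v"
  using \<tau>_\<B>[of v] by (simp add: pT_pCons \<B>_def)

lemma pT_w_\<Lambda>pow: "pT ([:1, 0, 1:] ^ k) ((\<Lambda> ^^ k) v) = v"
proof (induction k arbitrary: v)
  case (Suc k)
  have d: "degree ([:1, 0, 1::real:] ^ k) \<le> 2 * k" by (rule order_trans[OF degree_power_le]) simp
  have "pT ([:1, 0, 1:] ^ Suc k) ((\<Lambda> ^^ Suc k) v) = pT ([:1, 0, 1:] ^ k * [:1, 0, 1:]) ((\<Lambda> ^^ Suc k) v)"
    by (simp only: power_Suc2)
  also have "\<dots> = pT ([:1, 0, 1:] ^ k) (pT [:1, 0, 1:] ((\<Lambda> ^^ Suc k) v))"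
    using \<Lambda>pow_Dn[of "Suc k" v] by (intro pT_mult[of _ "2 * k" 2, OF _ d]) simp_all
  also have "\<dots> = v" using Suc.IH by (simp add: pT_w_\<Lambda> del: power_Suc)
  finally show ?case .
qed simp

lemma inj_\<Lambda>pow: "(\<Lambda> ^^ k) u = (\<Lambda> ^^ k) v \<Longrightarrow> u = v"
  using pT_w_\<Lambda>pow by metis

text \<open>The leading term of \<open>q[T]v\<close> is the only one that can fail to have the smoothness of the others.\<close>

lemma Dn_of_pT_Dn:
  assumes q: "q \<noteq> 0" and v: "v \<in> Dn (degree q)"
  shows "pT q v \<in> Dn j \<Longrightarrow> v \<in> Dn (degree q + j)"
proof (induction j)
  case (Suc j)
  let ?d = "degree q"
  have vj: "v \<in> Dn (?d + j)" using Suc Dn_mono[OF Suc.prems, of j] by simp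
  have split: "pT q v = (\<Sum>i<?d. coeff q i *\<^sub>R (\<tau> ^^ i) v) + lead_coeff q *\<^sub>R (\<tau> ^^ ?d) v"
    unfolding pT_def by (simp add: lessThan_Suc_atMost[symmetric])
  have "(\<Sum>i<?d. coeff q i *\<^sub>R (\<tau> ^^ i) v) \<in> Dn (Suc j)"
    using vj by (intro Dn_sum Dn_scale funpow_Dn) (auto intro: Dn_mono)
  with Suc.prems have "pT q v - (\<Sum>i<?d. coeff q i *\<^sub>R (\<tau> ^^ i) v) \<in> Dn (Suc j)" by (rule Dn_diff)
  then have "lead_coeff q *\<^sub>R (\<tau> ^^ ?d) v \<in> Dn (Suc j)" by (simp add: split)
  from Dn_scale(1)[OF this, of "1 / lead_coeff q"] have "(\<tau> ^^ ?d) v \<in> Dn (Suc j)" using q by simp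
  then show ?case by (simp only: funpow_Dn_iff[OF v])
qed (use v in simp)

lemma pT_quad: "pT (quad z) v = \<tau> (\<tau> v) - (2 * Re z) *\<^sub>R \<tau> v + (cmod z)\<^sup>2 *\<^sub>R v"
  by (simp add: quad_def pT_pCons algebra_simps)

lemma pT_quad_bijective:
  assumes z: "z \<notin> closed_csector \<omega>"
  shows "\<exists>!v. v \<in> Dn 2 \<and> pT (quad z) v = w"
proof (rule ex1I[of _ "Qi z w"])
  show "Qi z w \<in> Dn 2 \<and> pT (quad z) (Qi z w) = w"
    using z by (simp add: Dn_2 Qi_D \<tau>_Qi_D pT_quad Qi_eq)
  show "v = Qi z w" if "v \<in> Dn 2 \<and> pT (quad z) v = w" for v
    using that Qi_eqI[OF z, of v w] by (simp add: Dn_2 pT_quad)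
qed

text \<open>The closed double sector contains the real axis, so every root z of q is non-real and q
  has the real factor \<open>quad z\<close>. At the operator this factor is Q_z[T], invertible
  because z lies outside the closed sector, and induction on the degree handles the
  cofactor.\<close>

lemma pT_bijective:
  assumes "q \<noteq> 0" "\<And>z. z \<in> closed_csector \<omega> \<Longrightarrow> cpoly q z \<noteq> 0"
  shows "\<exists>!v. v \<in> Dn (degree q) \<and> pT q v = w"
  using assms
proof (induction "degree q" arbitrary: q w rule: less_induct)
  case less
  show ?case
  proof (cases "degree q = 0")
    case True
    then obtain c where c: "q = [:c:]" by (metis degree_eq_zeroE)
    then have "c \<noteq> 0" using less.prems by simp
    then have "(c *\<^sub>R v = w) \<longleftrightarrow> v = (1 / c) *\<^sub>R w" for v :: 'w by auto
    then show ?thesis by (simp add: c pT_pCons)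
  next
    case False
    have "\<not> constant (poly (map_poly complex_of_real q))"
      using False by (simp add: constant_degree degree_map_poly)
    then obtain z where z: "cpoly q z = 0" using fundamental_theorem_of_algebra by blast
    then have zs: "z \<notin> closed_csector \<omega>" using less.prems by blast
    then have "Im z \<noteq> 0" using \<omega> tan_gt_zero[of \<omega>] by (auto simp: closed_csector_def)
    then obtain q' where q': "q = quad z * q'" using quad_dvd[OF z] by (auto elim: dvdE)
    then have n: "q' \<noteq> 0" using less.prems by auto
    have deg: "degree q = 2 + degree q'" unfolding q' using n by (simp add: degree_mult_eq)
    have nz: "cpoly q' u \<noteq> 0" if "u \<in> closed_csector \<omega>" for u
      using less.prems(2)[OF that] by (simp add: q' cpoly_mult)
    have ih: "\<exists>!v. v \<in> Dn (degree q') \<and> pT q' v = w" for w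
      using deg by (intro less.hyps n nz) auto
    have mult: "pT q v = pT (quad z) (pT q' v)" if "v \<in> Dn (degree q)" for v
      unfolding q' using that deg by (intro pT_mult[of _ 2 "degree q'"]) simp_all
    obtain y where y: "y \<in> Dn 2" "pT (quad z) y = w" "\<And>y'. y' \<in> Dn 2 \<Longrightarrow> pT (quad z) y' = w \<Longrightarrow> y' = y"
      using pT_quad_bijective[OF zs, of w] by blast
    obtain v where v: "v \<in> Dn (degree q')" "pT q' v = y" "\<And>v'. v' \<in> Dn (degree q') \<Longrightarrow> pT q' v' = y \<Longrightarrow> v' = v"
      using ih[of y] by blast
    \<comment> \<open>The induction only yields v in the domain of q'[T]. As q'[T] v = y lies in the
      domain of T^2, the leading term of q' supplies the two missing degrees.\<close>
    have vq: "v \<in> Dn (degree q)"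
      using Dn_of_pT_Dn[OF n v(1), of 2] y(1) v(2) by (simp add: deg add.commute)
    show ?thesis
    proof (rule ex1I[of _ v])
      show "v \<in> Dn (degree q) \<and> pT q v = w" using vq mult[OF vq] v(2) y(2) by simp
      fix v' assume v': "v' \<in> Dn (degree q) \<and> pT q v' = w"
      then have "pT q' v' \<in> Dn 2" using deg by (intro pT_Dn[of _ "degree q'"]) (simp_all add: add.commute)
      moreover have "pT (quad z) (pT q' v') = w" using v' mult[of v'] by simp
      ultimately have "pT q' v' = y" using y(3) by blast
      moreover have "v' \<in> Dn (degree q')" using v' deg by (auto intro: Dn_mono)
      ultimately show "v' = v" using v(3) by blast
    qed
  qed
qed


lemma holo_N0_zero: "0 < \<theta> \<Longrightarrow> \<theta> < pi/2 \<Longrightarrow> holo_N0 \<theta> (\<lambda>z. 0)"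
  using holo_N0_scale[OF _ _ holo_N0_base, of \<theta> 0] by simp

lemma holo_N0_cong:
  assumes \<theta>: "0 < \<theta>" "\<theta> < pi/2" and F: "holo_N0 \<theta> F" and eq: "\<And>z. z \<in> csector \<theta> \<Longrightarrow> F z = G z"
  shows "holo_N0 \<theta> G"
proof -
  have "holo_intrinsic \<theta> G"
    using F eq unfolding holo_N0_def holo_intrinsic_def
    by (metis (no_types, lifting) cnj_in_csector holomorphic_cong)
  moreover have "F ` csector \<theta> = G ` csector \<theta>" using eq by (rule image_cong[OF refl])
  moreover have "set_integrable lborel {0<..} (\<lambda>t. cmod (G (rcis t \<psi>)) / t)" if "\<psi> \<in> sector_angles \<theta>" for \<psi>
  proof -
    have "set_integrable lborel {0<..} (\<lambda>t. cmod (F (rcis t \<psi>)) / t)"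
      using F that unfolding holo_N0_def by blast
    also have "?this \<longleftrightarrow> ?thesis"
      by (rule set_integrable_cong) (auto simp: eq rcis_in_csector[OF \<theta>] that)
    finally show ?thesis .
  qed
  ultimately show ?thesis using F unfolding holo_N0_def by metis
qed

section \<open>Compatibility of the integral calculus with polynomials\<close>

context
  fixes \<theta> \<phi> :: real
  assumes \<theta>: "\<theta> < pi/2" and \<phi>: "\<phi> \<in> {\<omega><..<\<theta>}"
begin

lemma \<theta>_pos: "0 < \<theta>" using \<phi> \<omega> by auto

lemma \<Phi>_sum:
  assumes "\<And>i. i \<in> I \<Longrightarrow> holo_N0 \<theta> (F i)"
  shows "holo_N0 \<theta> (\<lambda>z. \<Sum>i\<in>I. F i z) \<and> \<Phi> \<phi> (\<lambda>z. \<Sum>i\<in>I. F i z) v = (\<Sum>i\<in>I. \<Phi> \<phi> (F i) v)"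
proof -
  have z: "\<Phi> \<phi> (\<lambda>z. 0) v = 0"
    using \<Phi>_scale[OF \<theta> \<phi> holo_N0_base[OF \<theta>_pos \<theta>], of 0 v] by simp
  show ?thesis using assms
    by (induction I rule: infinite_finite_induct)
      (auto simp: z holo_N0_zero[OF \<theta>_pos \<theta>] \<Phi>_add[OF \<theta> \<phi>] intro: holo_N0_add[OF \<theta>_pos \<theta>])
qed

text \<open>One factor lam absorbs up to two factors z: z^2 lam = 1 - lam on the function side
  corresponds to T^2 \<Lambda> = 1 - \<Lambda> on the operator side. The bound on j keeps the
  function in the class and the iterates of T within the domain that the range of \<Lambda>^k
  provides.\<close>

lemma \<Phi>_monomial:
  assumes F: "holo_N0 \<theta> F"
  shows "j \<le> 2 * k \<Longrightarrow> holo_N0 \<theta> (\<lambda>z. z ^ j * (lam z ^ k * F z)) \<and>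
    \<Phi> \<phi> (\<lambda>z. z ^ j * (lam z ^ k * F z)) v = (\<tau> ^^ j) ((\<Lambda> ^^ k) (\<Phi> \<phi> F v))"
proof (induction k arbitrary: j)
  case 0
  then show ?case using F by simp
next
  case (Suc k)
  let ?x = "(\<Lambda> ^^ k) (\<Phi> \<phi> F v)"
  consider "j = 0" | "j = 1" | i where "j = Suc (Suc i)" by (metis One_nat_def not0_implies_Suc)
  then show ?case
  proof cases
    case 1
    have ih: "holo_N0 \<theta> (\<lambda>z. lam z ^ k * F z)" "\<Phi> \<phi> (\<lambda>z. lam z ^ k * F z) v = ?x"
      using Suc.IH[of 0] by simp_all
    show ?thesis
      using holo_N0_lam[OF \<theta>_pos \<theta> ih(1)] \<Phi>_lam(1)[OF \<theta> \<phi> ih(1), of v] by (simp add: 1 ih(2) mult.assoc)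
  next
    case 2
    have ih: "holo_N0 \<theta> (\<lambda>z. lam z ^ k * F z)" "\<Phi> \<phi> (\<lambda>z. lam z ^ k * F z) v = ?x"
      using Suc.IH[of 0] by simp_all
    show ?thesis
      using holo_N0_z_lam[OF \<theta>_pos \<theta> ih(1)] \<Phi>_lam(2)[OF \<theta> \<phi> ih(1), of v] by (simp add: 2 ih(2) mult.assoc \<B>_def)
  next
    case (3 i)
    have i: "i \<le> 2 * k" using Suc.prems 3 by simp
    let ?G = "\<lambda>z. z ^ i * (lam z ^ k * F z)"
    have ih: "holo_N0 \<theta> ?G" "\<Phi> \<phi> ?G v = (\<tau> ^^ i) ?x"
      using Suc.IH[OF i] by simp_all
    have eq: "?G z + of_real (- 1) * (lam z * ?G z) = z ^ j * (lam z ^ Suc k * F z)" if "z \<in> csector \<theta>" for z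
    proof -
      have "1 + z\<^sup>2 \<noteq> 0" using that csector_mem_closed one_plus_square_nonzero by blast
      then have "lam z * z\<^sup>2 = 1 - lam z" by (simp add: lam_def field_simps)
      then have "z ^ j * (lam z ^ Suc k * F z) = (1 - lam z) * ?G z"
        by (simp add: 3 power2_eq_square mult_ac)
      then show ?thesis by (simp add: algebra_simps)
    qed
    have h1: "holo_N0 \<theta> (\<lambda>z. of_real (- 1) * (lam z * ?G z))"
      by (intro holo_N0_scale holo_N0_lam \<theta>_pos \<theta> ih(1))
    have h: "holo_N0 \<theta> (\<lambda>z. z ^ j * (lam z ^ Suc k * F z))"
      by (rule holo_N0_cong[OF \<theta>_pos \<theta> holo_N0_add[OF \<theta>_pos \<theta> ih(1) h1] eq])
    have "\<Phi> \<phi> (\<lambda>z. z ^ j * (lam z ^ Suc k * F z)) v = \<Phi> \<phi> (\<lambda>z. ?G z + of_real (- 1) * (lam z * ?G z)) v"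
      by (rule \<Phi>_cong[OF \<theta> \<phi>]) (simp only: eq)
    also have "\<dots> = (\<tau> ^^ i) ?x - \<Lambda> ((\<tau> ^^ i) ?x)"
      unfolding \<Phi>_add[OF \<theta> \<phi> ih(1) h1] \<Phi>_scale[OF \<theta> \<phi> holo_N0_lam[OF \<theta>_pos \<theta> ih(1)]]
        \<Phi>_lam(1)[OF \<theta> \<phi> ih(1)] ih(2) by simp
    also have "\<dots> = \<tau> (\<tau> (\<Lambda> ((\<tau> ^^ i) ?x)))"
      using \<tau>_\<B> by (simp add: \<B>_def)
    also have "\<Lambda> ((\<tau> ^^ i) ?x) = (\<tau> ^^ i) (\<Lambda> ?x)"
      by (rule commuting_Dn(2)[OF commuting_\<Lambda>, symmetric]) (rule Dn_mono[OF \<Lambda>pow_Dn i])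
    finally show ?thesis using h by (simp add: 3)
  qed
qed

lemma \<Phi>_poly:
  assumes F: "holo_N0 \<theta> F" and p: "degree p \<le> 2 * k"
  shows "holo_N0 \<theta> (\<lambda>z. cpoly p z * (lam z ^ k * F z))"
    and "\<Phi> \<phi> (\<lambda>z. cpoly p z * (lam z ^ k * F z)) v = pT p ((\<Lambda> ^^ k) (\<Phi> \<phi> F v))"
proof -
  let ?f = "\<lambda>i z. of_real (coeff p i) * (z ^ i * (lam z ^ k * F z))"
  have eq: "(\<lambda>z. cpoly p z * (lam z ^ k * F z)) = (\<lambda>z. \<Sum>i\<le>degree p. ?f i z)"
    by (simp add: cpoly_altdef sum_distrib_right mult.assoc)
  have m: "holo_N0 \<theta> (\<lambda>z. z ^ i * (lam z ^ k * F z))"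
    "\<Phi> \<phi> (\<lambda>z. z ^ i * (lam z ^ k * F z)) v = (\<tau> ^^ i) ((\<Lambda> ^^ k) (\<Phi> \<phi> F v))" if "i \<le> degree p" for i
    using \<Phi>_monomial[OF F, of i k v] that p by simp_all
  have f: "holo_N0 \<theta> (?f i)" if "i \<in> {..degree p}" for i
    using that by (intro holo_N0_scale \<theta>_pos \<theta> m) simp
  show "holo_N0 \<theta> (\<lambda>z. cpoly p z * (lam z ^ k * F z))"
    unfolding eq using \<Phi>_sum[of "{..degree p}" ?f, OF f] by blast
  have "\<Phi> \<phi> (\<lambda>z. cpoly p z * (lam z ^ k * F z)) v = (\<Sum>i\<le>degree p. \<Phi> \<phi> (?f i) v)"
    unfolding eq using \<Phi>_sum[of "{..degree p}" ?f, OF f] by blast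
  also have "\<dots> = pT p ((\<Lambda> ^^ k) (\<Phi> \<phi> F v))"
    unfolding pT_def by (intro sum.cong refl) (simp add: \<Phi>_scale[OF \<theta> \<phi> m(1)] m(2))
  finally show "\<Phi> \<phi> (\<lambda>z. cpoly p z * (lam z ^ k * F z)) v = pT p ((\<Lambda> ^^ k) (\<Phi> \<phi> F v))" .
qed

text \<open>The zero of N at 0 supplies a factor z, and the function becomes N'(z) lam^k times the
  base function z lam, whose calculus is \<B>. Without this zero the function would not be
  integrable against dt/t.\<close>

lemma \<Phi>_rational:
  assumes "coeff N 0 = 0" "degree N < 2 * Suc k"
  shows "holo_N0 \<theta> (\<lambda>z. cpoly N z * lam z ^ Suc k)"
    and "\<Phi> \<phi> (\<lambda>z. cpoly N z * lam z ^ Suc k) v = pT N ((\<Lambda> ^^ Suc k) v)"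
proof -
  obtain N' where N: "N = pCons 0 N'" using assms(1) by (cases N) auto
  have d: "degree N' \<le> 2 * k" using assms(2) by (cases "N' = 0") (auto simp: N)
  have eq: "(\<lambda>z. cpoly N z * lam z ^ Suc k) = (\<lambda>z. cpoly N' z * (lam z ^ k * (z * lam z)))"
    by (simp add: N mult_ac)
  note b = holo_N0_base[OF \<theta>_pos \<theta>]
  show "holo_N0 \<theta> (\<lambda>z. cpoly N z * lam z ^ Suc k)"
    unfolding eq by (rule \<Phi>_poly(1)[OF b d])
  have "(\<Lambda> ^^ k) (\<B> v) = \<tau> ((\<Lambda> ^^ Suc k) v)"
    using commuting_funpow[OF commuting_\<Lambda>, of k] \<Lambda>_D[of v]
    by (simp add: commuting_def \<B>_def funpow_swap1)
  then show "\<Phi> \<phi> (\<lambda>z. cpoly N z * lam z ^ Suc k) v = pT N ((\<Lambda> ^^ Suc k) v)"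
    unfolding eq \<Phi>_poly(2)[OF b d] \<Phi>_base[OF \<theta> \<phi>] by (simp add: N pT_pCons)
qed

section \<open>The extended calculus and its quotients\<close>

definition \<Psi> :: "real \<Rightarrow> real \<Rightarrow> (complex \<Rightarrow> complex) \<Rightarrow> 'w \<Rightarrow> 'w" where
  "\<Psi> e0 ei E v = ei *\<^sub>R v + (e0 - ei) *\<^sub>R \<Lambda> v + \<Phi> \<phi> E v"

text \<open>Commutation with the unbounded T is derived from commutation with \<Lambda> and \<B>.
  For v in D and u the calculus of E at v, \<B> u is \<Lambda> of the calculus at T v. So T \<B> u
  is in D, and u = T \<B> u + \<Lambda> u is in D too. Injectivity of \<Lambda> then identifies T
  u.\<close>

lemma commuting_\<Psi>:
  assumes E: "holo_N0 \<theta> E"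
  shows "commuting (\<Psi> e0 ei E)"
proof -
  interpret P: linear "\<Phi> \<phi> E" by (rule linear_\<Phi>[OF \<theta> \<phi> E])
  interpret L: linear \<Lambda> by (rule linear_\<Lambda>)
  have "linear (\<Psi> e0 ei E)"
    unfolding \<Psi>_def by (rule linearI) (simp_all add: P.add P.scale L.add L.scale algebra_simps)
  moreover have "\<Phi> \<phi> E v \<in> D \<and> \<tau> (\<Phi> \<phi> E v) = \<Phi> \<phi> E (\<tau> v)" if v: "v \<in> D" for v
  proof -
    let ?u = "\<Phi> \<phi> E v"
    have "\<Lambda> (\<Phi> \<phi> E (\<tau> v)) = \<Phi> \<phi> E (\<B> v)"
      using \<Phi>_\<Lambda>(1)[OF \<theta> \<phi> E, of "\<tau> v"] v by (simp add: \<Lambda>_\<tau> \<B>_def)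
    then have e: "\<Lambda> (\<Phi> \<phi> E (\<tau> v)) = \<B> ?u" by (simp add: \<Phi>_\<Lambda>(2)[OF \<theta> \<phi> E])
    have "\<tau> (\<B> ?u) \<in> D" using \<B>_D[of "\<Phi> \<phi> E (\<tau> v)"] by (simp add: \<B>_def e)
    then have "\<tau> (\<B> ?u) + \<Lambda> ?u \<in> D" using \<Lambda>_D by (rule D_closed)
    then have u: "?u \<in> D" by (simp add: \<tau>_\<B>)
    moreover have "\<tau> ?u = \<Phi> \<phi> E (\<tau> v)"
      using e inj_\<Lambda>pow[of 1 "\<tau> ?u" "\<Phi> \<phi> E (\<tau> v)"] u by (simp add: \<Lambda>_\<tau> \<B>_def)
    ultimately show ?thesis ..
  qed
  ultimately show ?thesis
    unfolding commuting_def by (simp add: \<Psi>_def \<tau>_linear D_closed \<Lambda>_D \<Lambda>_\<tau>)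
qed

text \<open>The rational parts of both sides combine to a rational function that equals a combination of
  \<open>E\<close> and \<open>G\<close>; being integrable against \<open>dt/t\<close>, it vanishes at \<open>0\<close>, so that \<open>\<Phi>_rational\<close> applies to it.\<close>

theorem \<Psi>_product_rule:
  assumes E: "holo_N0 \<theta> E" and G: "holo_N0 \<theta> G"
    and deg: "degree p < 2 * k" "degree q < 2 * k"
    and eq: "\<And>z. z \<in> csector \<theta> \<Longrightarrow>
      cpoly p z * (of_real ei + of_real (e0 - ei) * lam z + E z) = cpoly q z * (of_real gi + of_real (g0 - gi) * lam z + G z)"
  shows "pT p ((\<Lambda> ^^ k) (\<Psi> e0 ei E v)) = pT q ((\<Lambda> ^^ k) (\<Psi> g0 gi G v))"
proof -
  \<comment> \<open>Over the denominator 1 + z^2 the rational part of e has the numerator e_0 +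
    e_inf z^2. Hence N/(1 + z^2) is the difference of the rational parts of the two sides of p e = q
    g.\<close>
  define N where "N = p * [:e0, 0, ei:] - q * [:g0, 0, gi:]"
  have degc: "degree [:a, 0, b:] \<le> 2" for a b :: real by simp
  have dp: "degree (p * [:e0, 0, ei:]) \<le> degree p + 2" "degree (q * [:g0, 0, gi:]) \<le> degree q + 2"
    by (intro order_trans[OF degree_mult_le] add_left_mono degc)+
  have degN: "degree N < 2 * Suc k"
    unfolding N_def by (rule degree_diff_less) (use dp deg in auto)
  define H where "H z = cpoly q z * (lam z ^ k * G z) + of_real (- 1) * (cpoly p z * (lam z ^ k * E z))" for z
  have hp: "holo_N0 \<theta> (\<lambda>z. cpoly p z * (lam z ^ k * E z))" "holo_N0 \<theta> (\<lambda>z. cpoly q z * (lam z ^ k * G z))"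
    using deg by (intro \<Phi>_poly E G; simp)+
  have hs: "holo_N0 \<theta> (\<lambda>z. of_real (- 1) * (cpoly p z * (lam z ^ k * E z)))"
    by (intro holo_N0_scale \<theta>_pos \<theta> hp)
  have H: "holo_N0 \<theta> H" unfolding H_def by (intro holo_N0_add \<theta>_pos \<theta> hp hs)
  have NH: "cpoly N z * lam z ^ Suc k = H z" if z: "z \<in> csector \<theta>" for z
  proof -
    have "1 + z\<^sup>2 \<noteq> 0" using z csector_mem_closed one_plus_square_nonzero by blast
    then have l: "lam z * (1 + z\<^sup>2) = 1" by (simp add: lam_def)
    have c: "cpoly [:a, 0, b:] z * lam z = of_real b + of_real (a - b) * lam z" for a b
    proof -
      have "cpoly [:a, 0, b:] z * lam z = of_real b * (lam z * (1 + z\<^sup>2)) + of_real (a - b) * lam z"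
        by (simp add: power2_eq_square algebra_simps)
      then show ?thesis by (simp add: l)
    qed
    have "cpoly N z * lam z = cpoly p z * (cpoly [:e0, 0, ei:] z * lam z) - cpoly q z * (cpoly [:g0, 0, gi:] z * lam z)"
      unfolding N_def cpoly_diff cpoly_mult by (simp only: left_diff_distrib mult.assoc)
    also have "\<dots> = cpoly q z * G z - cpoly p z * E z"
      unfolding c using eq[OF z] by (simp only: distrib_left) (simp add: algebra_simps)
    finally have "(cpoly N z * lam z) * lam z ^ k = (cpoly q z * G z - cpoly p z * E z) * lam z ^ k" by simp
    then show ?thesis by (simp add: H_def algebra_simps)
  qed
  have "of_real (coeff N 0) = (0 :: complex)"
  proof (rule holo_N0_limit_zero[OF \<theta>_pos H])
    have "((\<lambda>t. cpoly N (of_real t) * lam (of_real t) ^ Suc k) \<longlongrightarrow> cpoly N (of_real 0) * lam (of_real 0) ^ Suc k) (at_right 0)"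
      unfolding lam_def by (intro tendsto_intros) auto
    then have "((\<lambda>t. cpoly N (of_real t) * lam (of_real t) ^ Suc k) \<longlongrightarrow> of_real (coeff N 0)) (at_right 0)"
      by (simp add: lam_def poly_0_coeff_0 coeff_map_poly)
    moreover have "\<forall>\<^sub>F t in at_right 0. cpoly N (of_real t) * lam (of_real t) ^ Suc k = H (of_real t)"
      unfolding eventually_at_right_field
    proof (intro exI[of _ 1] conjI allI impI)
      fix t :: real assume "0 < t"
      then have "of_real t \<in> csector \<theta>" using \<theta>_pos \<theta> by (simp add: csector_def tan_gt_zero)
      then show "cpoly N (of_real t) * lam (of_real t) ^ Suc k = H (of_real t)" by (rule NH)
    qed simp
    ultimately show "((\<lambda>t. H (of_real t)) \<longlongrightarrow> of_real (coeff N 0)) (at_right 0)"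
      by (rule Lim_transform_eventually)
  qed
  then have N0: "coeff N 0 = 0" by simp
  let ?x = "(\<Lambda> ^^ k) v"
  \<comment> \<open>The same vector is now evaluated in two ways, through the integral calculus of H
    and by polynomial algebra on the range of \<Lambda>^(k+1). Comparing them gives the claim after
    rearrangement.\<close>
  have "pT N ((\<Lambda> ^^ Suc k) v) = \<Phi> \<phi> H v"
    unfolding \<Phi>_rational(2)[OF N0 degN, symmetric] by (rule \<Phi>_cong[OF \<theta> \<phi> NH])
  also have "\<dots> = pT q ((\<Lambda> ^^ k) (\<Phi> \<phi> G v)) - pT p ((\<Lambda> ^^ k) (\<Phi> \<phi> E v))"
    unfolding H_def \<Phi>_add[OF \<theta> \<phi> hp(2) hs] \<Phi>_scale[OF \<theta> \<phi> hp(1)]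
    using deg by (subst \<Phi>_poly(2)[OF E], simp, subst \<Phi>_poly(2)[OF G], simp_all)
  finally have 1: "pT N ((\<Lambda> ^^ Suc k) v) = pT q ((\<Lambda> ^^ k) (\<Phi> \<phi> G v)) - pT p ((\<Lambda> ^^ k) (\<Phi> \<phi> E v))" .
  have cx: "pT [:a, 0, b:] ((\<Lambda> ^^ Suc k) v) = (\<Lambda> ^^ k) (b *\<^sub>R v + (a - b) *\<^sub>R \<Lambda> v)" for a b
  proof -
    have "pT [:a, 0, b:] ((\<Lambda> ^^ Suc k) v) = a *\<^sub>R \<Lambda> ?x + b *\<^sub>R (?x - \<Lambda> ?x)"
      using \<tau>_\<B>[of ?x] by (simp add: pT_pCons \<B>_def)
    also have "\<dots> = b *\<^sub>R ?x + (a - b) *\<^sub>R (\<Lambda> ^^ k) (\<Lambda> v)" by (simp add: algebra_simps funpow_swap1)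
    also have "\<dots> = (\<Lambda> ^^ k) (b *\<^sub>R v + (a - b) *\<^sub>R \<Lambda> v)"
      by (simp add: linear_add[OF linear_\<Lambda>pow] linear_scale[OF linear_\<Lambda>pow])
    finally show ?thesis .
  qed
  have xD: "(\<Lambda> ^^ Suc k) v \<in> Dn (2 * k + 2)" using \<Lambda>pow_Dn[of "Suc k" v] by simp
  have m: "pT (p * [:e0, 0, ei:]) ((\<Lambda> ^^ Suc k) v) = pT p (pT [:e0, 0, ei:] ((\<Lambda> ^^ Suc k) v))"
    "pT (q * [:g0, 0, gi:]) ((\<Lambda> ^^ Suc k) v) = pT q (pT [:g0, 0, gi:] ((\<Lambda> ^^ Suc k) v))"
    using deg by (intro pT_mult[OF xD _ degc]; simp)+
  have "pT N ((\<Lambda> ^^ Suc k) v) = pT p ((\<Lambda> ^^ k) (ei *\<^sub>R v + (e0 - ei) *\<^sub>R \<Lambda> v)) - pT q ((\<Lambda> ^^ k) (gi *\<^sub>R v + (g0 - gi) *\<^sub>R \<Lambda> v))"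
    unfolding N_def pT_diff_poly m cx ..
  with 1 have 2: "pT p ((\<Lambda> ^^ k) (ei *\<^sub>R v + (e0 - ei) *\<^sub>R \<Lambda> v)) - pT q ((\<Lambda> ^^ k) (gi *\<^sub>R v + (g0 - gi) *\<^sub>R \<Lambda> v))
      = pT q ((\<Lambda> ^^ k) (\<Phi> \<phi> G v)) - pT p ((\<Lambda> ^^ k) (\<Phi> \<phi> E v))" by (simp only:)
  have "a + d = b + c" if "a - b = c - d" for a b c d :: 'w using that by (simp add: algebra_simps)
  from this[OF 2] have "pT p ((\<Lambda> ^^ k) (ei *\<^sub>R v + (e0 - ei) *\<^sub>R \<Lambda> v)) + pT p ((\<Lambda> ^^ k) (\<Phi> \<phi> E v))
      = pT q ((\<Lambda> ^^ k) (gi *\<^sub>R v + (g0 - gi) *\<^sub>R \<Lambda> v)) + pT q ((\<Lambda> ^^ k) (\<Phi> \<phi> G v))" .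
  moreover have "pT r ((\<Lambda> ^^ k) (a + b)) = pT r ((\<Lambda> ^^ k) a) + pT r ((\<Lambda> ^^ k) b)" if "degree r < 2 * k" for r a b
    unfolding linear_add[OF linear_\<Lambda>pow] using that by (intro pT_add[OF \<Lambda>pow_Dn \<Lambda>pow_Dn]) simp
  ultimately show ?thesis using deg unfolding \<Psi>_def by simp
qed

text \<open>Powers of \<open>\<Lambda>\<close> are injective, so it suffices to compare after applying \<open>\<Lambda>\<^sup>k\<close>, where
  \<open>\<Psi>_product_rule\<close> makes both sides polynomials of the operator.\<close>

theorem \<Psi>_quotient:
  assumes E: "holo_N0 \<theta> E" and G: "holo_N0 \<theta> G" and p: "p \<noteq> 0"
    and eq: "\<And>z. z \<in> csector \<theta> \<Longrightarrow>
      cpoly p z * (of_real ei + of_real (e0 - ei) * lam z + E z) = cpoly q z * (of_real gi + of_real (g0 - gi) * lam z + G z)"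
    and inj: "inj (\<Psi> e0 ei E)"
    and u: "u \<in> Dn (degree q)"
  shows "\<Psi> e0 ei E w = \<Psi> g0 gi G (pT q u) \<longleftrightarrow> u \<in> Dn (degree p) \<and> w = pT p u"
proof -
  \<comment> \<open>Any k with both degrees below 2k would do: it makes p[T] and q[T] defined on the
    whole range of \<Lambda>^k.\<close>
  define k where "k = Suc (degree p + degree q)"
  have deg: "degree p < 2 * k" "degree q < 2 * k" by (auto simp: k_def)
  let ?A = "\<Lambda> ^^ k" and ?e = "\<Psi> e0 ei E" and ?g = "\<Psi> g0 gi G"
  note ce = commuting_\<Psi>[OF E, of e0 ei] and cg = commuting_\<Psi>[OF G, of g0 gi]
  have cA: "commuting ?A" by (rule commuting_funpow[OF commuting_\<Lambda>])
  have eA: "?A (\<Psi> a b F x) = \<Psi> a b F (?A x)" if "holo_N0 \<theta> F" for a b F x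
  proof -
    have "\<Lambda> (\<Psi> a b F x) = \<Psi> a b F (\<Lambda> x)" for x
      by (simp add: \<Psi>_def linear_add[OF linear_\<Lambda>] linear_scale[OF linear_\<Lambda>] \<Phi>_\<Lambda>(1)[OF \<theta> \<phi> that])
    then show ?thesis by (induction k) auto
  qed
  have pr: "pT p (?A (?e x)) = pT q (?A (?g x))" for x
    by (rule \<Psi>_product_rule[OF E G deg eq])
  have AD: "?A x \<in> Dn (degree p)" "?A x \<in> Dn (degree q)" for x
    by (rule Dn_mono[OF \<Lambda>pow_Dn], use deg in simp)+
  \<comment> \<open>Here u is only assumed to be in the domain of q[T]. The polynomial p[T] acts
    solely on vectors in the range of \<Lambda>^k, so no regularity with respect to p is
    presupposed.\<close>
  have key: "?A (?g (pT q u)) = ?e (pT p (?A u))"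
  proof -
    have "?A (?g (pT q u)) = ?g (?A (pT q u))" by (rule eA[OF G])
    also have "\<dots> = ?g (pT q (?A u))" by (simp only: commuting_pT[OF cA u order_refl])
    also have "\<dots> = pT q (?g (?A u))" by (simp only: commuting_pT[OF cg AD(2) order_refl])
    also have "\<dots> = pT q (?A (?g u))" by (simp only: eA[OF G])
    also have "\<dots> = pT p (?A (?e u))" by (rule pr[symmetric])
    also have "\<dots> = pT p (?e (?A u))" by (simp only: eA[OF E])
    also have "\<dots> = ?e (pT p (?A u))" by (rule commuting_pT[OF ce AD(1) order_refl])
    finally show ?thesis .
  qed
  show ?thesis
  proof
    assume "?e w = ?g (pT q u)"
    then have "?e (?A w) = ?e (pT p (?A u))" using key eA[OF E] by metis
    then have Aw: "?A w = pT p (?A u)" using inj by (rule injD[rotated])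
    \<comment> \<open>The vector \<Lambda>^k w has 2k degrees of regularity, so \<Lambda>^k u has 2k
      more than p[T] requires. Applying (1 + T^2)^k strips \<Lambda>^k off and leaves u in the
      domain of p[T].\<close>
    then have "pT p (?A u) \<in> Dn (2 * k)" using \<Lambda>pow_Dn by metis
    then have "?A u \<in> Dn (degree p + 2 * k)" by (rule Dn_of_pT_Dn[OF p AD(1)])
    then have "pT ([:1, 0, 1:] ^ k) (?A u) \<in> Dn (degree p)"
      by (intro pT_Dn[of _ "2 * k"]) (simp_all add: add.commute order_trans[OF degree_power_le])
    then have uD: "u \<in> Dn (degree p)" by (simp only: pT_w_\<Lambda>pow)
    have "?A w = ?A (pT p u)" unfolding Aw by (rule commuting_pT[OF cA uD order_refl])
    then show "u \<in> Dn (degree p) \<and> w = pT p u" using uD inj_\<Lambda>pow by blast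
  next
    assume uw: "u \<in> Dn (degree p) \<and> w = pT p u"
    then have "?A (?e w) = ?e (pT p (?A u))"
      unfolding eA[OF E] using commuting_pT[OF cA _ order_refl] by metis
    then have "?A (?e w) = ?A (?g (pT q u))" by (simp only: key)
    then show "?e w = ?g (pT q u)" by (rule inj_\<Lambda>pow)
  qed
qed

text \<open>This is the product rule for (1 + z^2)^k times lam^k = 1, where the constant 1 on the
  right has the components 1, 1 and 0. Thus the operator of lam^k determines \<Lambda>^(k+1) v, and
  thereby v.\<close>

lemma \<Psi>_lam_power_injective:
  assumes E: "holo_N0 \<theta> E"
    and eq: "\<And>z. z \<in> csector \<theta> \<Longrightarrow> of_real ei + of_real (e0 - ei) * lam z + E z = lam z ^ k"
  shows "inj (\<Psi> e0 ei E)"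
proof (rule injI)
  let ?w = "[:1, 0, 1::real:] ^ k"
  have d: "degree ?w < 2 * Suc k" "degree (1 :: real poly) < 2 * Suc k"
    using degree_power_le[of "[:1, 0, 1::real:]" k] by simp_all
  have *: "pT ?w ((\<Lambda> ^^ Suc k) (\<Psi> e0 ei E v)) = pT 1 ((\<Lambda> ^^ Suc k) (\<Psi> 1 1 (\<lambda>z. 0) v))" for v
  proof (rule \<Psi>_product_rule[OF E holo_N0_zero[OF \<theta>_pos \<theta>] d])
    fix z assume z: "z \<in> csector \<theta>"
    then have "1 + z\<^sup>2 \<noteq> 0" using csector_mem_closed one_plus_square_nonzero by blast
    then have "(1 + z * z) * lam z = 1" by (simp add: lam_def power2_eq_square)
    then have "cpoly ?w z * lam z ^ k = 1" by (simp add: cpoly_power power_mult_distrib[symmetric] mult.commute)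
    then show "cpoly ?w z * (of_real ei + of_real (e0 - ei) * lam z + E z) = cpoly 1 z * (of_real 1 + of_real (1 - 1) * lam z + 0)"
      by (simp only: eq[OF z]) simp
  qed
  have z: "\<Phi> \<phi> (\<lambda>z. 0) v = 0" for v
    using \<Phi>_scale[OF \<theta> \<phi> holo_N0_base[OF \<theta>_pos \<theta>], of 0 v] by simp
  fix u v assume "\<Psi> e0 ei E u = \<Psi> e0 ei E v"
  then have "(\<Lambda> ^^ Suc k) u = (\<Lambda> ^^ Suc k) v"
    using *[of u] *[of v] by (simp add: \<Psi>_def z del: funpow.simps)
  then show "u = v" by (rule inj_\<Lambda>pow)
qed

end

end

section \<open>The left multiplication\<close>

lemma
  fixes a b :: "'n::{finite,linorder} clifford" and v w :: "'v::real_vector^('n set)"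
  shows lmult_add_left: "lmult (a + b) v = lmult a v + lmult b v"
    and lmult_scaleR_left: "lmult (r *\<^sub>R a) v = r *\<^sub>R lmult a v"
    and lmult_add_right: "lmult a (v + w) = lmult a v + lmult a w"
    and lmult_scaleR_right: "lmult a (r *\<^sub>R v) = r *\<^sub>R lmult a v"
proof -
  have axis: "axis A (x + y) = axis A x + axis A y" "axis A (t *\<^sub>R x) = t *\<^sub>R axis A x"
    for A :: "'n set" and x y :: 'v and t :: real
    by (simp_all add: axis_def vec_eq_iff)
  show "lmult (a + b) v = lmult a v + lmult b v" "lmult a (v + w) = lmult a v + lmult a w"
    by (simp_all add: lmult_def axis distrib_left scaleR_add_left scaleR_add_right sum.distrib)
  show "lmult (r *\<^sub>R a) v = r *\<^sub>R lmult a v" "lmult a (r *\<^sub>R v) = r *\<^sub>R lmult a v"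
    by (simp_all add: lmult_def axis scaleR_sum_right mult_ac)
qed

lemma vec_expansion: "v = (\<Sum>A\<in>UNIV. axis A (v $ A))" for v :: "'v::real_vector^'m"
  by (simp add: vec_eq_iff axis_def)

lemma lmult_basis_axis:
  "lmult (cl_basis A) (axis B x) = axis (sym_diff A B) (cl_sign A B *\<^sub>R x)"
proof -
  have "lmult (cl_basis A) (axis B x) = (\<Sum>A'\<in>UNIV. \<Sum>B'\<in>UNIV.
     if A' = A then if B' = B then axis (sym_diff A B) (cl_sign A B *\<^sub>R x) else 0 else 0)"
    unfolding lmult_def by (intro sum.cong refl) (auto simp: axis_def vec_eq_iff)
  also have "\<dots> = (\<Sum>A'\<in>UNIV. if A' = A then axis (sym_diff A B) (cl_sign A B *\<^sub>R x) else 0)"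
    by (intro sum.cong refl) auto
  finally show ?thesis by simp
qed

lemma linear_lmult_right: "linear (lmult a)"
  by (intro linearI lmult_add_right lmult_scaleR_right)

lemma linear_lmult_left: "linear (\<lambda>a. lmult a v)"
  by (intro linearI lmult_add_left lmult_scaleR_left)

text \<open>By linearity it suffices to treat basis elements, where the claim is the cocycle
  identity of the signs.\<close>

lemma lmult_lmult: "lmult a (lmult b v) = lmult (a * b) v"
proof -
  have axis: "axis C (r *\<^sub>R x) = r *\<^sub>R axis C x" for C :: "'b set" and r and x :: 'a
    by (simp add: axis_def vec_eq_iff)
  have basis: "lmult (cl_basis A) (lmult (cl_basis B) (axis C x)) = lmult (cl_basis A * cl_basis B) (axis C x)"
    for A B C :: "'b set" and x :: 'a
  proof -
    have "sym_diff (sym_diff A B) C = sym_diff A (sym_diff B C)" by auto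
    then show ?thesis
      by (simp only: cl_basis_mult lmult_scaleR_left lmult_basis_axis axis lmult_scaleR_right scaleR_scaleR
          cl_sign_cocycle mult.commute)
  qed
  have "lmult (\<Sum>A\<in>UNIV. cl_coeff a A *\<^sub>R cl_basis A) (lmult (\<Sum>A\<in>UNIV. cl_coeff b A *\<^sub>R cl_basis A) (\<Sum>A\<in>UNIV. axis A (v $ A)))
     = lmult ((\<Sum>A\<in>UNIV. cl_coeff a A *\<^sub>R cl_basis A) * (\<Sum>A\<in>UNIV. cl_coeff b A *\<^sub>R cl_basis A)) (\<Sum>A\<in>UNIV. axis A (v $ A))"
    by (simp only: linear_sum[OF linear_lmult_left] linear_sum[OF linear_lmult_right] cl_mult_sum cl_mult_scaleR
        lmult_scaleR_left lmult_scaleR_right basis)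
  then show ?thesis by (simp flip: cl_expansion vec_expansion)
qed

lemma lmult_of_real [simp]: "lmult (of_real r) v = r *\<^sub>R v"
proof -
  have "lmult (of_real r) v = r *\<^sub>R lmult (cl_basis {}) (\<Sum>A\<in>UNIV. axis A (v $ A))"
    by (simp add: of_real_def one_clifford_def lmult_scaleR_left flip: vec_expansion)
  also have "\<dots> = r *\<^sub>R v"
    by (simp only: linear_sum[OF linear_lmult_right] lmult_basis_axis) (simp flip: vec_expansion)
  finally show ?thesis .
qed

lemma rmult_of_real:
  fixes v :: "'v::real_vector^('n::{finite,linorder} set)"
  shows "rmult v (of_real r) = r *\<^sub>R v"
proof -
  have "rmult v (of_real r) = (\<Sum>A\<in>UNIV. \<Sum>B\<in>(UNIV :: 'n set set). if B = {} then r *\<^sub>R axis A (v $ A) else 0)"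
    unfolding rmult_def
  proof (intro sum.cong refl)
    fix A B :: "'n set"
    show "axis (sym_diff A B) ((cl_sign A B * cl_coeff (of_real r) B) *\<^sub>R v $ A) = (if B = {} then r *\<^sub>R axis A (v $ A) else 0)"
      by (cases "B = {}") (auto simp: of_real_def cl_coeff_one axis_def vec_eq_iff)
  qed
  also have "\<dots> = r *\<^sub>R (\<Sum>A\<in>UNIV. axis A (v $ A))" by (simp add: scaleR_sum_right)
  finally show ?thesis by (simp flip: vec_expansion)
qed

lemma abs_cl_sign [simp]: "\<bar>cl_sign A B\<bar> = 1"
  unfolding cl_sign_def abs_prod by (auto intro!: prod.neutral)

lemma norm_axis_le: "norm (axis i x) \<le> norm x" for x :: "'v::real_normed_vector"
proof -
  have "norm (axis i x) \<le> (\<Sum>j\<in>UNIV. norm (axis i x $ j))"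
    unfolding norm_vec_def by (rule L2_set_le_sum) simp
  also have "\<dots> = (\<Sum>j\<in>UNIV. if j = i then norm x else 0)"
    by (intro sum.cong refl) (simp add: axis_def)
  finally show ?thesis by simp
qed

lemma bounded_bilinear_lmult:
  "bounded_bilinear (lmult :: 'n::{finite,linorder} clifford \<Rightarrow> 'v::real_normed_vector^('n set) \<Rightarrow> _)"
proof
  let ?n = "real (card (UNIV :: 'n set set))"
  have "norm (lmult a v) \<le> norm a * norm v * (?n * ?n)" for a :: "'n clifford" and v :: "'v^('n set)"
  proof -
    have "norm (lmult a v) \<le> (\<Sum>A\<in>UNIV. \<Sum>B\<in>UNIV. norm (axis (sym_diff A B) ((cl_sign A B * cl_coeff a A) *\<^sub>R (v $ B)) :: 'v^('n set)))"
      unfolding lmult_def by (intro order_trans[OF norm_sum] sum_mono norm_sum)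
    also have "\<dots> \<le> (\<Sum>A\<in>(UNIV :: 'n set set). \<Sum>B\<in>(UNIV :: 'n set set). norm a * norm v)"
    proof (intro sum_mono order_trans[OF norm_axis_le])
      fix A B :: "'n set"
      have "norm ((cl_sign A B * cl_coeff a A) *\<^sub>R (v $ B)) = \<bar>cl_coeff a A\<bar> * norm (v $ B)"
        by (simp add: abs_mult)
      also have "\<dots> \<le> norm a * norm v"
        by (intro mult_mono abs_cl_coeff_le Finite_Cartesian_Product.norm_nth_le) auto
      finally show "norm ((cl_sign A B * cl_coeff a A) *\<^sub>R (v $ B)) \<le> norm a * norm v" .
    qed
    finally show ?thesis by (simp add: mult_ac)
  qed
  then show "\<exists>K. \<forall>(a :: 'n clifford) (v :: 'v^('n set)). norm (lmult a v) \<le> norm a * norm v * K" by blast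
qed (rule lmult_add_left lmult_add_right lmult_scaleR_left lmult_scaleR_right)+

section \<open>Partial maps\<close>

lemma map_comp_eq_Some: "(f \<circ>\<^sub>m g) x = Some z \<longleftrightarrow> (\<exists>y. g x = Some y \<and> f y = Some z)"
  by (auto simp: map_comp_Some_iff)

lemma op_inv_eq_Some:
  assumes "inj_on A (dom A)"
  shows "op_inv A w = Some v \<longleftrightarrow> A v = Some w"
proof -
  have u: "v = v'" if "A v = Some w" "A v' = Some w" for v v'
    using inj_onD[OF assms, of v v'] that by (simp add: domI)
  show ?thesis
  proof
    assume "A v = Some w"
    then have "\<exists>!v. A v = Some w" "(THE v. A v = Some w) = v" using u by blast+
    then show "op_inv A w = Some v" by (simp add: op_inv_def)
  next
    assume *: "op_inv A w = Some v"
    then have ex: "\<exists>!v. A v = Some w" by (auto simp: op_inv_def split: if_splits)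
    with * have "v = (THE v. A v = Some w)" by (simp add: op_inv_def)
    then show "A v = Some w" using theI'[OF ex] by simp
  qed
qed

lemma right_linear_opD:
  assumes "right_linear_op A"
  shows "subspace (dom A)"
    and "v \<in> dom A \<Longrightarrow> w \<in> dom A \<Longrightarrow> the (A (v + w)) = the (A v) + the (A w)"
    and "v \<in> dom A \<Longrightarrow> the (A (r *\<^sub>R v)) = r *\<^sub>R the (A v)"
proof -
  show "subspace (dom A)" using assms by (simp add: right_linear_op_def)
  show "v \<in> dom A \<Longrightarrow> w \<in> dom A \<Longrightarrow> the (A (v + w)) = the (A v) + the (A w)"
    using assms unfolding right_linear_op_def by (metis option.sel)
  assume "v \<in> dom A"
  then have "A (rmult v (of_real r)) = Some (rmult (the (A v)) (of_real r))"
    using assms unfolding right_linear_op_def by blast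
  then show "the (A (r *\<^sub>R v)) = r *\<^sub>R the (A v)" by (simp add: rmult_of_real)
qed

lemma option_eqI: "(\<And>w. a = Some w \<longleftrightarrow> b = Some w) \<Longrightarrow> a = b"
  by (cases a; cases b) auto

lemma Q_op_eq_Some:
  "Q_op s T v = Some w \<longleftrightarrow> v \<in> dom T \<and> the (T v) \<in> dom T \<and>
     w = the (T (the (T v))) - (2 * cl_re s) *\<^sub>R the (T v) + (norm s)\<^sup>2 *\<^sub>R v"
proof (cases "T v")
  case None
  then show ?thesis by (simp add: Q_op_def op_add_def op_diff_def map_comp_def dom_def)
next
  case (Some u)
  then show ?thesis
    by (cases "T u") (auto simp: Q_op_def op_add_def op_diff_def map_comp_def dom_def cl_op_def
        simp del: of_real_mult of_real_power)
qed

text \<open>The unit J is a parameter so that it can be instantiated by the one selected in the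
  definition of the calculus. The inverses of Q_s[T] are needed only for s in the slice of
  J.\<close>

locale bisectorial_op =
  fixes T :: "('v::banach, 'n::{finite,linorder}) operator" and \<omega> :: real and J :: "'n clifford"
  assumes angle: "0 < \<omega>" "\<omega> < pi/2" and T: "T \<in> closed_ops" and bis: "bisectorial \<omega> T"
    and J: "J \<in> imag_sphere"
begin

definition QiT :: "complex \<Rightarrow> 'v^('n set) \<Rightarrow> 'v^('n set)" where
  "QiT z v = the (op_inv (Q_op (cl_of J z) T) v)"

lemma resolvent_mem:
  assumes "z \<notin> closed_csector \<omega>" shows "cl_of J z \<in> S_resolvent_set T"
proof -
  have "cl_of J z \<notin> closure (bisector \<omega>)" using assms by (simp add: cl_of_in_closure_bisector[OF angle J])
  then show ?thesis
    using bis cl_of_paravector[OF J, of z] unfolding bisectorial_def S_spectrum_def by blast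
qed

lemma QiT_Some:
  assumes "z \<notin> closed_csector \<omega>"
  shows "op_inv (Q_op (cl_of J z) T) v = Some (QiT z v)" "Q_op (cl_of J z) T (QiT z v) = Some v"
proof -
  have i: "inj_on (Q_op (cl_of J z) T) (dom (Q_op (cl_of J z) T))"
    and b: "op_inv (Q_op (cl_of J z) T) \<in> bounded_ops"
    using resolvent_mem[OF assms] by (auto simp: S_resolvent_set_def)
  have "dom (op_inv (Q_op (cl_of J z) T)) = UNIV" using b by (auto simp: bounded_ops_def op_bound_def)
  then show 1: "op_inv (Q_op (cl_of J z) T) v = Some (QiT z v)"
    unfolding QiT_def by (metis UNIV_I domD option.sel)
  then show "Q_op (cl_of J z) T (QiT z v) = Some v" by (simp add: op_inv_eq_Some[OF i])
qed

lemma linear_QiT: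
  assumes "z \<notin> closed_csector \<omega>" shows "linear (QiT z)"
proof -
  have r: "right_linear_op (op_inv (Q_op (cl_of J z) T))" and d: "dom (op_inv (Q_op (cl_of J z) T)) = UNIV"
    using resolvent_mem[OF assms] by (auto simp: S_resolvent_set_def bounded_ops_def op_bound_def)
  show ?thesis unfolding QiT_def using right_linear_opD(2,3)[OF r] by (intro linearI) (simp_all add: d)
qed

lemma QiT_cnj: "QiT (cnj z) = QiT z"
proof -
  have "Q_op (cl_of J (cnj z)) T v = Q_op (cl_of J z) T v" for v
    by (rule option_eqI) (simp add: Q_op_eq_Some cl_re_cl_of J norm_cl_of)
  then have "Q_op (cl_of J (cnj z)) T = Q_op (cl_of J z) T" by blast
  then show ?thesis by (simp add: QiT_def[abs_def])
qed

end

text \<open>Outside the sector the imaginary part controls the modulus. This permits division by Im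
  z where the difference of conjugate points appears.\<close>

lemma cmod_le_Im:
  assumes "0 < \<phi>" "\<phi> < pi/2" "z \<notin> csector \<phi>"
  shows "cmod z \<le> (1 / tan \<phi> + 1) * \<bar>Im z\<bar>"
proof -
  have t: "0 < tan \<phi>" using assms by (simp add: tan_gt_zero)
  have "tan \<phi> * \<bar>Re z\<bar> \<le> \<bar>Im z\<bar>" using assms(3) by (simp add: csector_def)
  then have "\<bar>Re z\<bar> \<le> 1 / tan \<phi> * \<bar>Im z\<bar>" using t by (simp add: field_simps)
  then show ?thesis using cmod_le[of z] by (simp add: distrib_right)
qed

lemma vector_derivative_gamma:
  assumes "0 < t"
  shows "vector_derivative (gamma \<sigma> \<phi> J) (at t) = \<sigma> *\<^sub>R cl_exp J (- \<phi>)"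
    and "vector_derivative (gamma \<sigma> \<phi> J) (at (- t)) = - \<sigma> *\<^sub>R cl_exp J \<phi>"
proof -
  have d: "((\<lambda>u. u *\<^sub>R c) has_vector_derivative c) (at u)" for u and c :: "'a clifford"
    unfolding has_vector_derivative_def by (intro bounded_linear_imp_has_derivative bounded_linear_scaleR_left)
  have "(gamma \<sigma> \<phi> J has_vector_derivative \<sigma> *\<^sub>R cl_exp J (- \<phi>)) (at t)"
    by (rule has_vector_derivative_transform_within_open[OF d, of "{0<..}"])
       (use assms in \<open>auto simp: gamma_def mult.commute\<close>)
  then show "vector_derivative (gamma \<sigma> \<phi> J) (at t) = \<sigma> *\<^sub>R cl_exp J (- \<phi>)"
    by (rule vector_derivative_at)
  have "(gamma \<sigma> \<phi> J has_vector_derivative - \<sigma> *\<^sub>R cl_exp J \<phi>) (at (- t))"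
    by (rule has_vector_derivative_transform_within_open[OF d, of "{..<0}"])
       (use assms in \<open>auto simp: gamma_def mult.commute\<close>)
  then show "vector_derivative (gamma \<sigma> \<phi> J) (at (- t)) = - \<sigma> *\<^sub>R cl_exp J \<phi>"
    by (rule vector_derivative_at)
qed

lemma gamma_eq_cl_of:
  assumes "0 < t"
  shows "gamma \<sigma> \<phi> J t = cl_of J (rcis (\<sigma> * t) (- \<phi>))" "gamma \<sigma> \<phi> J (- t) = cl_of J (rcis (\<sigma> * t) \<phi>)"
  using assms by (simp_all add: gamma_def scaleR_cl_exp)

section \<open>The Clifford integral as a ray integral\<close>

context bisectorial_op
begin

abbreviation \<tau>T :: "'v^('n set) \<Rightarrow> 'v^('n set)" where
  "\<tau>T v \<equiv> the (T v)"

lemma right_linear_T: "right_linear_op T"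
  using T by (simp add: closed_ops_def)

lemma QiT_props:
  assumes "z \<notin> closed_csector \<omega>"
  shows "QiT z v \<in> dom T" "\<tau>T (QiT z v) \<in> dom T"
    "\<tau>T (\<tau>T (QiT z v)) - (2 * Re z) *\<^sub>R \<tau>T (QiT z v) + (cmod z)\<^sup>2 *\<^sub>R QiT z v = v"
  using QiT_Some(2)[OF assms, of v] unfolding Q_op_eq_Some by (auto simp: cl_re_cl_of J norm_cl_of)

lemma QiT_unique:
  assumes z: "z \<notin> closed_csector \<omega>" and u: "u \<in> dom T" "\<tau>T u \<in> dom T"
  shows "QiT z (\<tau>T (\<tau>T u) - (2 * Re z) *\<^sub>R \<tau>T u + (cmod z)\<^sup>2 *\<^sub>R u) = u"
proof -
  let ?w = "\<tau>T (\<tau>T u) - (2 * Re z) *\<^sub>R \<tau>T u + (cmod z)\<^sup>2 *\<^sub>R u"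
  have i: "inj_on (Q_op (cl_of J z) T) (dom (Q_op (cl_of J z) T))"
    using resolvent_mem[OF z] by (auto simp: S_resolvent_set_def)
  have "Q_op (cl_of J z) T u = Some ?w"
    using u by (simp add: Q_op_eq_Some cl_re_cl_of J norm_cl_of)
  then have "op_inv (Q_op (cl_of J z) T) ?w = Some u" by (simp add: op_inv_eq_Some[OF i])
  then show ?thesis by (simp add: QiT_def)
qed

definition SLz :: "complex \<Rightarrow> 'v^('n set) \<Rightarrow> 'v^('n set)" where
  "SLz z v = QiT z (lmult (cl_of J (cnj z)) v) - \<tau>T (QiT z v)"

lemma SL_resolvent_eq:
  assumes z: "z \<notin> closed_csector \<omega>"
  shows "SL_resolvent (cl_of J z) T v = Some (SLz z v)"
proof -
  obtain w where "T (QiT z v) = Some w" using QiT_props(1)[OF z, of v] by blast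
  then show ?thesis
    by (simp add: SL_resolvent_def op_diff_def map_comp_def QiT_Some(1)[OF z] cl_op_def cl_conj_cl_of J SLz_def dom_def)
qed

lemma SLz_bound:
  assumes \<phi>: "\<phi> \<in> {\<omega><..<pi/2}"
  obtains C where "0 \<le> C" "\<And>z v. z \<notin> csector \<phi> \<Longrightarrow> z \<noteq> 0 \<Longrightarrow> norm (SLz z v) \<le> C / cmod z * norm v"
proof -
  from bis have "\<forall>\<phi>\<in>{\<omega><..<pi/2}. \<exists>C\<ge>0. \<forall>s \<in> paravectors - (bisector \<phi> \<union> {0}). op_bound (SL_resolvent s T) (C / norm s)"
    unfolding bisectorial_def by (rule conjunct2)
  from bspec[OF this \<phi>] obtain C where C: "0 \<le> C"
    "\<And>s. s \<in> paravectors - (bisector \<phi> \<union> {0}) \<Longrightarrow> op_bound (SL_resolvent s T) (C / norm s)"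
    by blast
  have "norm (SLz z v) \<le> C / cmod z * norm v" if z: "z \<notin> csector \<phi>" "z \<noteq> 0" for z v
  proof -
    have "cl_of J z \<notin> bisector \<phi>" using z \<phi> angle by (simp add: cl_of_in_bisector[OF _ _ J])
    moreover have "cl_of J z \<noteq> 0" using z(2) norm_cl_of[OF J, of z] by auto
    ultimately have "op_bound (SL_resolvent (cl_of J z) T) (C / cmod z)"
      using C(2)[of "cl_of J z"] by (simp add: cl_of_paravector[OF J] norm_cl_of[OF J])
    then have "norm (the (SL_resolvent (cl_of J z) T v)) \<le> C / cmod z * norm v"
      unfolding op_bound_def by blast
    moreover have "z \<notin> closed_csector \<omega>" using not_csector_imp_not_closed[OF angle(1) _ _ z] \<phi> by simp
    ultimately show ?thesis by (simp add: SL_resolvent_eq)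
  qed
  then show ?thesis using that C(1) by blast
qed

text \<open>The bounds on \<open>Q_s[T]\<^sup>-\<^sup>1\<close> and \<open>TQ_s[T]\<^sup>-\<^sup>1\<close> come from combining the
  bounds on the left resolvent at \<open>s\<close> and at its conjugate.\<close>

lemma QiT_bound:
  assumes \<phi>: "\<phi> \<in> {\<omega><..<pi/2}"
  shows "\<exists>C\<ge>0. \<forall>z v. z \<notin> csector \<phi> \<longrightarrow> z \<noteq> 0 \<longrightarrow>
       norm (QiT z v) \<le> C / (cmod z)\<^sup>2 * norm v \<and> norm (\<tau>T (QiT z v)) \<le> C / cmod z * norm v"
proof -
  obtain C where C: "0 \<le> C" "\<And>z v. z \<notin> csector \<phi> \<Longrightarrow> z \<noteq> 0 \<Longrightarrow> norm (SLz z v) \<le> C / cmod z * norm v"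
    using SLz_bound[OF \<phi>] by blast
  have t: "0 < tan \<phi>" using \<phi> angle by (simp add: tan_gt_zero)
  define c where "c = 1 / tan \<phi> + 1"
  have c: "1 \<le> c" using t by (simp add: c_def)
  obtain K where K: "0 \<le> K" "\<And>v :: 'v^('n set). norm (lmult J v) \<le> norm v * K"
    using bounded_linear.nonneg_bounded[OF bounded_bilinear.bounded_linear_right[OF bounded_bilinear_lmult, of J]] by blast
  have main: "norm (QiT z v) \<le> (c * C * K) / (cmod z)\<^sup>2 * norm v \<and> norm (\<tau>T (QiT z v)) \<le> (C + c * C * K) / cmod z * norm v"
    if z: "z \<notin> csector \<phi>" "z \<noteq> 0" for z v
  proof -
    have zc: "cnj z \<notin> csector \<phi>" "cnj z \<noteq> 0" using z by simp_all
    have zo: "z \<notin> closed_csector \<omega>" using not_csector_imp_not_closed[OF angle(1) _ _ z] \<phi> by simp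
    interpret Q: linear "QiT z" by (rule linear_QiT[OF zo])
    have Im: "cmod z \<le> c * \<bar>Im z\<bar>" unfolding c_def using cmod_le_Im[OF _ _ z(1)] \<phi> angle by simp
    have SL: "SLz z u = QiT z (lmult (cl_of J (cnj z)) u) - \<tau>T (QiT z u)"
      "SLz (cnj z) u = QiT z (lmult (cl_of J z) u) - \<tau>T (QiT z u)" for u
      by (simp_all add: SLz_def QiT_cnj)
    \<comment> \<open>\<open>QiT z\<close> is only real linear with respect to scalars acting from
      the left. Inserting J turns the difference of the conjugate points into the real number -2 Im
      z, which can be taken out, and isolates \<open>QiT z\<close>.\<close>
    have "cl_of J z * J - cl_of J (cnj z) * J = cl_of J (z * \<i> - cnj z * \<i>)"
      by (simp add: cl_of_mult[OF J] cl_of_diff)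
    also have "z * \<i> - cnj z * \<i> = of_real (- 2 * Im z)" by (simp add: complex_eq_iff)
    finally have sJ: "cl_of J z * J - cl_of J (cnj z) * J = of_real (- 2 * Im z)" by (simp only: cl_of_of_real)
    have "SLz (cnj z) (lmult J v) - SLz z (lmult J v) = QiT z (lmult (cl_of J z * J) v - lmult (cl_of J (cnj z) * J) v)"
      by (simp add: SL Q.diff lmult_lmult)
    also have "lmult (cl_of J z * J) v - lmult (cl_of J (cnj z) * J) v = lmult (cl_of J z * J - cl_of J (cnj z) * J) v"
      by (rule bounded_bilinear.diff_left[OF bounded_bilinear_lmult, symmetric])
    also have "QiT z \<dots> = (- 2 * Im z) *\<^sub>R QiT z v"
      unfolding sJ lmult_of_real by (rule Q.scale)
    finally have "2 * (\<bar>Im z\<bar> * norm (QiT z v)) = norm (SLz (cnj z) (lmult J v) - SLz z (lmult J v))"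
      by (simp add: abs_mult)
    also have "\<dots> \<le> C / cmod z * norm (lmult J v) + C / cmod z * norm (lmult J v)"
      using C(2)[OF zc, of "lmult J v"] C(2)[OF z, of "lmult J v"] by (intro norm_triangle_le_diff add_mono) simp_all
    also have "\<dots> = 2 * (C / cmod z * norm (lmult J v))" by simp
    finally have "\<bar>Im z\<bar> * norm (QiT z v) \<le> C / cmod z * norm (lmult J v)" by simp
    also have "\<dots> \<le> C / cmod z * (norm v * K)" using C(1) K(2) by (intro mult_left_mono) auto
    finally have "c * (\<bar>Im z\<bar> * norm (QiT z v)) \<le> c * (C / cmod z * (norm v * K))"
      using c by (intro mult_left_mono) auto
    moreover have "cmod z * norm (QiT z v) \<le> (c * \<bar>Im z\<bar>) * norm (QiT z v)"
      by (rule mult_right_mono[OF Im norm_ge_zero])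
    ultimately have zQ: "cmod z * norm (QiT z v) \<le> (c * C * K) / cmod z * norm v" by (simp add: mult_ac)
    then have "norm (QiT z v) \<le> (c * C * K) / cmod z * norm v / cmod z"
      using z(2) by (simp add: le_divide_eq mult.commute)
    then have 1: "norm (QiT z v) \<le> (c * C * K) / (cmod z)\<^sup>2 * norm v" by (simp add: power2_eq_square)
    \<comment> \<open>For the sum of the resolvents no factor J is needed, as s plus its conjugate
      is already real. The known bound on \<open>QiT z\<close> then leaves that on T
      \<open>QiT z\<close>.\<close>
    have "cl_of J z + cl_of J (cnj z) = cl_of J (z + cnj z)" by (simp only: cl_of_add)
    also have "z + cnj z = of_real (2 * Re z)" by (simp add: complex_eq_iff)
    finally have s2: "cl_of J z + cl_of J (cnj z) = of_real (2 * Re z)" by (simp only: cl_of_of_real)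
    have "QiT z (lmult (cl_of J z) v) + QiT z (lmult (cl_of J (cnj z)) v) = QiT z (lmult (cl_of J z + cl_of J (cnj z)) v)"
      by (simp only: Q.add lmult_add_left)
    also have "\<dots> = (2 * Re z) *\<^sub>R QiT z v" unfolding s2 lmult_of_real by (rule Q.scale)
    finally have "SLz (cnj z) v + SLz z v = (2 * Re z) *\<^sub>R QiT z v - 2 *\<^sub>R \<tau>T (QiT z v)"
      by (simp add: SL scaleR_2 algebra_simps)
    then have "2 *\<^sub>R \<tau>T (QiT z v) = (2 * Re z) *\<^sub>R QiT z v - (SLz (cnj z) v + SLz z v)" by simp
    then have "2 * norm (\<tau>T (QiT z v)) = norm ((2 * Re z) *\<^sub>R QiT z v - (SLz (cnj z) v + SLz z v))"
      by (metis norm_scaleR abs_numeral)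
    also have "\<dots> \<le> 2 * \<bar>Re z\<bar> * norm (QiT z v) + (C / cmod z * norm v + C / cmod z * norm v)"
      using C(2)[OF zc, of v] C(2)[OF z, of v]
      by (intro order_trans[OF norm_triangle_ineq4] add_mono order_trans[OF norm_triangle_ineq]) simp_all
    finally have "norm (\<tau>T (QiT z v)) \<le> \<bar>Re z\<bar> * norm (QiT z v) + C / cmod z * norm v" by simp
    also have "\<bar>Re z\<bar> * norm (QiT z v) \<le> cmod z * norm (QiT z v)"
      by (intro mult_right_mono abs_Re_le_cmod) simp
    also note zQ
    finally have "norm (\<tau>T (QiT z v)) \<le> (C + c * C * K) / cmod z * norm v"
      by (simp add: add_divide_distrib distrib_right)
    with 1 show ?thesis by blast
  qed
  have "0 \<le> c * C * K" using c C(1) K(1) by simp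
  show ?thesis
  proof (intro exI[of _ "C + c * C * K"] conjI allI impI)
    show "0 \<le> C + c * C * K" using C(1) \<open>0 \<le> c * C * K\<close> by simp
    fix z v assume z: "z \<notin> csector \<phi>" "z \<noteq> 0"
    show "norm (\<tau>T (QiT z v)) \<le> (C + c * C * K) / cmod z * norm v" using main[OF z] by blast
    have "(c * C * K) / (cmod z)\<^sup>2 * norm v \<le> (C + c * C * K) / (cmod z)\<^sup>2 * norm v"
      using C(1) by (intro mult_right_mono divide_right_mono) auto
    then show "norm (QiT z v) \<le> (C + c * C * K) / (cmod z)\<^sup>2 * norm v" using main[OF z, of v] by linarith
  qed
qed

sublocale sector_op "dom T" \<tau>T QiT \<omega>
  by unfold_locales
     (use angle right_linear_opD[OF right_linear_T] QiT_props QiT_unique QiT_bound in auto)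

section \<open>The operator valued integrand\<close>

definition inl0 :: "('v^('n set)) \<Rightarrow>\<^sub>L (('v^('n set)) \<times> ('v^('n set)))" where
  "inl0 = Blinfun (\<lambda>u. (u, 0))"

lemma inl0_apply [simp]: "blinfun_apply inl0 u = (u, 0)"
  unfolding inl0_def
  by (subst bounded_linear_Blinfun_apply) (intro bounded_linear_Pair bounded_linear_ident bounded_linear_zero, rule refl)

text \<open>The second component of R(z)(u, 0) is -Im z times \<open>QiT z\<close> u, and the first
  is Re z \<open>QiT z\<close> u - T \<open>QiT z\<close> u. Recovering the operators from
  \<open>RB\<close> in this way passes its norm continuity on to them.\<close>

definition QB :: "complex \<Rightarrow> ('v^('n set)) \<Rightarrow>\<^sub>L ('v^('n set))" where
  "QB z = (- 1 / Im z) *\<^sub>R (snd_blinfun o\<^sub>L (RB z o\<^sub>L inl0))"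

definition PB :: "complex \<Rightarrow> ('v^('n set)) \<Rightarrow>\<^sub>L ('v^('n set))" where
  "PB z = Re z *\<^sub>R QB z - (fst_blinfun o\<^sub>L (RB z o\<^sub>L inl0))"

definition LB :: "complex \<Rightarrow> ('v^('n set)) \<Rightarrow>\<^sub>L ('v^('n set))" where
  "LB c = bounded_bilinear.prod_right lmult (cl_of J c)"

definition SB :: "complex \<Rightarrow> ('v^('n set)) \<Rightarrow>\<^sub>L ('v^('n set))" where
  "SB z = (QB z o\<^sub>L LB (cnj z)) - PB z"

lemma LB_apply [simp]: "blinfun_apply (LB c) v = lmult (cl_of J c) v"
  by (simp add: LB_def bounded_bilinear.prod_right.rep_eq[OF bounded_bilinear_lmult])

lemma bounded_linear_LB: "bounded_linear LB"
  unfolding LB_def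
  by (rule bounded_linear_compose[OF bounded_bilinear.bounded_linear_prod_right[OF bounded_bilinear_lmult] bounded_linear_cl_of])

lemma not_closed_Im: "z \<notin> closed_csector \<phi> \<Longrightarrow> 0 < \<phi> \<Longrightarrow> \<phi> < pi/2 \<Longrightarrow> Im z \<noteq> 0"
  using tan_gt_zero[of \<phi>] by (auto simp: closed_csector_def)

lemma QB_PB_apply:
  assumes \<phi>: "\<phi> \<in> {\<omega><..<pi/2}" and z: "z \<notin> closed_csector \<phi>"
  shows "blinfun_apply (QB z) v = QiT z v" "blinfun_apply (PB z) v = \<tau>T (QiT z v)"
proof -
  have z0: "QiT z 0 = 0" using linear_QiT[OF outside_csector(3)[OF \<phi> z]] by (rule linear_0)
  have "Im z \<noteq> 0" using not_closed_Im[OF z] \<phi> angle by auto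
  then show 1: "blinfun_apply (QB z) v = QiT z v"
    by (simp add: QB_def blinfun.minus_left blinfun.scaleR_left RB_apply[OF \<phi> z] Rz_components z0)
  show "blinfun_apply (PB z) v = \<tau>T (QiT z v)"
    by (simp add: PB_def blinfun.scaleR_left blinfun.diff_left RB_apply[OF \<phi> z] Rz_components z0 1)
qed

lemma SB_apply:
  assumes \<phi>: "\<phi> \<in> {\<omega><..<pi/2}" and z: "z \<notin> closed_csector \<phi>"
  shows "blinfun_apply (SB z) v = SLz z v"
  by (simp add: SB_def blinfun.diff_left QB_PB_apply[OF assms] SLz_def)

lemma continuous_on_SB:
  assumes \<phi>: "\<phi> \<in> {\<omega><..<pi/2}"
  shows "continuous_on (- closed_csector \<phi>) SB"
proof -
  have nz: "\<forall>z\<in>- closed_csector \<phi>. Im z \<noteq> 0" using not_closed_Im \<phi> angle by auto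
  note comp = bounded_bilinear.continuous_on[OF bounded_bilinear_blinfun_compose]
  have QB: "continuous_on (- closed_csector \<phi>) QB"
    unfolding QB_def using nz by (intro comp continuous_intros continuous_on_RB[OF \<phi>]) auto
  have PB: "continuous_on (- closed_csector \<phi>) PB"
    unfolding PB_def by (intro comp continuous_intros continuous_on_RB[OF \<phi>] QB)
  show ?thesis
    unfolding SB_def
    by (intro comp continuous_intros QB PB bounded_linear.continuous_on[OF bounded_linear_LB])
qed

definition integrand :: "real \<Rightarrow> real \<Rightarrow> ('n clifford \<Rightarrow> 'n clifford) \<Rightarrow> real \<Rightarrow> ('v^('n set)) \<Rightarrow>\<^sub>L ('v^('n set))" where
  "integrand \<phi> \<sigma> f t = Blinfun (the \<circ> (SL_resolvent (gamma \<sigma> \<phi> J t) T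
       \<circ>\<^sub>m cl_op (vector_derivative (gamma \<sigma> \<phi> J) (at t) / J)
       \<circ>\<^sub>m cl_op (f (gamma \<sigma> \<phi> J t))))"

lemma ray_mem:
  assumes "\<theta> < pi/2" "\<phi> \<in> {\<omega><..<\<theta>}" "\<sigma> \<in> {1, - 1}" "0 < t" "\<psi> \<in> {\<phi>, - \<phi>}"
  shows "rcis (\<sigma> * t) \<psi> \<in> csector \<theta>" "\<alpha> \<in> {\<omega><..<\<phi>} \<Longrightarrow> rcis (\<sigma> * t) \<psi> \<notin> closed_csector \<alpha>"
proof -
  have r: "rcis t \<psi> \<in> csector \<theta>" using assms angle by (intro rcis_in_csector_right) auto
  have m: "rcis (\<sigma> * t) \<psi> = of_real \<sigma> * rcis t \<psi>" by (simp add: rcis_def)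
  show "rcis (\<sigma> * t) \<psi> \<in> csector \<theta>" unfolding m using assms(3) r by auto
  assume \<alpha>: "\<alpha> \<in> {\<omega><..<\<phi>}"
  have "rcis t \<phi> \<notin> closed_csector \<alpha>"
    using assms \<alpha> angle by (intro rcis_not_closed_csector(1)[of \<alpha> \<phi>]) auto
  then show "rcis (\<sigma> * t) \<psi> \<notin> closed_csector \<alpha>"
    unfolding m using assms(3,5) by (auto simp: closed_csector_def)
qed

text \<open>On the contour all Clifford factors lie in the slice of J. They multiply like complex
  numbers, with division by J becoming division by i, and merge into a single left
  multiplication.\<close>

lemma integrand_eq:
  assumes \<theta>: "\<theta> < pi/2" and \<phi>: "\<phi> \<in> {\<omega><..<\<theta>}" and f: "slice_extends \<theta> F f"
    and \<sigma>: "\<sigma> \<in> {1, - 1}" and t: "0 < t"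
  shows "integrand \<phi> \<sigma> f t = SB (rcis (\<sigma> * t) (- \<phi>)) o\<^sub>L LB (of_real \<sigma> * cis (- \<phi>) / \<i> * F (rcis (\<sigma> * t) (- \<phi>)))"
    and "integrand \<phi> \<sigma> f (- t) = SB (rcis (\<sigma> * t) \<phi>) o\<^sub>L LB (- of_real \<sigma> * cis \<phi> / \<i> * F (rcis (\<sigma> * t) \<phi>))"
proof -
  have \<phi>': "\<phi> \<in> {\<omega><..<pi/2}" using \<phi> \<theta> by auto
  obtain \<alpha> where \<alpha>: "\<alpha> \<in> {\<omega><..<pi/2}" "\<alpha> < \<phi>" using mid_angle[OF \<phi>'] .
  have *: "Blinfun (the \<circ> (SL_resolvent (cl_of J z) T \<circ>\<^sub>m cl_op (cl_of J c) \<circ>\<^sub>m cl_op (f (cl_of J z))))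
     = SB z o\<^sub>L LB (c * F z)" if z: "z \<in> csector \<theta>" "z \<notin> closed_csector \<alpha>" for z c
  proof -
    have fz: "f (cl_of J z) = cl_of J (F z)" using f J z(1) by (simp add: slice_extends_def)
    have zo: "z \<notin> closed_csector \<omega>" by (rule outside_csector(3)[OF \<alpha>(1) z(2)])
    have "the ((SL_resolvent (cl_of J z) T \<circ>\<^sub>m cl_op (cl_of J c) \<circ>\<^sub>m cl_op (f (cl_of J z))) v) = blinfun_apply (SB z o\<^sub>L LB (c * F z)) v" for v
      unfolding fz by (simp add: map_comp_def cl_op_def SL_resolvent_eq[OF zo] SB_apply[OF \<alpha>(1) z(2)] lmult_lmult cl_of_mult[OF J])
    then have "the \<circ> (SL_resolvent (cl_of J z) T \<circ>\<^sub>m cl_op (cl_of J c) \<circ>\<^sub>m cl_op (f (cl_of J z))) = blinfun_apply (SB z o\<^sub>L LB (c * F z))"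
      by (simp add: fun_eq_iff)
    then show ?thesis by (simp add: blinfun_apply_inverse)
  qed
  have d: "(\<sigma>' *\<^sub>R cl_exp J \<psi>) / J = cl_of J (of_real \<sigma>' * cis \<psi> / \<i>)" for \<sigma>' \<psi>
  proof -
    have "\<sigma>' *\<^sub>R cl_exp J \<psi> = cl_of J (of_real \<sigma>' * cis \<psi>)" by (simp add: scaleR_cl_exp rcis_def)
    then show ?thesis using cl_of_divide[OF J, of "of_real \<sigma>' * cis \<psi>" \<i>] by simp
  qed
  note m = ray_mem[OF \<theta> \<phi> \<sigma> t]
  have \<alpha>': "\<alpha> \<in> {\<omega><..<\<phi>}" using \<alpha> by auto
  show "integrand \<phi> \<sigma> f t = SB (rcis (\<sigma> * t) (- \<phi>)) o\<^sub>L LB (of_real \<sigma> * cis (- \<phi>) / \<i> * F (rcis (\<sigma> * t) (- \<phi>)))"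
    unfolding integrand_def vector_derivative_gamma(1)[OF t] gamma_eq_cl_of(1)[OF t] d
    by (rule *[OF m(1) m(2)[OF _ \<alpha>']]) simp_all
  show "integrand \<phi> \<sigma> f (- t) = SB (rcis (\<sigma> * t) \<phi>) o\<^sub>L LB (- of_real \<sigma> * cis \<phi> / \<i> * F (rcis (\<sigma> * t) \<phi>))"
    unfolding integrand_def vector_derivative_gamma(2)[OF t] gamma_eq_cl_of(2)[OF t] d of_real_minus
    by (rule *[OF m(1) m(2)[OF _ \<alpha>']]) simp_all
qed

lemma ray_operator_integrable:
  assumes \<theta>: "\<theta> < pi/2" and \<phi>: "\<phi> \<in> {\<omega><..<\<theta>}" and F: "holo_N0 \<theta> F"
    and \<sigma>: "\<sigma> \<in> {1, - 1}" and \<psi>: "\<psi> \<in> {\<phi>, - \<phi>}"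
  shows "(\<lambda>t. SB (rcis (\<sigma> * t) \<psi>) o\<^sub>L LB (c * F (rcis (\<sigma> * t) \<psi>))) integrable_on {0<..}"
proof -
  have \<phi>': "\<phi> \<in> {\<omega><..<pi/2}" using \<phi> \<theta> by auto
  obtain \<alpha> where \<alpha>: "\<alpha> \<in> {\<omega><..<pi/2}" "\<alpha> < \<phi>" using mid_angle[OF \<phi>'] .
  then have \<alpha>': "\<alpha> \<in> {\<omega><..<\<phi>}" by auto
  note m = ray_mem(1)[OF \<theta> \<phi> \<sigma> _ \<psi>] ray_mem(2)[OF \<theta> \<phi> \<sigma> _ \<psi> \<alpha>']
  obtain C where C: "0 \<le> C" "\<And>z v. z \<notin> csector \<alpha> \<Longrightarrow> z \<noteq> 0 \<Longrightarrow> norm (SLz z v) \<le> C / cmod z * norm v"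
    using SLz_bound[OF \<alpha>(1)] by blast
  obtain K where K: "\<And>c. norm (LB c) \<le> norm c * K"
    using bounded_linear.bounded[OF bounded_linear_LB] by blast
  have \<theta>0: "0 < \<theta>" using \<phi> angle by auto
  \<comment> \<open>A negative radius amounts to a shift of the angle by pi. Integrability against
    dt/t is given along rays with positive radius, so the ray is renamed by its actual
    angle.\<close>
  define \<kappa> where "\<kappa> = (if \<sigma> = 1 then \<psi> else \<psi> + pi)"
  have \<kappa>: "\<kappa> \<in> sector_angles \<theta>" "rcis (\<sigma> * t) \<psi> = rcis t \<kappa>" for t
    using \<sigma> \<psi> \<phi> angle by (auto simp: \<kappa>_def sector_angles_def rcis_uminus) (auto simp: rcis_def)
  show ?thesis
  proof (rule dominated_integrable[where g = "\<lambda>t. C * cmod c * K * (cmod (F (rcis t \<kappa>)) / t)"])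
    have rc: "continuous_on {0<..} (\<lambda>t. rcis (\<sigma> * t) \<psi>)" unfolding rcis_def by (intro continuous_intros)
    have F': "continuous_on (csector \<theta>) F"
      using F by (intro holomorphic_on_imp_continuous_on) (simp add: holo_N0_def holo_intrinsic_def)
    have 1: "continuous_on {0<..} (\<lambda>t. F (rcis (\<sigma> * t) \<psi>))"
      by (rule continuous_on_compose2[OF F' rc]) (use m(1) in auto)
    have 2: "continuous_on {0<..} (\<lambda>t. SB (rcis (\<sigma> * t) \<psi>))"
      by (rule continuous_on_compose2[OF continuous_on_SB[OF \<alpha>(1)] rc]) (use m(2) in auto)
    show "continuous_on {0<..} (\<lambda>t. SB (rcis (\<sigma> * t) \<psi>) o\<^sub>L LB (c * F (rcis (\<sigma> * t) \<psi>)))"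
      by (intro bounded_bilinear.continuous_on[OF bounded_bilinear_blinfun_compose] 2
        bounded_linear.continuous_on[OF bounded_linear_LB] continuous_intros 1)
    show "(\<lambda>t. C * cmod c * K * (cmod (F (rcis t \<kappa>)) / t)) integrable_on {0<..}"
      using F \<kappa>(1) by (intro integrable_on_mult_right set_borel_integral_eq_integral(1)) (simp add: holo_N0_def)
    fix t :: real assume t: "0 < t"
    let ?z = "rcis (\<sigma> * t) \<psi>"
    have zn: "cmod ?z = t" using \<sigma> t by auto
    have "norm (SB ?z) \<le> C / t"
    proof (rule norm_blinfun_bound)
      show "0 \<le> C / t" using C(1) t by simp
      show "norm (blinfun_apply (SB ?z) v) \<le> C / t * norm v" for v
        using C(2)[OF outside_csector(1,2)[OF \<alpha>(1) m(2)[OF t]], of v] by (simp only: zn SB_apply[OF \<alpha>(1) m(2)[OF t]])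
    qed
    then have "norm (SB ?z o\<^sub>L LB (c * F ?z)) \<le> C / t * (norm (c * F ?z) * K)"
      using C(1) t by (intro order_trans[OF norm_blinfun_compose] mult_mono K) auto
    then show "norm (SB ?z o\<^sub>L LB (c * F ?z)) \<le> C * cmod c * K * (cmod (F (rcis t \<kappa>)) / t)"
      by (simp add: \<kappa>(2) norm_mult mult_ac)
  qed
qed

text \<open>Q_s[T] is the same at conjugate points. In the sum of the two contributions the left
  factors in front of v combine to the real numbers 2 Re(cnj z c) and 2 Re c, which pass through
  \<open>QiT z\<close> and T. What is left is the real part of c (z - T)^(-1) v.\<close>

lemma SB_conjugate_sum:
  assumes \<alpha>: "\<alpha> \<in> {\<omega><..<pi/2}" and z: "z \<notin> closed_csector \<alpha>"
  shows "blinfun_apply (SB z o\<^sub>L LB c) v + blinfun_apply (SB (cnj z) o\<^sub>L LB (cnj c)) v = 2 *\<^sub>R fst (cact c (Rz z (v, 0)))"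
proof -
  have zc: "cnj z \<notin> closed_csector \<alpha>" using z by (simp add: closed_csector_def)
  have zo: "z \<notin> closed_csector \<omega>" by (rule outside_csector(3)[OF \<alpha> z])
  interpret Q: linear "QiT z" by (rule linear_QiT[OF zo])
  have "lmult (cl_of J (cnj z)) (lmult (cl_of J c) v) + lmult (cl_of J z) (lmult (cl_of J (cnj c)) v)
     = lmult (cl_of J (cnj z * c + z * cnj c)) v"
    by (simp add: lmult_lmult cl_of_mult[OF J] cl_of_add lmult_add_left)
  also have "cnj z * c + z * cnj c = of_real (2 * (Re z * Re c + Im z * Im c))"
    by (simp add: complex_eq_iff)
  finally have a: "lmult (cl_of J (cnj z)) (lmult (cl_of J c) v) + lmult (cl_of J z) (lmult (cl_of J (cnj c)) v)
     = (2 * (Re z * Re c + Im z * Im c)) *\<^sub>R v" by (simp only: cl_of_of_real lmult_of_real)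
  have "lmult (cl_of J c) v + lmult (cl_of J (cnj c)) v = lmult (cl_of J (c + cnj c)) v"
    by (simp add: cl_of_add lmult_add_left)
  also have "c + cnj c = of_real (2 * Re c)" by (simp add: complex_eq_iff)
  finally have b: "lmult (cl_of J c) v + lmult (cl_of J (cnj c)) v = (2 * Re c) *\<^sub>R v" by (simp only: cl_of_of_real lmult_of_real)
  have "blinfun_apply (SB z o\<^sub>L LB c) v + blinfun_apply (SB (cnj z) o\<^sub>L LB (cnj c)) v
     = QiT z (lmult (cl_of J (cnj z)) (lmult (cl_of J c) v) + lmult (cl_of J z) (lmult (cl_of J (cnj c)) v))
       - (\<tau>T (QiT z (lmult (cl_of J c) v)) + \<tau>T (QiT z (lmult (cl_of J (cnj c)) v)))"
    by (simp add: SB_apply[OF \<alpha> z] SB_apply[OF \<alpha> zc] SLz_def QiT_cnj Q.add)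
  also have "\<tau>T (QiT z (lmult (cl_of J c) v)) + \<tau>T (QiT z (lmult (cl_of J (cnj c)) v))
     = \<tau>T (QiT z (lmult (cl_of J c) v + lmult (cl_of J (cnj c)) v))"
    by (simp add: Q.add \<tau>_add Qi_D zo)
  finally show ?thesis
    unfolding a b
    by (simp add: Q.add Q.scale \<tau>_scale Qi_D zo cact_def Rz_components Q.zero algebra_simps)
qed

lemma blinfun_integral_apply:
  assumes "f integrable_on S"
  shows "blinfun_apply (integral S f) v = integral S (\<lambda>t. blinfun_apply (f t) v)" "(\<lambda>t. blinfun_apply (f t) v) integrable_on S"
  using integral_linear[OF assms blinfun.bounded_linear_left] integrable_linear[OF assms blinfun.bounded_linear_left]
  by (simp_all add: o_def)

text \<open>On each of the two contours the parameters t and -t give conjugate points with conjugate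
  coefficients. Pairing them leaves one ray of the upper half plane for each sign, of angle \<phi>
  for 1 and pi - \<phi> for -1. The factor 2 of the pairing turns 1/(2 pi) into 1/pi.\<close>

theorem omega_integral_eq_\<Phi>:
  assumes \<theta>: "\<theta> < pi/2" and \<phi>: "\<phi> \<in> {\<omega><..<\<theta>}" and F: "holo_N0 \<theta> F" and f: "slice_extends \<theta> F f"
  shows "blinfun_apply (omega_integral \<phi> J T f) v = \<Phi> \<phi> F v"
proof -
  have \<phi>': "\<phi> \<in> {\<omega><..<pi/2}" using \<phi> \<theta> by auto
  obtain \<alpha> where \<alpha>: "\<alpha> \<in> {\<omega><..<pi/2}" "\<alpha> < \<phi>" using mid_angle[OF \<phi>'] .
  have \<alpha>': "\<alpha> \<in> {\<omega><..<\<phi>}" using \<alpha> by auto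
  let ?I = "\<lambda>\<psi>. ray_integral F \<psi> (v, 0)"
  have F_cnj: "F (cnj z) = cnj (F z)" if "z \<in> csector \<theta>" for z
    using F that by (simp add: holo_N0_def holo_intrinsic_def)
  have half: "blinfun_apply (integral UNIV (integrand \<phi> \<sigma> f)) v
      = integral {0<..} (\<lambda>t. blinfun_apply (integrand \<phi> \<sigma> f t) v + blinfun_apply (integrand \<phi> \<sigma> f (- t)) v)"
    if \<sigma>: "\<sigma> \<in> {1, - 1}" for \<sigma>
  proof -
    have p: "integrand \<phi> \<sigma> f integrable_on {0<..}"
      by (rule integrable_eq[OF ray_operator_integrable[OF \<theta> \<phi> F \<sigma>, of "- \<phi>" "of_real \<sigma> * cis (- \<phi>) / \<i>"]])
         (simp_all add: integrand_eq(1)[OF \<theta> \<phi> f \<sigma>])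
    have m: "(\<lambda>t. integrand \<phi> \<sigma> f (- t)) integrable_on {0<..}"
      by (rule integrable_eq[OF ray_operator_integrable[OF \<theta> \<phi> F \<sigma>, of "\<phi>" "- of_real \<sigma> * cis \<phi> / \<i>"]])
         (simp_all add: integrand_eq(2)[OF \<theta> \<phi> f \<sigma>])
    have "integral UNIV (integrand \<phi> \<sigma> f) = integral {0<..} (integrand \<phi> \<sigma> f) + integral {0<..} (\<lambda>t. integrand \<phi> \<sigma> f (- t))"
      by (rule integral_unique[OF has_integral_UNIV_halflines[OF integrable_integral[OF p] integrable_integral[OF m]]])
    then show ?thesis
      using blinfun_integral_apply[OF p, of v] blinfun_integral_apply[OF m, of v]
      by (simp add: blinfun.add_left Henstock_Kurzweil_Integration.integral_add)
  qed
  have fi: "(\<lambda>t. cact (cis \<psi> * F (rcis t \<psi>)) (Rz (rcis t \<psi>) (v, 0))) integrable_on {0<..}" if "\<psi> \<in> {\<phi>, pi - \<phi>}" for \<psi>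
    by (rule ray_integrable[OF \<theta> \<phi> that F])
  have snd_int: "integral {0<..} (\<lambda>t. c *\<^sub>R snd (cact (cis \<psi> * F (rcis t \<psi>)) (Rz (rcis t \<psi>) (v, 0)))) = c *\<^sub>R snd (?I \<psi>)"
    if "\<psi> \<in> {\<phi>, pi - \<phi>}" for \<psi> c
    using integral_linear[OF fi[OF that] bounded_linear_snd] by (simp add: o_def ray_integral_def)
  have fst_i: "fst (cact (\<i> * c) p) = - snd (cact c p)" for c and p :: "('v^('n set)) \<times> ('v^('n set))"
    by (simp add: cact_def)
  have plus: "blinfun_apply (integral UNIV (integrand \<phi> 1 f)) v = (- 2) *\<^sub>R snd (?I \<phi>)"
  proof -
    have "blinfun_apply (integral UNIV (integrand \<phi> 1 f)) v
      = integral {0<..} (\<lambda>t. (- 2) *\<^sub>R snd (cact (cis \<phi> * F (rcis t \<phi>)) (Rz (rcis t \<phi>) (v, 0))))"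
      unfolding half[of 1, OF insertI1]
    proof (rule Henstock_Kurzweil_Integration.integral_cong)
      fix t :: real assume "t \<in> {0<..}"
      then have t: "0 < t" by simp
      \<comment> \<open>For the sign 1 the point in the upper half plane belongs to the parameter
        -t. The coefficient is taken there, and -1/i = i.\<close>
      let ?z = "rcis t \<phi>" let ?c = "- of_real 1 * cis \<phi> / \<i> * F (rcis (1 * t) \<phi>)"
      note m = ray_mem(1)[OF \<theta> \<phi> insertI1 t, of \<phi>] ray_mem(2)[OF \<theta> \<phi> insertI1 t _ \<alpha>', of \<phi>]
      have zc: "rcis (1 * t) (- \<phi>) = cnj ?z" by (simp add: rcis_def cis_cnj)
      have cc: "of_real 1 * cis (- \<phi>) / \<i> * F (rcis (1 * t) (- \<phi>)) = cnj ?c"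
        unfolding zc using m(1) by (simp add: F_cnj cis_cnj)
      have "blinfun_apply (integrand \<phi> 1 f t) v + blinfun_apply (integrand \<phi> 1 f (- t)) v
         = blinfun_apply (SB (cnj ?z) o\<^sub>L LB (cnj ?c)) v + blinfun_apply (SB ?z o\<^sub>L LB ?c) v"
        unfolding integrand_eq[OF \<theta> \<phi> f insertI1 t] unfolding cc unfolding zc by (simp only: mult_1)
      also have "\<dots> = 2 *\<^sub>R fst (cact ?c (Rz ?z (v, 0)))"
        using SB_conjugate_sum[OF \<alpha>(1), of ?z ?c v] m(2) by (simp add: add.commute)
      also have "?c = \<i> * (cis \<phi> * F ?z)" by (simp add: field_simps)
      finally show "blinfun_apply (integrand \<phi> 1 f t) v + blinfun_apply (integrand \<phi> 1 f (- t)) v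
        = (- 2) *\<^sub>R snd (cact (cis \<phi> * F ?z) (Rz ?z (v, 0)))" by (simp only: fst_i) simp
    qed
    also have "\<dots> = (- 2) *\<^sub>R snd (?I \<phi>)" by (rule snd_int) simp
    finally show ?thesis .
  qed
  have minus: "blinfun_apply (integral UNIV (integrand \<phi> (- 1) f)) v = 2 *\<^sub>R snd (?I (pi - \<phi>))"
  proof -
    have \<sigma>: "- 1 \<in> {1, - 1 :: real}" by simp
    have "blinfun_apply (integral UNIV (integrand \<phi> (- 1) f)) v
      = integral {0<..} (\<lambda>t. 2 *\<^sub>R snd (cact (cis (pi - \<phi>) * F (rcis t (pi - \<phi>))) (Rz (rcis t (pi - \<phi>)) (v, 0))))"
      unfolding half[OF \<sigma>]
    proof (rule Henstock_Kurzweil_Integration.integral_cong)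
      fix t :: real assume "t \<in> {0<..}"
      then have t: "0 < t" by simp
      \<comment> \<open>For the sign -1 the parameter t itself gives the point in the upper half
        plane.\<close>
      let ?z = "rcis t (pi - \<phi>)" let ?c = "of_real (- 1) * cis (- \<phi>) / \<i> * F (rcis (- 1 * t) (- \<phi>))"
      have z: "rcis (- 1 * t) (- \<phi>) = ?z" by (simp add: rcis_uminus) (simp add: rcis_def)
      have zc: "rcis (- 1 * t) \<phi> = cnj ?z" by (simp add: rcis_uminus) (simp add: rcis_def cis_cnj)
      note m = ray_mem(1)[OF \<theta> \<phi> \<sigma> t, of "- \<phi>", unfolded z] ray_mem(2)[OF \<theta> \<phi> \<sigma> t _ \<alpha>', of "- \<phi>", unfolded z]
      have cc: "- of_real (- 1) * cis \<phi> / \<i> * F (rcis (- 1 * t) \<phi>) = cnj ?c"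
        unfolding zc z using m(1) by (simp add: F_cnj cis_cnj)
      have "blinfun_apply (integrand \<phi> (- 1) f t) v + blinfun_apply (integrand \<phi> (- 1) f (- t)) v
         = blinfun_apply (SB ?z o\<^sub>L LB ?c) v + blinfun_apply (SB (cnj ?z) o\<^sub>L LB (cnj ?c)) v"
        unfolding integrand_eq[OF \<theta> \<phi> f \<sigma> t] unfolding cc unfolding zc z ..
      also have "\<dots> = 2 *\<^sub>R fst (cact ?c (Rz ?z (v, 0)))"
        using SB_conjugate_sum[OF \<alpha>(1), of ?z ?c v] m(2) by simp
      also have "?c = \<i> * (- (cis (pi - \<phi>) * F ?z))"
      proof -
        have "cis (pi - \<phi>) = - cis (- \<phi>)" using rcis_uminus(3)[of 1 \<phi>] by (simp add: rcis_def)
        then show ?thesis unfolding z by (simp add: field_simps)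
      qed
      finally show "blinfun_apply (integrand \<phi> (- 1) f t) v + blinfun_apply (integrand \<phi> (- 1) f (- t)) v
        = 2 *\<^sub>R snd (cact (cis (pi - \<phi>) * F ?z) (Rz ?z (v, 0)))" by (simp only: fst_i) (simp add: cact.minus_left)
    qed
    also have "\<dots> = 2 *\<^sub>R snd (?I (pi - \<phi>))" by (rule snd_int) simp
    finally show ?thesis .
  qed
  have "omega_integral \<phi> J T f = (1 / (2 * pi)) *\<^sub>R (integral UNIV (integrand \<phi> 1 f) + integral UNIV (integrand \<phi> (- 1) f))"
    unfolding omega_integral_def integrand_def[abs_def] by simp
  then have "blinfun_apply (omega_integral \<phi> J T f) v = (1 / (2 * pi)) *\<^sub>R ((- 2) *\<^sub>R snd (?I \<phi>) + 2 *\<^sub>R snd (?I (pi - \<phi>)))"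
    by (simp only: blinfun.scaleR_left blinfun.add_left plus minus)
  also have "\<dots> = \<Phi> \<phi> F v" by (simp add: \<Phi>_def algebra_simps)
  finally show ?thesis .
qed

end

section \<open>Rational functions\<close>

lemma rational_limit_at_infinity:
  fixes R M :: "complex poly"
  assumes "M \<noteq> 0" "degree R \<le> degree M"
  shows "((\<lambda>z. poly R z / poly M z) \<longlongrightarrow> coeff R (degree M) / lead_coeff M) at_infinity"
proof -
  let ?m = "degree M"
  have R: "((\<lambda>z. poly R z / z ^ ?m) \<longlongrightarrow> coeff R ?m) at_infinity"
  proof (cases "degree R = ?m")
    case True
    then show ?thesis using poly_divide_tendsto_aux[of R] by simp
  next
    case False
    define k where "k = ?m - degree R"
    have k: "?m = degree R + k" "0 < k" using assms False by (simp_all add: k_def)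
    have "((\<lambda>z. poly R z / z ^ degree R * inverse z ^ k) \<longlongrightarrow> lead_coeff R * 0 ^ k) at_infinity"
      by (intro tendsto_intros poly_divide_tendsto_aux tendsto_inverse_0)
    then have "((\<lambda>z. poly R z / z ^ ?m) \<longlongrightarrow> 0) at_infinity"
      using k by (simp add: power_add power_inverse divide_inverse mult.assoc zero_power)
    moreover have "coeff R ?m = 0" using k by (simp add: coeff_eq_0)
    ultimately show ?thesis by simp
  qed
  have "((\<lambda>z. (poly R z / z ^ ?m) / (poly M z / z ^ ?m)) \<longlongrightarrow> coeff R ?m / lead_coeff M) at_infinity"
    using assms by (intro tendsto_divide R poly_divide_tendsto_aux) simp
  moreover have "\<forall>\<^sub>F z in at_infinity. (poly R z / z ^ ?m) / (poly M z / z ^ ?m) = poly R z / poly M z"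
    unfolding eventually_at_infinity by (intro exI[of _ 1]) auto
  ultimately show ?thesis by (rule Lim_transform_eventually)
qed

text \<open>The finite limit at infinity bounds the quotient for large z, and compactness bounds it
  on the rest of the set.\<close>

lemma rational_bounded_on_closed:
  fixes R M :: "complex poly"
  assumes "closed S" "\<And>z. z \<in> S \<Longrightarrow> poly M z \<noteq> 0" "degree R \<le> degree M"
  obtains C where "\<And>z. z \<in> S \<Longrightarrow> cmod (poly R z / poly M z) \<le> C"
proof (cases "M = 0")
  case True
  then show ?thesis using assms(2) that[of 0] by auto
next
  case False
  let ?l = "cmod (coeff R (degree M) / lead_coeff M)"
  have "\<forall>\<^sub>F z in at_infinity. cmod (poly R z / poly M z) < ?l + 1"
    by (rule order_tendstoD(2)[OF tendsto_norm[OF rational_limit_at_infinity[OF False assms(3)]]]) simp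
  then obtain B where B: "\<And>z. B \<le> cmod z \<Longrightarrow> cmod (poly R z / poly M z) < ?l + 1"
    unfolding eventually_at_infinity by auto
  have "compact (S \<inter> cball 0 B)" using assms(1) by (intro closed_Int_compact) auto
  moreover have "continuous_on (S \<inter> cball 0 B) (\<lambda>z. poly R z / poly M z)"
    using assms(2) by (intro continuous_intros) auto
  ultimately have "bounded ((\<lambda>z. poly R z / poly M z) ` (S \<inter> cball 0 B))"
    by (intro compact_imp_bounded compact_continuous_image)
  then obtain C where C: "\<And>z. z \<in> S \<inter> cball 0 B \<Longrightarrow> cmod (poly R z / poly M z) \<le> C"
    unfolding bounded_iff by blast
  have "cmod (poly R z / poly M z) \<le> max C (?l + 1)" if "z \<in> S" for z
  proof (cases "cmod z \<le> B")
    case True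
    then show ?thesis using C[of z] that by (intro le_max_iff_disj[THEN iffD2] disjI1) simp
  next
    case False
    then show ?thesis using B[of z] by (intro le_max_iff_disj[THEN iffD2] disjI2) simp
  qed
  then show ?thesis by (rule that)
qed

lemma cpoly_cnj: "cpoly p (cnj z) = cnj (cpoly p z)"
  by (induction p) simp_all

lemma holo_intrinsic_rational:
  assumes "\<And>z. z \<in> csector \<theta> \<Longrightarrow> cpoly M z \<noteq> 0"
  shows "holo_intrinsic \<theta> (\<lambda>z. cpoly N z / cpoly M z)"
  unfolding holo_intrinsic_def using assms
  by (auto intro!: holomorphic_intros simp: cpoly_cnj)

text \<open>With N = z N', the quotient is z lam times N'(1 + z^2)/M. The degree condition makes the
  second factor bounded on the closed sector, so the decay of z lam at 0 and infinity carries
  over.\<close>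

lemma holo_N0_rational:
  assumes \<theta>: "0 < \<theta>" "\<theta> < pi/2" and M: "\<And>z. z \<in> closed_csector \<theta> \<Longrightarrow> cpoly M z \<noteq> 0"
    and N: "coeff N 0 = 0" "degree N < degree M"
  shows "holo_N0 \<theta> (\<lambda>z. cpoly N z / cpoly M z)"
proof -
  obtain N' where N': "N = pCons 0 N'" using N(1) by (cases N) auto
  let ?R = "N' * [:1, 0, 1:]"
  have degR: "degree (map_poly complex_of_real ?R) \<le> degree (map_poly complex_of_real M)"
  proof (cases "N' = 0")
    case False
    have "degree ?R \<le> degree N' + degree [:1, 0, 1 :: real:]" by (rule degree_mult_le)
    also have "\<dots> \<le> degree M" using N(2) False by (simp add: N')
    finally show ?thesis by (simp add: degree_map_poly)
  qed simp
  obtain C where C: "\<And>z. z \<in> closed_csector \<theta> \<Longrightarrow> cmod (cpoly ?R z / cpoly M z) \<le> C"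
    using rational_bounded_on_closed[OF closed_closed_csector M degR] by blast
  show ?thesis
  proof (rule holo_N0_decay[OF \<theta> holo_intrinsic_rational])
    show "cpoly M z \<noteq> 0" if "z \<in> csector \<theta>" for z using M csector_mem_closed that by blast
    fix z assume "z \<in> csector \<theta>"
    then have z: "z \<in> closed_csector \<theta>" by (rule csector_mem_closed)
    have n: "1 + z\<^sup>2 \<noteq> 0" by (rule one_plus_square_nonzero[OF z])
    then have "(1 + z * z) * lam z = 1" by (simp add: lam_def power2_eq_square)
    then have "cpoly N z = z * (cpoly N' z * ((1 + z * z) * lam z))" by (simp add: N')
    moreover have "cpoly ?R z = cpoly N' z * (1 + z * z)" by (simp only: cpoly_mult) simp
    ultimately have "cpoly N z = (z * lam z) * cpoly ?R z" by (simp only: mult_ac)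
    then have "cpoly N z / cpoly M z = (z * lam z) * (cpoly ?R z / cpoly M z)" by (simp only: times_divide_eq_right)
    then have "cmod (cpoly N z / cpoly M z) = cmod z * cmod (lam z) * cmod (cpoly ?R z / cpoly M z)"
      by (simp only: norm_mult)
    also have "\<dots> \<le> cmod z * (lam_bound \<theta> * (1 / (1 + (cmod z)\<^sup>2))) * C"
      by (intro mult_mono mult_left_mono norm_lam_le[OF z] C[OF z] norm_ge_zero mult_nonneg_nonneg
          order_trans[OF norm_ge_zero norm_lam_le[OF z]])
    finally show "cmod (cpoly N z / cpoly M z) \<le> (lam_bound \<theta> * C) * (cmod z / (1 + (cmod z)\<^sup>2))"
      by (simp add: mult_ac)
  qed
qed

text \<open>A point outside a closed double sector stays outside a slightly wider one. For finitely
  many points the minimum of the admissible angles works for all of them.\<close>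

lemma avoid_finite_set:
  assumes "finite R" "0 < \<omega>" "\<omega> < pi/2" "\<And>z. z \<in> R \<Longrightarrow> z \<notin> closed_csector \<omega>"
  shows "\<exists>\<theta>\<in>{\<omega><..<pi/2}. \<forall>z\<in>R. z \<notin> closed_csector \<theta>"
  using assms(1,4)
proof (induction R)
  case empty
  have "(\<omega> + pi/2) / 2 \<in> {\<omega><..<pi/2}" using assms(2,3) by (auto simp: field_simps)
  then show ?case by blast
next
  case (insert z R)
  then obtain \<theta>1 where \<theta>1: "\<theta>1 \<in> {\<omega><..<pi/2}" "\<forall>z\<in>R. z \<notin> closed_csector \<theta>1" by auto
  have mono: "closed_csector a \<subseteq> closed_csector b" if "0 < a" "a \<le> b" "b < pi/2" for a b
    unfolding closed_csector_def
    using mult_right_mono[OF tan_mono_le_0[OF that] abs_ge_zero] by (auto intro: order_trans)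
  have z: "tan \<omega> * \<bar>Re z\<bar> < \<bar>Im z\<bar>" using insert.prems[of z] by (simp add: closed_csector_def)
  have "\<exists>\<theta>2\<in>{\<omega><..<pi/2}. z \<notin> closed_csector \<theta>2"
  proof (cases "Re z = 0")
    case True
    then show ?thesis using z \<theta>1(1) by (intro bexI[of _ \<theta>1]) (auto simp: closed_csector_def)
  next
    case False
    define \<beta> where "\<beta> = arctan (\<bar>Im z\<bar> / \<bar>Re z\<bar>)"
    have "tan \<omega> < \<bar>Im z\<bar> / \<bar>Re z\<bar>" using z False by (simp add: less_divide_eq)
    then have "arctan (tan \<omega>) < \<beta>" unfolding \<beta>_def by (simp only: arctan_less_iff)
    then have \<beta>: "\<omega> < \<beta>" "\<beta> < pi/2"
      using assms(2,3) arctan_ubound by (simp_all add: arctan_tan \<beta>_def)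
    \<comment> \<open>\<open>\<beta>\<close> is the angle between the line through 0 and z and the
      real axis. Any angle strictly between \<omega> and \<beta> excludes z, and the midpoint is
      taken.\<close>
    define \<theta>2 where "\<theta>2 = (\<omega> + \<beta>) / 2"
    have \<theta>2: "\<omega> < \<theta>2" "\<theta>2 < \<beta>" using \<beta> by (auto simp: \<theta>2_def field_simps)
    then have "tan \<theta>2 < tan \<beta>" using \<beta> assms(2) by (intro tan_monotone) auto
    then have "tan \<theta>2 * \<bar>Re z\<bar> < \<bar>Im z\<bar>" using False by (simp add: \<beta>_def tan_arctan less_divide_eq)
    then show ?thesis using \<theta>2 \<beta> by (intro bexI[of _ \<theta>2]) (auto simp: closed_csector_def)
  qed
  then obtain \<theta>2 where \<theta>2: "\<theta>2 \<in> {\<omega><..<pi/2}" "z \<notin> closed_csector \<theta>2" by blast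
  have "min \<theta>1 \<theta>2 \<in> {\<omega><..<pi/2}" using \<theta>1(1) \<theta>2(1) by auto
  moreover have "closed_csector (min \<theta>1 \<theta>2) \<subseteq> closed_csector \<theta>1"
    using \<theta>1(1) \<theta>2(1) assms(2) by (intro mono) auto
  moreover have "closed_csector (min \<theta>1 \<theta>2) \<subseteq> closed_csector \<theta>2"
    using \<theta>1(1) \<theta>2(1) assms(2) by (intro mono) auto
  ultimately show ?case using \<theta>1(2) \<theta>2(2) by (intro bexI[of _ "min \<theta>1 \<theta>2"]) auto
qed

lemma cl_lam: "J \<in> imag_sphere \<Longrightarrow> 1 / (1 + (cl_of J z)\<^sup>2) = cl_of J (lam z)"
  by (simp add: lam_def cl_of_divide cl_of_add cl_of_power)

lemma slice_extends_rational:
  "slice_extends \<theta> (\<lambda>z. cpoly N z / cpoly M z) (\<lambda>s. cl_poly N s / cl_poly M s)"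
  unfolding slice_extends_def by (simp add: cl_poly_cl_of cl_of_divide)

text \<open>Here a and b are the values of the function at 0 and at infinity: \<open>lam\<close>
  interpolates between them, and the remaining quotient vanishes at both ends.\<close>

lemma Nbnd_rationalI:
  fixes g :: "'n::{finite,linorder} clifford \<Rightarrow> 'n clifford"
  assumes \<theta>: "0 < \<theta>" "\<theta> < pi/2" and M: "\<And>z. z \<in> closed_csector \<theta> \<Longrightarrow> cpoly M z \<noteq> 0"
    and N: "coeff N 0 = 0" "degree N < degree M"
    and g: "\<And>J z. J \<in> imag_sphere \<Longrightarrow> z \<in> csector \<theta> \<Longrightarrow>
      g (cl_of J z) = cl_of J (of_real b + lam z * of_real (a - b) + cpoly N z / cpoly M z)"
  shows "g \<in> Nbnd \<theta>"
proof -
  have "(\<lambda>s. cl_poly N s / cl_poly M s :: 'n clifford) \<in> N0 \<theta>"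
    by (rule holo_imp_N0[OF \<theta> holo_N0_rational[OF \<theta> M N] slice_extends_rational])
  moreover have "g s = of_real b + 1 / (1 + s\<^sup>2) * of_real (a - b) + cl_poly N s / cl_poly M s" if "s \<in> bisector \<theta>" for s
  proof -
    obtain J z where J: "J \<in> imag_sphere" and z: "z \<in> csector \<theta>" and s: "s = cl_of J z"
      using \<open>s \<in> bisector \<theta>\<close> unfolding bisector_eq_cl_of[OF \<theta>] by blast
    show ?thesis unfolding s g[OF J z] cl_lam[OF J]
      by (simp only: cl_of_add cl_of_mult[OF J] cl_of_of_real cl_of_divide[OF J] cl_poly_cl_of[OF J])
  qed
  ultimately show ?thesis unfolding Nbnd_def bnd_components_def by blast
qed

section \<open>The functional calculus of a quotient\<close>

context bisectorial_op
begin

lemma op_power_eq: "op_power T k v = (if v \<in> Dn k then Some ((\<tau>T ^^ k) v) else None)"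
proof (induction k)
  case (Suc k)
  show ?case
  proof (cases "v \<in> Dn k")
    case True
    then have "v \<in> Dn (Suc k) \<longleftrightarrow> (\<tau>T ^^ k) v \<in> dom T"
      using funpow_Dn_iff[OF True, of 1] by (simp add: Dn_Suc)
    then show ?thesis using True Suc by (auto simp: map_comp_def)
  next
    case False
    then have "v \<notin> Dn (Suc k)" using Dn_mono by (metis lessI less_imp_le)
    then show ?thesis using False Suc by (simp add: map_comp_def)
  qed
qed simp

lemma op_poly_eq_Some: "op_poly p T v = Some w \<longleftrightarrow> v \<in> Dn (degree p) \<and> w = pT p v"
proof -
  have "v \<in> dom (op_power T (degree p)) \<longleftrightarrow> v \<in> Dn (degree p)"
    by (simp add: op_power_eq dom_def)
  moreover have "(\<Sum>i\<le>degree p. coeff p i *\<^sub>R the (op_power T i v)) = pT p v" if "v \<in> Dn (degree p)"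
    unfolding pT_def using that Dn_mono by (intro sum.cong refl) (auto simp: op_power_eq)
  ultimately show ?thesis by (auto simp: op_poly_def)
qed

lemma op_poly_bijective:
  assumes "q \<noteq> 0" "\<And>z. z \<in> closed_csector \<omega> \<Longrightarrow> cpoly q z \<noteq> 0"
  shows "inj_on (op_poly q T) (dom (op_poly q T))" "ran (op_poly q T) = UNIV"
proof -
  have ex1: "\<exists>!v. op_poly q T v = Some w" for w
    using pT_bijective[OF assms, of w] unfolding op_poly_eq_Some by (simp add: eq_commute[of w])
  show "inj_on (op_poly q T) (dom (op_poly q T))"
  proof (rule inj_onI)
    fix u v assume "u \<in> dom (op_poly q T)" and eq: "op_poly q T u = op_poly q T v"
    then obtain w where "op_poly q T u = Some w" by blast
    with eq show "u = v" using ex1[of w] by (metis (no_types))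
  qed
  show "ran (op_poly q T) = UNIV"
  proof (rule UNIV_eq_I[symmetric])
    show "w \<in> ran (op_poly q T)" for w using ex1[of w] by (auto intro: ranI)
  qed
qed

text \<open>As partial maps, 1 + T^2 and Q_s[T] at s = J agree, including their domains.\<close>

lemma op_inv_one_plus_square: "op_inv (op_add (cl_op 1) (T \<circ>\<^sub>m T)) v = Some (\<Lambda> v)"
proof -
  have "op_add (cl_op 1) (T \<circ>\<^sub>m T) u = Q_op (cl_of J \<i>) T u" for u
  proof (rule option_eqI)
    fix w
    have one: "lmult 1 u = u" using lmult_of_real[of 1 u] by simp
    have "op_add (cl_op 1) (T \<circ>\<^sub>m T) u = Some w \<longleftrightarrow> u \<in> dom T \<and> \<tau>T u \<in> dom T \<and> w = u + \<tau>T (\<tau>T u)"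
    proof (cases "T u")
      case None
      then show ?thesis by (simp add: op_add_def map_comp_def dom_def)
    next
      case (Some u')
      then show ?thesis by (cases "T u'") (auto simp: op_add_def map_comp_def dom_def cl_op_def one)
    qed
    moreover have "cl_re (cl_of J \<i>) = 0" "norm (cl_of J \<i>) = 1"
      using cl_re_cl_of[OF J, of \<i>] norm_cl_of[OF J, of \<i>] by simp_all
    ultimately show "op_add (cl_op 1) (T \<circ>\<^sub>m T) u = Some w \<longleftrightarrow> Q_op (cl_of J \<i>) T u = Some w"
      unfolding Q_op_eq_Some by (auto simp: add.commute)
  qed
  then have "op_add (cl_op 1) (T \<circ>\<^sub>m T) = Q_op (cl_of J \<i>) T" by blast
  then show ?thesis using QiT_Some(1)[OF i_not_closed, of v] by (simp only: \<Lambda>_def)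
qed

text \<open>The components picked by the choice operator satisfy \<open>bnd_components\<close>.
  Their integrable part is represented by a holomorphic function, which brings the operator into the
  form \<Psi>.\<close>

lemma bnd_calc_eq:
  assumes \<theta>: "\<theta> < pi/2" and \<phi>: "\<phi> \<in> {\<omega><..<\<theta>}"
    and some: "(SOME (\<phi>, J). \<phi> \<in> {\<omega><..<\<theta>} \<and> J \<in> imag_sphere) = (\<phi>, J)"
    and g: "g \<in> Nbnd \<theta>"
  obtains g0 gi G where "holo_N0 \<theta> G"
    "\<And>z. z \<in> csector \<theta> \<Longrightarrow> g (cl_of J z) = cl_of J (of_real gi + of_real (g0 - gi) * lam z + G z)"
    "bnd_calc \<omega> \<theta> T g = (\<lambda>v. Some (\<Psi> \<phi> g0 gi G v))"
proof -
  have \<theta>0: "0 < \<theta>" using \<phi> angle by auto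
  obtain g0 gi gt where e: "(SOME (g0, gi, gt). bnd_components \<theta> g g0 gi gt) = (g0, gi, gt)"
    by (rule prod_cases3)
  have "\<exists>p. case p of (g0, gi, gt) \<Rightarrow> bnd_components \<theta> g g0 gi gt"
    using g by (auto simp: Nbnd_def)
  from someI_ex[OF this] have bc: "bnd_components \<theta> g g0 gi gt" unfolding e by simp
  then have "gt \<in> N0 \<theta>" by (simp add: bnd_components_def)
  from N0_imp_holo[OF \<theta>0 \<theta> this] obtain G where G: "holo_N0 \<theta> G" "slice_extends \<theta> G gt" .
  show ?thesis
  proof (rule that[OF G(1)])
    fix z assume z: "z \<in> csector \<theta>"
    have "g (cl_of J z) = of_real gi + 1 / (1 + (cl_of J z)\<^sup>2) * of_real (g0 - gi) + gt (cl_of J z)"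
      using bc z by (simp add: bnd_components_def cl_of_in_bisector[OF \<theta>0 \<theta> J])
    also have "gt (cl_of J z) = cl_of J (G z)" using G(2) J z by (simp add: slice_extends_def)
    finally show "g (cl_of J z) = cl_of J (of_real gi + of_real (g0 - gi) * lam z + G z)"
      unfolding cl_lam[OF J] mult.commute[of "of_real (g0 - gi)"]
      by (simp only: cl_of_add cl_of_mult[OF J] cl_of_of_real)
  next
    have oc: "omega_calc \<omega> \<theta> T gt = (\<lambda>v. Some (\<Phi> \<phi> G v))"
      unfolding omega_calc_def some Let_def
      by (simp add: o_def omega_integral_eq_\<Phi>[OF \<theta> \<phi> G])
    have inv: "op_inv (op_add (cl_op 1) (T \<circ>\<^sub>m T)) = (\<lambda>v. Some (\<Lambda> v))"
      using op_inv_one_plus_square by blast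
    have "bnd_calc \<omega> \<theta> T g v = Some (\<Psi> \<phi> g0 gi G v)" for v
      unfolding bnd_calc_def e Let_def prod.case oc inv
      by (simp add: op_add_def cl_op_def map_comp_def dom_def \<Psi>_def[OF \<theta> \<phi>] linear_scale[OF linear_\<Lambda>] del: of_real_diff)
    then show "bnd_calc \<omega> \<theta> T g = (\<lambda>v. Some (\<Psi> \<phi> g0 gi G v))" by blast
  qed
qed

text \<open>A power of \<open>lam\<close> shows that a regularizer exists. The calculus itself is
  then computed with the regularizer that the choice operator selects, of which only its membership
  in the extended class, that of its product with p/q, and injectivity enter.\<close>

lemma Hinf_calc_rational:
  assumes \<theta>: "\<theta> \<in> {\<omega><..<pi/2}" and \<phi>: "\<phi> \<in> {\<omega><..<\<theta>}"
    and some: "(SOME (\<phi>, J). \<phi> \<in> {\<omega><..<\<theta>} \<and> J \<in> imag_sphere) = (\<phi>, J)"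
    and p: "p \<noteq> 0" and q: "\<And>z. z \<in> closed_csector \<theta> \<Longrightarrow> cpoly q z \<noteq> 0"
  defines "r \<equiv> \<lambda>s. cl_poly p s / cl_poly q s"
  shows "r \<in> Nreg \<omega> \<theta> T" "Hinf_calc \<omega> \<theta> T r = op_poly p T \<circ>\<^sub>m op_inv (op_poly q T)"
proof -
  have \<theta>': "0 < \<theta>" "\<theta> < pi/2" using \<theta> angle by auto
  have qs: "cpoly q z \<noteq> 0" if "z \<in> csector \<theta>" for z using q csector_mem_closed that by blast
  have q\<omega>: "cpoly q z \<noteq> 0" if "z \<in> closed_csector \<omega>" for z
  proof (rule q)
    have "tan \<omega> \<le> tan \<theta>" using \<theta> angle by (intro tan_mono_le_0) auto
    then have "tan \<omega> * \<bar>Re z\<bar> \<le> tan \<theta> * \<bar>Re z\<bar>" by (rule mult_right_mono) simp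
    then show "z \<in> closed_csector \<theta>" using that by (simp add: closed_csector_def)
  qed
  have "0 \<in> closed_csector \<theta>" by (simp add: closed_csector_def)
  from q[OF this] have q0: "coeff q 0 \<noteq> 0" "q \<noteq> 0" by (auto simp: poly_0_coeff_0 coeff_map_poly)
  have r_cl: "r (cl_of I z) = cl_of I (cpoly p z / cpoly q z)" if "I \<in> imag_sphere" for I z
    using that by (simp add: r_def cl_poly_cl_of cl_of_divide)
  have r_int: "r \<in> intrinsic (bisector \<theta>)"
    unfolding r_def
    by (rule holo_imp_intrinsic[OF \<theta>' holo_intrinsic_rational slice_extends_rational]) (rule qs)

  let ?w = "[:1, 0, 1 :: real:]"
  \<comment> \<open>With w = 1 + z^2 of degree 2, this makes p/(w^k q) vanish at infinity whatever
    the degree of q.\<close>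
  define k where "k = Suc (degree p)"
  define e :: "'n clifford \<Rightarrow> 'n clifford" where "e s = 1 / cl_poly (?w ^ k) s" for s
  have w: "cpoly (?w ^ j) z * lam z ^ j = 1" "cpoly (?w ^ j) z \<noteq> 0" if "z \<in> closed_csector \<theta>" for z j
  proof -
    have "(1 + z * z) * lam z = 1"
      using one_plus_square_nonzero[OF that] by (simp add: lam_def power2_eq_square)
    then show "cpoly (?w ^ j) z * lam z ^ j = 1" by (simp add: cpoly_power power_mult_distrib[symmetric])
    then show "cpoly (?w ^ j) z \<noteq> 0" by auto
  qed
  have wk: "lam z * cpoly (?w ^ k) z = cpoly (?w ^ (k - 1)) z" if "z \<in> closed_csector \<theta>" for z
  proof -
    have "cpoly (?w ^ k) z = cpoly ?w z * cpoly (?w ^ (k - 1)) z"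
      by (simp only: k_def power_Suc cpoly_mult diff_Suc_1)
    then have "lam z * cpoly (?w ^ k) z = (cpoly ?w z * lam z) * cpoly (?w ^ (k - 1)) z"
      by (simp only: mult_ac)
    moreover have "cpoly ?w z * lam z = 1" using w(1)[OF that, of 1] by (simp only: power_one_right)
    ultimately show ?thesis by (simp only: mult_1)
  qed
  have degw: "degree (?w ^ j) = 2 * j" for j by (simp add: degree_power_eq)
  have w0: "coeff (?w ^ j) 0 = 1" for j by (simp add: coeff_0_power)
  have e_cl: "e (cl_of I z) = cl_of I (lam z ^ k)" if "I \<in> imag_sphere" "z \<in> csector \<theta>" for I z
  proof -
    have "1 / cpoly (?w ^ k) z = lam z ^ k"
      using w[OF csector_mem_closed[OF that(2)], of k] by (simp add: divide_eq_eq mult.commute)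
    moreover have "e (cl_of I z) = cl_of I (1 / cpoly (?w ^ k) z)"
      using that(1) by (simp only: e_def cl_poly_cl_of cl_of_divide cl_of_one)
    ultimately show ?thesis by simp
  qed
  \<comment> \<open>The function lam^k is 1 at 0 and 0 at infinity. Removing its rational part lam
    leaves (1 - w^(k-1))/w^k, whose numerator vanishes at 0.\<close>
  have eN: "e \<in> Nbnd \<theta>"
  proof (rule Nbnd_rationalI[OF \<theta>', where M = "?w ^ k" and N = "1 - ?w ^ (k - 1)" and b = 0 and a = 1])
    show "degree (1 - ?w ^ (k - 1)) < degree (?w ^ k)"
      by (rule degree_diff_less) (simp_all only: degw k_def degree_1, simp_all)
    fix I :: "'n clifford" and z assume I: "I \<in> imag_sphere" and z: "z \<in> csector \<theta>"
    have zc: "z \<in> closed_csector \<theta>" by (rule csector_mem_closed[OF z])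
    have "lam z * cpoly (?w ^ k) z = cpoly (?w ^ (k - 1)) z"
      by (rule wk[OF zc])
    then have "lam z = cpoly (?w ^ (k - 1)) z / cpoly (?w ^ k) z" using w(2)[OF zc] by (simp add: eq_divide_eq)
    moreover have "lam z ^ k = 1 / cpoly (?w ^ k) z"
      using w[OF zc, of k] by (simp add: eq_divide_eq mult.commute)
    ultimately have "lam z ^ k = of_real 0 + lam z * of_real (1 - 0) + cpoly (1 - ?w ^ (k - 1)) z / cpoly (?w ^ k) z"
      by (simp add: cpoly_diff diff_divide_distrib)
    then show "e (cl_of I z) = cl_of I (of_real 0 + lam z * of_real (1 - 0) + cpoly (1 - ?w ^ (k - 1)) z / cpoly (?w ^ k) z)"
      by (simp only: e_cl[OF I z])
  qed (use w(2) in \<open>simp_all add: w0\<close>)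
  \<comment> \<open>At 0 the product lam^k p/q has the value p(0)/q(0), and at infinity it vanishes.
    Subtracting this value times lam = w^(k-1)/w^k and using the common denominator w^k q gives the
    numerator.\<close>
  have erN: "(\<lambda>s. e s * r s) \<in> Nbnd \<theta>"
  proof (rule Nbnd_rationalI[OF \<theta>', where M = "?w ^ k * q" and N = "p - smult (coeff p 0 / coeff q 0) (?w ^ (k - 1) * q)"
        and b = 0 and a = "coeff p 0 / coeff q 0"])
    let ?g0 = "coeff p 0 / coeff q 0"
    have dM: "degree (?w ^ j * q) = 2 * j + degree q" for j
      using q0 by (simp add: degree_mult_eq degw del: power_Suc)
    show "degree (p - smult ?g0 (?w ^ (k - 1) * q)) < degree (?w ^ k * q)"
    proof (rule degree_diff_less)
      show "degree p < degree (?w ^ k * q)" by (simp only: dM k_def) simp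
      have "degree (smult ?g0 (?w ^ (k - 1) * q)) \<le> degree (?w ^ (k - 1) * q)" by (rule degree_smult_le)
      also have "\<dots> < degree (?w ^ k * q)" by (simp only: dM k_def) simp
      finally show "degree (smult ?g0 (?w ^ (k - 1) * q)) < degree (?w ^ k * q)" .
    qed
    show "coeff (p - smult ?g0 (?w ^ (k - 1) * q)) 0 = 0"
      using q0 by (simp add: coeff_mult_0 w0)
    show "cpoly (?w ^ k * q) z \<noteq> 0" if "z \<in> closed_csector \<theta>" for z
      using w(2)[OF that] q[OF that] by (simp add: cpoly_mult)
    fix I :: "'n clifford" and z assume I: "I \<in> imag_sphere" and z: "z \<in> csector \<theta>"
    have zc: "z \<in> closed_csector \<theta>" by (rule csector_mem_closed[OF z])
    have "lam z * cpoly (?w ^ k) z = cpoly (?w ^ (k - 1)) z"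
      by (rule wk[OF zc])
    then have l: "lam z = cpoly (?w ^ (k - 1)) z / cpoly (?w ^ k) z" using w(2)[OF zc] by (simp add: eq_divide_eq)
    have lk: "lam z ^ k = 1 / cpoly (?w ^ k) z"
      using w[OF zc, of k] by (simp add: eq_divide_eq mult.commute)
    have "cpoly (p - smult ?g0 (?w ^ (k - 1) * q)) z / cpoly (?w ^ k * q) z = lam z ^ k * (cpoly p z / cpoly q z) - lam z * of_real ?g0"
      unfolding lk unfolding l cpoly_diff cpoly_smult cpoly_mult using w(2)[OF zc, of k] qs[OF z]
      by (simp add: diff_divide_distrib mult_ac)
    then have "lam z ^ k * (cpoly p z / cpoly q z) = of_real 0 + lam z * of_real (?g0 - 0) + cpoly (p - smult ?g0 (?w ^ (k - 1) * q)) z / cpoly (?w ^ k * q) z"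
      by simp
    then show "e (cl_of I z) * r (cl_of I z)
        = cl_of I (of_real 0 + lam z * of_real (?g0 - 0) + cpoly (p - smult ?g0 (?w ^ (k - 1) * q)) z / cpoly (?w ^ k * q) z)"
      by (simp only: e_cl[OF I z] r_cl[OF I] cl_of_mult[OF I, symmetric])
  qed
  have "inj_on (bnd_calc \<omega> \<theta> T e) (dom (bnd_calc \<omega> \<theta> T e))"
  proof -
    obtain e0 ei E where E: "holo_N0 \<theta> E"
      "\<And>z. z \<in> csector \<theta> \<Longrightarrow> e (cl_of J z) = cl_of J (of_real ei + of_real (e0 - ei) * lam z + E z)"
      "bnd_calc \<omega> \<theta> T e = (\<lambda>v. Some (\<Psi> \<phi> e0 ei E v))"
      by (rule bnd_calc_eq[OF \<theta>'(2) \<phi> some eN], rule that)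
    have "of_real ei + of_real (e0 - ei) * lam z + E z = lam z ^ k" if "z \<in> csector \<theta>" for z
      using E(2)[OF that] e_cl[OF J that] by (simp only: cl_of_inject[OF J])
    then have "inj (\<Psi> \<phi> e0 ei E)" by (rule \<Psi>_lam_power_injective[OF \<theta>'(2) \<phi> E(1)])
    then show ?thesis unfolding E(3) by (auto simp: inj_on_def)
  qed
  then have reg: "regularizer \<omega> \<theta> T r e" using eN erN by (simp add: regularizer_def)
  then show "r \<in> Nreg \<omega> \<theta> T" using r_int by (auto simp: Nreg_def)

  define e' where "e' = (SOME e. regularizer \<omega> \<theta> T r e)"
  have "regularizer \<omega> \<theta> T r e'" unfolding e'_def by (rule someI[of "regularizer \<omega> \<theta> T r", OF reg])
  then have e': "e' \<in> Nbnd \<theta>" "(\<lambda>s. e' s * r s) \<in> Nbnd \<theta>"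
    "inj_on (bnd_calc \<omega> \<theta> T e') (dom (bnd_calc \<omega> \<theta> T e'))"
    by (simp_all add: regularizer_def)
  obtain e0 ei E where E: "holo_N0 \<theta> E"
    "\<And>z. z \<in> csector \<theta> \<Longrightarrow> e' (cl_of J z) = cl_of J (of_real ei + of_real (e0 - ei) * lam z + E z)"
    "bnd_calc \<omega> \<theta> T e' = (\<lambda>v. Some (\<Psi> \<phi> e0 ei E v))"
    by (rule bnd_calc_eq[OF \<theta>'(2) \<phi> some e'(1)], rule that)
  obtain g0 gi G where G: "holo_N0 \<theta> G"
    "\<And>z. z \<in> csector \<theta> \<Longrightarrow> e' (cl_of J z) * r (cl_of J z) = cl_of J (of_real gi + of_real (g0 - gi) * lam z + G z)"
    "bnd_calc \<omega> \<theta> T (\<lambda>s. e' s * r s) = (\<lambda>v. Some (\<Psi> \<phi> g0 gi G v))"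
    by (rule bnd_calc_eq[OF \<theta>'(2) \<phi> some e'(2)], rule that)
  have inj: "inj (\<Psi> \<phi> e0 ei E)"
  proof (rule injI)
    fix u v assume "\<Psi> \<phi> e0 ei E u = \<Psi> \<phi> e0 ei E v"
    then show "u = v" using e'(3) unfolding E(3) by (auto simp: inj_on_def)
  qed
  have eq: "cpoly p z * (of_real ei + of_real (e0 - ei) * lam z + E z) = cpoly q z * (of_real gi + of_real (g0 - gi) * lam z + G z)"
    if z: "z \<in> csector \<theta>" for z
  proof -
    have "cl_of J ((of_real ei + of_real (e0 - ei) * lam z + E z) * (cpoly p z / cpoly q z))
       = cl_of J (of_real gi + of_real (g0 - gi) * lam z + G z)"
      using G(2)[OF z] by (simp only: E(2)[OF z] r_cl[OF J] cl_of_mult[OF J])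
    then have "(of_real ei + of_real (e0 - ei) * lam z + E z) * (cpoly p z / cpoly q z) = of_real gi + of_real (g0 - gi) * lam z + G z"
      by (simp only: cl_of_inject[OF J])
    moreover have "x * a = y * b" if "a * (x / y) = b" "y \<noteq> 0" for a b x y :: complex using that by auto
    ultimately show ?thesis using qs[OF z] by blast
  qed
  have injq: "inj_on (op_poly q T) (dom (op_poly q T))"
    by (rule op_poly_bijective(1)[OF q0(2) q\<omega>])
  have injS: "inj_on (\<lambda>v. Some (\<Psi> \<phi> e0 ei E v)) (dom (\<lambda>v. Some (\<Psi> \<phi> e0 ei E v)))"
    using inj by (auto simp: inj_on_def)
  show "Hinf_calc \<omega> \<theta> T r = op_poly p T \<circ>\<^sub>m op_inv (op_poly q T)"
  proof (rule ext, rule option_eqI)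
    fix v w
    obtain u where u: "u \<in> Dn (degree q)" "pT q u = v" "\<And>u'. u' \<in> Dn (degree q) \<Longrightarrow> pT q u' = v \<Longrightarrow> u' = u"
      using pT_bijective[OF q0(2) q\<omega>, of v] by blast
    have "Hinf_calc \<omega> \<theta> T r v = Some w \<longleftrightarrow> \<Psi> \<phi> e0 ei E w = \<Psi> \<phi> g0 gi G (pT q u)"
      unfolding Hinf_calc_def e'_def[symmetric] Let_def E(3) G(3) map_comp_eq_Some op_inv_eq_Some[OF injS] u(2) by auto
    also have "\<dots> \<longleftrightarrow> u \<in> Dn (degree p) \<and> w = pT p u"
      by (rule \<Psi>_quotient[OF \<theta>'(2) \<phi> E(1) G(1) p eq inj u(1)])
    also have "\<dots> \<longleftrightarrow> (op_poly p T \<circ>\<^sub>m op_inv (op_poly q T)) v = Some w"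
      unfolding map_comp_eq_Some op_inv_eq_Some[OF injq] op_poly_eq_Some using u by blast
    finally show "Hinf_calc \<omega> \<theta> T r v = Some w \<longleftrightarrow> (op_poly p T \<circ>\<^sub>m op_inv (op_poly q T)) v = Some w" .
  qed
qed

end

theorem theorem5p9:
  fixes T :: "('v::banach, 'n::{finite,linorder}) operator"
    and p q :: "real poly" and \<omega> :: real
  assumes "\<omega> \<in> {0<..<pi/2}"
    and "T \<in> closed_ops" and "bisectorial \<omega> T"
    and "p \<noteq> 0" and "q \<noteq> 0"
    and "\<forall>s \<in> closure (bisector \<omega> :: 'n clifford set). cl_poly q s \<noteq> 0"
  shows "inj_on (op_poly q T) (dom (op_poly q T)) \<and> ran (op_poly q T) = UNIV \<and>
    (\<exists>\<theta>\<in>{\<omega><..<pi/2}.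
       (\<lambda>s. cl_poly p s / cl_poly q s) \<in> Nreg \<omega> \<theta> T \<and>
       Hinf_calc \<omega> \<theta> T (\<lambda>s. cl_poly p s / cl_poly q s)
         = op_poly p T \<circ>\<^sub>m op_inv (op_poly q T))"
proof -
  have \<omega>: "0 < \<omega>" "\<omega> < pi/2" using assms(1) by auto
  have q\<omega>: "cpoly q z \<noteq> 0" if "z \<in> closed_csector \<omega>" for z
  proof -
    obtain I :: "'n clifford" where I: "I \<in> imag_sphere" using imag_sphere_nonempty by blast
    have "cl_poly q (cl_of I z) \<noteq> 0"
      using assms(6) that cl_of_in_closure_bisector[OF \<omega> I] by blast
    then show ?thesis by (auto simp: cl_poly_cl_of[OF I])
  qed
  have "map_poly complex_of_real q \<noteq> 0" using assms(5) by (simp add: map_poly_eq_0_iff)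
  then have "finite {z. cpoly q z = 0}" by (rule poly_roots_finite)
  \<comment> \<open>The finitely many complex zeros of q lie outside the closed sector of angle
    \<omega>, so a wider closed sector still avoids them.\<close>
  then obtain \<theta> where \<theta>: "\<theta> \<in> {\<omega><..<pi/2}" "\<forall>z\<in>{z. cpoly q z = 0}. z \<notin> closed_csector \<theta>"
    using avoid_finite_set[OF _ \<omega>, of "{z. cpoly q z = 0}"] q\<omega> by blast
  then have q: "cpoly q z \<noteq> 0" if "z \<in> closed_csector \<theta>" for z using that by blast
  \<comment> \<open>This is the pair of angle and unit at which the definition of the calculus
    evaluates its integral. Naming it allows the slice of exactly this J to be used in the
    locale.\<close>
  obtain \<phi> J where some: "(SOME (\<phi>, J :: 'n clifford). \<phi> \<in> {\<omega><..<\<theta>} \<and> J \<in> imag_sphere) = (\<phi>, J)"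
    by (rule prod.exhaust)
  obtain J0 :: "'n clifford" where "J0 \<in> imag_sphere" using imag_sphere_nonempty by blast
  moreover have "(\<omega> + \<theta>) / 2 \<in> {\<omega><..<\<theta>}" using \<theta>(1) by auto
  ultimately have "\<exists>p. case p of (\<phi>, J :: 'n clifford) \<Rightarrow> \<phi> \<in> {\<omega><..<\<theta>} \<and> J \<in> imag_sphere"
    by (intro exI[of _ "((\<omega> + \<theta>) / 2, J0)"]) simp
  from someI_ex[OF this] have \<phi>: "\<phi> \<in> {\<omega><..<\<theta>}" and J: "J \<in> imag_sphere" unfolding some by simp_all
  interpret bisectorial_op T \<omega> J
    using \<omega> assms(2,3) J by unfold_locales
  have "inj_on (op_poly q T) (dom (op_poly q T))"
    by (rule op_poly_bijective(1)[OF assms(5) q\<omega>])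
  moreover have "ran (op_poly q T) = UNIV"
    by (rule op_poly_bijective(2)[OF assms(5) q\<omega>])
  ultimately show ?thesis
    using \<theta>(1) Hinf_calc_rational[OF \<theta>(1) \<phi> some assms(4) q] by blast
qed

end
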